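(* Let $p\geq 3$ be a prime, $F$ an algebraically closed field of characteristic $p$, $k\in[0,p-2]$, $b\in\mathbb{N}_0$ and $r\in[0,2p-3]$. Then, for $F\mathfrak{S}_p$-modules, \[(\Omega^r(D_k))^{\otimes 2b}\equiv\bigoplus_{0\leq 2\ell\leq p-3}(\mathsf{M}_k^b)_{\ell,0}\,\Omega^{2br}(D_{2\ell}),\] where $(\mathsf{M}_k^b)_{\ell,0}$ is the $(\ell,0)$-entry of the $b$th power of the matrix $\mathsf{M}_k$.
   Context: For integers $a\leq b$, $[a,b]$ denotes the set of integers $c$ with $a\leq c\leq b$. $\mathfrak{S}_p$ is the symmetric group on $p$ letters. Modules are finite-dimensional; $V\otimes W$ is the tensor product over $F$ with diagonal group action, and $V^{\otimes 0}$ is the trivial module. For $i\in[0,p-2]$, $D_i=D^{(p-i,1^i)}$ is the simple $F\mathfrak{S}_p$-module labelled by the ($p$-regular) hook partition $(p-i,1^i)$, i.e. the unique simple quotient (James) of the Specht module of that partition. $\Omega^r(V)$ is the $r$th Heller translate of $V$. $V\equiv W$ means $V\oplus P\cong W\oplus Q$ for some projective modules $P,Q$. For a non-negative integer $a$, $aV$ means the direct sum of $a$ copies of $V$. For $W$ indecomposable, $[V:W]$ is the multiplicity of $W$ as a direct summand of $V$. The matrix $\mathsf{M}_k$: let $m=\min\{k,p-2-k\}$. $\mathsf{M}_k$ is the square matrix with rows and columns labelled by $[0,\frac{p-3}{2}]$ (so the top left entry is the $(0,0)$-entry) with $(\ell,j)$-entry \[(\mathsf{M}_k)_{\ell,j}=\sum_{i=0}^m[D_{2i}\otimes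 D_{2j}:D_{2\ell}].\] *)

theory Defs
  imports
    "HOL-Algebra.Sym_Groups"
    "HOL-Combinatorics.Permutations"
    "HOL-Computational_Algebra.Polynomial"
    "HOL-Computational_Algebra.Primes"
    "Jordan_Normal_Form.Matrix_Kernel"
    "Jordan_Normal_Form.VS_Connect"
begin

text \<open>
  The field \<open>F\<close> is the type \<open>'a\<close>. A finite-dimensional \<open>FG\<close>-module is given in coordinates: its
  underlying space is \<open>F^d\<close> (column vectors \<^term>\<open>carrier_vec d\<close>), and \<open>g\<close> acts from the left by the
  matrix \<open>mact V g\<close>. Hence all finite-dimensional modules live in one type, whatever their dimension,
  and every finite-dimensional module is isomorphic to one of this form. Constructions that
  yield modules without a preferred basis (submodules, kernels, quotients) pick a
  representative by \<open>SOME\<close>; they are determined up to isomorphism, and every statement below is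
  invariant under isomorphism.
\<close>

section \<open>Modules over a group algebra\<close>

record ('g, 'a) fgmod =
  mdim :: nat
  mact :: "'g \<Rightarrow> 'a mat"

definition is_fgmod :: "'g monoid \<Rightarrow> ('g, 'a::field) fgmod \<Rightarrow> bool" where
  "is_fgmod G V \<longleftrightarrow>
     (\<forall>g\<in>carrier G. mact V g \<in> carrier_mat (mdim V) (mdim V)) \<and>
     mact V \<one>\<^bsub>G\<^esub> = 1\<^sub>m (mdim V) \<and>
     (\<forall>g\<in>carrier G. \<forall>h\<in>carrier G. mact V (g \<otimes>\<^bsub>G\<^esub> h) = mact V g * mact V h)"

definition fghom :: "'g monoid \<Rightarrow> ('g, 'a::field) fgmod \<Rightarrow> ('g, 'a) fgmod \<Rightarrow> 'a mat set" where
  "fghom G V W =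
     {A \<in> carrier_mat (mdim W) (mdim V). \<forall>g\<in>carrier G. A * mact V g = mact W g * A}"

definition fgiso :: "'g monoid \<Rightarrow> ('g, 'a::field) fgmod \<Rightarrow> ('g, 'a) fgmod \<Rightarrow> bool" where
  "fgiso G V W \<longleftrightarrow> is_fgmod G V \<and> is_fgmod G W \<and> (\<exists>A\<in>fghom G V W. invertible_mat A)"

definition fgsurj :: "'g monoid \<Rightarrow> ('g, 'a::field) fgmod \<Rightarrow> ('g, 'a) fgmod \<Rightarrow> 'a mat set" where
  "fgsurj G V W =
     {A \<in> fghom G V W. (\<lambda>v. A *\<^sub>v v) ` carrier_vec (mdim V) = carrier_vec (mdim W)}"

definition fgsub :: "'g monoid \<Rightarrow> ('g, 'a::field) fgmod \<Rightarrow> 'a vec set \<Rightarrow> bool" where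
  "fgsub G V U \<longleftrightarrow>
     VectorSpace.subspace class_ring U (module_vec TYPE('a) (mdim V)) \<and>
     (\<forall>g\<in>carrier G. \<forall>u\<in>U. mact V g *\<^sub>v u \<in> U)"

text \<open>\<open>realizes_sub G K V U\<close>: the module \<open>K\<close> is the submodule \<open>U \<subseteq> V\<close> written in some basis.\<close>

definition realizes_sub ::
  "'g monoid \<Rightarrow> ('g, 'a::field) fgmod \<Rightarrow> ('g, 'a) fgmod \<Rightarrow> 'a vec set \<Rightarrow> bool" where
  "realizes_sub G K V U \<longleftrightarrow> is_fgmod G K \<and>
     (\<exists>A\<in>fghom G K V. bij_betw (\<lambda>v. A *\<^sub>v v) (carrier_vec (mdim K)) U)"

definition simple_fgmod :: "'g monoid \<Rightarrow> ('g, 'a::field) fgmod \<Rightarrow> bool" where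
  "simple_fgmod G V \<longleftrightarrow> is_fgmod G V \<and> mdim V > 0 \<and>
     (\<forall>U. fgsub G V U \<longrightarrow> U = {0\<^sub>v (mdim V)} \<or> U = carrier_vec (mdim V))"

section \<open>Direct sums and tensor products\<close>

definition dsum :: "('g, 'a::field) fgmod list \<Rightarrow> ('g, 'a) fgmod" where
  "dsum Vs = \<lparr> mdim = sum_list (map mdim Vs),
               mact = (\<lambda>g. diag_block_mat (map (\<lambda>V. mact V g) Vs)) \<rparr>"

definition indecomposable_fgmod :: "'g monoid \<Rightarrow> ('g, 'a::field) fgmod \<Rightarrow> bool" where
  "indecomposable_fgmod G V \<longleftrightarrow> is_fgmod G V \<and> mdim V > 0 \<and>
     (\<forall>U W. is_fgmod G U \<and> is_fgmod G W \<and> fgiso G V (dsum [U, W]) \<longrightarrow> mdim U = 0 \<or> mdim W = 0)"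

text \<open>
  The multiplicity of the indecomposable module \<open>W\<close> as a direct summand of \<open>V\<close>: the number of
  summands isomorphic to \<open>W\<close> in a decomposition of \<open>V\<close> into indecomposables (well defined by
  Krull--Schmidt).
\<close>

definition summand_mult :: "'g monoid \<Rightarrow> ('g, 'a::field) fgmod \<Rightarrow> ('g, 'a) fgmod \<Rightarrow> nat" where
  "summand_mult G V W = (THE n. \<exists>Us. (\<forall>U\<in>set Us. indecomposable_fgmod G U) \<and>
     fgiso G V (dsum Us) \<and> n = length (filter (\<lambda>U. fgiso G U W) Us))"

definition kronecker :: "'a::field mat \<Rightarrow> 'a mat \<Rightarrow> 'a mat" where
  "kronecker A B = mat (dim_row A * dim_row B) (dim_col A * dim_col B)
     (\<lambda>(i, j). A $$ (i div dim_row B, j div dim_col B) * B $$ (i mod dim_row B, j mod dim_col B))"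

text \<open>The basis vector number \<open>i * mdim W + j\<close> of \<open>tensor V W\<close> is \<open>e\<^sub>i \<otimes> e\<^sub>j\<close>.\<close>

definition tensor :: "('g, 'a::field) fgmod \<Rightarrow> ('g, 'a) fgmod \<Rightarrow> ('g, 'a) fgmod" where
  "tensor V W = \<lparr> mdim = mdim V * mdim W, mact = (\<lambda>g. kronecker (mact V g) (mact W g)) \<rparr>"

definition trivial_fgmod :: "('g, 'a::field) fgmod" where
  "trivial_fgmod = \<lparr> mdim = 1, mact = (\<lambda>g. 1\<^sub>m 1) \<rparr>"

fun tensor_power :: "('g, 'a::field) fgmod \<Rightarrow> nat \<Rightarrow> ('g, 'a) fgmod" where
  "tensor_power V 0 = trivial_fgmod"
| "tensor_power V (Suc n) = tensor V (tensor_power V n)"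

section \<open>Projective modules and Heller translates\<close>

definition projective_fgmod :: "'g monoid \<Rightarrow> ('g, 'a::field) fgmod \<Rightarrow> bool" where
  "projective_fgmod G P \<longleftrightarrow> is_fgmod G P \<and>
     (\<forall>U V. is_fgmod G U \<and> is_fgmod G V \<longrightarrow>
        (\<forall>A\<in>fgsurj G U V. \<forall>B\<in>fghom G P V. \<exists>C\<in>fghom G P U. A * C = B))"

definition proj_equiv :: "'g monoid \<Rightarrow> ('g, 'a::field) fgmod \<Rightarrow> ('g, 'a) fgmod \<Rightarrow> bool" where
  "proj_equiv G V W \<longleftrightarrow> (\<exists>P Q. projective_fgmod G P \<and> projective_fgmod G Q \<and>
     fgiso G (dsum [V, P]) (dsum [W, Q]))"

definition projective_cover ::
  "'g monoid \<Rightarrow> ('g, 'a::field) fgmod \<Rightarrow> 'a mat \<Rightarrow> ('g, 'a) fgmod \<Rightarrow> bool" where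
  "projective_cover G P A V \<longleftrightarrow> projective_fgmod G P \<and> A \<in> fgsurj G P V \<and>
     (\<forall>U. fgsub G P U \<and> (\<lambda>v. A *\<^sub>v v) ` U = carrier_vec (mdim V) \<longrightarrow> U = carrier_vec (mdim P))"

definition heller1 :: "'g monoid \<Rightarrow> ('g, 'a::field) fgmod \<Rightarrow> ('g, 'a) fgmod" where
  "heller1 G V = (SOME K. \<exists>P A. projective_cover G P A V \<and> realizes_sub G K P (mat_kernel A))"

text \<open>
  Here \<open>\<Omega>\<^sup>0(V) = V\<close>. Some authors let \<open>\<Omega>\<^sup>0\<close> discard the projective summands of \<open>V\<close>; this makes no
  difference for \<open>\<Omega>\<^sup>r\<close> with \<open>r > 0\<close>, nor for \<open>\<Omega>\<^sup>0(V)\<close> up to projective summands.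
\<close>

definition heller :: "'g monoid \<Rightarrow> nat \<Rightarrow> ('g, 'a::field) fgmod \<Rightarrow> ('g, 'a) fgmod" where
  "heller G r V = (heller1 G ^^ r) V"

section \<open>Specht modules and simple modules of symmetric groups\<close>

text \<open>A partition is the list of its parts; rows and columns of diagrams are numbered from \<open>0\<close>.\<close>

definition diagram :: "nat list \<Rightarrow> (nat \<times> nat) set" where
  "diagram ps = {(i, j). i < length ps \<and> j < ps ! i}"

definition tableaux :: "nat list \<Rightarrow> (nat \<times> nat \<Rightarrow> nat) set" where
  "tableaux ps = {t. bij_betw t (diagram ps) {1..sum_list ps}}"

text \<open>The tabloid of a tableau is the list of its row sets.\<close>

definition tabloid :: "nat list \<Rightarrow> (nat \<times> nat \<Rightarrow> nat) \<Rightarrow> nat set list" where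
  "tabloid ps t = map (\<lambda>i. (\<lambda>j. t (i, j)) ` {..<ps ! i}) [0..<length ps]"

definition tabloids :: "nat list \<Rightarrow> nat set list set" where
  "tabloids ps = tabloid ps ` tableaux ps"

definition column_stabilizer :: "nat list \<Rightarrow> (nat \<times> nat \<Rightarrow> nat) \<Rightarrow> (nat \<Rightarrow> nat) set" where
  "column_stabilizer ps t = {\<pi>. \<pi> permutes {1..sum_list ps} \<and>
     (\<forall>j. let C = {t (i, j) | i. (i, j) \<in> diagram ps} in \<pi> ` C = C)}"

text \<open>The enumeration only fixes the order of the basis of the permutation module.\<close>

definition tabloid_list :: "nat list \<Rightarrow> nat set list list" where
  "tabloid_list ps = (SOME ts. distinct ts \<and> set ts = tabloids ps)"

definition perm_module :: "nat list \<Rightarrow> (nat \<Rightarrow> nat, 'a::field) fgmod" where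
  "perm_module ps = (let ts = tabloid_list ps; N = length ts in
     \<lparr> mdim = N,
       mact = (\<lambda>g. mat N N (\<lambda>(i, j). if ts ! i = map (image g) (ts ! j) then 1 else 0)) \<rparr>)"

text \<open>The polytabloid \<open>\<Sum>\<^bsub>\<pi>\<in>C\<^sub>t\<^esub> sgn(\<pi>) {\<pi>t}\<close> as a coordinate vector.\<close>

definition polytabloid :: "nat list \<Rightarrow> (nat \<times> nat \<Rightarrow> nat) \<Rightarrow> 'a::field vec" where
  "polytabloid ps t = (let ts = tabloid_list ps in
     vec (length ts) (\<lambda>i. \<Sum>\<pi>\<in>column_stabilizer ps t.
       if ts ! i = tabloid ps (\<pi> \<circ> t) then of_int (sign \<pi>) else 0))"

definition specht_space :: "nat list \<Rightarrow> 'a::field vec set" where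
  "specht_space ps = LinearCombinations.module.span class_ring
     (module_vec TYPE('a) (length (tabloid_list ps))) (polytabloid ps ` tableaux ps)"

definition specht :: "nat list \<Rightarrow> (nat \<Rightarrow> nat, 'a::field) fgmod" where
  "specht ps = (SOME S.
     realizes_sub (sym_group (sum_list ps)) S (perm_module ps) (specht_space ps))"

text \<open>
  The simple module \<open>D\<^sup>\<lambda>\<close>, the unique simple quotient of the Specht module. It is meaningful only
  for \<open>p\<close>-regular partitions, where \<open>p\<close> is the characteristic of the field.
\<close>

definition simple_D :: "nat list \<Rightarrow> (nat \<Rightarrow> nat, 'a::field) fgmod" where
  "simple_D ps = (let G = sym_group (sum_list ps) in
     SOME D. simple_fgmod G D \<and> fgsurj G (specht ps) D \<noteq> {})"

definition hook_D :: "nat \<Rightarrow> nat \<Rightarrow> (nat \<Rightarrow> nat, 'a::field) fgmod" where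
  "hook_D p i = simple_D ((p - i) # replicate i 1)"

text \<open>
  The type argument of \<open>mat_M\<close> fixes the field over which the multiplicities are taken. For odd \<open>p\<close>
  its index set \<open>{0..<(p - 1) div 2}\<close> is the interval from \<open>0\<close> to \<open>(p - 3) / 2\<close>.
\<close>

definition mat_M :: "'a::field itself \<Rightarrow> nat \<Rightarrow> nat \<Rightarrow> nat mat" where
  "mat_M TYPE('a) p k = mat ((p - 1) div 2) ((p - 1) div 2)
     (\<lambda>(l, j). \<Sum>i = 0..min k (p - 2 - k).
        summand_mult (sym_group p)
          (tensor (hook_D p (2 * i)) (hook_D p (2 * j) :: (nat \<Rightarrow> nat, 'a) fgmod))
          (hook_D p (2 * l)))"

end

(* Everything happens in the stable module category of G = S_p, where Heller translates can be
   moved through tensor products; so the claim reduces to decomposing the modules D_i (x) D_j.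

   Realise the exterior powers of the natural permutation module by alternating functions on lists
   of points, with exterior multiplication (delta) by the invariant vector (1,...,1) and
   contraction (bd) with it; these anticommute because p = 0 in F. The Specht module of
   (p-i,1^i) is the kernel of bd in degree i. Since a transposition acts as a reflection, an
   argument in the Clifford algebra shows that a submodule of the Specht module is everything or is
   killed by delta. Hence D_i is the image under delta, which is the common kernel of delta and bd
   in degree i+1.

   Exterior multiplication and contraction define maps from D_1 (x) D_i to D_{i+1} and D_{i-1}.
   Both split, and the projection to the complement is a nonzero multiple of a trace, so that
   D_1 (x) D_i is stably D_{i+1} + D_{i-1}. Because simple summands can be cancelled, induction
   gives the truncated Clebsch-Gordan rule for D_i (x) D_j. In particular D_k (x) D_k is stably the
   sum of the D_{2i} with i <= min(k, p-2-k), and tensoring D_{2j} with this sum is column j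
   of M_k. *)
theory Submission
  imports Defs "HOL-Library.Multiset" "HOL-Library.Function_Algebras"
begin

text \<open>Higman's criterion makes the stable category computable: a map factors through a
  projective module iff it is the trace of a linear map. A decomposition may therefore fail by an
  explicit trace, and for D_1 (x) D_i that trace has only (p-2)! as its orbit factor, a unit in F,
  although the group order p! is zero there.

  Multiplicities and cancellation both rest on Schur's lemma: a null endomorphism of a
  non-projective simple module is zero, so stable equations between copies of such a module are
  honest equations.

  The degree is shifted by one against the label: D_i lives in degree i+1. The common kernel of the
  two differentials vanishes in degrees 0 and p, which acts as D_{-1} = D_{p-1} = 0 and explains
  both ends of the truncated rule.

  The exponent is even because D_k (x) D_k involves even labels only and even labels are closed
  under the rule; so a matrix indexed by even labels can record the multiplicities.\<close>

section \<open>Finitely supported matrices\<close>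

text \<open>Finitely supported matrices form a ring (without unit) in which products are total and
  associative; a rectangular matrix is embedded by padding with zeros. This removes all dimension
  side conditions from computations with module homomorphisms.\<close>

typedef (overloaded) 'a fmat =
  "{f :: nat \<Rightarrow> nat \<Rightarrow> 'a::zero. \<exists>N. \<forall>i j. i \<ge> N \<or> j \<ge> N \<longrightarrow> f i j = 0}"
  morphisms ent Fmat
  by (rule exI[of _ "\<lambda>i j. 0"]) auto

setup_lifting type_definition_fmat

lemma fmat_eqI: "(\<And>i j. ent f i j = ent g i j) \<Longrightarrow> f = g"
  unfolding ent_inject[symmetric] by (intro ext)

lemma fmat_bound: "\<exists>N. \<forall>i j. i \<ge> N \<or> j \<ge> N \<longrightarrow> ent f i j = 0"
  using ent[of f] by simp

instantiation fmat :: (ring) ab_group_add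
begin

lift_definition zero_fmat :: "'a fmat" is "\<lambda>i j. 0" by simp

lift_definition plus_fmat :: "'a fmat \<Rightarrow> 'a fmat \<Rightarrow> 'a fmat" is "\<lambda>f g i j. f i j + g i j"
proof -
  fix f g :: "nat \<Rightarrow> nat \<Rightarrow> 'a"
  assume "\<exists>N. \<forall>i j. N \<le> i \<or> N \<le> j \<longrightarrow> f i j = 0" "\<exists>N. \<forall>i j. N \<le> i \<or> N \<le> j \<longrightarrow> g i j = 0"
  then obtain N M where "\<forall>i j. N \<le> i \<or> N \<le> j \<longrightarrow> f i j = 0" "\<forall>i j. M \<le> i \<or> M \<le> j \<longrightarrow> g i j = 0"
    by blast
  then show "\<exists>N. \<forall>i j. N \<le> i \<or> N \<le> j \<longrightarrow> f i j + g i j = 0"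
    by (intro exI[of _ "max N M"]) auto
qed

lift_definition uminus_fmat :: "'a fmat \<Rightarrow> 'a fmat" is "\<lambda>f i j. - f i j" by simp

definition minus_fmat :: "'a fmat \<Rightarrow> 'a fmat \<Rightarrow> 'a fmat" where "minus_fmat f g = f + - g"

instance
proof
  fix a b c :: "'a fmat"
  show "a + b + c = a + (b + c)" "a + b = b + a" "0 + a = a" "- a + a = 0"
    by (auto intro!: fmat_eqI simp: zero_fmat.rep_eq plus_fmat.rep_eq uminus_fmat.rep_eq ac_simps)
qed (simp add: minus_fmat_def)

end

lemma ent_zero [simp]: "ent 0 i j = 0"
  and ent_plus [simp]: "ent (f + g) i j = ent f i j + ent g i j"
  and ent_uminus [simp]: "ent (- f) i j = - ent f i j"
  by (auto simp: zero_fmat.rep_eq plus_fmat.rep_eq uminus_fmat.rep_eq)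

lemma ent_minus [simp]: "ent (f - g) i j = ent f i j - ent g i j"
  by (simp only: minus_fmat_def plus_fmat.rep_eq uminus_fmat.rep_eq diff_conv_add_uminus)

lemma ent_sum [simp]: "ent (sum f A) i j = (\<Sum>x\<in>A. ent (f x) i j)"
  by (induction A rule: infinite_finite_induct) auto

instantiation fmat :: (ring) ring
begin

lift_definition times_fmat :: "'a fmat \<Rightarrow> 'a fmat \<Rightarrow> 'a fmat" is
  "\<lambda>f g i j. \<Sum>k | f i k \<noteq> 0. f i k * g k j"
proof -
  fix f g :: "nat \<Rightarrow> nat \<Rightarrow> 'a"
  assume "\<exists>N. \<forall>i j. N \<le> i \<or> N \<le> j \<longrightarrow> f i j = 0" "\<exists>N. \<forall>i j. N \<le> i \<or> N \<le> j \<longrightarrow> g i j = 0"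
  then obtain N M where "\<forall>i j. N \<le> i \<or> N \<le> j \<longrightarrow> f i j = 0" "\<forall>i j. M \<le> i \<or> M \<le> j \<longrightarrow> g i j = 0"
    by blast
  then show "\<exists>N. \<forall>i j. N \<le> i \<or> N \<le> j \<longrightarrow> (\<Sum>k | f i k \<noteq> 0. f i k * g k j) = 0"
    by (intro exI[of _ "max N M"]) auto
qed

text \<open>The product sums over the support of a row, so that it is total without a common inner
  dimension. Any bound past which one of the two factors vanishes turns it into an ordinary finite
  sum.\<close>

lemma ent_times_gen:
  assumes "\<And>k. k \<ge> N \<Longrightarrow> ent f i k = 0 \<or> ent g k j = 0"
  shows "ent (f * g) i j = (\<Sum>k<N. ent f i k * ent g k j)"
proof -
  obtain M where M: "\<And>a b. M \<le> a \<or> M \<le> b \<Longrightarrow> ent f a b = 0"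
    using fmat_bound by metis
  have "ent (f * g) i j = (\<Sum>k | ent f i k \<noteq> 0. ent f i k * ent g k j)"
    by (simp add: times_fmat.rep_eq)
  also have "\<dots> = (\<Sum>k<max M N. ent f i k * ent g k j)"
  proof (rule sum.mono_neutral_left)
    show "{k. ent f i k \<noteq> 0} \<subseteq> {..<max M N}"
      using M by (force simp: not_le[symmetric])
    show "\<forall>k\<in>{..<max M N} - {k. ent f i k \<noteq> 0}. ent f i k * ent g k j = 0"
      by auto
  qed simp
  also have "\<dots> = (\<Sum>k<N. ent f i k * ent g k j)"
  proof (rule sum.mono_neutral_right)
    show "\<forall>k\<in>{..<max M N} - {..<N}. ent f i k * ent g k j = 0"
      using assms by (metis Diff_iff lessThan_iff mult_not_zero not_le)
  qed auto
  finally show ?thesis .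
qed

instance
proof
  fix a b c :: "'a fmat"
  obtain N where N: "\<And>i j. N \<le> i \<or> N \<le> j \<Longrightarrow> ent a i j = 0"
    using fmat_bound by metis
  obtain M where M: "\<And>i j. M \<le> i \<or> M \<le> j \<Longrightarrow> ent b i j = 0"
    using fmat_bound by metis
  obtain K where K: "\<And>i j. K \<le> i \<or> K \<le> j \<Longrightarrow> ent c i j = 0"
    using fmat_bound by metis
  define B where "B = max N (max M K)"
  have a: "\<And>i j. B \<le> i \<or> B \<le> j \<Longrightarrow> ent a i j = 0"
    and b: "\<And>i j. B \<le> i \<or> B \<le> j \<Longrightarrow> ent b i j = 0"
    and c: "\<And>i j. B \<le> i \<or> B \<le> j \<Longrightarrow> ent c i j = 0"
    using N M K by (auto simp: B_def)
  have ab: "ent (a * f) i j = (\<Sum>k<B. ent a i k * ent f k j)" for i j f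
    by (rule ent_times_gen) (use a in auto)
  have bb: "ent (b * f) i j = (\<Sum>k<B. ent b i k * ent f k j)" for i j f
    by (rule ent_times_gen) (use b in auto)
  have cb: "ent (f * c) i j = (\<Sum>k<B. ent f i k * ent c k j)" for i j f
    by (rule ent_times_gen) (use c in auto)
  show "a * b * c = a * (b * c)"
  proof (rule fmat_eqI)
    fix i j
    have "ent (a * b * c) i j = (\<Sum>k<B. \<Sum>l<B. ent a i l * ent b l k * ent c k j)"
      by (simp add: ab cb sum_distrib_right)
    also have "\<dots> = (\<Sum>l<B. \<Sum>k<B. ent a i l * ent b l k * ent c k j)"
      by (rule sum.swap)
    also have "\<dots> = ent (a * (b * c)) i j"
      by (simp add: ab bb sum_distrib_left mult.assoc)
    finally show "ent (a * b * c) i j = ent (a * (b * c)) i j" .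
  qed
  show "(a + b) * c = a * c + b * c"
    by (rule fmat_eqI) (simp add: cb distrib_right sum.distrib)
  show "a * (b + c) = a * b + a * c"
    by (rule fmat_eqI) (simp add: ab distrib_left sum.distrib)
qed

end

text \<open>The identity of the space of dimension \<open>n\<close>. The equations
  \<open>E r * f = f\<close> and \<open>f * E c = f\<close> take over the role of the dimensions:
  they say that \<open>f\<close> fits into \<open>r\<close> rows and \<open>c\<close>
  columns.\<close>

lift_definition E :: "nat \<Rightarrow> 'a::ring_1 fmat" is "\<lambda>n i j. if i = j \<and> i < n then 1 else 0"
proof -
  fix n :: nat
  show "\<exists>N. \<forall>i j. N \<le> i \<or> N \<le> j \<longrightarrow> (if i = j \<and> i < n then 1 else 0 :: 'a) = 0"
    by (intro exI[of _ n]) auto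
qed

lemma ent_E: "ent (E n) i j = (if i = j \<and> i < n then 1 else 0)"
  by (simp add: E.rep_eq)

lemma ent_E_mult: "ent (E n * f) i j = (if i < n then ent f i j else 0)"
  by (subst ent_times_gen[of n]) (auto simp: ent_E if_distrib[of "\<lambda>x. x * _"] cong: if_cong)

lemma ent_mult_E: "ent (f * E n) i j = (if j < n then ent f i j else 0)"
  by (subst ent_times_gen[of n]) (auto simp: ent_E if_distrib[of "\<lambda>x. _ * x"] cong: if_cong)

lemma E_mult_iff: "E n * f = f \<longleftrightarrow> (\<forall>i j. i \<ge> n \<longrightarrow> ent f i j = 0)"
proof
  assume "E n * f = f"
  then have "\<And>i j. ent (E n * f) i j = ent f i j" by simp
  then show "\<forall>i j. i \<ge> n \<longrightarrow> ent f i j = 0" by (simp add: ent_E_mult) (metis not_le)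
qed (auto intro!: fmat_eqI simp: ent_E_mult)

lemma mult_E_iff: "f * E n = f \<longleftrightarrow> (\<forall>i j. j \<ge> n \<longrightarrow> ent f i j = 0)"
proof
  assume "f * E n = f"
  then have "\<And>i j. ent (f * E n) i j = ent f i j" by simp
  then show "\<forall>i j. j \<ge> n \<longrightarrow> ent f i j = 0" by (simp add: ent_mult_E) (metis not_le)
qed (auto intro!: fmat_eqI simp: ent_mult_E)

lemma E_E [simp]: "E n * E n = (E n :: 'a::ring_1 fmat)"
  by (rule fmat_eqI) (simp add: ent_E_mult ent_E)

lift_definition fm :: "nat \<Rightarrow> nat \<Rightarrow> (nat \<Rightarrow> nat \<Rightarrow> 'a::zero) \<Rightarrow> 'a fmat" is
  "\<lambda>r c f i j. if i < r \<and> j < c then f i j else 0"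
proof -
  fix r c and f :: "nat \<Rightarrow> nat \<Rightarrow> 'a"
  show "\<exists>N. \<forall>i j. N \<le> i \<or> N \<le> j \<longrightarrow> (if i < r \<and> j < c then f i j else 0) = 0"
    by (intro exI[of _ "max r c"]) auto
qed

lemma ent_fm [simp]: "ent (fm r c f) i j = (if i < r \<and> j < c then f i j else 0)"
  by (simp add: fm.rep_eq)

lemma E_fm: "r \<le> n \<Longrightarrow> E n * fm r c f = (fm r c f :: 'a::ring_1 fmat)"
  by (rule fmat_eqI) (simp add: ent_E_mult)

lemma fm_E: "c \<le> n \<Longrightarrow> fm r c f * E n = (fm r c f :: 'a::ring_1 fmat)"
  by (rule fmat_eqI) (simp add: ent_mult_E)

definition em :: "'a mat \<Rightarrow> 'a::zero fmat" where
  "em A = fm (dim_row A) (dim_col A) (\<lambda>i j. A $$ (i, j))"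

definition dm :: "nat \<Rightarrow> nat \<Rightarrow> 'a fmat \<Rightarrow> 'a::zero mat" where
  "dm r c f = mat r c (\<lambda>(i, j). ent f i j)"

lemma dm_carrier [simp]: "dm r c f \<in> carrier_mat r c"
  and dim_dm [simp]: "dim_row (dm r c f) = r" "dim_col (dm r c f) = c"
  by (auto simp: dm_def)

lemma ent_em: "A \<in> carrier_mat r c \<Longrightarrow> ent (em A) i j = (if i < r \<and> j < c then A $$ (i, j) else 0)"
  by (simp add: em_def carrier_matD)

lemma em_dm: "E r * f = f \<Longrightarrow> f * E c = f \<Longrightarrow> em (dm r c f) = (f :: 'a::ring_1 fmat)"
  by (rule fmat_eqI) (auto simp: E_mult_iff mult_E_iff em_def dm_def)

lemma dm_em: "A \<in> carrier_mat r c \<Longrightarrow> dm r c (em A) = A"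
  by (rule eq_matI) (auto simp: em_def dm_def)

lemma em_inj:
  assumes "A \<in> carrier_mat r c" "B \<in> carrier_mat r c" "em A = em B"
  shows "A = B"
  using assms dm_em by metis

lemma em_mult:
  fixes A B :: "'a::ring mat"
  assumes "A \<in> carrier_mat r n" "B \<in> carrier_mat n c"
  shows "em (A * B) = em A * em B"
proof (rule fmat_eqI)
  fix i j
  have "ent (em A * em B) i j = (\<Sum>k<n. ent (em A) i k * ent (em B) k j)"
    by (rule ent_times_gen) (use assms in \<open>auto simp: ent_em\<close>)
  also have "\<dots> = ent (em (A * B)) i j"
    using assms by (auto simp: ent_em[OF mult_carrier_mat[OF assms]] ent_em[OF assms(1)]
        ent_em[OF assms(2)] scalar_prod_def atLeast0LessThan)
  finally show "ent (em (A * B)) i j = ent (em A * em B) i j" by simp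
qed

lemma em_one: "em (1\<^sub>m n) = (E n :: 'a::ring_1 fmat)"
  by (rule fmat_eqI) (auto simp: em_def ent_E)

lemma E_em: "A \<in> carrier_mat r c \<Longrightarrow> E r * em A = (em A :: 'a::ring_1 fmat)"
  and em_E: "A \<in> carrier_mat r c \<Longrightarrow> em A * E c = (em A :: 'a::ring_1 fmat)"
  by (auto simp: em_def E_fm fm_E)

text \<open>Rests on the fact that a one-sided inverse of a square matrix over a field is
  two-sided.\<close>

lemma E_left_inverse:
  assumes "E n * a = a" "a * E n = a" "E n * b = b" "b * E n = b" "a * b = (E n :: 'a::field fmat)"
  shows "b * a = E n"
proof -
  let ?A = "dm n n a" and ?B = "dm n n b"
  have em: "em ?A = a" "em ?B = b" using assms by (simp_all add: em_dm)
  have "em (?A * ?B) = em (1\<^sub>m n)" by (subst em_mult[of _ n n _ n]) (auto simp: em em_one assms)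
  then have "?A * ?B = 1\<^sub>m n" by (intro em_inj[of _ n n]) auto
  then have "?B * ?A = 1\<^sub>m n" by (intro mat_mult_left_right_inverse[of ?A n ?B]) auto
  then have "em ?B * em ?A = E n" by (metis em_mult em_one dm_carrier)
  then show ?thesis by (simp add: em)
qed

text \<open>A rank inequality. If \<open>n < m\<close>, both factors may be regarded as square of
  size \<open>m\<close>, hence \<open>b * a = E m\<close>; but row \<open>n\<close> of
  \<open>b\<close> is zero.\<close>

lemma E_le_if_factor:
  assumes "E m * a = a" "a * E n = a" "E n * b = b" "b * E m = b" "a * b = (E m :: 'a::field fmat)"
  shows "m \<le> n"
proof (rule ccontr)
  assume "\<not> m \<le> n"
  then have nm: "n < m" by simp
  have z: "\<And>i j. j \<ge> n \<Longrightarrow> ent a i j = 0" "\<And>i j. i \<ge> n \<Longrightarrow> ent b i j = 0"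
    using assms by (auto simp: E_mult_iff mult_E_iff)
  have "a * E m = a" "E m * b = b" using z nm by (auto simp: E_mult_iff mult_E_iff)
  then have ba: "b * a = E m" using E_left_inverse assms by metis
  have "ent (b * a) n n = 0" by (subst ent_times_gen[of 0]) (auto simp: z)
  then show False using nm by (simp add: ba ent_E)
qed

lemma E_eq_zero_iff [simp]: "(E n :: 'a::field fmat) = 0 \<longleftrightarrow> n = 0"
proof
  assume "(E n :: 'a fmat) = 0"
  then have "ent (E n :: 'a fmat) 0 0 = 0" by simp
  then show "n = 0" by (simp add: ent_E split: if_splits)
qed (auto intro!: fmat_eqI simp: ent_E)

section \<open>The stable module category\<close>

abbreviation Idm :: "('g, 'a::field) fgmod \<Rightarrow> 'a fmat" where "Idm V \<equiv> E (mdim V)"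

definition rh :: "('g, 'a::field) fgmod \<Rightarrow> 'g \<Rightarrow> 'a fmat" where "rh V g = em (mact V g)"

text \<open>The first two equations replace the dimension condition of \<open>fghom\<close>: they
  confine the support of \<open>f\<close> to a rectangle.\<close>

definition hm :: "'g monoid \<Rightarrow> ('g, 'a::field) fgmod \<Rightarrow> ('g, 'a) fgmod \<Rightarrow> 'a fmat \<Rightarrow> bool" where
  "hm G V W f \<longleftrightarrow> Idm W * f = f \<and> f * Idm V = f \<and> (\<forall>g\<in>carrier G. f * rh V g = rh W g * f)"

lemma mult_assoc_eq: "a * b = c \<Longrightarrow> a * (b * x) = c * (x :: 'a::semigroup_mult)"
  by (metis mult.assoc)

lemma hm_simps:
  assumes "hm G V W f"
  shows "Idm W * f = f" "f * Idm V = f" "Idm W * (f * x) = f * x" "f * (Idm V * x) = f * x"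
  using assms by (auto simp: hm_def mult.assoc[symmetric])

lemma hm_rh: "hm G V W f \<Longrightarrow> g \<in> carrier G \<Longrightarrow> f * rh V g = rh W g * f"
  by (simp add: hm_def)

lemma hm_comp: "hm G V W f \<Longrightarrow> hm G W X h \<Longrightarrow> hm G V X (h * f)"
  unfolding hm_def by (metis mult.assoc)

lemma hm_add: "hm G V W f \<Longrightarrow> hm G V W h \<Longrightarrow> hm G V W (f + h)"
  and hm_diff: "hm G V W f \<Longrightarrow> hm G V W h \<Longrightarrow> hm G V W (f - h)"
  and hm_uminus: "hm G V W f \<Longrightarrow> hm G V W (- f)"
  and hm_zero: "hm G V W 0"
  by (auto simp: hm_def algebra_simps)

lemma fghom_hm: "A \<in> fghom G V W \<Longrightarrow> is_fgmod G V \<Longrightarrow> is_fgmod G W \<Longrightarrow> hm G V W (em A)"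
  unfolding fghom_def hm_def is_fgmod_def rh_def
  by (auto simp: E_em em_E) (metis em_mult)

lemma hm_fghom:
  assumes "hm G V W f" "is_fgmod G V" "is_fgmod G W"
  shows "dm (mdim W) (mdim V) f \<in> fghom G V W" "em (dm (mdim W) (mdim V) f) = f"
proof -
  let ?A = "dm (mdim W) (mdim V) f"
  show em: "em ?A = f" using assms by (auto simp: hm_def intro!: em_dm)
  have "?A * mact V g = mact W g * ?A" if g: "g \<in> carrier G" for g
  proof (rule em_inj[of _ "mdim W" "mdim V"])
    have c: "mact V g \<in> carrier_mat (mdim V) (mdim V)" "mact W g \<in> carrier_mat (mdim W) (mdim W)"
      using assms g by (auto simp: is_fgmod_def)
    then show "?A * mact V g \<in> carrier_mat (mdim W) (mdim V)"
      "mact W g * ?A \<in> carrier_mat (mdim W) (mdim V)" by auto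
    show "em (?A * mact V g) = em (mact W g * ?A)"
      using hm_rh[OF assms(1) g] em_mult[OF dm_carrier c(1)] em_mult[OF c(2) dm_carrier]
      by (simp add: em rh_def)
  qed
  then show "?A \<in> fghom G V W" by (simp add: fghom_def)
qed

definition ds :: "('g, 'a::field) fgmod \<Rightarrow> ('g, 'a) fgmod \<Rightarrow> ('g, 'a) fgmod" where
  "ds V W = dsum [V, W]"

text \<open>Biproduct data without the equation \<open>i1 * q1 + i2 * q2 = Idm V\<close>. That
  equation is imposed separately, exactly for a direct sum, or only up to a null map for a stable
  one.\<close>

definition bip :: "'g monoid \<Rightarrow> ('g, 'a::field) fgmod \<Rightarrow> ('g, 'a) fgmod \<Rightarrow> ('g, 'a) fgmod \<Rightarrow>
    'a fmat \<Rightarrow> 'a fmat \<Rightarrow> 'a fmat \<Rightarrow> 'a fmat \<Rightarrow> bool" where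
  "bip G V U W i1 q1 i2 q2 \<longleftrightarrow> hm G U V i1 \<and> hm G V U q1 \<and> hm G W V i2 \<and> hm G V W q2 \<and>
     q1 * i1 = Idm U \<and> q2 * i2 = Idm W \<and> q1 * i2 = 0 \<and> q2 * i1 = 0"

locale fin_group = group G for G :: "'g monoid" (structure) +
  assumes fin: "finite (carrier G)"
begin

abbreviation md :: "('g, 'a::field) fgmod \<Rightarrow> bool" where "md V \<equiv> is_fgmod G V"

lemma rh_simps:
  assumes "md V"
  shows "g \<in> carrier G \<Longrightarrow> Idm V * rh V g = rh V g" "g \<in> carrier G \<Longrightarrow> rh V g * Idm V = rh V g"
    "g \<in> carrier G \<Longrightarrow> Idm V * (rh V g * x) = rh V g * x"
    "g \<in> carrier G \<Longrightarrow> rh V g * (Idm V * x) = rh V g * x"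
    "rh V \<one> = Idm V"
    "g \<in> carrier G \<Longrightarrow> h \<in> carrier G \<Longrightarrow> rh V (g \<otimes> h) = rh V g * rh V h"
    "g \<in> carrier G \<Longrightarrow> rh V g * rh V (inv g) = Idm V"
    "g \<in> carrier G \<Longrightarrow> rh V (inv g) * rh V g = Idm V"
    "g \<in> carrier G \<Longrightarrow> rh V g * (rh V (inv g) * x) = Idm V * x"
    "g \<in> carrier G \<Longrightarrow> rh V (inv g) * (rh V g * x) = Idm V * x"
proof -
  show u: "Idm V * rh V g = rh V g" "rh V g * Idm V = rh V g" if "g \<in> carrier G" for g
    using that assms by (auto simp: rh_def is_fgmod_def E_em em_E)
  show "Idm V * (rh V g * x) = rh V g * x" "rh V g * (Idm V * x) = rh V g * x" if "g \<in> carrier G"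
    using u that by (simp_all flip: mult.assoc)
  show one: "rh V \<one> = Idm V" using assms by (simp add: rh_def is_fgmod_def em_one)
  show m: "rh V (g \<otimes> h) = rh V g * rh V h" if "g \<in> carrier G" "h \<in> carrier G" for g h
    using that assms
    by (auto simp: rh_def is_fgmod_def em_mult[of _ "mdim V" "mdim V" _ "mdim V"])
  show i: "rh V g * rh V (inv g) = Idm V" "rh V (inv g) * rh V g = Idm V" if "g \<in> carrier G"
    using m[of g "inv g"] m[of "inv g" g] that by (auto simp: one)
  show "rh V g * (rh V (inv g) * x) = Idm V * x" "rh V (inv g) * (rh V g * x) = Idm V * x"
    if "g \<in> carrier G"
    using i that by (simp_all flip: mult.assoc)
qed

lemma hm_Id: "md V \<Longrightarrow> hm G V V (Idm V)"
  by (simp add: hm_def rh_simps)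

text \<open>The relative trace from the trivial subgroup; \<open>t\<close> is merely linear.\<close>

definition Tr :: "('g, 'a::field) fgmod \<Rightarrow> ('g, 'a) fgmod \<Rightarrow> 'a fmat \<Rightarrow> 'a fmat" where
  "Tr V W t = (\<Sum>g\<in>carrier G. rh W g * t * rh V (inv g))"

lemma hm_Tr:
  assumes V: "md V" and W: "md W"
  shows "hm G V W (Tr V W t)"
  unfolding hm_def
proof (intro conjI ballI)
  show "Idm W * Tr V W t = Tr V W t" "Tr V W t * Idm V = Tr V W t"
    by (simp_all add: Tr_def sum_distrib_left sum_distrib_right mult.assoc rh_simps assms
        cong: sum.cong)
  fix h assume h: "h \<in> carrier G"
  have "rh W h * Tr V W t = (\<Sum>g\<in>carrier G. rh W (h \<otimes> g) * t * rh V (inv g))"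
    by (simp add: Tr_def sum_distrib_left mult.assoc rh_simps assms h cong: sum.cong)
  also have "\<dots> = (\<Sum>g\<in>carrier G. rh W g * t * rh V (inv g \<otimes> h))"
  proof (rule sum.reindex_bij_witness[of _ "\<lambda>g. inv h \<otimes> g" "\<lambda>g. h \<otimes> g"])
    fix g assume g: "g \<in> carrier G"
    show "inv h \<otimes> (h \<otimes> g) = g" "h \<otimes> (inv h \<otimes> g) = g"
      using g h by (simp_all flip: m_assoc)
    have "inv (h \<otimes> g) \<otimes> h = inv g"
      using g h by (simp add: inv_mult_group m_assoc)
    then show "rh W (h \<otimes> g) * t * rh V (inv (h \<otimes> g) \<otimes> h) = rh W (h \<otimes> g) * t * rh V (inv g)"
      by simp
  qed (use h in auto)
  also have "\<dots> = Tr V W t * rh V h"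
    by (simp add: Tr_def sum_distrib_right mult.assoc rh_simps assms h cong: sum.cong)
  finally show "Tr V W t * rh V h = rh W h * Tr V W t" by simp
qed

lemma hm_mult_Tr: "hm G W X f \<Longrightarrow> f * Tr V W t = Tr V X (f * t)"
  by (simp add: Tr_def sum_distrib_left hm_rh mult.assoc[symmetric] cong: sum.cong)

lemma Tr_mult_hm: "hm G V W f \<Longrightarrow> Tr W X t * f = Tr V X (t * f)"
  by (simp add: Tr_def sum_distrib_right hm_rh mult.assoc cong: sum.cong)

lemma Tr_add: "Tr V W (s + t) = Tr V W s + Tr V W t"
  and Tr_uminus: "Tr V W (- t) = - Tr V W t"
  by (simp_all add: Tr_def sum.distrib algebra_simps sum_negf)

text \<open>By Higman's criterion \<^term>\<open>null V W f\<close> says that \<open>f\<close> factors through a projective module.\<close>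

definition null :: "('g, 'a::field) fgmod \<Rightarrow> ('g, 'a) fgmod \<Rightarrow> 'a fmat \<Rightarrow> bool" where
  "null V W f \<longleftrightarrow> (\<exists>t. f = Tr V W t)"

lemma null_add: "null V W f \<Longrightarrow> null V W h \<Longrightarrow> null V W (f + h)"
  and null_uminus: "null V W f \<Longrightarrow> null V W (- f)"
  unfolding null_def by (metis Tr_add, metis Tr_uminus)

lemma null_zero: "null V W 0"
  unfolding null_def by (rule exI[of _ 0]) (simp add: Tr_def)

lemma null_diff: "null V W f \<Longrightarrow> null V W h \<Longrightarrow> null V W (f - h)"
  using null_add[OF _ null_uminus] by fastforce

lemma null_left: "null V W f \<Longrightarrow> hm G W X h \<Longrightarrow> null V X (h * f)"
  unfolding null_def by (metis hm_mult_Tr)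

lemma null_right: "null W X f \<Longrightarrow> hm G V W h \<Longrightarrow> null V X (f * h)"
  unfolding null_def by (metis Tr_mult_hm)

definition proj :: "('g, 'a::field) fgmod \<Rightarrow> bool" where
  "proj V \<longleftrightarrow> md V \<and> null V V (Idm V)"

lemma proj_null:
  assumes "proj V" "hm G V W f" shows "null V W f"
  using null_left[of V V "Idm V" W f] assms by (simp add: proj_def hm_simps)

lemma proj_null':
  assumes "proj W" "hm G V W f" shows "null V W f"
  using null_right[of W W "Idm W" V f] assms by (simp add: proj_def hm_simps)

lemma proj_retract:
  assumes "proj V" "md W" "hm G W V i" "hm G V W q" "q * i = Idm W" shows "proj W"
  using null_left[OF proj_null'[OF assms(1,3)] assms(4)] assms by (simp add: proj_def)

section \<open>Isomorphism in the stable category\<close>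

definition siso :: "('g, 'a::field) fgmod \<Rightarrow> ('g, 'a) fgmod \<Rightarrow> bool" where
  "siso V W \<longleftrightarrow> md V \<and> md W \<and> (\<exists>f h. hm G V W f \<and> hm G W V h \<and>
     null V V (Idm V - h * f) \<and> null W W (Idm W - f * h))"

lemma siso_md: "siso V W \<Longrightarrow> md V" "siso V W \<Longrightarrow> md W"
  by (auto simp: siso_def)

lemma siso_refl: "md V \<Longrightarrow> siso V V"
  unfolding siso_def by (intro conjI exI[of _ "Idm V"]) (auto simp: hm_Id null_zero)

lemma siso_sym: "siso V W \<Longrightarrow> siso W V"
  unfolding siso_def by blast

text \<open>Null maps form an ideal, and
  \<open>1 - h h' f' f = (1 - h f) + h (1 - h' f') f\<close>.\<close>

lemma null_comp:
  assumes f: "hm G V W f" "hm G W V h" "null V V (Idm V - h * f)"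
    and f': "hm G W X f'" "hm G X W h'" "null W W (Idm W - h' * f')"
  shows "null V V (Idm V - h * h' * (f' * f))"
proof -
  have "null V V ((Idm V - h * f) + h * ((Idm W - h' * f') * f))"
    using null_add[OF f(3) null_left[OF null_right[OF f'(3) f(1)] f(2)]] .
  moreover have "(Idm V - h * f) + h * ((Idm W - h' * f') * f) = Idm V - h * h' * (f' * f)"
    using f f' by (simp add: algebra_simps hm_simps)
  ultimately show ?thesis by simp
qed

lemma siso_trans:
  assumes "siso V W" "siso W X" shows "siso V X"
proof -
  obtain f h where f: "hm G V W f" "hm G W V h" "null V V (Idm V - h * f)" "null W W (Idm W - f * h)"
    using assms(1) by (auto simp: siso_def)
  obtain f' h' where f': "hm G W X f'" "hm G X W h'" "null W W (Idm W - h' * f')" "null X X (Idm X - f' * h')"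
    using assms(2) by (auto simp: siso_def)
  show ?thesis
    unfolding siso_def
    using assms siso_md hm_comp[OF f(1) f'(1)] hm_comp[OF f'(2) f(2)] null_comp[OF f(1-3) f'(1-3)]
      null_comp[OF f'(2,1,4) f(2,1,4)] by blast
qed

lemma iso_siso:
  assumes "md V" "md W" "hm G V W f" "hm G W V h" "h * f = Idm V" "f * h = Idm W"
  shows "siso V W"
  unfolding siso_def using assms null_zero by (metis cancel_comm_monoid_add_class.diff_cancel)

lemma hm_inverse:
  assumes "md V" "md W" "hm G V W f" "Idm V * h = h" "h * Idm W = h" "h * f = Idm V" "f * h = Idm W"
  shows "hm G W V h"
  unfolding hm_def
proof (intro conjI ballI)
  fix g assume g: "g \<in> carrier G"
  have "h * rh W g = h * (rh W g * (f * h))"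
    by (simp add: assms rh_simps g)
  also have "\<dots> = h * ((f * rh V g) * h)" using hm_rh[OF assms(3) g] by (simp add: mult.assoc)
  also have "\<dots> = rh V g * h"
    using assms g by (simp add: mult.assoc[symmetric] rh_simps)
  finally show "h * rh W g = rh V g * h" .
qed (use assms in auto)

text \<open>Padded matrices forget their dimensions, whereas \<open>invertible_mat\<close> demands a
  square matrix. \<open>E_le_if_factor\<close>, used in both directions, shows that the dimensions
  agree.\<close>

lemma fgiso_iff:
  "fgiso G V W \<longleftrightarrow> md V \<and> md W \<and> (\<exists>f h. hm G V W f \<and> hm G W V h \<and> h * f = Idm V \<and> f * h = Idm W)"
proof
  assume "fgiso G V W"
  then obtain A where A: "md V" "md W" "A \<in> fghom G V W" "invertible_mat A"
    by (auto simp: fgiso_def)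
  then have cA: "A \<in> carrier_mat (mdim W) (mdim V)" by (simp add: fghom_def)
  obtain B where B: "inverts_mat A B" "inverts_mat B A" and sq: "mdim W = mdim V"
    using A cA by (auto simp: invertible_mat_def)
  then have cB: "B \<in> carrier_mat (mdim V) (mdim W)"
    using cA unfolding inverts_mat_def
    by (metis carrier_matD carrier_matI index_mult_mat(2,3) index_one_mat(2,3))
  have AB: "em A * em B = Idm W" "em B * em A = Idm V"
    using B cA cB em_mult[OF cA cB] em_mult[OF cB cA] by (auto simp: inverts_mat_def em_one)
  have "hm G W V (em B)"
    by (rule hm_inverse[OF A(1,2) fghom_hm[OF A(3,1,2)]]) (use AB E_em[OF cB] em_E[OF cB] in auto)
  then show "md V \<and> md W \<and> (\<exists>f h. hm G V W f \<and> hm G W V h \<and> h * f = Idm V \<and> f * h = Idm W)"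
    using A AB fghom_hm by blast
next
  assume "md V \<and> md W \<and> (\<exists>f h. hm G V W f \<and> hm G W V h \<and> h * f = Idm V \<and> f * h = Idm W)"
  then obtain f h where f: "md V" "md W" "hm G V W f" "hm G W V h" "h * f = Idm V" "f * h = Idm W"
    by blast
  have d: "mdim V = mdim W"
    using E_le_if_factor[of "mdim V" h "mdim W" f] E_le_if_factor[of "mdim W" f "mdim V" h] f
    by (simp add: hm_def)
  let ?A = "dm (mdim W) (mdim V) f" and ?B = "dm (mdim V) (mdim W) h"
  have em: "em ?A = f" "em ?B = h" using hm_fghom f by blast+
  have "em (?A * ?B) = em (1\<^sub>m (mdim W))" "em (?B * ?A) = em (1\<^sub>m (mdim V))"
    using em_mult[OF dm_carrier[of "mdim W" "mdim V" f] dm_carrier[of "mdim V" "mdim W" h]]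
      em_mult[OF dm_carrier[of "mdim V" "mdim W" h] dm_carrier[of "mdim W" "mdim V" f]]
    by (simp_all add: em em_one f)
  then have "?A * ?B = 1\<^sub>m (mdim W)" "?B * ?A = 1\<^sub>m (mdim V)"
    using em_inj[of "?A * ?B" "mdim W" "mdim W" "1\<^sub>m (mdim W)"]
      em_inj[of "?B * ?A" "mdim V" "mdim V" "1\<^sub>m (mdim V)"]
    by (metis dm_carrier mult_carrier_mat one_carrier_mat)+
  then have "invertible_mat ?A"
    by (auto simp: invertible_mat_def inverts_mat_def d intro!: exI[of _ ?B])
  then show "fgiso G V W" using f hm_fghom(1)[OF f(3,1,2)] by (auto simp: fgiso_def)
qed

lemma fgiso_siso: "fgiso G V W \<Longrightarrow> siso V W"
  by (auto simp: fgiso_iff intro: iso_siso)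

lemma fgiso_refl: "md V \<Longrightarrow> fgiso G V V"
  unfolding fgiso_iff using hm_Id E_E by blast

lemma fgiso_sym: "fgiso G V W \<Longrightarrow> fgiso G W V"
  unfolding fgiso_iff by blast

lemma fgiso_trans:
  assumes "fgiso G V W" "fgiso G W X" shows "fgiso G V X"
proof -
  obtain f h where f: "md V" "md W" "hm G V W f" "hm G W V h" "h * f = Idm V" "f * h = Idm W"
    using assms(1) unfolding fgiso_iff by auto
  obtain f' h' where f': "md X" "hm G W X f'" "hm G X W h'" "h' * f' = Idm W" "f' * h' = Idm X"
    using assms(2) unfolding fgiso_iff by auto
  have "(h * h') * (f' * f) = Idm V"
    using f f' by (simp add: mult.assoc mult_assoc_eq[OF f'(4)] hm_simps)
  moreover have "(f' * f) * (h * h') = Idm X"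
    using f f' by (simp add: mult.assoc mult_assoc_eq[OF f(6)] hm_simps)
  ultimately show ?thesis
    unfolding fgiso_iff using f f' hm_comp by blast
qed

lemma fgiso_mdim: "fgiso G V W \<Longrightarrow> mdim V = mdim W"
  by (auto simp: fgiso_def fghom_def invertible_mat_def)

end

section \<open>Direct sums\<close>

lemma diag_block_mat_pair:
  "diag_block_mat [A, B] = four_block_mat A (0\<^sub>m (dim_row A) (dim_col B)) (0\<^sub>m (dim_row B) (dim_col A)) B"
  by (simp add: Let_def) (rule eq_matI; auto)

lemma dsum_Cons: "dsum (V # Vs) = ds V (dsum Vs)"
proof -
  have "diag_block_mat (A # As) = diag_block_mat [A, diag_block_mat As]" for A :: "'z::zero mat" and As
    unfolding diag_block_mat_pair by (simp add: Let_def)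
  then show ?thesis
    by (simp add: ds_def dsum_def del: diag_block_mat.simps) (intro ext)
qed

text \<open>An equality of modules and not only an isomorphism, because block diagonal matrices
  concatenate strictly. Hence \<open>ds_assoc\<close> and \<open>dsum_concat\<close> are equations
  too, and nested sums can be rewritten.\<close>

lemma dsum_append: "dsum (Vs @ Ws) = ds (dsum Vs) (dsum Ws)"
proof -
  have "diag_block_mat (As @ Bs) = diag_block_mat [diag_block_mat As, diag_block_mat Bs]"
    for As Bs :: "'z::zero mat list"
    unfolding diag_block_mat_pair by (simp add: Let_def diag_block_mat_append)
  then show ?thesis
    by (simp add: ds_def dsum_def del: diag_block_mat.simps) (intro ext)
qed

lemma dsum_single [simp]: "dsum [V] = V"
  by (simp add: dsum_def diag_block_mat_singleton del: diag_block_mat.simps)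

lemma ds_dsum_Nil [simp]: "ds V (dsum []) = V"
  by (simp flip: dsum_Cons)

lemma ds_assoc: "ds (ds U V) W = ds U (ds V W)"
  using dsum_append[of "[U, V]" "[W]"] by (simp add: dsum_Cons)

lemma dsum_concat: "dsum (concat Vss) = dsum (map dsum Vss)"
  by (induction Vss) (simp_all add: dsum_append dsum_Cons)

text \<open>With \<open>a = m\<close>, \<open>b = 0\<close> this is the inclusion of a second
  summand behind \<open>m\<close> coordinates; with \<open>a = 0\<close>, \<open>b = m\<close> it is
  the projection to that summand.\<close>

definition shift :: "nat \<Rightarrow> nat \<Rightarrow> nat \<Rightarrow> nat \<Rightarrow> 'a::ring_1 fmat" where
  "shift r c a b = fm r c (\<lambda>i j. if i + b = j + a then 1 else 0)"

lemma ent_shift_mult: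
  "ent (shift (b + n) n b 0 * f) i j = (if b \<le> i \<and> i < b + n then ent f (i - b) j else 0)"
proof -
  have "ent (shift (b + n) n b 0 * f) i j = (\<Sum>k<n. if k = i - b \<and> b \<le> i \<and> i < b + n then ent f k j else 0)"
    by (subst ent_times_gen[of n]) (auto simp: shift_def intro!: sum.cong)
  then show ?thesis by (auto simp: sum.delta)
qed

lemma ent_mult_shift:
  "ent (f * shift n (b + n) 0 b) i j = (if b \<le> j \<and> j < b + n then ent f i (j - b) else 0)"
proof -
  have "ent (f * shift n (b + n) 0 b) i j = (\<Sum>k<n. if k = j - b \<and> b \<le> j \<and> j < b + n then ent f i k else 0)"
    by (subst ent_times_gen[of n]) (auto simp: shift_def intro!: sum.cong)
  then show ?thesis by (auto simp: sum.delta)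
qed

lemma ent_shift'_mult:
  "ent (shift n (b + n) 0 b * f) i j = (if i < n then ent f (i + b) j else 0)"
proof -
  have "ent (shift n (b + n) 0 b * f) i j = (\<Sum>k<b + n. if k = i + b \<and> i < n then ent f k j else 0)"
    by (subst ent_times_gen[of "b + n"]) (auto simp: shift_def intro!: sum.cong)
  then show ?thesis by (auto simp: sum.delta)
qed

context fin_group
begin

lemma ds_data:
  fixes U W :: "('g, 'a::field) fgmod"
  assumes U: "md U" and W: "md W"
  obtains i1 q1 i2 q2 where "md (ds U W)" "bip G (ds U W) U W i1 q1 i2 q2"
    "i1 * q1 + i2 * q2 = Idm (ds U W)"
proof -
  define m n where "m = mdim U" and "n = mdim W"
  \<comment> \<open>Padding identifies the first summand with the leading coordinates, so
    \<open>E m\<close> serves both as its inclusion and as its projection.\<close>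
  define i1 :: "'a fmat" where "i1 = E m"
  define i2 :: "'a fmat" where "i2 = shift (m + n) n m 0"
  define q2 :: "'a fmat" where "q2 = shift n (m + n) 0 m"
  have d: "mdim (ds U W) = m + n" by (simp add: ds_def dsum_def m_def n_def)
  have q2i2: "q2 * i2 = E n" by (rule fmat_eqI) (simp add: i2_def q2_def ent_shift'_mult, auto simp: shift_def ent_E)
  have q2i1: "q2 * i1 = 0" by (rule fmat_eqI) (auto simp: i1_def q2_def ent_shift'_mult ent_E)
  have q1i2: "i1 * i2 = 0" by (rule fmat_eqI) (auto simp: i1_def i2_def ent_E_mult shift_def)
  have sm: "i1 * i1 + i2 * q2 = E (m + n)"
    by (rule fmat_eqI) (simp add: i1_def i2_def q2_def ent_shift_mult ent_E_mult, auto simp: shift_def ent_E)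
  have car: "mact U g \<in> carrier_mat m m" "mact W g \<in> carrier_mat n n" if "g \<in> carrier G" for g
    using U W that by (auto simp: is_fgmod_def m_def n_def)
  have mact: "mact (ds U W) g = four_block_mat (mact U g) (0\<^sub>m m n) (0\<^sub>m n m) (mact W g)"
    if "g \<in> carrier G" for g
    using car[OF that] by (simp only: ds_def dsum_def diag_block_mat_pair list.map fgmod.simps) auto
  then have dc: "mact (ds U W) g \<in> carrier_mat (m + n) (m + n)" if "g \<in> carrier G" for g
    using car[OF that] that by (metis four_block_carrier_mat)
  have rh: "rh (ds U W) g = i1 * rh U g * i1 + i2 * rh W g * q2" if g: "g \<in> carrier G" for g
  proof (rule fmat_eqI)
    fix i j
    have "ent (rh (ds U W) g) i j = (if i < m + n \<and> j < m + n then mact (ds U W) g $$ (i, j) else 0)"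
      by (simp add: rh_def ent_em[OF dc[OF g]])
    then show "ent (rh (ds U W) g) i j = ent (i1 * rh U g * i1 + i2 * rh W g * q2) i j"
      using car[OF g] by (auto simp: rh_def mact[OF g] i1_def i2_def q2_def
          ent_mult_shift ent_shift_mult ent_mult_E ent_E_mult ent_em[OF car(1)[OF g]] ent_em[OF car(2)[OF g]])
  qed
  have e: "Idm U = i1" "Idm W = E n" "Idm (ds U W) = E (m + n)" by (simp_all add: m_def n_def d i1_def)
  have un: "E (m + n) * i1 = i1" "i1 * E (m + n) = i1" "E (m + n) * i2 = i2" "i2 * E n = i2"
    "q2 * E (m + n) = q2" "E n * q2 = q2" "i1 * i1 = i1"
    by (auto simp: i1_def i2_def q2_def shift_def E_fm fm_E E_mult_iff mult_E_iff ent_E)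
  note rU = rh_simps[OF U, unfolded e] and rW = rh_simps[OF W, unfolded e]
  have z: "rh U g * i2 = 0" "q2 * rh U g = 0" if "g \<in> carrier G" for g
    using rU(1,2)[OF that] q1i2 q2i1 by (metis mult.assoc mult_zero_right, metis mult.assoc mult_zero_left)
  have h: "rh (ds U W) g * i1 = i1 * rh U g" "i1 * rh (ds U W) g = rh U g * i1"
    "rh (ds U W) g * i2 = i2 * rh W g" "q2 * rh (ds U W) g = rh W g * q2" if g: "g \<in> carrier G" for g
    by (simp_all add: rh[OF g] algebra_simps q2i2 q2i1 q1i2 un mult_assoc_eq[OF q2i2]
        mult_assoc_eq[OF q2i1] mult_assoc_eq[OF q1i2] mult_assoc_eq[OF un(7)] rU rW g z)
  have b: "bip G (ds U W) U W i1 i1 i2 q2"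
    unfolding bip_def hm_def e using un h q2i2 q2i1 q1i2 by auto
  have "md (ds U W)"
    unfolding is_fgmod_def
  proof (intro conjI ballI)
    show "mact (ds U W) g \<in> carrier_mat (mdim (ds U W)) (mdim (ds U W))" if "g \<in> carrier G" for g
      using dc that d by simp
    have "em (mact (ds U W) \<one>) = em (1\<^sub>m (mdim (ds U W)))"
      unfolding em_one d using rh[of \<one>] rU(5) rW(5) un sm by (simp add: rh_def mult.assoc)
    then show "mact (ds U W) \<one> = 1\<^sub>m (mdim (ds U W))"
      using dc d by (metis em_inj one_carrier_mat one_closed)
    fix g k assume g: "g \<in> carrier G" and k: "k \<in> carrier G"
    have "rh (ds U W) (g \<otimes> k) = rh (ds U W) g * rh (ds U W) k"
      by (simp add: rh g k algebra_simps q2i2 q2i1 q1i2 un mult_assoc_eq[OF q2i2]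
        mult_assoc_eq[OF q2i1] mult_assoc_eq[OF q1i2] mult_assoc_eq[OF un(7)] rU rW z z[THEN mult_assoc_eq])
    then show "mact (ds U W) (g \<otimes> k) = mact (ds U W) g * mact (ds U W) k"
      using dc g k em_mult[OF dc[OF g] dc[OF k]]
      by (intro em_inj[OF _ mult_carrier_mat[OF dc dc]]) (auto simp: rh_def)
  qed
  with b sm show ?thesis using that[of i1 i1 i2 q2] by (simp add: d)
qed

text \<open>Both modules may be direct sums merely up to null maps: the defect of the sum
  decomposition is added to the conjugated defects of the two given isomorphisms, and all of them
  are null.\<close>

lemma bip_siso:
  assumes V: "md V" "bip G V U W i1 q1 i2 q2" "null V V (Idm V - (i1 * q1 + i2 * q2))"
    and V': "md V'" "bip G V' U' W' i1' q1' i2' q2'" "null V' V' (Idm V' - (i1' * q1' + i2' * q2'))"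
    and iso: "siso U U'" "siso W W'"
  shows "siso V V'"
proof -
  have main: "\<exists>F H. F = i1' * a * q1 + i2' * b * q2 \<and> H = i1 * a' * q1' + i2 * b' * q2' \<and>
      hm G V V' F \<and> hm G V' V H \<and> null V V (Idm V - H * F)"
    if V: "bip G V U W i1 q1 i2 q2" "null V V (Idm V - (i1 * q1 + i2 * q2))"
    and V': "bip G V' U' W' i1' q1' i2' q2'"
    and a: "hm G U U' a" "hm G U' U a'" "null U U (Idm U - a' * a)"
    and b: "hm G W W' b" "hm G W' W b'" "null W W (Idm W - b' * b)"
    for V U W V' U' W' :: "('g, 'x::field) fgmod" and i1 q1 i2 q2 i1' q1' i2' q2' a b a' b'
  proof (intro exI conjI)
    have h: "hm G U V i1" "hm G V U q1" "hm G W V i2" "hm G V W q2"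
      and h': "hm G U' V' i1'" "hm G V' U' q1'" "hm G W' V' i2'" "hm G V' W' q2'"
      using V(1) V' by (auto simp: bip_def)
    have z: "q1' * i1' = Idm U'" "q2' * i2' = Idm W'" "q1' * i2' = 0" "q2' * i1' = 0"
      using V' by (auto simp: bip_def)
    show "hm G V V' (i1' * a * q1 + i2' * b * q2)" "hm G V' V (i1 * a' * q1' + i2 * b' * q2')"
      using h h' a b by (meson hm_add hm_comp)+
    have "null V V ((Idm V - (i1 * q1 + i2 * q2)) + i1 * ((Idm U - a' * a) * q1) + i2 * ((Idm W - b' * b) * q2))"
      using a b h by (intro null_add V null_left[OF null_right]) auto
    moreover have "(Idm V - (i1 * q1 + i2 * q2)) + i1 * ((Idm U - a' * a) * q1) + i2 * ((Idm W - b' * b) * q2)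
        = Idm V - (i1 * a' * q1' + i2 * b' * q2') * (i1' * a * q1 + i2' * b * q2)"
      using h a b by (simp add: algebra_simps z mult_assoc_eq[OF z(1)] mult_assoc_eq[OF z(2)]
          mult_assoc_eq[OF z(3)] mult_assoc_eq[OF z(4)] hm_simps)
    ultimately show "null V V (Idm V - (i1 * a' * q1' + i2 * b' * q2') * (i1' * a * q1 + i2' * b * q2))"
      by simp
  qed auto
  obtain a a' where a: "hm G U U' a" "hm G U' U a'" "null U U (Idm U - a' * a)" "null U' U' (Idm U' - a * a')"
    using iso(1) by (auto simp: siso_def)
  obtain b b' where b: "hm G W W' b" "hm G W' W b'" "null W W (Idm W - b' * b)" "null W' W' (Idm W' - b * b')"
    using iso(2) by (auto simp: siso_def)
  from main[OF V(2,3) V'(2) a(1-3) b(1-3)] main[OF V'(2,3) V(2) a(2,1,4) b(2,1,4)]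
  show ?thesis unfolding siso_def using V(1) V'(1) by blast
qed

lemma bip_siso_ds:
  assumes "md V" "md U" "md W" "bip G V U W i1 q1 i2 q2" "null V V (Idm V - (i1 * q1 + i2 * q2))"
  shows "siso V (ds U W)"
proof -
  obtain j1 p1 j2 p2 where d: "md (ds U W)" "bip G (ds U W) U W j1 p1 j2 p2"
    "j1 * p1 + j2 * p2 = Idm (ds U W)"
    using ds_data[OF assms(2,3)] .
  show ?thesis
    by (rule bip_siso[OF assms(1,4,5) d(1,2)]) (use d assms in \<open>auto simp: null_zero siso_refl\<close>)
qed

lemma md_ds [simp]: "md U \<Longrightarrow> md W \<Longrightarrow> md (ds U W)"
  by (meson ds_data)

lemma siso_ds: "siso U U' \<Longrightarrow> siso W W' \<Longrightarrow> siso (ds U W) (ds U' W')"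
proof -
  assume a: "siso U U'" "siso W W'"
  obtain i1 q1 i2 q2 where d: "md (ds U W)" "bip G (ds U W) U W i1 q1 i2 q2"
    "i1 * q1 + i2 * q2 = Idm (ds U W)"
    using ds_data a siso_md by metis
  obtain j1 p1 j2 p2 where e: "md (ds U' W')" "bip G (ds U' W') U' W' j1 p1 j2 p2"
    "j1 * p1 + j2 * p2 = Idm (ds U' W')"
    using ds_data a siso_md by metis
  show ?thesis by (rule bip_siso[OF d(1,2) _ e(1,2) _ a]) (simp_all add: d e null_zero)
qed

lemma siso_ds_comm: "md U \<Longrightarrow> md W \<Longrightarrow> siso (ds U W) (ds W U)"
proof -
  assume a: "md U" "md W"
  obtain i1 q1 i2 q2 where d: "md (ds U W)" "bip G (ds U W) U W i1 q1 i2 q2"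
    "i1 * q1 + i2 * q2 = Idm (ds U W)"
    using ds_data[OF a] .
  show ?thesis
    by (rule bip_siso_ds[of _ _ _ i2 q2 i1 q1]) (use a d null_zero in \<open>auto simp: bip_def add.commute\<close>)
qed

lemma siso_zero_proj: "mdim P = 0 \<Longrightarrow> md P \<Longrightarrow> proj P"
  by (simp add: proj_def) (metis E_eq_zero_iff null_zero)

lemma siso_ds_proj:
  assumes "md V" "proj P" shows "siso (ds V P) V"
proof -
  have P: "md P" using assms(2) by (simp add: proj_def)
  obtain i1 q1 i2 q2 where d: "md (ds V P)" "bip G (ds V P) V P i1 q1 i2 q2"
    "i1 * q1 + i2 * q2 = Idm (ds V P)"
    using ds_data[OF assms(1) P] .
  have "null (ds V P) (ds V P) (i2 * q2)"
    using d by (intro null_left[OF proj_null'[OF assms(2)]]) (auto simp: bip_def)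
  moreover have "i2 * q2 = Idm (ds V P) - i1 * q1" using d(3) by (metis add_diff_cancel_left')
  ultimately show ?thesis
    unfolding siso_def using d assms null_zero
    by (intro conjI exI[of _ q1] exI[of _ i1]) (auto simp: bip_def)
qed

lemma siso_projs:
  assumes "proj P" "proj Q" shows "siso P Q"
  unfolding siso_def using assms hm_zero by (fastforce simp: proj_def)

lemma siso_proj: "siso P Q \<Longrightarrow> proj P \<Longrightarrow> proj Q"
proof -
  assume a: "siso P Q" "proj P"
  then obtain f h where f: "md Q" "hm G P Q f" "hm G Q P h" "null Q Q (Idm Q - f * h)"
    by (auto simp: siso_def)
  have "null Q Q (f * h)" using proj_null'[OF a(2) f(3)] f(2) by (rule null_left)
  from null_add[OF f(4) this] show ?thesis by (simp add: proj_def f)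
qed

lemma md_dsum [simp]: "\<forall>V\<in>set Vs. md V \<Longrightarrow> md (dsum Vs)"
proof (induction Vs)
  case Nil
  then show ?case by (auto simp: is_fgmod_def dsum_def intro: eq_matI)
next
  case (Cons V Vs)
  then show ?case by (simp add: dsum_Cons)
qed

lemma md_dsum' [intro!]: "(\<And>V. V \<in> set Vs \<Longrightarrow> md V) \<Longrightarrow> md (dsum Vs)"
  by simp

lemma mdim_dsum_Nil [simp]: "mdim (dsum []) = 0"
  by (simp add: dsum_def)

lemma mdim_ds [simp]: "mdim (ds U W) = mdim U + mdim W"
  by (simp add: ds_def dsum_def)

lemma proj_dsum_Nil [simp]: "proj (dsum [])"
  by (rule siso_zero_proj) auto

lemma siso_dsum_cong: "list_all2 siso Vs Ws \<Longrightarrow> siso (dsum Vs) (dsum Ws)"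
  by (induction rule: list_all2_induct) (auto simp: dsum_Cons siso_ds siso_refl)

lemma siso_ds_left_comm:
  assumes "md A" "md B" "md C" shows "siso (ds A (ds B C)) (ds B (ds A C))"
  using siso_ds[OF siso_ds_comm siso_refl, of A B C] assms unfolding ds_assoc by blast

text \<open>Decompositions are recorded as lists. Their comparison is hereby reduced to an identity
  of multisets, and so to counting.\<close>

lemma siso_dsum_mset:
  "mset Vs = mset Ws \<Longrightarrow> (\<And>V. V \<in> set Vs \<Longrightarrow> md V) \<Longrightarrow> siso (dsum Vs) (dsum Ws)"
proof (induction Vs arbitrary: Ws)
  case Nil
  then show ?case by (simp add: siso_refl)
next
  case (Cons V Vs)
  have "V \<in> set Ws" using Cons.prems(1) by (metis list.set_intros(1) set_mset_mset)
  then obtain As Bs where W: "Ws = As @ V # Bs" by (metis split_list)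
  have s: "set (V # Vs) = set Ws" using Cons.prems(1) by (metis set_mset_mset)
  have m: "md X" if "X \<in> set As \<union> set Bs \<union> {V} \<union> set Vs" for X
    using that Cons.prems(2) s unfolding W by auto
  have "siso (dsum Vs) (dsum (As @ Bs))" using Cons W m by (intro Cons.IH) auto
  then have 1: "siso (dsum (V # Vs)) (ds V (dsum (As @ Bs)))"
    using m by (simp add: dsum_Cons siso_ds siso_refl)
  have "siso (ds V (dsum (As @ Bs))) (dsum (As @ V # Bs))"
    using m
  proof (induction As)
    case Nil
    then show ?case by (simp add: dsum_Cons siso_refl)
  next
    case (Cons A As)
    have "siso (ds V (ds A (dsum (As @ Bs)))) (ds A (ds V (dsum (As @ Bs))))"
      using Cons.prems by (intro siso_ds_left_comm) auto
    moreover have "siso (ds A (ds V (dsum (As @ Bs)))) (ds A (dsum (As @ V # Bs)))"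
      using Cons.prems by (intro siso_ds siso_refl Cons.IH) auto
    ultimately show ?case using siso_trans by (fastforce simp: dsum_Cons)
  qed
  with 1 show ?case unfolding W by (rule siso_trans)
qed

end

section \<open>Tensor products\<close>

lemma less_mult_div: "(i::nat) div n < m" if "i < m * n"
  using that by (simp add: less_mult_imp_div_less)

lemma sum_divmod:
  "(\<Sum>k<N * c. F (k div c) (k mod c)) = (\<Sum>i<N. \<Sum>j<c. F i j)" for F :: "nat \<Rightarrow> nat \<Rightarrow> 'z::comm_monoid_add"
proof (cases "c = 0")
  case False
  have "(\<Sum>k<N * c. F (k div c) (k mod c)) = (\<Sum>x\<in>{..<N} \<times> {..<c}. case x of (i, j) \<Rightarrow> F i j)"
  proof (rule sum.reindex_bij_witness[of _ "\<lambda>(i, j). i * c + j" "\<lambda>k. (k div c, k mod c)"])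
    fix x assume "x \<in> {..<N} \<times> {..<c}"
    then obtain i j where x: "x = (i, j)" "i < N" "j < c" by auto
    have "i * c + j < Suc i * c" using x by simp
    also have "\<dots> \<le> N * c" using x by (intro mult_le_mono1) simp
    finally show "(case x of (i, j) \<Rightarrow> i * c + j) \<in> {..<N * c}" by (simp add: x)
  qed (use False in \<open>auto simp: less_mult_div\<close>)
  then show ?thesis by (simp add: sum.cartesian_product)
qed simp

text \<open>\<open>b\<close> and \<open>d\<close> are the numbers of rows and columns of the second
  factor, which a padded matrix does not remember. Without the guard, \<open>x div 0 = 0\<close>
  would leave entries in a product with an empty factor.\<close>

lift_definition kr :: "nat \<Rightarrow> nat \<Rightarrow> 'a::field fmat \<Rightarrow> 'a fmat \<Rightarrow> 'a fmat" is
  "\<lambda>b d f h x y. if b = 0 \<or> d = 0 then 0 else f (x div b) (y div d) * h (x mod b) (y mod d)"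
proof -
  fix b d :: nat and f h :: "nat \<Rightarrow> nat \<Rightarrow> 'a"
  assume "\<exists>N. \<forall>i j. N \<le> i \<or> N \<le> j \<longrightarrow> f i j = 0"
  then obtain N where N: "\<And>i j. N \<le> i \<or> N \<le> j \<Longrightarrow> f i j = 0" by blast
  have "f (x div b) (y div d) = 0" if "max (N * b) (N * d) \<le> x \<or> max (N * b) (N * d) \<le> y" "b \<noteq> 0" "d \<noteq> 0" for x y
  proof -
    have "N \<le> x div b \<or> N \<le> y div d"
      using that by (auto simp: less_eq_div_iff_mult_less_eq)
    then show ?thesis by (rule N)
  qed
  then show "\<exists>N. \<forall>x y. N \<le> x \<or> N \<le> y \<longrightarrow>
      (if b = 0 \<or> d = 0 then 0 else f (x div b) (y div d) * h (x mod b) (y mod d)) = 0"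
    by (intro exI[of _ "max (N * b) (N * d)"]) auto
qed

lemma ent_kr: "ent (kr b d f h) x y =
    (if b = 0 \<or> d = 0 then 0 else ent f (x div b) (y div d) * ent h (x mod b) (y mod d))"
  by (simp add: kr.rep_eq)

lemma kr_add: "kr b d (f + f') h = kr b d f h + kr b d f' h"
  and kr_diff: "kr b d (f - f') h = kr b d f h - kr b d f' h"
  and kr_zero [simp]: "kr b d 0 h = 0"
  by (auto intro!: fmat_eqI simp: ent_kr algebra_simps)

lemma kr_sum: "kr b d (sum f A) h = (\<Sum>x\<in>A. kr b d (f x) h)"
  by (induction A rule: infinite_finite_induct) (auto simp: kr_add)

text \<open>The inner index is split as \<open>k = i * c + j\<close> with \<open>j < c\<close>, so
  only the first \<open>c\<close> summands of \<open>h * h'\<close> appear; the hypothesis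
  guarantees that there are no others.\<close>

lemma kr_mult:
  assumes "h * E c = h \<or> E c * h' = h'"
  shows "kr b c f h * kr c d f' h' = kr b d (f * f') (h * h')"
proof (rule fmat_eqI)
  fix x y
  obtain N where N: "\<And>i j. N \<le> i \<or> N \<le> j \<Longrightarrow> ent f i j = 0"
    using fmat_bound by metis
  have "ent (kr b c f h * kr c d f' h') x y = (\<Sum>k<N * c. ent (kr b c f h) x k * ent (kr c d f' h') k y)"
  proof (rule ent_times_gen)
    fix k assume "N * c \<le> k"
    then show "ent (kr b c f h) x k = 0 \<or> ent (kr c d f' h') k y = 0"
      using N by (cases "c = 0") (auto simp: ent_kr less_eq_div_iff_mult_less_eq)
  qed
  also have "\<dots> = (\<Sum>k<N * c. (\<lambda>i j. if b = 0 \<or> d = 0 then 0 else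
      (ent f (x div b) i * ent h (x mod b) j) * (ent f' i (y div d) * ent h' j (y mod d))) (k div c) (k mod c))"
    by (rule sum.cong) (auto simp: ent_kr)
  also have "\<dots> = (\<Sum>i<N. \<Sum>j<c. if b = 0 \<or> d = 0 then 0 else
      (ent f (x div b) i * ent h (x mod b) j) * (ent f' i (y div d) * ent h' j (y mod d)))"
    by (rule sum_divmod)
  also have "\<dots> = (if b = 0 \<or> d = 0 then 0 else (\<Sum>i<N. ent f (x div b) i * ent f' i (y div d)) *
      (\<Sum>j<c. ent h (x mod b) j * ent h' j (y mod d)))"
    by (auto simp: sum_product ac_simps)
  also have "(\<Sum>i<N. ent f (x div b) i * ent f' i (y div d)) = ent (f * f') (x div b) (y div d)"
    by (rule ent_times_gen[symmetric]) (simp add: N)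
  also have "(\<Sum>j<c. ent h (x mod b) j * ent h' j (y mod d)) = ent (h * h') (x mod b) (y mod d)"
    by (rule ent_times_gen[symmetric]) (use assms in \<open>auto simp: E_mult_iff mult_E_iff\<close>)
  finally show "ent (kr b c f h * kr c d f' h') x y = ent (kr b d (f * f') (h * h')) x y"
    by (simp add: ent_kr)
qed

lemma kr_E: "kr n n (E m) (E n) = (E (m * n) :: 'a::field fmat)"
proof (rule fmat_eqI)
  fix x y
  have *: "x div n < m \<longleftrightarrow> x < m * n" if "n > 0" using that by (simp add: div_less_iff_less_mult)
  show "ent (kr n n (E m) (E n)) x y = ent (E (m * n) :: 'a fmat) x y"
  proof (cases "x = y")
    case False
    then have "x div n \<noteq> y div n \<or> x mod n \<noteq> y mod n" by (metis div_mult_mod_eq)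
    with False show ?thesis by (simp add: ent_kr ent_E)
  qed (use * in \<open>simp add: ent_kr ent_E\<close>)
qed

lemma kronecker_carrier: "A \<in> carrier_mat a b \<Longrightarrow> B \<in> carrier_mat c d \<Longrightarrow> kronecker A B \<in> carrier_mat (a * c) (b * d)"
  by (auto simp: kronecker_def)

lemma em_kronecker:
  assumes A: "A \<in> carrier_mat a b" and B: "B \<in> carrier_mat c d"
  shows "em (kronecker A B) = kr c d (em A) (em B)"
proof (rule fmat_eqI)
  fix i j
  have "i div c < a \<longleftrightarrow> i < a * c" if "c > 0" using that by (simp add: div_less_iff_less_mult)
  moreover have "j div d < b \<longleftrightarrow> j < b * d" if "d > 0" using that by (simp add: div_less_iff_less_mult)
  ultimately show "ent (em (kronecker A B)) i j = ent (kr c d (em A) (em B)) i j"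
    unfolding ent_em[OF kronecker_carrier[OF A B]] ent_kr ent_em[OF A] ent_em[OF B]
    using A B by (cases "c = 0 \<or> d = 0") (auto simp: kronecker_def)
qed

lemma mod_div_mult: "(i::nat) mod (b * c) div c = i div c mod b"
  using mod_mult2_eq[of i c b] by (cases "c = 0") (simp_all add: mult.commute[of c])

text \<open>Holds strictly because the numbering \<open>i * n + j\<close> of pairs is associative.
  So brackets in tensor products of modules can be moved by rewriting.\<close>

lemma kronecker_assoc: "kronecker (kronecker A B) C = kronecker A (kronecker B C)"
proof (rule eq_matI)
  fix i j
  assume "i < dim_row (kronecker A (kronecker B C))" "j < dim_col (kronecker A (kronecker B C))"
  then have i: "i < dim_row A * (dim_row B * dim_row C)" and j: "j < dim_col A * (dim_col B * dim_col C)"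
    by (auto simp: kronecker_def)
  have "0 < dim_row B * dim_row C" "0 < dim_col B * dim_col C" using i j by (auto intro: ccontr)
  moreover have "i div dim_row C < dim_row A * dim_row B" "j div dim_col C < dim_col A * dim_col B"
    using i j by (simp_all add: less_mult_div mult.assoc)
  moreover have "i div dim_row C mod dim_row B = i mod (dim_row B * dim_row C) div dim_row C"
    "j div dim_col C mod dim_col B = j mod (dim_col B * dim_col C) div dim_col C"
    by (simp_all add: mod_div_mult)
  ultimately show "kronecker (kronecker A B) C $$ (i, j) = kronecker A (kronecker B C) $$ (i, j)"
    using i j by (simp add: kronecker_def mult.assoc div_mult2_eq[symmetric] mod_mod_cancel mult.commute[of "dim_row C"]
        mult.commute[of "dim_col C"])
qed (auto simp: kronecker_def mult.assoc)

lemma tensor_assoc: "tensor (tensor U V) W = tensor U (tensor V W)"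
  by (simp add: tensor_def mult.assoc kronecker_assoc)

lemma tensor_trivial: "tensor trivial_fgmod V = V"
proof -
  have "kronecker (1\<^sub>m 1) A = A" for A :: "'b mat" by (rule eq_matI) (auto simp: kronecker_def)
  then show ?thesis by (simp add: tensor_def trivial_fgmod_def)
qed

lemma mdim_tensor [simp]: "mdim (tensor V W) = mdim V * mdim W"
  by (simp add: tensor_def)

text \<open>The permutation matrix that exchanges the tensor factors: column
  \<open>y = i * n + j\<close> has its 1 in row \<open>x = j * m + i\<close>.\<close>

definition swap :: "nat \<Rightarrow> nat \<Rightarrow> 'a::field fmat" where
  "swap m n = fm (m * n) (m * n) (\<lambda>x y. if x div m = y mod n \<and> x mod m = y div n then 1 else 0)"

lemma divmod_unique: "r < n \<Longrightarrow> (k::nat) = q * n + r \<longleftrightarrow> k div n = q \<and> k mod n = r"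
  by auto

lemma swap_index:
  fixes x k m n :: nat
  assumes "x < m * n" "k < m * n"
  shows "x div m = k mod n \<and> x mod m = k div n \<longleftrightarrow> k = x mod m * n + x div m"
    "x div m = k mod n \<and> x mod m = k div n \<longleftrightarrow> x = k mod n * m + k div n"
proof -
  have "0 < m" "0 < n" "x div m < n" "k div n < m"
    using assms by (auto simp: less_mult_div mult.commute intro: ccontr)
  then show "x div m = k mod n \<and> x mod m = k div n \<longleftrightarrow> k = x mod m * n + x div m"
    "x div m = k mod n \<and> x mod m = k div n \<longleftrightarrow> x = k mod n * m + k div n"
    using divmod_unique[of "x div m" n k "x mod m"] divmod_unique[of "k div n" m x "k mod n"] by auto
qed

lemma swap_index_less: "(x::nat) < m * n \<Longrightarrow> x mod m * n + x div m < m * (n::nat)"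
proof -
  assume x: "x < m * n"
  then have "0 < m" "x div m < n" by (auto simp: less_mult_div mult.commute intro: ccontr)
  then have "x mod m * n + x div m < Suc (x mod m) * n" by simp
  also have "\<dots> \<le> m * n" using \<open>0 < m\<close> by (intro mult_le_mono1) (simp add: Suc_leI)
  finally show ?thesis .
qed

lemma ent_swap: "k < m * n \<Longrightarrow> ent (swap m n) x k = (if x < m * n \<and> k = x mod m * n + x div m then 1 else 0)"
  and ent_swap': "x < m * n \<Longrightarrow> ent (swap m n) x k = (if k < m * n \<and> x = k mod n * m + k div n then 1 else 0)"
  using swap_index[of x m n k] by (auto simp: swap_def)

lemma ent_swap_mult:
  "ent (swap m n * f) x y = (if x < m * n then ent f (x mod m * n + x div m) y else 0)"
proof -
  have "ent (swap m n * f) x y = (\<Sum>k<m * n. ent (swap m n) x k * ent f k y)"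
    by (rule ent_times_gen) (auto simp: swap_def)
  also have "\<dots> = (\<Sum>k<m * n. if k = x mod m * n + x div m then (if x < m * n then ent f k y else 0) else 0)"
    by (rule sum.cong) (simp_all add: ent_swap)
  finally show ?thesis using swap_index_less[of x m n] by (auto simp: sum.delta)
qed

lemma ent_mult_swap:
  "ent (f * swap m n) x y = (if y < m * n then ent f x (y mod n * m + y div n) else 0)"
proof -
  have "ent (f * swap m n) x y = (\<Sum>k<m * n. ent f x k * ent (swap m n) k y)"
    by (rule ent_times_gen) (auto simp: swap_def)
  also have "\<dots> = (\<Sum>k<m * n. if k = y mod n * m + y div n then (if y < m * n then ent f x k else 0) else 0)"
    by (rule sum.cong) (simp_all add: ent_swap')
  finally show ?thesis using swap_index_less[of y n m] by (auto simp: sum.delta mult.commute)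
qed

lemma swap_swap: "swap n m * swap m n = E (m * n)"
proof (rule fmat_eqI)
  fix x y
  have "x mod n * m + x div n = y mod n * m + y div n \<longleftrightarrow> x = y" if "x < n * m" "y < n * m"
  proof -
    have "0 < n" "x div n < m" "y div n < m" using that by (auto simp: less_mult_div mult.commute intro: ccontr)
    then have "x mod n * m + x div n = y mod n * m + y div n \<Longrightarrow> x mod n = y mod n \<and> x div n = y div n"
      by (metis add.commute div_less div_mult_self1 add.right_neutral mod_less mod_mult_self1 less_nat_zero_code)
    then show ?thesis by (metis div_mult_mod_eq)
  qed
  then show "ent (swap n m * swap m n) x y = ent (E (m * n) :: 'a fmat) x y"
    using swap_index_less[of x n m] ent_swap'[of "x mod n * m + x div n" m n y]
    by (auto simp: ent_swap_mult ent_E mult.commute[of n])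
qed

lemma swap_kr:
  assumes A: "E m * A = A" "A * E m = A" and B: "E n * B = B" "B * E n = B"
  shows "swap m n * kr n n A B = kr m m B A * swap m n"
proof (rule fmat_eqI)
  fix x y
  have z: "\<And>i j. m \<le> i \<or> m \<le> j \<Longrightarrow> ent A i j = 0" "\<And>i j. n \<le> i \<or> n \<le> j \<Longrightarrow> ent B i j = 0"
    using assms by (auto simp: E_mult_iff mult_E_iff)
  consider "m = 0 \<or> n = 0" | "0 < m" "0 < n" "x < m * n" "y < m * n" | "0 < m" "0 < n" "m * n \<le> x" "y < m * n"
    | "0 < m" "0 < n" "m * n \<le> y" by linarith
  then show "ent (swap m n * kr n n A B) x y = ent (kr m m B A * swap m n) x y"
  proof cases
    case 1
    then show ?thesis by (auto simp: ent_swap_mult ent_mult_swap)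
  next
    case 2
    then have "x div m < n" "y div n < m" by (auto simp: less_mult_div mult.commute)
    with 2 show ?thesis by (simp add: ent_swap_mult ent_mult_swap ent_kr)
  next
    case 3
    then have "n \<le> x div m" by (simp add: less_eq_div_iff_mult_less_eq mult.commute)
    with 3 show ?thesis by (simp add: ent_swap_mult ent_mult_swap ent_kr z)
  next
    case 4
    then have "m \<le> y div n" by (simp add: less_eq_div_iff_mult_less_eq)
    with 4 show ?thesis by (simp add: ent_swap_mult ent_mult_swap ent_kr z)
  qed
qed

section \<open>Tensoring maps with a fixed module\<close>

definition tenl :: "('g, 'a::field) fgmod \<Rightarrow> 'a fmat \<Rightarrow> 'a fmat" where
  "tenl W f = kr (mdim W) (mdim W) f (Idm W)"

lemma tenl_mult: "tenl W f * tenl W h = tenl W (f * h)"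
  by (simp add: tenl_def kr_mult)

lemma tenl_linear [simp]: "tenl W (f + h) = tenl W f + tenl W h" "tenl W (f - h) = tenl W f - tenl W h" "tenl W 0 = 0"
  by (simp_all add: tenl_def kr_add kr_diff)

lemma tenl_Idm [simp]: "tenl W (Idm V) = Idm (tensor V W)"
  by (simp add: tenl_def kr_E)

context fin_group
begin

lemma rh_tensor:
  assumes "md V" "md W" "g \<in> carrier G"
  shows "rh (tensor V W) g = kr (mdim W) (mdim W) (rh V g) (rh W g)"
  using assms by (auto simp: rh_def tensor_def is_fgmod_def intro!: em_kronecker)

lemma md_tensor [simp]:
  assumes "md V" "md W" shows "md (tensor V W)"
  unfolding is_fgmod_def
proof (intro conjI ballI)
  show c: "mact (tensor V W) g \<in> carrier_mat (mdim (tensor V W)) (mdim (tensor V W))" if "g \<in> carrier G" for g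
    using assms that by (auto simp: tensor_def is_fgmod_def intro!: kronecker_carrier)
  have "em (mact (tensor V W) \<one>) = em (1\<^sub>m (mdim (tensor V W)))"
    using rh_tensor[OF assms, of \<one>] rh_simps(5)[OF assms(1)] rh_simps(5)[OF assms(2)]
    by (simp add: rh_def em_one kr_E)
  then show "mact (tensor V W) \<one> = 1\<^sub>m (mdim (tensor V W))"
    using c[OF one_closed] by (metis em_inj one_carrier_mat)
  fix g h assume g: "g \<in> carrier G" and h: "h \<in> carrier G"
  have "rh (tensor V W) (g \<otimes> h) = rh (tensor V W) g * rh (tensor V W) h"
    using g h assms by (simp add: rh_tensor rh_simps kr_mult)
  then show "mact (tensor V W) (g \<otimes> h) = mact (tensor V W) g * mact (tensor V W) h"
    using c g h em_mult[OF c[OF g] c[OF h]]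
    by (intro em_inj[OF _ mult_carrier_mat[OF c c]]) (auto simp: rh_def)
qed

lemma hm_tenl:
  assumes "md V" "md V'" "md W" "hm G V V' f" shows "hm G (tensor V W) (tensor V' W) (tenl W f)"
  unfolding hm_def
proof (intro conjI ballI)
  show "Idm (tensor V' W) * tenl W f = tenl W f" "tenl W f * Idm (tensor V W) = tenl W f"
    unfolding tenl_Idm[symmetric] tenl_mult using hm_simps(1,2)[OF assms(4)] by simp_all
  fix g assume g: "g \<in> carrier G"
  then show "tenl W f * rh (tensor V W) g = rh (tensor V' W) g * tenl W f"
    using assms by (simp add: rh_tensor tenl_def kr_mult rh_simps hm_rh)
qed

text \<open>Conjugation by a group element fixes the identity of \<open>W\<close>, so the trace
  passes through the tensor factor. Consequently null maps are preserved by tensoring, and a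
  projective module tensored with any module is projective.\<close>

lemma tenl_Tr:
  assumes "md V" "md V'" "md W" shows "tenl W (Tr V V' t) = Tr (tensor V W) (tensor V' W) (tenl W t)"
  unfolding Tr_def tenl_def kr_sum
  by (rule sum.cong) (simp_all add: rh_tensor assms kr_mult rh_simps)

lemma null_tenl:
  assumes "md V" "md V'" "md W" "null V V' f" shows "null (tensor V W) (tensor V' W) (tenl W f)"
  using assms tenl_Tr unfolding null_def by metis

lemma proj_tensor:
  assumes "proj P" "md W" shows "proj (tensor P W)"
  using assms null_tenl[of P P W "Idm P"] by (simp add: proj_def)

lemma siso_tensor_left:
  assumes "siso V V'" "md W" shows "siso (tensor V W) (tensor V' W)"
proof -
  obtain f h where f: "md V" "md V'" "hm G V V' f" "hm G V' V h" "null V V (Idm V - h * f)"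
    "null V' V' (Idm V' - f * h)"
    using assms(1) by (auto simp: siso_def)
  show ?thesis
    unfolding siso_def
    using f assms(2) hm_tenl[OF f(1,2) assms(2) f(3)] hm_tenl[OF f(2,1) assms(2) f(4)]
      null_tenl[OF f(1,1) assms(2) f(5)] null_tenl[OF f(2,2) assms(2) f(6)]
    by (intro conjI exI[of _ "tenl W f"] exI[of _ "tenl W h"]) (auto simp: tenl_mult)
qed

lemma siso_tensor_comm:
  assumes "md V" "md W" shows "siso (tensor V W) (tensor W V)"
proof -
  have un: "E (m * n) * swap m n = swap m n" "swap m n * E (m * n) = swap m n" for m n
    by (auto simp: swap_def E_fm fm_E)
  have h: "hm G (tensor V W) (tensor W V) (swap (mdim V) (mdim W))" if "md V" "md W" for V W :: "('g, 'b::field) fgmod"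
    unfolding hm_def using that un[of "mdim V" "mdim W"]
    by (auto simp: rh_tensor mult.commute intro!: swap_kr rh_simps)
  show ?thesis
    by (rule iso_siso[OF _ _ h[OF assms] h[OF assms(2,1)]])
      (use assms in \<open>auto simp: swap_swap mult.commute\<close>)
qed

lemma siso_tensor_right:
  assumes "siso V V'" "md W" shows "siso (tensor W V) (tensor W V')"
  using siso_trans[OF siso_trans[OF siso_tensor_comm siso_tensor_left[OF assms]] siso_tensor_comm]
    siso_md[OF assms(1)] assms(2) by blast

lemma siso_tensor:
  assumes "siso V V'" "siso W W'" shows "siso (tensor V W) (tensor V' W')"
  using siso_trans[OF siso_tensor_left[OF assms(1)] siso_tensor_right[OF assms(2)]]
    siso_md[OF assms(1)] siso_md[OF assms(2)] by blast

lemma siso_tensor_ds: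
  assumes "md U" "md W" "md X" shows "siso (tensor (ds U W) X) (ds (tensor U X) (tensor W X))"
proof -
  obtain i1 q1 i2 q2 where d: "md (ds U W)" "bip G (ds U W) U W i1 q1 i2 q2"
    "i1 * q1 + i2 * q2 = Idm (ds U W)"
    using ds_data[OF assms(1,2)] .
  have h: "hm G U (ds U W) i1" "hm G (ds U W) U q1" "hm G W (ds U W) i2" "hm G (ds U W) W q2"
    and z: "q1 * i1 = Idm U" "q2 * i2 = Idm W" "q1 * i2 = 0" "q2 * i1 = 0"
    using d(2) by (auto simp: bip_def)
  show ?thesis
  proof (rule bip_siso_ds)
    show "bip G (tensor (ds U W) X) (tensor U X) (tensor W X) (tenl X i1) (tenl X q1) (tenl X i2) (tenl X q2)"
      unfolding bip_def tenl_mult z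
      using h[THEN hm_tenl[rotated 3]] assms by simp
    have "tenl X i1 * tenl X q1 + tenl X i2 * tenl X q2 = tenl X (Idm (ds U W))"
      unfolding tenl_mult d(3)[symmetric] by simp
    then show "null (tensor (ds U W) X) (tensor (ds U W) X)
        (Idm (tensor (ds U W) X) - (tenl X i1 * tenl X q1 + tenl X i2 * tenl X q2))"
      by (simp only: tenl_Idm diff_self null_zero)
  qed (use assms in auto)
qed

lemma siso_tensor_dsum_left:
  "(\<And>V. V \<in> set Vs \<Longrightarrow> md V) \<Longrightarrow> md X \<Longrightarrow> siso (tensor (dsum Vs) X) (dsum (map (\<lambda>V. tensor V X) Vs))"
proof (induction Vs)
  case Nil
  have "proj (tensor (dsum []) X)" using Nil by (intro proj_tensor) auto
  then show ?case by (simp add: siso_projs)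
next
  case (Cons V Vs)
  have "siso (tensor (ds V (dsum Vs)) X) (ds (tensor V X) (tensor (dsum Vs) X))"
    using Cons.prems by (intro siso_tensor_ds) auto
  moreover have "siso (ds (tensor V X) (tensor (dsum Vs) X)) (ds (tensor V X) (dsum (map (\<lambda>V. tensor V X) Vs)))"
    using Cons by (intro siso_ds siso_refl) auto
  ultimately show ?case by (simp add: dsum_Cons) (rule siso_trans)
qed

lemma siso_tensor_dsum_right:
  assumes "\<And>V. V \<in> set Vs \<Longrightarrow> md V" "md X"
  shows "siso (tensor X (dsum Vs)) (dsum (map (tensor X) Vs))"
proof -
  have "siso (tensor X (dsum Vs)) (tensor (dsum Vs) X)"
    using assms by (intro siso_tensor_comm) auto
  also note siso_tensor_dsum_left[of Vs X]
  moreover have "siso (dsum (map (\<lambda>V. tensor V X) Vs)) (dsum (map (tensor X) Vs))"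
    using assms by (intro siso_dsum_cong) (auto simp: list_all2_conv_all_nth intro!: siso_tensor_comm)
  ultimately show ?thesis using siso_trans assms by blast
qed

lemma md_trivial [simp]: "md trivial_fgmod"
  by (simp add: is_fgmod_def trivial_fgmod_def)

end

section \<open>Submodules\<close>

definition subsp :: "('x \<Rightarrow> 'a::field) set \<Rightarrow> bool" where
  "subsp U \<longleftrightarrow> (\<lambda>x. 0) \<in> U \<and> (\<forall>f\<in>U. \<forall>h\<in>U. (\<lambda>x. f x + h x) \<in> U) \<and> (\<forall>c. \<forall>f\<in>U. (\<lambda>x. c * f x) \<in> U)"

lemma subspD:
  assumes "subsp U"
  shows "(\<lambda>x. 0) \<in> U" "f \<in> U \<Longrightarrow> h \<in> U \<Longrightarrow> (\<lambda>x. f x + h x) \<in> U" "f \<in> U \<Longrightarrow> (\<lambda>x. c * f x) \<in> U"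
    "f \<in> U \<Longrightarrow> h \<in> U \<Longrightarrow> (\<lambda>x. f x - h x) \<in> U"
proof -
  show a: "(\<lambda>x. 0) \<in> U" "f \<in> U \<Longrightarrow> h \<in> U \<Longrightarrow> (\<lambda>x. f x + h x) \<in> U" "f \<in> U \<Longrightarrow> (\<lambda>x. c * f x) \<in> U" for f h c
    using assms by (auto simp: subsp_def)
  show "f \<in> U \<Longrightarrow> h \<in> U \<Longrightarrow> (\<lambda>x. f x - h x) \<in> U"
    using a(2)[of f "\<lambda>x. - 1 * h x"] a(3)[of h "- 1"] by simp
qed

lemma subsp_sum:
  assumes "subsp U" "\<And>k. k \<in> A \<Longrightarrow> F k \<in> U" shows "(\<lambda>x. \<Sum>k\<in>A. F k x) \<in> U"
  using assms(2)
  by (induction A rule: infinite_finite_induct) (auto simp: subspD[OF assms(1)])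

text \<open>A basis of a space of functions that is dual to the evaluations at finitely many points.\<close>

definition pbas :: "('x \<Rightarrow> 'a::field) set \<Rightarrow> nat \<Rightarrow> (nat \<Rightarrow> 'x) \<Rightarrow> (nat \<Rightarrow> 'x \<Rightarrow> 'a) \<Rightarrow> bool" where
  "pbas U d pt bs \<longleftrightarrow> (\<forall>j<d. bs j \<in> U) \<and> (\<forall>j<d. \<forall>k<d. bs j (pt k) = (if j = k then 1 else 0)) \<and>
     (\<forall>f\<in>U. \<forall>x. f x = (\<Sum>j<d. f (pt j) * bs j x))"

text \<open>A family dual to points is chosen of the largest possible size. If some \<open>f\<close>
  were not recovered from its values, the interpolation error \<open>h\<close> would vanish at all
  chosen points but not at some \<open>x\<close>; adjoining \<open>x\<close> and clearing the values
  \<open>bs j x\<close> by multiples of \<open>h\<close> would enlarge the family.\<close>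

lemma pbas_exists:
  fixes U :: "('x \<Rightarrow> 'a::field) set"
  assumes U: "subsp U" and X: "finite X" "\<And>f x. f \<in> U \<Longrightarrow> x \<notin> X \<Longrightarrow> f x = 0"
  obtains d pt bs where "pbas U d pt bs"
proof -
  define Q where "Q d \<longleftrightarrow> (\<exists>pt bs. (\<forall>j<d. bs j \<in> U) \<and>
    (\<forall>j<d. \<forall>k<d. bs j (pt k) = (if j = k then 1 else 0)))" for d :: nat
  have Q0: "Q 0" by (simp add: Q_def)
  have Qb: "d \<le> card X" if Qd: "Q d" for d
  proof -
    obtain pt bs where b: "\<forall>j<d. bs j \<in> U" "\<forall>j<d. \<forall>k<d. bs j (pt k) = (if j = k then 1 else 0)"
      using Qd unfolding Q_def by blast
    have "inj_on pt {..<d}" by (rule inj_onI) (metis b(2) lessThan_iff one_neq_zero)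
    moreover have "pt ` {..<d} \<subseteq> X"
      using X(2) b by (metis image_subsetI lessThan_iff one_neq_zero)
    ultimately show ?thesis using card_inj_on_le[of pt "{..<d}" X] X(1) by simp
  qed
  obtain d where d: "Q d" "\<And>e. Q e \<Longrightarrow> e \<le> d"
    using GreatestI_nat[of Q, OF Q0] Greatest_le_nat[of Q] Qb by blast
  obtain pt bs where b: "\<forall>j<d. bs j \<in> U" "\<forall>j<d. \<forall>k<d. bs j (pt k) = (if j = k then 1 else 0)"
    using d(1) unfolding Q_def by blast
  have "f x = (\<Sum>j<d. f (pt j) * bs j x)" if f: "f \<in> U" for f x
  proof (rule ccontr)
    assume ne: "f x \<noteq> (\<Sum>j<d. f (pt j) * bs j x)"
    define h where "h y = f y - (\<Sum>j<d. f (pt j) * bs j y)" for y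
    have h: "h \<in> U" unfolding h_def
      by (intro subspD[OF U] subsp_sum[OF U] f) (use b in auto)
    have hz: "h (pt k) = 0" if "k < d" for k
    proof -
      have "(\<Sum>j<d. f (pt j) * bs j (pt k)) = (\<Sum>j<d. if j = k then f (pt j) else 0)"
        using b(2) that by (intro sum.cong) auto
      then show ?thesis using that by (simp add: h_def)
    qed
    have hx: "h x \<noteq> 0" using ne by (simp add: h_def)
    define pt' where "pt' = pt(d := x)"
    define bs' where "bs' j = (if j = d then (\<lambda>y. (1 / h x) * h y) else (\<lambda>y. bs j y - (bs j x / h x) * h y))" for j
    have "(\<lambda>y. bs j y - c * h y) \<in> U" "(\<lambda>y. c * h y) \<in> U" if "j < d" for j c
      using b(1) that by (auto intro!: subspD[OF U] h)
    then have "\<forall>j<Suc d. bs' j \<in> U"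
      using subspD(3)[OF U h, of "1 / h x"] unfolding bs'_def less_Suc_eq by presburger
    moreover have "\<forall>j<Suc d. \<forall>k<Suc d. bs' j (pt' k) = (if j = k then 1 else 0)"
      using b(2) hx by (auto simp: bs'_def pt'_def less_Suc_eq hz)
    ultimately have "Q (Suc d)" unfolding Q_def by blast
    then show False using d(2) by fastforce
  qed
  with b have "pbas U d pt bs" by (simp add: pbas_def)
  then show ?thesis by (rule that)
qed

section \<open>Vectors as columns of finitely supported matrices\<close>

definition ap :: "nat \<Rightarrow> 'a::field fmat \<Rightarrow> (nat \<Rightarrow> 'a) \<Rightarrow> nat \<Rightarrow> 'a" where
  "ap n f u i = (\<Sum>k<n. ent f i k * u k)"

definition clm :: "'a::field fmat \<Rightarrow> nat \<Rightarrow> nat \<Rightarrow> 'a" where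
  "clm X j = (\<lambda>i. ent X i j)"

lemma clm_mult:
  assumes "f * E n = f \<or> E n * X = X" shows "clm (f * X) j = ap n f (clm X j)"
proof
  fix i
  show "clm (f * X) j i = ap n f (clm X j) i"
    unfolding clm_def ap_def using assms by (intro ent_times_gen) (auto simp: E_mult_iff mult_E_iff)
qed

lemma clm_eqI: "(\<And>j. clm X j = clm Y j) \<Longrightarrow> X = Y"
  unfolding clm_def by (rule fmat_eqI) metis

lemma ap_mult: "f * E n = f \<Longrightarrow> h * E m = h \<Longrightarrow> ap m (f * h) u = ap n f (ap m h u)"
proof
  fix i assume f: "f * E n = f" "h * E m = h"
  have "ap m (f * h) u i = (\<Sum>k<m. \<Sum>l<n. ent f i l * (ent h l k * u k))"
    unfolding ap_def
    by (subst ent_times_gen[of n]) (use f in \<open>auto simp: mult_E_iff sum_distrib_right mult.assoc\<close>)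
  also have "\<dots> = (\<Sum>l<n. \<Sum>k<m. ent f i l * (ent h l k * u k))" by (rule sum.swap)
  finally show "ap m (f * h) u i = ap n f (ap m h u) i" by (simp add: ap_def sum_distrib_left)
qed

definition sup_le :: "nat \<Rightarrow> (nat \<Rightarrow> 'a::zero) \<Rightarrow> bool" where
  "sup_le n u \<longleftrightarrow> (\<forall>i\<ge>n. u i = 0)"

lemma ap_E: "sup_le n u \<Longrightarrow> ap n (E n) u = u"
proof
  fix i assume "sup_le n u"
  have "ap n (E n) u i = (\<Sum>k<n. if k = i then u k else 0)"
    unfolding ap_def by (rule sum.cong) (auto simp: ent_E)
  then show "ap n (E n) u i = u i" using \<open>sup_le n u\<close> by (simp add: sup_le_def)
qed

lemma sup_ap: "E n * f = f \<Longrightarrow> sup_le n (ap m f u)"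
  by (auto simp: sup_le_def ap_def E_mult_iff)

lemma sup_clm: "E n * f = f \<Longrightarrow> sup_le n (clm f j)"
  by (auto simp: sup_le_def clm_def E_mult_iff)

lemma ap_linear: "ap n f (\<lambda>x. u x + v x) = (\<lambda>x. ap n f u x + ap n f v x)"
  "ap n f (\<lambda>x. c * u x) = (\<lambda>x. c * ap n f u x)" "ap n f (\<lambda>x. 0) = (\<lambda>x. 0)"
  by (auto simp: ap_def sum.distrib algebra_simps sum_distrib_left fun_eq_iff)

lemma matrix_of_cols:
  assumes "\<And>j. j < m \<Longrightarrow> sup_le n (c j)"
  obtains X where "E n * X = (X::'a::field fmat)" "X * E m = X" "\<And>j. clm X j = (if j < m then c j else (\<lambda>i. 0))"
  by (rule that[of "fm n m (\<lambda>i j. c j i)"])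
    (use assms in \<open>auto simp: E_fm fm_E clm_def fun_eq_iff sup_le_def\<close>)

definition fv :: "nat \<Rightarrow> 'a::zero vec \<Rightarrow> nat \<Rightarrow> 'a" where
  "fv n v i = (if i < n then v $ i else 0)"

lemma fv_vec: "sup_le n u \<Longrightarrow> fv n (vec n u) = u"
  by (auto simp: fv_def sup_le_def fun_eq_iff)

lemma vec_fv: "v \<in> carrier_vec n \<Longrightarrow> vec n (fv n v) = v"
  by (auto simp: fv_def)

lemma sup_fv [simp]: "sup_le n (fv n v)"
  by (simp add: sup_le_def fv_def)

lemma fv_inj: "v \<in> carrier_vec n \<Longrightarrow> w \<in> carrier_vec n \<Longrightarrow> fv n v = fv n w \<Longrightarrow> v = w"
  by (metis vec_fv)

lemma fv_mult: "A \<in> carrier_mat m n \<Longrightarrow> v \<in> carrier_vec n \<Longrightarrow> fv m (A *\<^sub>v v) = ap n (em A) (fv n v)"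
  by (auto simp: fv_def ap_def fun_eq_iff ent_em scalar_prod_def atLeast0LessThan)

text \<open>The counterpart of \<open>fgsub\<close> in which vectors are functions of bounded
  support, that is, columns of padded matrices; \<open>fgsub_iff\<close> translates.\<close>

definition fsub :: "'g monoid \<Rightarrow> ('g, 'a::field) fgmod \<Rightarrow> (nat \<Rightarrow> 'a) set \<Rightarrow> bool" where
  "fsub G V U \<longleftrightarrow> subsp U \<and> (\<forall>u\<in>U. sup_le (mdim V) u) \<and>
     (\<forall>g\<in>carrier G. \<forall>u\<in>U. ap (mdim V) (rh V g) u \<in> U)"

lemma subspace_iff:
  fixes U :: "'a::field vec set"
  shows "VectorSpace.subspace class_ring U (module_vec TYPE('a) n) \<longleftrightarrow>
    U \<subseteq> carrier_vec n \<and> 0\<^sub>v n \<in> U \<and> (\<forall>u\<in>U. \<forall>v\<in>U. u + v \<in> U) \<and> (\<forall>c. \<forall>u\<in>U. c \<cdot>\<^sub>v u \<in> U)"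
proof -
  interpret vec_space "TYPE('a)" n .
  show ?thesis
    unfolding VectorSpace.subspace_def submodule_def
    using vectorspace_axioms module_axioms by (auto simp: module_vec_simps class_ring_simps)
qed

lemma fgsub_iff:
  fixes V :: "('g, 'a::field) fgmod"
  assumes V: "is_fgmod G V"
  shows "fgsub G V U \<longleftrightarrow> U \<subseteq> carrier_vec (mdim V) \<and> fsub G V (fv (mdim V) ` U)"
proof -
  let ?n = "mdim V"
  have c: "mact V g \<in> carrier_mat ?n ?n" if "g \<in> carrier G" for g using V that by (simp add: is_fgmod_def)
  have eq: "fv ?n ` U = {u. sup_le ?n u \<and> vec ?n u \<in> U}" if "U \<subseteq> carrier_vec ?n"
    using that by (auto simp: vec_fv subsetD image_iff) (metis fv_vec)
  have ad: "vec ?n (\<lambda>x. u x + v x) = vec ?n u + vec ?n v" and sm: "vec ?n (\<lambda>x. a * u x) = a \<cdot>\<^sub>v vec ?n u"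
    and ze: "vec ?n (\<lambda>x. 0 :: 'a) = 0\<^sub>v ?n" for u v :: "nat \<Rightarrow> 'a" and a by auto
  have mu: "vec ?n (ap ?n (rh V g) u) = mact V g *\<^sub>v vec ?n u" if "g \<in> carrier G" "sup_le ?n u" for g u
    using fv_mult[OF c[OF that(1)], of "vec ?n u"] that c[OF that(1)]
    by (metis fv_vec mult_mat_vec_carrier rh_def vec_carrier vec_fv)
  have sup: "sup_le ?n (ap ?n (rh V g) u)" if "g \<in> carrier G" for g u
    by (rule sup_ap) (use c[OF that] in \<open>simp add: rh_def E_em\<close>)
  have ff: "fsub G V (fv ?n ` U) \<longleftrightarrow> 0\<^sub>v ?n \<in> U \<and> (\<forall>u\<in>U. \<forall>v\<in>U. u + v \<in> U) \<and> (\<forall>c. \<forall>u\<in>U. c \<cdot>\<^sub>v u \<in> U) \<and>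
      (\<forall>g\<in>carrier G. \<forall>u\<in>U. mact V g *\<^sub>v u \<in> U)" if U: "U \<subseteq> carrier_vec ?n"
  proof
    assume l: "fsub G V (fv ?n ` U)"
    note d = l[unfolded fsub_def subsp_def eq[OF U], simplified]
    show "0\<^sub>v ?n \<in> U \<and> (\<forall>u\<in>U. \<forall>v\<in>U. u + v \<in> U) \<and> (\<forall>c. \<forall>u\<in>U. c \<cdot>\<^sub>v u \<in> U) \<and>
      (\<forall>g\<in>carrier G. \<forall>u\<in>U. mact V g *\<^sub>v u \<in> U)"
    proof (intro conjI ballI allI)
      show "0\<^sub>v ?n \<in> U" using d unfolding ze by blast
      fix u assume u: "u \<in> U"
      have v: "sup_le ?n (fv ?n w)" "vec ?n (fv ?n w) \<in> U" if "w \<in> U" for w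
        using that U by (auto simp: vec_fv subsetD)
      show "u + w \<in> U" if w: "w \<in> U" for w
      proof -
        have "vec ?n (\<lambda>x. fv ?n u x + fv ?n w x) \<in> U" using d v[OF u] v[OF w] by blast
        then show ?thesis using u w U by (simp add: ad vec_fv subsetD)
      qed
      show "c \<cdot>\<^sub>v u \<in> U" for c
      proof -
        have "vec ?n (\<lambda>x. c * fv ?n u x) \<in> U" using d v[OF u] by blast
        then show ?thesis using u U by (simp add: sm vec_fv subsetD)
      qed
      show "mact V g *\<^sub>v u \<in> U" if g: "g \<in> carrier G" for g
      proof -
        have "vec ?n (ap ?n (rh V g) (fv ?n u)) \<in> U" using d g v[OF u] by blast
        then show ?thesis using u U g by (simp add: mu vec_fv subsetD)
      qed
    qed
  next
    assume "0\<^sub>v ?n \<in> U \<and> (\<forall>u\<in>U. \<forall>v\<in>U. u + v \<in> U) \<and> (\<forall>c. \<forall>u\<in>U. c \<cdot>\<^sub>v u \<in> U) \<and>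
      (\<forall>g\<in>carrier G. \<forall>u\<in>U. mact V g *\<^sub>v u \<in> U)"
    then show "fsub G V (fv ?n ` U)"
      unfolding fsub_def subsp_def eq[OF U] using ad sm ze mu sup by (auto simp: sup_le_def)
  qed
  show ?thesis unfolding fgsub_def subspace_iff using ff by blast
qed

lemma fsub_fgsub:
  assumes "is_fgmod G V" "fsub G V U"
  shows "fgsub G V (vec (mdim V) ` U)" "fv (mdim V) ` vec (mdim V) ` U = U"
proof -
  show e: "fv (mdim V) ` vec (mdim V) ` U = U"
    using assms(2) by (auto simp: fsub_def fv_vec image_image)
  show "fgsub G V (vec (mdim V) ` U)"
    unfolding fgsub_iff[OF assms(1)] e using assms(2) by auto
qed

lemma simple_fsub:
  assumes "simple_fgmod G V" "fsub G V U"
  shows "U = {\<lambda>i. 0} \<or> U = {u. sup_le (mdim V) u}"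
proof -
  let ?n = "mdim V"
  have V: "is_fgmod G V" using assms(1) by (simp add: simple_fgmod_def)
  have "vec ?n ` U = {0\<^sub>v ?n} \<or> vec ?n ` U = carrier_vec ?n"
    using assms(1) fsub_fgsub(1)[OF V assms(2)] by (simp add: simple_fgmod_def)
  moreover have "fv ?n ` {0\<^sub>v ?n} = {\<lambda>i. 0}" by (auto simp: fv_def)
  moreover have "fv ?n ` carrier_vec ?n = {u. sup_le ?n u}"
    by (auto simp: image_iff) (metis fv_vec vec_carrier)
  ultimately show ?thesis using fsub_fgsub(2)[OF V assms(2)] by metis
qed

context fin_group
begin

lemma hm_lift:
  assumes K: "md K" and V: "md V" and W: "md W" and i: "hm G K V i" and r: "Idm K * r = r" "r * i = Idm K"
    and f: "hm G W V f" "i * (r * f) = f"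
  shows "hm G W K (r * f)"
  unfolding hm_def
proof (intro conjI ballI)
  show "Idm K * (r * f) = r * f" "r * f * Idm W = r * f"
    using r f by (simp_all add: mult.assoc[symmetric] mult.assoc[of r f] hm_simps)
  fix g assume g: "g \<in> carrier G"
  have "r * f * rh W g = r * (rh V g * (i * (r * f)))"
    using hm_rh[OF f(1) g] by (simp add: mult.assoc f(2))
  also have "\<dots> = r * (i * (rh K g * (r * f)))"
    by (simp flip: mult.assoc hm_rh[OF i g])
  also have "\<dots> = rh K g * (r * f)"
    using g by (simp add: mult_assoc_eq[OF r(2)] rh_simps K)
  finally show "r * f * rh W g = rh K g * (r * f)" .
qed

text \<open>In a basis of \<open>U\<close> dual to evaluations, reading off the coordinates at the
  chosen points is an explicit linear retraction \<open>r\<close> of the inclusion \<open>i\<close>.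
  The action on \<open>K\<close> is then \<open>r * (rh V g * i)\<close>, and \<open>i * r\<close>
  fixes every matrix whose columns lie in \<open>U\<close>.\<close>

lemma realize:
  fixes V :: "('g, 'a::field) fgmod"
  assumes V: "md V" and U: "fsub G V U"
  obtains K i r where "md K" "hm G K V i" "Idm K * r = r" "r * Idm V = r" "r * i = Idm K"
    "\<forall>X. (\<forall>j. clm X j \<in> U) \<longrightarrow> i * (r * X) = X" "\<forall>u. ap (mdim K) i u \<in> U"
proof -
  define n where "n = mdim V"
  have Us: "subsp U" and sup: "\<And>u. u \<in> U \<Longrightarrow> sup_le n u"
    and Ug: "\<And>g u. g \<in> carrier G \<Longrightarrow> u \<in> U \<Longrightarrow> ap n (rh V g) u \<in> U"
    using U by (auto simp: fsub_def n_def)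
  obtain d pt bs where b: "pbas U d pt bs"
    by (rule pbas_exists[OF Us, of "{..<n}"]) (use sup in \<open>auto simp: sup_le_def\<close>)
  have bU: "\<And>j. j < d \<Longrightarrow> bs j \<in> U" and bp: "\<And>j k. j < d \<Longrightarrow> k < d \<Longrightarrow> bs j (pt k) = (if j = k then 1 else 0)"
    and be: "\<And>f x. f \<in> U \<Longrightarrow> f x = (\<Sum>j<d. f (pt j) * bs j x)"
    using b by (auto simp: pbas_def)
  have ptn: "pt j < n" if "j < d" for j
    using bp[OF that that] sup[OF bU[OF that]] by (simp add: sup_le_def) (metis not_le one_neq_zero)
  define i where "i = fm n d (\<lambda>x j. bs j x)"
  define r where "r = fm d n (\<lambda>j x. if x = pt j then 1 else 0 :: 'a)"
  have ei: "E n * i = i" "i * E d = i" "E d * r = r" "r * E n = r"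
    by (auto simp: i_def r_def E_fm fm_E)
  have rX: "ent (r * X) j k = (if j < d then ent X (pt j) k else 0)" for X j k
    by (subst ent_times_gen[of n]) (auto simp: r_def ptn if_distrib[of "\<lambda>x. x * _"] cong: if_cong)
  have ri: "r * i = E d"
    by (rule fmat_eqI) (auto simp: rX i_def ent_E bp ptn)
  have iX: "i * (r * X) = X" if "\<And>j. clm X j \<in> U" for X
  proof (rule fmat_eqI)
    fix x k
    have "ent (i * (r * X)) x k = (\<Sum>j<d. ent i x j * ent X (pt j) k)"
      by (subst ent_times_gen[of d]) (auto simp: i_def rX)
    also have "\<dots> = (\<Sum>j<d. clm X k (pt j) * bs j x)"
      using sup[OF bU] by (intro sum.cong) (auto simp: i_def clm_def sup_le_def)
    finally show "ent (i * (r * X)) x k = ent X x k" using be[OF that, of k x] by (simp add: clm_def)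
  qed
  have api: "ap d i u \<in> U" for u
  proof -
    have "ap d i u = (\<lambda>x. \<Sum>j<d. u j * bs j x)"
      using sup[OF bU] by (auto simp: ap_def i_def fun_eq_iff sup_le_def mult.commute intro!: sum.cong)
    then show ?thesis using subsp_sum[OF Us, of "{..<d}" "\<lambda>j x. u j * bs j x"] subspD(3)[OF Us] bU by simp
  qed
  have colU: "clm (i * X) j \<in> U" for X j
    by (subst clm_mult[of _ d]) (auto simp: ei api)
  note rV = rh_simps[OF V, folded n_def]
  have gi: "i * (r * (rh V g * i)) = rh V g * i" if g: "g \<in> carrier G" for g
  proof (rule iX)
    fix j
    have "clm (rh V g * i) j = ap n (rh V g) (clm (i * E d) j)"
      unfolding ei by (rule clm_mult) (simp add: ei)
    then show "clm (rh V g * i) j \<in> U" using Ug[OF g colU] by simp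
  qed
  define K where "K = \<lparr> mdim = d, mact = (\<lambda>g. dm d d (r * (rh V g * i))) \<rparr>"
  have rK: "rh K g = r * (rh V g * i)" for g
    unfolding rh_def K_def fgmod.simps
    by (rule em_dm) (simp_all add: mult.assoc ei mult_assoc_eq[OF ei(3)])
  have dK: "mdim K = d" by (simp add: K_def)
  have mK: "md K"
    unfolding is_fgmod_def dK
  proof (intro conjI ballI)
    show cK: "mact K g \<in> carrier_mat d d" for g by (simp add: K_def)
    have "em (mact K \<one>) = em (1\<^sub>m d)"
      using rK[of \<one>] by (simp add: rh_def[symmetric] rV em_one ei ri)
    then show "mact K \<one> = 1\<^sub>m d" using cK by (metis em_inj one_carrier_mat)
    fix g h assume g: "g \<in> carrier G" and h: "h \<in> carrier G"
    have "rh K (g \<otimes> h) = rh K g * rh K h"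
      using g h gi[OF h] by (simp add: rK rV mult.assoc)
    then show "mact K (g \<otimes> h) = mact K g * mact K h"
      using em_mult[OF cK[of g] cK[of h]] by (intro em_inj[OF _ mult_carrier_mat[OF cK cK]])
        (auto simp: rh_def cK)
  qed
  have "hm G K V i"
    unfolding hm_def dK n_def[symmetric] using ei gi by (auto simp: rK)
  then show ?thesis using that[OF mK, of i r] ei ri iX api by (simp add: dK n_def[symmetric])
qed

lemma kernel_factor:
  fixes V W :: "('g, 'a::field) fgmod"
  assumes V: "md V" and W: "md W" and f: "hm G V W f"
  obtains K i r where "md K" "hm G K V i" "Idm K * r = r" "r * Idm V = r" "r * i = Idm K" "f * i = 0"
    "\<forall>X. Idm V * X = X \<longrightarrow> f * X = 0 \<longrightarrow> i * (r * X) = X"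
proof -
  define U where "U = {u. sup_le (mdim V) u \<and> ap (mdim V) f u = (\<lambda>i. 0)}"
  have fs: "fsub G V U"
    unfolding fsub_def
  proof (intro conjI ballI)
    show "subsp U" by (auto simp: subsp_def U_def ap_linear sup_le_def)
    fix g u assume g: "g \<in> carrier G" and u: "u \<in> U"
    have "ap (mdim V) f (ap (mdim V) (rh V g) u) = ap (mdim V) (f * rh V g) u"
      by (rule ap_mult[symmetric]) (use f V g in \<open>auto simp: hm_simps rh_simps\<close>)
    also have "\<dots> = ap (mdim W) (rh W g) (ap (mdim V) f u)"
      unfolding hm_rh[OF f g] by (rule ap_mult) (use f W g in \<open>auto simp: hm_simps rh_simps\<close>)
    finally show "ap (mdim V) (rh V g) u \<in> U"
      using u V g by (auto simp: U_def ap_linear rh_simps intro!: sup_ap)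
  qed (auto simp: U_def)
  obtain K i r where K: "md K" "hm G K V i" "Idm K * r = r" "r * Idm V = r" "r * i = Idm K"
    "\<forall>X. (\<forall>j. clm X j \<in> U) \<longrightarrow> i * (r * X) = X" "\<forall>u. ap (mdim K) i u \<in> U"
    using realize[OF V fs] .
  have "f * i = 0"
  proof (rule clm_eqI)
    fix j
    have "clm (f * i) j = ap (mdim V) f (clm (i * Idm K) j)"
      by (simp add: clm_mult[of f "mdim V"] hm_simps[OF f] hm_simps(2)[OF K(2)])
    also have "\<dots> = ap (mdim V) f (ap (mdim K) i (clm (Idm K) j))"
      by (subst clm_mult) simp_all
    finally show "clm (f * i) j = clm 0 j" using K(7) by (simp add: U_def clm_def)
  qed
  moreover have "i * (r * X) = X" if "Idm V * X = X" "f * X = 0" for X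
  proof (rule K(6)[rule_format])
    fix j show "clm X j \<in> U"
      using that clm_mult[of f "mdim V" X j] by (auto simp: U_def sup_clm) (simp add: clm_def)
  qed
  ultimately show ?thesis using that K by blast
qed

lemma fsub_range:
  fixes V W :: "('g, 'a::field) fgmod"
  assumes V: "md V" and W: "md W" and f: "hm G V W f"
  shows "fsub G W (range (ap (mdim V) f))"
proof -
  define U where "U = range (ap (mdim V) f)"
  have "fsub G W U"
    unfolding fsub_def
  proof (intro conjI ballI)
    show "subsp U"
      unfolding subsp_def U_def
    proof (intro conjI ballI allI; (elim rangeE)?)
      show "(\<lambda>x. 0) \<in> range (ap (mdim V) f)"
        by (rule range_eqI[of _ _ "\<lambda>x. 0"]) (simp add: ap_linear)
      show "(\<lambda>x. u x + w x) \<in> range (ap (mdim V) f)"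
        if "u = ap (mdim V) f u'" "w = ap (mdim V) f w'" for u w u' w'
        by (rule range_eqI[of _ _ "\<lambda>x. u' x + w' x"]) (simp add: ap_linear that)
      show "(\<lambda>x. c * u x) \<in> range (ap (mdim V) f)" if "u = ap (mdim V) f u'" for c u u'
        by (rule range_eqI[of _ _ "\<lambda>x. c * u' x"]) (simp add: ap_linear that)
    qed
    fix g u assume g: "g \<in> carrier G" and u: "u \<in> U"
    then obtain v where v: "u = ap (mdim V) f v" by (auto simp: U_def)
    have "ap (mdim W) (rh W g) u = ap (mdim V) (rh W g * f) v"
      unfolding v by (rule ap_mult[symmetric]) (use f W g in \<open>auto simp: hm_simps rh_simps\<close>)
    also have "\<dots> = ap (mdim V) f (ap (mdim V) (rh V g) v)"
      unfolding hm_rh[OF f g, symmetric] by (rule ap_mult) (use f V g in \<open>auto simp: hm_simps rh_simps\<close>)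
    finally show "ap (mdim W) (rh W g) u \<in> U" by (simp add: U_def)
  qed (use f in \<open>auto simp: U_def hm_simps intro!: sup_ap\<close>)
  then show ?thesis by (simp add: U_def)
qed

text \<open>\<open>r\<close> is a linear retraction of the inclusion of the image and
  \<open>s\<close> a linear section of \<open>f\<close> over it. Neither has to commute with the
  group, but \<open>r * f\<close> does.\<close>

lemma image_factor:
  fixes V W :: "('g, 'a::field) fgmod"
  assumes V: "md V" and W: "md W" and f: "hm G V W f"
  obtains X i r s where "md X" "hm G X W i" "hm G V X (r * f)" "Idm X * r = r" "r * Idm W = r"
    "r * i = Idm X" "i * (r * f) = f" "Idm V * s = s" "s * Idm X = s" "f * s = i"
proof -
  define U where "U = range (ap (mdim V) f)"
  have fs: "fsub G W U" unfolding U_def by (rule fsub_range[OF assms])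
  obtain X i r where K: "md X" "hm G X W i" "Idm X * r = r" "r * Idm W = r" "r * i = Idm X"
    "\<forall>Y. (\<forall>j. clm Y j \<in> U) \<longrightarrow> i * (r * Y) = Y" "\<forall>u. ap (mdim X) i u \<in> U"
    using realize[OF W fs] .
  have e: "i * (r * f) = f"
  proof (rule K(6)[rule_format])
    fix j show "clm f j \<in> U"
      using clm_mult[of f "mdim V" "Idm V" j] f by (simp add: hm_simps U_def)
  qed
  have "\<exists>v. clm i j = ap (mdim V) f v \<and> sup_le (mdim V) v" for j
  proof -
    have "clm i j \<in> U" using clm_mult[of i "mdim X" "Idm X" j] K(7) by (simp add: hm_simps[OF K(2)])
    then obtain v where v: "clm i j = ap (mdim V) f v" by (auto simp: U_def)
    have "ap (mdim V) f v = ap (mdim V) f (ap (mdim V) (Idm V) v)"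
      by (subst ap_mult[symmetric]) (auto simp: hm_simps[OF f])
    then show ?thesis using v sup_ap[OF E_E] by metis
  qed
  then obtain c where c: "\<And>j. clm i j = ap (mdim V) f (c j)" "\<And>j. sup_le (mdim V) (c j)" by metis
  obtain s where s: "Idm V * s = s" "s * Idm X = s" "\<And>j. clm s j = (if j < mdim X then c j else (\<lambda>i. 0))"
    using matrix_of_cols[of "mdim X" "mdim V" c] c(2) by metis
  have "f * s = i"
  proof (rule clm_eqI)
    fix j
    have "clm i j = (\<lambda>i. 0)" if "\<not> j < mdim X"
      using hm_simps(2)[OF K(2)] that by (auto simp: clm_def mult_E_iff)
    then show "clm (f * s) j = clm i j"
      by (subst clm_mult[of _ "mdim V"]) (auto simp: hm_simps[OF f] s c(1)[symmetric] ap_linear)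
  qed
  with K e s show ?thesis
    using that[of X i r s] hm_lift[OF K(1) W V K(2,3,5) f e] by blast
qed

lemma split_idempotent:
  assumes V: "md V" and e: "hm G V V e" "e * e = e"
  obtains X i q where "md X" "hm G X V i" "hm G V X q" "q * i = Idm X" "i * q = e"
proof -
  obtain X i r s where X: "md X" "hm G X V i" "hm G V X (r * e)" "Idm X * r = r" "r * Idm V = r"
    "r * i = Idm X" "i * (r * e) = e" "Idm V * s = s" "s * Idm X = s" "e * s = i"
    using image_factor[OF V V e(1)] .
  have "e * i = i" using X(10) e(2) by (metis mult.assoc)
  then show ?thesis using that[OF X(1-3)] X by (simp add: mult.assoc)
qed

end

section \<open>Projective modules and Heller translates\<close>

context fin_group
begin

lemma bip_fgiso:
  assumes "md V" "md U" "md W" "bip G V U W i1 q1 i2 q2" "i1 * q1 + i2 * q2 = Idm V"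
  shows "fgiso G V (ds U W)"
proof -
  obtain j1 p1 j2 p2 where d: "md (ds U W)" "bip G (ds U W) U W j1 p1 j2 p2"
    "j1 * p1 + j2 * p2 = Idm (ds U W)"
    using ds_data[OF assms(2,3)] .
  note b = assms(4)[unfolded bip_def] d(2)[unfolded bip_def]
  have h: "hm G U V i1" "hm G V U q1" "hm G W V i2" "hm G V W q2" "hm G U (ds U W) j1" "hm G (ds U W) U p1"
    "hm G W (ds U W) j2" "hm G (ds U W) W p2"
    and z: "q1 * i1 = Idm U" "q2 * i2 = Idm W" "q1 * i2 = 0" "q2 * i1 = 0"
    "p1 * j1 = Idm U" "p2 * j2 = Idm W" "p1 * j2 = 0" "p2 * j1 = 0"
    using b by auto
  note zz = z z[THEN mult_assoc_eq] h[THEN hm_simps(1)] h[THEN hm_simps(2)] h[THEN hm_simps(3)]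
    h[THEN hm_simps(4)]
  have "hm G V (ds U W) (j1 * q1 + j2 * q2)" "hm G (ds U W) V (i1 * p1 + i2 * p2)"
    using h by (meson hm_add hm_comp)+
  moreover have "(i1 * p1 + i2 * p2) * (j1 * q1 + j2 * q2) = Idm V"
    "(j1 * q1 + j2 * q2) * (i1 * p1 + i2 * p2) = Idm (ds U W)"
    unfolding assms(5)[symmetric] d(3)[symmetric] by (simp_all add: algebra_simps zz)
  ultimately show ?thesis using assms d unfolding fgiso_iff by blast
qed

definition reg :: "('g, 'a::field) fgmod" where
  "reg = (let e = (SOME e. bij_betw e {..<card (carrier G)} (carrier G)) in
    \<lparr> mdim = card (carrier G),
      mact = (\<lambda>g. dm (card (carrier G)) (card (carrier G))
        (fm (card (carrier G)) (card (carrier G)) (\<lambda>i j. if e i = g \<otimes> e j then 1 else 0))) \<rparr>)"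

text \<open>The regular module \<open>R\<close> is projective, hence so is \<open>R\<close> tensored
  with \<open>V\<close>; the augmentation of \<open>R\<close> maps this product onto
  \<open>V\<close>. The section \<open>s\<close> is only linear.\<close>

lemma free_cover:
  fixes V :: "('g, 'a::field) fgmod"
  assumes V: "md V"
  obtains P p s where "proj P" "hm G P V p" "Idm P * s = s" "s * Idm V = s" "p * s = Idm V"
proof -
  define N where "N = card (carrier G)"
  define e where "e = (SOME e. bij_betw e {..<N} (carrier G))"
  have e: "bij_betw e {..<N} (carrier G)"
    using ex_bij_betw_nat_finite[OF fin] unfolding e_def N_def atLeast0LessThan by (rule someI_ex)
  have eG: "i < N \<Longrightarrow> e i \<in> carrier G" for i using e by (auto simp: bij_betw_def)
  have einj: "i < N \<Longrightarrow> j < N \<Longrightarrow> e i = e j \<longleftrightarrow> i = j" for i j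
    using e by (auto simp: bij_betw_def inj_on_def)
  have esur: "\<exists>i<N. e i = g" if "g \<in> carrier G" for g using e that unfolding bij_betw_def by (metis imageE lessThan_iff)
  define R :: "('g, 'a) fgmod" where "R = reg"
  define pm :: "'g \<Rightarrow> 'a fmat" where "pm g = fm N N (\<lambda>i j. if e i = g \<otimes> e j then 1 else 0)" for g
  have R: "R = \<lparr> mdim = N, mact = (\<lambda>g. dm N N (pm g)) \<rparr>"
    by (simp add: R_def reg_def Let_def N_def e_def pm_def)
  have dR: "mdim R = N" by (simp add: R)
  have pmE: "E N * pm g = pm g" "pm g * E N = pm g" for g by (auto simp: pm_def E_fm fm_E)
  have rR: "rh R g = pm g" for g
    unfolding rh_def R fgmod.simps by (rule em_dm) (auto simp: pmE)
  have pm_mult: "pm (g \<otimes> h) = pm g * pm h" if gh: "g \<in> carrier G" "h \<in> carrier G" for g h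
  proof (rule fmat_eqI)
    fix i j
    show "ent (pm (g \<otimes> h)) i j = ent (pm g * pm h) i j"
    proof (cases "j < N")
      case True
      obtain l where l: "l < N" "e l = h \<otimes> e j" using esur[of "h \<otimes> e j"] eG True gh by auto
      have "ent (pm g * pm h) i j = (\<Sum>k<N. ent (pm g) i k * ent (pm h) k j)"
        by (rule ent_times_gen) (simp add: pm_def)
      also have "\<dots> = (\<Sum>k<N. if k = l then ent (pm g) i l else 0)"
        by (rule sum.cong) (auto simp: pm_def True einj l(1) l(2)[symmetric])
      also have "\<dots> = ent (pm (g \<otimes> h)) i j"
        using l True gh eG by (simp add: pm_def m_assoc)
      finally show ?thesis by simp
    next
      case False
      then have "ent (pm g * pm h) i j = 0"
        using pmE[of g] pmE[of h] by (metis ent_mult_E mult.assoc)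
      then show ?thesis using False by (simp add: pm_def)
    qed
  qed
  have mR: "md R"
    unfolding is_fgmod_def dR
  proof (intro conjI ballI)
    show c: "mact R g \<in> carrier_mat N N" for g by (simp add: R)
    have "pm \<one> = E N" by (rule fmat_eqI) (auto simp: pm_def ent_E eG einj)
    then have "em (mact R \<one>) = em (1\<^sub>m N)" using rR[of \<one>] by (simp add: rh_def em_one)
    then show "mact R \<one> = 1\<^sub>m N" using c by (metis em_inj one_carrier_mat)
    show "mact R (g \<otimes> h) = mact R g * mact R h" if "g \<in> carrier G" "h \<in> carrier G" for g h
      by (rule em_inj[OF _ mult_carrier_mat[OF c c]])
        (use c in \<open>auto simp: em_mult[OF c c] rR[unfolded rh_def] pm_mult that\<close>)
  qed
  obtain k0 where k0: "k0 < N" "e k0 = \<one>" using esur[of \<one>] by auto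
  \<comment> \<open>The matrix unit at the identity element. Its conjugates are the diagonal matrix
    units at all group elements, so its trace is the identity of \<open>R\<close>.\<close>
  define t where "t = fm N N (\<lambda>i j. if i = k0 \<and> j = k0 then 1 else 0 :: 'a)"
  have conj: "ent (pm g * t * pm (inv g)) i j = (if i < N \<and> j < N \<and> e i = g \<and> e j = g then 1 else 0)"
    if g: "g \<in> carrier G" for g i j
  proof -
    have a: "ent (pm g * t) i k = (if i < N \<and> k = k0 \<and> e i = g then 1 else 0)" for k
    proof -
      have "ent (pm g * t) i k = (\<Sum>l<N. ent (pm g) i l * ent t l k)"
        by (rule ent_times_gen) (simp add: pm_def)
      also have "\<dots> = (\<Sum>l<N. if l = k0 then (if i < N \<and> k = k0 \<and> e i = g then 1 else 0) else 0)"
        by (rule sum.cong) (use k0 g in \<open>auto simp: pm_def t_def\<close>)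
      finally show ?thesis using k0 by simp
    qed
    have eq: "\<one> = inv g \<otimes> x \<longleftrightarrow> x = g" if "x \<in> carrier G" for x
      using g that by (metis inv_closed inv_equality inv_inv l_inv)
    have b: "ent (pm (inv g)) k0 j = (if j < N \<and> e j = g then 1 else 0)"
      using k0 eq[OF eG[of j]] by (auto simp: pm_def)
    have "ent (pm g * t * pm (inv g)) i j = (\<Sum>k<N. ent (pm g * t) i k * ent (pm (inv g)) k j)"
      by (rule ent_times_gen) (simp add: pm_def)
    also have "\<dots> = (\<Sum>k<N. if k = k0 then (if i < N \<and> j < N \<and> e i = g \<and> e j = g then 1 else 0) else 0)"
      by (rule sum.cong) (auto simp: a b)
    finally show ?thesis using k0 by simp
  qed
  have "Tr R R t = E N"
  proof (rule fmat_eqI)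
    fix i j
    have "ent (Tr R R t) i j = (\<Sum>g\<in>carrier G. if i < N \<and> j < N \<and> e i = g \<and> e j = g then 1 else 0)"
      by (simp add: Tr_def rR conj)
    also have "\<dots> = (\<Sum>g\<in>carrier G. if g = e i then (if i < N \<and> j < N \<and> i = j then 1 else 0) else 0)"
      by (rule sum.cong) (auto simp: einj)
    finally show "ent (Tr R R t) i j = ent (E N :: 'a fmat) i j"
      using eG fin by (auto simp: ent_E)
  qed
  then have "proj R" unfolding proj_def null_def using mR dR by metis
  then have P: "proj (tensor R V)" using V by (rule proj_tensor)
  define q where "q = fm 1 N (\<lambda>i j. 1 :: 'a)"
  define s where "s = fm N 1 (\<lambda>i j. if i = k0 then 1 else 0 :: 'a)"
  have qs: "E 1 * q = q" "q * E N = q" "E N * s = s" "s * E 1 = s" by (auto simp: q_def s_def E_fm fm_E)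
  have dt: "mdim (trivial_fgmod :: ('g, 'a) fgmod) = 1" "rh (trivial_fgmod :: ('g, 'a) fgmod) g = E 1" for g
    by (simp_all add: trivial_fgmod_def rh_def em_one)
  have "q * pm g = q" if g: "g \<in> carrier G" for g
  proof (rule fmat_eqI)
    fix i j
    show "ent (q * pm g) i j = ent q i j"
    proof (cases "j < N")
      case True
      obtain l where l: "l < N" "e l = g \<otimes> e j" using esur[of "g \<otimes> e j"] eG True g by auto
      have "ent (q * pm g) i j = (\<Sum>k<N. ent q i k * ent (pm g) k j)"
        by (rule ent_times_gen) (simp add: q_def)
      also have "\<dots> = (\<Sum>k<N. if k = l then ent q i l else 0)"
        by (rule sum.cong) (auto simp: pm_def True einj l(1) l(2)[symmetric])
      finally show ?thesis using l True by (simp add: q_def)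
    next
      case False
      then have "ent (q * pm g) i j = 0"
        using pmE[of g] by (metis ent_mult_E mult.assoc)
      then show ?thesis using False by (simp add: q_def)
    qed
  qed
  then have hq: "hm G R trivial_fgmod q" using qs by (simp add: hm_def dt dR rR)
  have q1: "q * s = E 1"
  proof (rule fmat_eqI)
    fix i j
    show "ent (q * s) i j = ent (E 1 :: 'a fmat) i j"
      by (subst ent_times_gen[of N]) (use k0 in \<open>auto simp: q_def s_def ent_E\<close>)
  qed
  show ?thesis
  proof (rule that[of "tensor R V" "tenl V q" "tenl V s"])
    show "hm G (tensor R V) V (tenl V q)"
      using hm_tenl[OF mR md_trivial V hq] by (simp add: tensor_trivial)
    have I: "Idm (tensor R V) = tenl V (E N)" "Idm V = tenl V (E 1)"
      using tenl_Idm[of V R] tenl_Idm[of V "trivial_fgmod :: ('g, 'a) fgmod"]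
      by (simp_all only: dR dt tensor_trivial)
    show "Idm (tensor R V) * tenl V s = tenl V s" "tenl V s * Idm V = tenl V s" "tenl V q * tenl V s = Idm V"
      unfolding I tenl_mult by (simp_all add: qs[simplified] q1[simplified])
  qed (rule P)
qed

text \<open>If \<open>Idm P\<close> is the trace of \<open>t\<close>, the linear map
  \<open>s * (b * t)\<close> is turned into a homomorphism by its trace, and \<open>p\<close> maps
  that trace to the trace of \<open>b * t\<close>, which is \<open>b\<close>.\<close>

lemma proj_lift:
  assumes P: "proj P" and Q: "md Q" "md W" and p: "hm G Q W p" "p * s = Idm W" and b: "hm G P W b"
  obtains F where "hm G P Q F" "p * F = b"
proof -
  obtain t where t: "md P" "Idm P = Tr P P t" using P by (auto simp: proj_def null_def)
  have "p * Tr P Q (s * (b * t)) = Tr P W (b * t)"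
    using hm_mult_Tr[OF p(1), of P "s * (b * t)"] by (simp add: mult_assoc_eq[OF p(2)] hm_simps[OF b])
  also have "\<dots> = b" using hm_mult_Tr[OF b, of P t] t hm_simps[OF b] by simp
  finally show ?thesis using that hm_Tr[OF t(1) Q(1)] by blast
qed

text \<open>By the same device a null map lifts through every linearly split surjection of
  modules.\<close>

lemma null_factor:
  assumes p: "hm G P V p" "p * s = Idm V" "Idm V * t = t" and P: "md P" "md W"
  shows "hm G W P (Tr W P (s * t))" "p * Tr W P (s * t) = Tr W V t"
  using hm_mult_Tr[OF p(1), of W "s * t"] hm_Tr[OF P(2,1)] p by (simp_all add: mult_assoc_eq[OF p(2)])

lemma Tr_Idm_left: "md V \<Longrightarrow> md W \<Longrightarrow> Tr V W (Idm W * t) = Tr V W t"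
  unfolding Tr_def by (rule sum.cong) (simp_all add: rh_simps mult.assoc)

lemma null_E: "null V W f \<Longrightarrow> md V \<Longrightarrow> md W \<Longrightarrow> \<exists>t. f = Tr V W t \<and> Idm W * t = t"
  unfolding null_def by (metis Tr_Idm_left E_E mult.assoc)

lemma surj_section:
  assumes V: "md V" and W: "md W" and A: "A \<in> fgsurj G V W"
  obtains s where "Idm V * s = s" "s * Idm W = s" "em A * s = Idm W"
proof -
  have cA: "A \<in> carrier_mat (mdim W) (mdim V)"
    and im: "(\<lambda>v. A *\<^sub>v v) ` carrier_vec (mdim V) = carrier_vec (mdim W)"
    using A by (auto simp: fgsurj_def fghom_def)
  have "\<exists>v\<in>carrier_vec (mdim V). A *\<^sub>v v = unit_vec (mdim W) j" for j
    using im unit_vec_carrier by (metis (no_types, lifting) image_iff)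
  then obtain v where v: "\<And>j. v j \<in> carrier_vec (mdim V)" "\<And>j. A *\<^sub>v v j = unit_vec (mdim W) j" by metis
  obtain s where s: "Idm V * s = s" "s * Idm W = s"
    "\<And>j. clm s j = (if j < mdim W then fv (mdim V) (v j) else (\<lambda>i. 0))"
    using matrix_of_cols[of "mdim W" "mdim V" "\<lambda>j. fv (mdim V) (v j)"] by auto
  have "em A * s = Idm W"
  proof (rule clm_eqI)
    fix j
    have "clm (em A * s) j = (if j < mdim W then fv (mdim W) (unit_vec (mdim W) j) else (\<lambda>i. 0))"
      by (subst clm_mult[of _ "mdim V"]) (auto simp: s(1) s(3) ap_linear fv_mult[OF cA v(1), symmetric] v(2))
    also have "\<dots> = clm (Idm W) j" by (auto simp: clm_def ent_E fv_def fun_eq_iff)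
    finally show "clm (em A * s) j = clm (Idm W) j" .
  qed
  with s show ?thesis using that by blast
qed

lemma section_surj:
  assumes V: "md V" and W: "md W" and f: "hm G V W f" "Idm V * s = s" "s * Idm W = s" "f * s = Idm W"
  shows "dm (mdim W) (mdim V) f \<in> fgsurj G V W"
proof -
  let ?A = "dm (mdim W) (mdim V) f" and ?S = "dm (mdim V) (mdim W) s"
  have em: "em ?A = f" "em ?S = s" using hm_fghom f V W em_dm by blast+
  have "em (?A * ?S) = em (1\<^sub>m (mdim W))"
    by (subst em_mult[OF dm_carrier dm_carrier]) (simp add: em f em_one)
  then have AS: "?A * ?S = 1\<^sub>m (mdim W)"
    by (metis em_inj dm_carrier mult_carrier_mat one_carrier_mat)
  have "w \<in> (\<lambda>v. ?A *\<^sub>v v) ` carrier_vec (mdim V)" if w: "w \<in> carrier_vec (mdim W)" for w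
  proof (rule image_eqI)
    show "w = ?A *\<^sub>v (?S *\<^sub>v w)"
      using assoc_mult_mat_vec[OF dm_carrier[of "mdim W" "mdim V" f] dm_carrier[of "mdim V" "mdim W" s] w] AS w
      by simp
  qed (use mult_mat_vec_carrier[OF dm_carrier w] in simp)
  then show ?thesis
    unfolding fgsurj_def using hm_fghom(1)[OF f(1) V W] mult_mat_vec_carrier[OF dm_carrier] by blast
qed

text \<open>The lifting property gives a section of the cover from \<open>free_cover\<close>, so
  \<open>P\<close> is a retract of a module that satisfies Higman's criterion. Conversely a
  surjection has a linear section, which is all that \<open>proj_lift\<close> asks for.\<close>

lemma projective_iff: "projective_fgmod G P \<longleftrightarrow> proj P"
proof
  assume p: "projective_fgmod G P"
  then have P: "md P" by (simp add: projective_fgmod_def)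
  obtain F f s where F: "proj F" "hm G F P f" "Idm F * s = s" "s * Idm P = s" "f * s = Idm P"
    using free_cover[OF P] .
  have mF: "md F" using F by (simp add: proj_def)
  have "1\<^sub>m (mdim P) \<in> fghom G P P"
    using P by (auto simp: fghom_def is_fgmod_def)
  then obtain C where C: "C \<in> fghom G P F" "dm (mdim P) (mdim F) f * C = 1\<^sub>m (mdim P)"
    using p section_surj[OF mF P F(2-5)] P mF unfolding projective_fgmod_def by blast
  have "f * em C = Idm P"
    using arg_cong[OF C(2), of em] C(1) em_mult[OF dm_carrier, of C "mdim F" "mdim P" "mdim P" f] hm_fghom(2)[OF F(2) mF P]
    by (simp add: em_one fghom_def)
  then show "proj P" using proj_retract[OF F(1) P fghom_hm[OF C(1) P mF] F(2)] by blast
next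
  assume p: "proj P"
  show "projective_fgmod G P"
    unfolding projective_fgmod_def
  proof (intro conjI allI impI ballI)
    show P: "md P" using p by (simp add: proj_def)
    fix U V A B assume m: "md U \<and> md V" and A: "A \<in> fgsurj G U V" and B: "B \<in> fghom G P V"
    obtain s where s: "em A * s = Idm V" using surj_section[OF _ _ A] m by metis
    have A': "A \<in> fghom G U V" using A by (simp add: fgsurj_def)
    obtain F where F: "hm G P U F" "em A * F = em B"
      using proj_lift[OF p _ _ fghom_hm[OF A'] s fghom_hm[OF B]] m P by metis
    let ?F = "dm (mdim U) (mdim P) F"
    have "em (A * ?F) = em B"
      using A' F hm_fghom(2)[OF F(1)] m P by (subst em_mult[OF _ dm_carrier]) (auto simp: fghom_def)
    then have "A * ?F = B"
      by (rule em_inj[of _ "mdim V" "mdim P", rotated 2])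
        (use A' B in \<open>auto simp: fghom_def intro!: mult_carrier_mat[OF _ dm_carrier]\<close>)
    then show "\<exists>C\<in>fghom G P U. A * C = B" using hm_fghom(1)[OF F(1)] m P by blast
  qed
qed

text \<open>If \<open>1 - h f\<close> factors as \<open>p a\<close> through a projective
  \<open>P\<close>, then \<open>V\<close> embeds into the sum of \<open>W\<close> and
  \<open>P\<close> by \<open>(f, a)\<close>, with retraction \<open>(h, p)\<close>. The
  complementary idempotent is null, so its image \<open>X\<close> is projective, and
  \<open>W\<close> plus \<open>P\<close> is isomorphic to \<open>V\<close> plus
  \<open>X\<close>.\<close>

lemma siso_proj_equiv:
  assumes "siso V W" shows "proj_equiv G V W"
proof -
  obtain f h where f: "md V" "md W" "hm G V W f" "hm G W V h" "null V V (Idm V - h * f)"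
    "null W W (Idm W - f * h)"
    using assms by (auto simp: siso_def)
  obtain t where t: "Idm V - h * f = Tr V V t" "Idm V * t = t" using null_E[OF f(5)] f by blast
  obtain P p s where P: "proj P" "hm G P V p" "Idm P * s = s" "s * Idm V = s" "p * s = Idm V"
    using free_cover[OF f(1)] .
  have mP: "md P" using P by (simp add: proj_def)
  define a where "a = Tr V P (s * t)"
  have a: "hm G V P a" "p * a = Idm V - h * f"
    using null_factor[OF P(2,5) t(2) mP f(1)] t by (auto simp: a_def)
  obtain i1 q1 i2 q2 where d: "md (ds W P)" "bip G (ds W P) W P i1 q1 i2 q2"
    "i1 * q1 + i2 * q2 = Idm (ds W P)"
    using ds_data[OF f(2) mP] .
  have b: "hm G W (ds W P) i1" "hm G (ds W P) W q1" "hm G P (ds W P) i2" "hm G (ds W P) P q2"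
    and z: "q1 * i1 = Idm W" "q2 * i2 = Idm P" "q1 * i2 = 0" "q2 * i1 = 0"
    using d(2) by (auto simp: bip_def)
  note hs = b[THEN hm_simps(1)] b[THEN hm_simps(2)] b[THEN hm_simps(3)] b[THEN hm_simps(4)]
    f(3,4)[THEN hm_simps(1)] f(3,4)[THEN hm_simps(2)] f(3,4)[THEN hm_simps(3)] f(3,4)[THEN hm_simps(4)]
    hm_simps[OF a(1)] hm_simps[OF P(2)] z z[THEN mult_assoc_eq]
  define F where "F = i1 * f + i2 * a"
  define H where "H = h * q1 + p * q2"
  have hF: "hm G V (ds W P) F" and hH: "hm G (ds W P) V H"
    unfolding F_def H_def using f a P b by (meson hm_add hm_comp)+
  have HF: "H * F = Idm V"
    by (simp add: F_def H_def algebra_simps hs a(2))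
  define e where "e = Idm (ds W P) - F * H"
  have ne: "null (ds W P) (ds W P) e"
  proof -
    have n1: "null (ds W P) (ds W P) (i1 * ((Idm W - f * h) * q1))"
      using null_left[OF null_right[OF f(6) b(2)] b(1)] by (simp add: mult.assoc)
    have n2: "null (ds W P) (ds W P) (x * q2)" if "hm G P (ds W P) x" for x
      using null_right[OF proj_null[OF P(1) that] b(4)] .
    have n3: "null (ds W P) (ds W P) (i2 * x)" if "hm G (ds W P) P x" for x
      using null_left[OF proj_null'[OF P(1) that] b(3)] .
    have "e = i1 * ((Idm W - f * h) * q1) + i2 * q2 - i2 * (a * h * q1) - (i1 * f * p + i2 * a * p) * q2"
      unfolding e_def F_def H_def d(3)[symmetric] by (simp add: algebra_simps hs)
    moreover have "hm G (ds W P) P (a * h * q1)" "hm G P (ds W P) (i1 * f * p + i2 * a * p)"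
      using f a P b by (meson hm_add hm_comp)+
    ultimately show ?thesis using null_diff null_add n1 n2 n3 b(3) by metis
  qed
  have he: "hm G (ds W P) (ds W P) e"
    unfolding e_def by (intro hm_diff hm_Id d hm_comp[OF hH hF])
  note hFs = hm_simps[OF hF] hm_simps[OF hH] mult_assoc_eq[OF HF] HF
  have ee: "e * e = e"
    by (simp add: e_def algebra_simps hFs del: mdim_ds)
  obtain X i q where X: "md X" "hm G X (ds W P) i" "hm G (ds W P) X q" "q * i = Idm X" "i * q = e"
    using split_idempotent[OF d(1) he ee] .
  have "Idm X = q * e * i"
    using X by (simp add: X(5)[symmetric] mult.assoc mult_assoc_eq[OF X(4)])
  then have "proj X"
    using null_left[OF null_right[OF ne X(2)] X(3)] X(1) by (simp add: proj_def mult.assoc)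
  have "e * F = 0" "H * e = 0" by (simp_all add: e_def algebra_simps hFs del: mdim_ds)
  then have "q * F = 0" "H * i = 0"
    using X hm_simps[OF X(3)] hm_simps[OF X(2)]
    by (metis mult.assoc mult_zero_right, metis mult.assoc mult_zero_left)
  then have "bip G (ds W P) V X F H i q" using HF X hF hH by (auto simp: bip_def)
  moreover have "F * H + i * q = Idm (ds W P)" by (simp add: X(5) e_def)
  ultimately have "fgiso G (ds W P) (ds V X)" using bip_fgiso d f X by blast
  then show ?thesis
    unfolding proj_equiv_def ds_def using \<open>proj X\<close> P(1) projective_iff fgiso_sym by blast
qed

text \<open>A short exact sequence from \<open>K\<close> through a projective \<open>P\<close> to
  \<open>V\<close>. Exactness is encoded by the linear splitting \<open>r\<close>, \<open>s\<close>,
  which need not be equivariant.\<close>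

definition syzd :: "('g, 'a::field) fgmod \<Rightarrow> ('g, 'a) fgmod \<Rightarrow> ('g, 'a) fgmod \<Rightarrow>
    'a fmat \<Rightarrow> 'a fmat \<Rightarrow> 'a fmat \<Rightarrow> 'a fmat \<Rightarrow> bool" where
  "syzd K V P i p s r \<longleftrightarrow> md K \<and> md V \<and> proj P \<and> hm G K P i \<and> hm G P V p \<and>
     r * i = Idm K \<and> p * s = Idm V \<and> p * i = 0 \<and> i * r + s * p = Idm P \<and>
     Idm P * s = s \<and> s * Idm V = s \<and> Idm K * r = r \<and> r * Idm P = r"

lemma syzd_lift:
  assumes a: "syzd K V P i p s r" and x: "hm G W P x" "p * x = 0" "md W"
  shows "hm G W K (r * x)" "i * (r * x) = x"
proof -
  have a': "md K" "md P" "hm G K P i" "Idm K * r = r" "r * i = Idm K" "i * r + s * p = Idm P"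
    using a by (auto simp: syzd_def proj_def)
  have "x = (i * r + s * p) * x" using a' hm_simps[OF x(1)] by simp
  also have "\<dots> = i * (r * x)" using x(2) by (simp add: distrib_right mult.assoc)
  finally show e: "i * (r * x) = x" by simp
  show "hm G W K (r * x)" using hm_lift[OF a'(1,2) x(3) a'(3-5) x(1) e] .
qed

lemma syz_map:
  assumes a: "syzd K V P i p s r" and b: "syzd L W Q j q u v" and f: "hm G V W f"
  obtains F k where "hm G P Q F" "q * F = f * p" "hm G K L k" "j * k = F * i"
proof -
  have P: "proj P" "md K" "hm G K P i" "hm G P V p" "p * i = 0" and Q: "md Q" "md W" "hm G Q W q" "q * u = Idm W"
    using a b by (auto simp: syzd_def proj_def)
  obtain F where F: "hm G P Q F" "q * F = f * p"
    using proj_lift[OF P(1) Q hm_comp[OF P(4) f]] .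
  have "q * (F * i) = 0" using F(2) P(5) by (metis mult.assoc mult_zero_right)
  from syzd_lift[OF b hm_comp[OF P(3) F(1)] this P(2)] show ?thesis using that F by blast
qed

text \<open>\<open>Y\<close> corrects \<open>1 - H F\<close> by a lift \<open>e\<close> of the null
  map \<open>1 - h f\<close>. Then \<open>p Y = 0\<close>, so \<open>Y\<close> factors through
  \<open>K\<close>; restricted to \<open>K\<close> it becomes \<open>1 - l k\<close>, which thereby
  factors through the projective \<open>P\<close>.\<close>

lemma syz_null:
  assumes a: "syzd K V P i p s r" and b: "syzd L W Q j q u v"
    and F: "hm G P Q F" "q * F = f * p" "hm G K L k" "j * k = F * i" "hm G V W f"
    and H: "hm G Q P H" "p * H = h * q" "hm G L K l" "i * l = H * j" "hm G W V h"
    and n: "null V V (Idm V - h * f)"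
  shows "null K K (Idm K - l * k)"
proof -
  have a': "md K" "md V" "proj P" "md P" "hm G K P i" "hm G P V p" "r * i = Idm K" "p * s = Idm V" "p * i = 0"
    using a by (auto simp: syzd_def proj_def)
  obtain t where t: "Idm V - h * f = Tr V V t" "Idm V * t = t" using null_E[OF n] a' by blast
  define e where "e = Tr V P (s * t)"
  have e: "hm G V P e" "p * e = Idm V - h * f"
    using null_factor[OF a'(6,8) t(2) a'(4,2)] t by (auto simp: e_def)
  define Y where "Y = Idm P - H * F - e * p"
  have hY: "hm G P P Y"
    unfolding Y_def by (intro hm_diff hm_Id a' hm_comp[OF F(1) H(1)] hm_comp[OF a'(6) e(1)])
  have pY: "p * Y = 0"
  proof -
    have "p * (H * F) = h * f * p" using F(2) H(2) by (metis mult.assoc)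
    moreover have "p * (e * p) = p - h * f * p"
      using e(2) hm_simps[OF a'(6)] by (simp add: mult_assoc_eq[OF e(2)] left_diff_distrib mult.assoc)
    ultimately show ?thesis by (simp add: Y_def right_diff_distrib hm_simps[OF a'(6)])
  qed
  note k = syzd_lift[OF a hY pY a'(4)]
  have "i * (Idm K - l * k) = i - H * (F * i)"
    using H(4) F(4) by (simp add: right_diff_distrib hm_simps[OF a'(5)] mult_assoc_eq[OF H(4)] mult.assoc)
  also have "\<dots> = Y * i"
    using a'(9) by (simp add: Y_def left_diff_distrib hm_simps[OF a'(5)] mult.assoc)
  finally have "r * (i * (Idm K - l * k)) = r * Y * i" by (simp add: mult.assoc)
  then have "Idm K - l * k = r * Y * i"
    using hm_simps[OF H(3)] by (simp add: mult_assoc_eq[OF a'(7)] right_diff_distrib)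
  then show ?thesis using null_right[OF proj_null[OF a'(3) k(1)] a'(5)] by simp
qed

definition syz :: "('g, 'a::field) fgmod \<Rightarrow> ('g, 'a) fgmod \<Rightarrow> bool" where
  "syz K V \<longleftrightarrow> (\<exists>P i p s r. syzd K V P i p s r)"

text \<open>A stable form of Schanuel's lemma: the syzygy depends only on the stable class of the
  module, whatever projective surjection is used. So the choice made in \<open>heller1\<close> never
  matters.\<close>

lemma syz_siso:
  assumes "syz K V" "syz L W" "siso V W" shows "siso K L"
proof -
  obtain P i p s r where a: "syzd K V P i p s r" using assms by (auto simp: syz_def)
  obtain Q j q u v where b: "syzd L W Q j q u v" using assms by (auto simp: syz_def)
  obtain f h where f: "hm G V W f" "hm G W V h" "null V V (Idm V - h * f)" "null W W (Idm W - f * h)"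
    using assms(3) by (auto simp: siso_def)
  obtain F k where F: "hm G P Q F" "q * F = f * p" "hm G K L k" "j * k = F * i" using syz_map[OF a b f(1)] .
  obtain H l where H: "hm G Q P H" "p * H = h * q" "hm G L K l" "i * l = H * j" using syz_map[OF b a f(2)] .
  show ?thesis
    unfolding siso_def using a b F(3) H(3) syz_null[OF a b F f(1) H f(2,3)] syz_null[OF b a H f(2) F f(1,4)]
    by (auto simp: syzd_def)
qed

text \<open>Tensoring with \<open>W\<close> keeps the sequence linearly split and its middle term
  projective.\<close>

lemma syz_tensor:
  assumes "syz K V" "md W" shows "syz (tensor K W) (tensor V W)"
proof -
  obtain P i p s r where a: "md K" "md V" "proj P" "hm G K P i" "hm G P V p"
     "r * i = Idm K" "p * s = Idm V" "p * i = 0" "i * r + s * p = Idm P"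
     "Idm P * s = s" "s * Idm V = s" "Idm K * r = r" "r * Idm P = r"
    using assms(1) unfolding syz_def syzd_def by blast
  have mP: "md P" using a by (simp add: proj_def)
  have "syzd (tensor K W) (tensor V W) (tensor P W) (tenl W i) (tenl W p) (tenl W s) (tenl W r)"
    unfolding syzd_def tenl_Idm[symmetric] tenl_mult tenl_linear(1)[symmetric]
    using a assms(2) mP by (simp add: proj_tensor hm_tenl del: tenl_linear(1)) 
  then show ?thesis unfolding syz_def by blast
qed

end

section \<open>Kernels of projective covers as syzygies\<close>

lemma ap_zero: "ap n 0 u = (\<lambda>i. 0)"
  by (simp add: ap_def fun_eq_iff)

context fin_group
begin

lemma mat_kernel_iff:
  assumes "A \<in> carrier_mat m n"
  shows "u \<in> mat_kernel A \<longleftrightarrow> u \<in> carrier_vec n \<and> ap n (em A) (fv n u) = (\<lambda>i. 0)"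
proof -
  have "A *\<^sub>v u = 0\<^sub>v m \<longleftrightarrow> ap n (em A) (fv n u) = (\<lambda>i. 0)" if u: "u \<in> carrier_vec n"
  proof -
    have "fv m (0\<^sub>v m) = (\<lambda>i. 0 :: 'a)" by (auto simp: fv_def)
    then show ?thesis
      using fv_inj[of "A *\<^sub>v u" m "0\<^sub>v m"] fv_mult[OF assms u] mult_mat_vec_carrier[OF assms u] by auto
  qed
  then show ?thesis using assms by (auto simp: mat_kernel_def)
qed

lemma realizes_kernel:
  assumes P: "md P" and V: "md V" and A: "A \<in> fghom G P V"
  obtains K where "realizes_sub G K P (mat_kernel A)"
proof -
  obtain K i r where K: "md K" "hm G K P i" "Idm K * r = r" "r * Idm P = r" "r * i = Idm K" "em A * i = 0"
    "\<forall>X. Idm P * X = X \<longrightarrow> em A * X = 0 \<longrightarrow> i * (r * X) = X"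
    using kernel_factor[OF P V fghom_hm[OF A P V]] .
  let ?B = "dm (mdim P) (mdim K) i"
  have B: "?B \<in> fghom G K P" "em ?B = i" using hm_fghom K P by blast+
  have cA: "A \<in> carrier_mat (mdim V) (mdim P)" using A by (simp add: fghom_def)
  have fB: "fv (mdim P) (?B *\<^sub>v v) = ap (mdim K) i (fv (mdim K) v)" if "v \<in> carrier_vec (mdim K)" for v
    using fv_mult[OF dm_carrier that] B(2) by metis
  have ri: "ap (mdim P) r (ap (mdim K) i u) = u" if "sup_le (mdim K) u" for u
    using ap_mult[OF K(4) hm_simps(2)[OF K(2)], of u] K(5) ap_E[OF that] by simp
  have Ai: "ap (mdim P) (em A) (ap (mdim K) i u) = (\<lambda>i. 0)" for u
    using ap_mult[OF hm_simps(2)[OF fghom_hm[OF A P V]] hm_simps(2)[OF K(2)], of u] K(6) by (simp add: ap_zero)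
  have "bij_betw (\<lambda>v. ?B *\<^sub>v v) (carrier_vec (mdim K)) (mat_kernel A)"
    unfolding bij_betw_def
  proof
    show "inj_on (\<lambda>v. ?B *\<^sub>v v) (carrier_vec (mdim K))"
      by (rule inj_onI) (metis fB fv_inj ri sup_fv)
    have "u \<in> (\<lambda>v. ?B *\<^sub>v v) ` carrier_vec (mdim K)" if u: "u \<in> mat_kernel A" for u
    proof -
      have uc: "u \<in> carrier_vec (mdim P)" and Au: "ap (mdim P) (em A) (fv (mdim P) u) = (\<lambda>i. 0)"
        using u mat_kernel_iff[OF cA] by auto
      obtain X where X: "Idm P * X = X" "\<And>j. clm X j = (if j < 1 then fv (mdim P) u else (\<lambda>i. 0))"
        using matrix_of_cols[of 1 "mdim P" "\<lambda>j. fv (mdim P) u"] by auto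
      have "em A * X = 0"
        by (rule clm_eqI, subst clm_mult[of _ "mdim P"]) (use X Au in \<open>auto simp: ap_linear, auto simp: clm_def\<close>)
      then have iX: "i * (r * X) = X" using K(7) X by blast
      define w where "w = vec (mdim K) (clm (r * X) 0)"
      have sw: "fv (mdim K) w = clm (r * X) 0"
        unfolding w_def by (rule fv_vec, rule sup_clm) (simp add: K(3) flip: mult.assoc)
      have "fv (mdim P) (?B *\<^sub>v w) = clm (i * (r * X)) 0"
        using fB[of w] sw clm_mult[of i "mdim K" "r * X" 0] hm_simps(2)[OF K(2)] by (simp add: w_def)
      then have "fv (mdim P) (?B *\<^sub>v w) = fv (mdim P) u" using iX X(2)[of 0] by simp
      then have "u = ?B *\<^sub>v w"
        using fv_inj[OF mult_mat_vec_carrier[OF dm_carrier] uc, of w "mdim K" i] by (simp add: w_def)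
      then show ?thesis by (auto simp: w_def)
    qed
    moreover have "?B *\<^sub>v v \<in> mat_kernel A" if "v \<in> carrier_vec (mdim K)" for v
      using mat_kernel_iff[OF cA] fB[OF that] Ai mult_mat_vec_carrier[OF dm_carrier that] by metis
    ultimately show "(\<lambda>v. ?B *\<^sub>v v) ` carrier_vec (mdim K) = mat_kernel A" by blast
  qed
  then show ?thesis using that K(1) B(1) unfolding realizes_sub_def by blast
qed

text \<open>\<open>1 - s * em A\<close> is a linear projection onto the kernel of \<open>A\<close>;
  expressing its columns through the injection \<open>B\<close> yields the retraction
  \<open>r\<close>.\<close>

lemma kernel_syz:
  assumes P: "proj P" and V: "md V" and A: "A \<in> fgsurj G P V" and K: "realizes_sub G K P (mat_kernel A)"
  shows "syz K V"
proof -
  have mP: "md P" using P by (simp add: proj_def)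
  have A': "A \<in> fghom G P V" and cA: "A \<in> carrier_mat (mdim V) (mdim P)"
    using A by (auto simp: fgsurj_def fghom_def)
  note hA = fghom_hm[OF A' mP V]
  obtain s where s: "Idm P * s = s" "s * Idm V = s" "em A * s = Idm V" using surj_section[OF mP V A] .
  obtain B where mK: "md K" and B: "B \<in> fghom G K P" "bij_betw (\<lambda>v. B *\<^sub>v v) (carrier_vec (mdim K)) (mat_kernel A)"
    using K by (auto simp: realizes_sub_def)
  have cB: "B \<in> carrier_mat (mdim P) (mdim K)" using B(1) by (simp add: fghom_def)
  define i where "i = em B"
  have hi: "hm G K P i" unfolding i_def by (rule fghom_hm[OF B(1) mK mP])
  define X where "X = Idm P - s * em A"
  have X: "Idm P * X = X" "X * Idm P = X" "em A * X = 0"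
    using s hm_simps[OF hA] by (simp_all add: X_def algebra_simps mult_assoc_eq[OF s(3)] mult_assoc_eq[OF s(1)])
  have "\<exists>w\<in>carrier_vec (mdim K). clm X j = ap (mdim K) i (fv (mdim K) w)" for j
  proof -
    have f: "fv (mdim P) (vec (mdim P) (clm X j)) = clm X j" by (intro fv_vec sup_clm X)
    have "ap (mdim P) (em A) (clm X j) = (\<lambda>i. 0)"
      using clm_mult[of "em A" "mdim P" X j] X by (simp add: clm_def)
    then have "vec (mdim P) (clm X j) \<in> mat_kernel A"
      using mat_kernel_iff[OF cA] f by simp
    then obtain w where "w \<in> carrier_vec (mdim K)" "vec (mdim P) (clm X j) = B *\<^sub>v w"
      using B(2) by (auto simp: bij_betw_def)
    then show ?thesis using fv_mult[OF cB] f by (metis i_def)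
  qed
  then obtain w where w: "\<And>j. w j \<in> carrier_vec (mdim K)" "\<And>j. clm X j = ap (mdim K) i (fv (mdim K) (w j))" by metis
  obtain r where r: "Idm K * r = r" "r * Idm P = r"
    "\<And>j. clm r j = (if j < mdim P then fv (mdim K) (w j) else (\<lambda>i. 0))"
    using matrix_of_cols[of "mdim P" "mdim K" "\<lambda>j. fv (mdim K) (w j)"] by auto
  have ir: "i * r = X"
  proof (rule clm_eqI)
    fix j
    have "clm X j = (\<lambda>i. 0)" if "\<not> j < mdim P"
      using X(2) that by (auto simp: clm_def mult_E_iff)
    then show "clm (i * r) j = clm X j"
      by (subst clm_mult[of _ "mdim K"]) (auto simp: r w(2) ap_linear hm_simps[OF hi])
  qed
  have Ai: "em A * i = 0"
  proof (rule clm_eqI)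
    fix j
    have u: "sup_le (mdim K) (clm (Idm K) j)" by (rule sup_clm) simp
    have ker: "B *\<^sub>v vec (mdim K) (clm (Idm K) j) \<in> mat_kernel A"
      using bij_betw_apply[OF B(2), of "vec (mdim K) (clm (Idm K) j)"] by simp
    have "clm (em A * i) j = ap (mdim P) (em A) (clm (i * Idm K) j)"
      using hm_simps[OF hA] hm_simps[OF hi] by (simp add: clm_mult[of "em A" "mdim P"])
    also have "clm (i * Idm K) j = fv (mdim P) (B *\<^sub>v vec (mdim K) (clm (Idm K) j))"
      by (subst clm_mult) (simp_all add: fv_mult[OF cB] fv_vec[OF u] i_def)
    also have "ap (mdim P) (em A) \<dots> = (\<lambda>i. 0)"
      using ker mat_kernel_iff[OF cA] by simp
    finally show "clm (em A * i) j = clm 0 j" by (simp add: clm_def)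
  qed
  have "i * (r * i) = i * Idm K"
  proof -
    have "i * (r * i) = X * i" by (simp only: mult.assoc[symmetric] ir)
    also have "\<dots> = Idm P * i - s * (em A * i)" by (simp only: X_def left_diff_distrib mult.assoc)
    finally show ?thesis by (simp only: Ai hm_simps[OF hi] mult_zero_right diff_zero)
  qed
  have "r * i = Idm K"
  proof (rule clm_eqI)
    fix j
    have u: "sup_le (mdim K) (clm (r * i) j)" "sup_le (mdim K) (clm (Idm K) j)"
      by (auto intro!: sup_clm simp: r(1) simp flip: mult.assoc)
    have "ap (mdim K) i (clm (r * i) j) = ap (mdim K) i (clm (Idm K) j)"
      using \<open>i * (r * i) = i * Idm K\<close> clm_mult[of i "mdim K" "r * i" j] clm_mult[of i "mdim K" "Idm K" j]
        hm_simps[OF hi] by simp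
    then have "B *\<^sub>v vec (mdim K) (clm (r * i) j) = B *\<^sub>v vec (mdim K) (clm (Idm K) j)"
      using fv_mult[OF cB] fv_vec[OF u(1)] fv_vec[OF u(2)] cB
      by (intro fv_inj[of _ "mdim P"]) (auto simp: i_def)
    then have "vec (mdim K) (clm (r * i) j) = vec (mdim K) (clm (Idm K) j)"
      using B(2) by (auto simp: bij_betw_def inj_on_def)
    then show "clm (r * i) j = clm (Idm K) j" using fv_vec[OF u(1)] fv_vec[OF u(2)] by metis
  qed
  moreover have "i * r + s * em A = Idm P" by (simp add: ir X_def)
  ultimately show ?thesis
    unfolding syz_def syzd_def using mK V P hi hA s r Ai by blast
qed

text \<open>Given a projective surjection \<open>p : P \<rightarrow> V\<close>, a projective cover is the image of an
  endomorphism of \<open>P\<close> over \<open>V\<close> through a module of the least possible dimension.\<close>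

lemma projective_cover_exists:
  assumes V: "md V"
  obtains P A where "projective_cover G P A V"
proof -
  obtain P p s where P: "proj P" "hm G P V p" "Idm P * s = s" "s * Idm V = s" "p * s = Idm V"
    using free_cover[OF V] .
  have mP: "md P" using P by (simp add: proj_def)
  define Q where "Q m \<longleftrightarrow> (\<exists>X i k. md X \<and> mdim X = m \<and> hm G X P i \<and> hm G P X k \<and> p * i * k = p)" for m
  have "Q (mdim P)" unfolding Q_def
    by (rule exI[of _ P], rule exI[of _ "Idm P"], rule exI[of _ "Idm P"]) (auto simp: mP hm_Id hm_simps[OF P(2)])
  then obtain m where m: "Q m" "\<And>k. Q k \<Longrightarrow> m \<le> k" by (metis LeastI Least_le)
  obtain X i k where X: "md X" "mdim X = m" "hm G X P i" "hm G P X k" "p * i * k = p"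
    using m(1) unfolding Q_def by blast
  have min: "mdim X \<le> mdim Y" if "md Y" "hm G Y P j" "hm G P Y l" "p * j * l = p" for Y j l
    using m(2) that X(2) unfolding Q_def by blast
  have hki: "hm G X X (k * i)" by (rule hm_comp[OF X(3,4)])
  \<comment> \<open>The image \<open>Y\<close> of \<open>k * i\<close> could replace
    \<open>X\<close>, so by minimality it has the same dimension. Hence \<open>k * i\<close> is
    invertible and \<open>X\<close> is a retract of \<open>P\<close>.\<close>
  obtain Y j r t where Y: "md Y" "hm G Y X j" "hm G X Y (r * (k * i))" "Idm Y * r = r" "r * Idm X = r"
    "r * j = Idm Y" "j * (r * (k * i)) = k * i" "Idm X * t = t" "t * Idm Y = t" "k * i * t = j"
    using image_factor[OF X(1,1) hki] .
  have "p * (i * j) * (r * (k * i) * k) = p"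
  proof -
    have "p * (i * j) * (r * (k * i) * k) = p * i * (j * (r * (k * i))) * k" by (simp add: mult.assoc)
    also have "\<dots> = p * i * k * i * k" using Y(7) by (simp add: mult.assoc)
    finally show ?thesis using X(5) by simp
  qed
  from min[OF Y(1) hm_comp[OF Y(2) X(3)] hm_comp[OF X(4) Y(3)] this]
  have dY: "mdim Y = mdim X"
    using E_le_if_factor[of "mdim Y" r "mdim X" j] Y hm_simps[OF Y(2)] by simp
  have jr: "j * r = Idm X"
    using E_left_inverse[of "mdim X" r j] Y hm_simps[OF Y(2)] by (simp add: dY)
  have kit: "k * i * (t * r) = Idm X" using Y(10) jr by (metis mult.assoc)
  have tr: "Idm X * (t * r) = t * r" "t * r * Idm X = t * r"
    using Y(5,8) by (metis mult.assoc)+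
  have tki: "t * r * (k * i) = Idm X"
    using E_left_inverse[OF _ _ tr kit] hm_simps[OF hki] by simp
  have htr: "hm G X X (t * r)"
    by (rule hm_inverse[OF X(1,1) hki tr tki kit])
  have pX: "proj X"
    by (rule proj_retract[OF P(1) X(1,3) hm_comp[OF X(4) htr]]) (use tki in \<open>simp add: mult.assoc\<close>)
  define q where "q = p * i"
  have hq: "hm G X V q" unfolding q_def by (rule hm_comp[OF X(3) P(2)])
  have ks: "Idm X * (k * s) = k * s" "k * s * Idm V = k * s" "q * (k * s) = Idm V"
    using P hm_simps[OF X(4)] X(5) by (auto simp: q_def mult.assoc) (metis mult.assoc)
  define A where "A = dm (mdim V) (mdim X) q"
  have A: "A \<in> fgsurj G X V" "em A = q"
    unfolding A_def using section_surj[OF X(1) V hq ks] hm_fghom(2)[OF hq X(1) V] by blast+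
  have cA: "A \<in> carrier_mat (mdim V) (mdim X)" by (simp add: A_def)
  \<comment> \<open>As \<open>X\<close> is projective, \<open>q\<close> factors through any
    submodule that maps onto \<open>V\<close>; minimality of \<open>X\<close> then forces the
    submodule to be everything.\<close>
  have "U = carrier_vec (mdim X)" if U: "fgsub G X U" "(\<lambda>v. A *\<^sub>v v) ` U = carrier_vec (mdim V)" for U
  proof -
    have Uc: "U \<subseteq> carrier_vec (mdim X)" and fU: "fsub G X (fv (mdim X) ` U)" using U(1) fgsub_iff[OF X(1)] by auto
    obtain Z e u where Z: "md Z" "hm G Z X e" "Idm Z * u = u" "u * Idm X = u" "u * e = Idm Z"
      "\<forall>W. (\<forall>j. clm W j \<in> fv (mdim X) ` U) \<longrightarrow> e * (u * W) = W" "\<forall>w. ap (mdim Z) e w \<in> fv (mdim X) ` U"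
      using realize[OF X(1) fU] .
    have "\<exists>v\<in>U. A *\<^sub>v v = unit_vec (mdim V) j" for j
      using U(2) unit_vec_carrier by (metis (no_types, lifting) image_iff)
    then obtain v where v: "\<And>j. v j \<in> U" "\<And>j. A *\<^sub>v v j = unit_vec (mdim V) j" by metis
    obtain W where W: "Idm X * W = W" "W * Idm V = W"
      "\<And>j. clm W j = (if j < mdim V then fv (mdim X) (v j) else (\<lambda>i. 0))"
      using matrix_of_cols[of "mdim V" "mdim X" "\<lambda>j. fv (mdim X) (v j)"] by auto
    have "(\<lambda>i. 0) \<in> fv (mdim X) ` U" using fU by (auto simp: fsub_def subsp_def)
    then have eW: "e * (u * W) = W" using Z(6) W(3) v(1) by auto
    have qW: "q * W = Idm V"
    proof (rule clm_eqI)
      fix j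
      have "clm (q * W) j = (if j < mdim V then fv (mdim V) (unit_vec (mdim V) j) else (\<lambda>i. 0))"
        using v(1) Uc by (subst clm_mult[of _ "mdim X"])
          (auto simp: W ap_linear fv_mult[OF cA, symmetric] v(2) A(2)[symmetric] subsetD)
      also have "\<dots> = clm (Idm V) j" by (auto simp: clm_def ent_E fv_def fun_eq_iff)
      finally show "clm (q * W) j = clm (Idm V) j" .
    qed
    have "q * e * (u * W) = Idm V" using eW qW by (simp add: mult.assoc)
    then obtain F where F: "hm G X Z F" "q * e * F = q"
      using proj_lift[OF pX Z(1) V hm_comp[OF Z(2) hq] _ hq] by metis
    have "p * (i * e) * (F * k) = q * e * F * k" by (simp add: q_def mult.assoc)
    also have "\<dots> = p" unfolding F(2) by (simp add: q_def X(5))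
    finally have "mdim X \<le> mdim Z"
      by (rule min[OF Z(1) hm_comp[OF Z(2) X(3)] hm_comp[OF X(4) F(1)]])
    then have dZ: "mdim Z = mdim X"
      using E_le_if_factor[of "mdim Z" u "mdim X" e] Z hm_simps[OF Z(2)] by simp
    have eu: "e * u = Idm X"
      using E_left_inverse[of "mdim X" u e] Z hm_simps[OF Z(2)] by (simp add: dZ)
    have "x \<in> U" if x: "x \<in> carrier_vec (mdim X)" for x
    proof -
      have "fv (mdim X) x = ap (mdim Z) e (ap (mdim X) u (fv (mdim X) x))"
        using ap_mult[of e "mdim Z" u "mdim X" "fv (mdim X) x"] eu Z hm_simps[OF Z(2)] by (simp add: ap_E)
      moreover have "ap (mdim Z) e (ap (mdim X) u (fv (mdim X) x)) \<in> fv (mdim X) ` U"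
        by (rule Z(7)[rule_format])
      ultimately obtain y where "y \<in> U" "fv (mdim X) x = fv (mdim X) y" by (auto simp del: sup_fv)
      then show ?thesis using fv_inj[OF x, of y] Uc by auto
    qed
    then show ?thesis using Uc by blast
  qed
  then have "projective_cover G X A V"
    unfolding projective_cover_def using A pX projective_iff by blast
  then show ?thesis by (rule that)
qed

text \<open>A projective cover and a matrix form of its kernel exist, so the \<open>SOME\<close> in
  \<open>heller1\<close> selects a genuine syzygy.\<close>

lemma heller1_syz:
  assumes "md V" shows "syz (heller1 G V) V"
proof -
  obtain P A where PA: "projective_cover G P A V" using projective_cover_exists[OF assms] .
  have "md P" "A \<in> fghom G P V"
    using PA by (auto simp: projective_cover_def projective_fgmod_def fgsurj_def)
  then obtain K where "realizes_sub G K P (mat_kernel A)" using realizes_kernel assms by blast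
  then have "\<exists>K P A. projective_cover G P A V \<and> realizes_sub G K P (mat_kernel A)" using PA by blast
  from someI_ex[OF this] obtain P A where "projective_cover G P A V" "realizes_sub G (heller1 G V) P (mat_kernel A)"
    unfolding heller1_def by blast
  then show ?thesis
    using kernel_syz assms projective_iff unfolding projective_cover_def by blast
qed

section \<open>Heller translates of tensor products and direct sums\<close>

lemma heller_0 [simp]: "heller G 0 V = V"
  and heller_Suc: "heller G (Suc n) V = heller1 G (heller G n V)"
  by (simp_all add: heller_def)

lemma md_heller [simp]: "md V \<Longrightarrow> md (heller G n V)"
proof (induction n)
  case (Suc n)
  then show ?case using heller1_syz[of "heller G n V"] by (auto simp: heller_Suc syz_def syzd_def)
qed simp

lemma siso_heller: "siso V W \<Longrightarrow> siso (heller G n V) (heller G n W)"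
proof (induction n)
  case (Suc n)
  then show ?case
    unfolding heller_Suc using syz_siso[OF heller1_syz heller1_syz] siso_md md_heller by blast
qed simp

lemma heller_tensor_left:
  assumes "md V" "md W" shows "siso (tensor (heller G n V) W) (heller G n (tensor V W))"
proof (induction n)
  case 0
  then show ?case using assms by (simp add: siso_refl)
next
  case (Suc n)
  show ?case
    unfolding heller_Suc
    by (rule syz_siso[OF syz_tensor[OF heller1_syz] heller1_syz Suc]) (use assms in auto)
qed

lemma heller_tensor_right:
  assumes "md V" "md W" shows "siso (tensor V (heller G n W)) (heller G n (tensor V W))"
proof -
  have "siso (tensor V (heller G n W)) (tensor (heller G n W) V)" using assms by (intro siso_tensor_comm) auto
  moreover have "siso (tensor (heller G n W) V) (heller G n (tensor W V))" by (rule heller_tensor_left[OF assms(2,1)])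
  moreover have "siso (heller G n (tensor W V)) (heller G n (tensor V W))"
    using assms by (intro siso_heller siso_tensor_comm)
  ultimately show ?thesis using siso_trans by blast
qed

lemma heller_add: "heller G m (heller G n V) = heller G (m + n) V"
  by (simp add: heller_def funpow_add)

lemma heller_tensor:
  assumes "md V" "md W"
  shows "siso (tensor (heller G m V) (heller G n W)) (heller G (m + n) (tensor V W))"
proof -
  have "siso (tensor (heller G m V) (heller G n W)) (heller G m (tensor V (heller G n W)))"
    using assms by (intro heller_tensor_left) auto
  moreover have "siso (heller G m (tensor V (heller G n W))) (heller G m (heller G n (tensor V W)))"
    by (intro siso_heller heller_tensor_right assms)
  ultimately show ?thesis unfolding heller_add by (rule siso_trans)
qed

text \<open>Up to stable isomorphism a Heller translate is tensoring with a fixed module; additivity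
  then comes from distributivity.\<close>

lemma heller_trivial_tensor: "md V \<Longrightarrow> siso (heller G n V) (tensor (heller G n trivial_fgmod) V)"
  using heller_tensor_left[of trivial_fgmod V n] by (simp add: tensor_trivial siso_sym)

lemma heller_dsum:
  assumes "\<And>V. V \<in> set Vs \<Longrightarrow> md V"
  shows "siso (heller G n (dsum Vs)) (dsum (map (heller G n) Vs))"
proof -
  let ?T = "heller G n trivial_fgmod"
  have "siso (heller G n (dsum Vs)) (tensor ?T (dsum Vs))"
    using assms by (intro heller_trivial_tensor) auto
  moreover have "siso (tensor ?T (dsum Vs)) (dsum (map (tensor ?T) Vs))"
    using assms by (intro siso_tensor_dsum_right) auto
  moreover have "siso (dsum (map (tensor ?T) Vs)) (dsum (map (heller G n) Vs))"
    using assms by (intro siso_dsum_cong) (auto simp: list_all2_conv_all_nth intro!: siso_sym[OF heller_trivial_tensor])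
  ultimately show ?thesis using siso_trans by blast
qed

end

section \<open>Simple summands\<close>

lemma E_0 [simp]: "(E 0 :: 'a::field fmat) = 0"
  by simp

context fin_group
begin

lemma simple_sub:
  assumes S: "simple_fgmod G S" and K: "md K" "hm G K S i"
    and r: "Idm K * r = r" "r * Idm S = r" "r * i = Idm K"
  shows "mdim K = 0 \<or> i * r = Idm S"
proof -
  have mS: "md S" using S by (simp add: simple_fgmod_def)
  have ci: "clm i j = ap (mdim K) i (clm (Idm K) j)" for j
    using clm_mult[of i "mdim K" "Idm K" j] hm_simps(2)[OF K(2)] by simp
  consider "range (ap (mdim K) i) = {\<lambda>i. 0}" | "range (ap (mdim K) i) = {u. sup_le (mdim S) u}"
    using simple_fsub[OF S fsub_range[OF K(1) mS K(2)]] by blast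
  then show ?thesis
  proof cases
    case 1
    then have z: "ap (mdim K) i u = (\<lambda>i. 0)" for u by blast
    have "i = 0" by (rule clm_eqI) (simp add: ci z, simp add: clm_def)
    then show ?thesis using r by simp
  next
    case 2
    have "i * r = Idm S"
    proof (rule clm_eqI)
      fix j
      have "clm (Idm S) j \<in> range (ap (mdim K) i)" using 2 sup_clm[OF E_E] by blast
      then obtain u where u: "clm (Idm S) j = ap (mdim K) i u" by blast
      have ir: "i * r * i = i" "i * r * Idm S = i * r" using r hm_simps[OF K(2)] by (simp_all add: mult.assoc)
      have "clm (i * r) j = ap (mdim S) (i * r) (clm (Idm S) j)"
        using clm_mult[of "i * r" "mdim S" "Idm S" j] ir(2) by simp
      also have "\<dots> = ap (mdim K) i u"
        unfolding u using ap_mult[of "i * r" "mdim S" i "mdim K" u] hm_simps(2)[OF K(2)] ir by simp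
      finally show "clm (i * r) j = clm (Idm S) j" by (simp add: u)
    qed
    then show ?thesis ..
  qed
qed

text \<open>The image of \<open>d\<close> is a nonzero submodule, hence everything. The resulting
  linear right inverse is two-sided, and an inverse of a homomorphism is a homomorphism.\<close>

lemma schur:
  assumes S: "simple_fgmod G S" and d: "hm G S S d" "d \<noteq> 0"
  obtains e where "hm G S S e" "e * d = Idm S" "d * e = Idm S"
proof -
  have mS: "md S" using S by (simp add: simple_fgmod_def)
  obtain X i r s where X: "md X" "hm G X S i" "hm G S X (r * d)" "Idm X * r = r" "r * Idm S = r"
    "r * i = Idm X" "i * (r * d) = d" "Idm S * s = s" "s * Idm X = s" "d * s = i"
    using image_factor[OF mS mS d(1)] .
  have "mdim X \<noteq> 0"
  proof
    assume "mdim X = 0"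
    then have "r * d = 0" using hm_simps(1)[OF X(3)] by simp
    then show False using X(7) d(2) by simp
  qed
  then have ir: "i * r = Idm S" using simple_sub[OF S X(1,2,4,5,6)] by simp
  have dsr: "d * (s * r) = Idm S" using X(10) ir by (simp flip: mult.assoc)
  have u: "Idm S * (s * r) = s * r" "s * r * Idm S = s * r"
    using X(5,8) by (simp_all add: mult.assoc, simp flip: mult.assoc)
  have srd: "s * r * d = Idm S"
    using E_left_inverse[OF _ _ u dsr] hm_simps[OF d(1)] by simp
  show ?thesis using that hm_inverse[OF mS mS d(1) u srd dsr] srd dsr by blast
qed

text \<open>A nonzero null endomorphism would be invertible and so make the identity null. On a
  non-projective simple module, equations modulo projectives are therefore equations.\<close>

lemma simple_null_zero:
  assumes S: "simple_fgmod G S" "\<not> proj S" and n: "null S S x" shows "x = 0"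
proof (rule ccontr)
  assume "x \<noteq> 0"
  have mS: "md S" using S by (simp add: simple_fgmod_def)
  have "hm G S S x" using n hm_Tr[OF mS mS] by (auto simp: null_def)
  then obtain e where "hm G S S e" "e * x = Idm S" using schur[OF S(1) _ \<open>x \<noteq> 0\<close>] by blast
  then have "null S S (Idm S)" using null_left[OF n] by metis
  then show False using S(2) mS by (simp add: proj_def)
qed

text \<open>Gaussian elimination. The stable isomorphism between the sums with \<open>S\<close> has
  matrix \<open>(a, b; c, d)\<close> and inverse \<open>(a', b'; c', d')\<close>. If
  \<open>d\<close> has the inverse \<open>e\<close>, the Schur complement \<open>a - b e c\<close>
  is a stable inverse of \<open>a'\<close>.\<close>

lemma gauss:
  assumes m: "md A" "md B"
    and h: "hm G A B a" "hm G S B b" "hm G A S c" "hm G S S d" "hm G B A a'" "hm G S A b'" "hm G B S c'" "hm G S S d'"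
    and n: "null A A (Idm A - a' * a - b' * c)" "null S A (a' * b + b' * d)"
      "null B B (Idm B - a * a' - b * c')" "null B S (c * a' + d * c')"
    and e: "hm G S S e" "d * e = Idm S" "e * d = Idm S"
  shows "siso A B"
proof -
  note hs = h[THEN hm_simps(1)] h[THEN hm_simps(2)] h[THEN hm_simps(3)] h[THEN hm_simps(4)] hm_simps[OF e(1)]
    e(2,3) e(2,3)[THEN mult_assoc_eq]
  have 1: "hm G A B (a - b * e * c)" using h e by (meson hm_diff hm_comp)
  have "null A A ((Idm A - a' * a - b' * c) + (a' * b + b' * d) * (e * c))"
    by (intro null_add n null_right[OF n(2)] hm_comp[OF h(3) e(1)])
  moreover have "(Idm A - a' * a - b' * c) + (a' * b + b' * d) * (e * c) = Idm A - a' * (a - b * e * c)"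
    by (simp add: algebra_simps hs)
  moreover have "null B B ((Idm B - a * a' - b * c') + (b * e) * (c * a' + d * c'))"
    by (intro null_add n null_left[OF n(4)] hm_comp[OF e(1) h(2)])
  moreover have "(Idm B - a * a' - b * c') + (b * e) * (c * a' + d * c') = Idm B - (a - b * e * c) * a'"
    by (simp add: algebra_simps hs)
  ultimately show ?thesis unfolding siso_def using m 1 h(5) by (intro conjI exI[of _ "a - b * e * c"] exI[of _ a']) auto
qed

text \<open>If the \<open>S \<rightarrow> S\<close> entry of the given isomorphism vanishes, adding a multiple of its first row to
  the second makes that entry the identity.\<close>

lemma siso_cancel_simple:
  assumes S: "simple_fgmod G S" and iso: "siso (ds A S) (ds B S)" and m: "md A" "md B"
  shows "siso A B"
proof (cases "proj S")
  case True
  show ?thesis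
    using siso_trans[OF siso_trans[OF siso_sym[OF siso_ds_proj[OF m(1) True]] iso] siso_ds_proj[OF m(2) True]] .
next
  case False
  have mS: "md S" using S by (simp add: simple_fgmod_def)
  obtain i1 q1 i2 q2 where d: "bip G (ds A S) A S i1 q1 i2 q2" "i1 * q1 + i2 * q2 = Idm (ds A S)"
    using ds_data[OF m(1) mS] by metis
  obtain j1 p1 j2 p2 where e: "bip G (ds B S) B S j1 p1 j2 p2" "j1 * p1 + j2 * p2 = Idm (ds B S)"
    using ds_data[OF m(2) mS] by metis
  note hz = d(1)[unfolded bip_def] e(1)[unfolded bip_def]
  obtain f h where f: "hm G (ds A S) (ds B S) f" "hm G (ds B S) (ds A S) h"
    "null (ds A S) (ds A S) (Idm (ds A S) - h * f)" "null (ds B S) (ds B S) (Idm (ds B S) - f * h)"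
    using iso by (auto simp: siso_def)
  define a b c dd where "a = p1 * f * i1" "b = p1 * f * i2" "c = p2 * f * i1" "dd = p2 * f * i2"
  define a' b' c' dd' where "a' = q1 * h * j1" "b' = q1 * h * j2" "c' = q2 * h * j1" "dd' = q2 * h * j2"
  note defs = a_b_c_dd_def a'_b'_c'_dd'_def
  have hd: "hm G A B a" "hm G S B b" "hm G A S c" "hm G S S dd"
    "hm G B A a'" "hm G S A b'" "hm G B S c'" "hm G S S dd'"
    unfolding defs using hz f by (meson hm_comp)+
  have nl: "null X Y (q * (Idm (ds A S) - h * f) * i)" if "hm G X (ds A S) i" "hm G (ds A S) Y q" for X Y q i
    using null_right[OF null_left[OF f(3) that(2)] that(1)] .
  have nl': "null X Y (q * (Idm (ds B S) - f * h) * i)" if "hm G X (ds B S) i" "hm G (ds B S) Y q" for X Y q i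
    using null_right[OF null_left[OF f(4) that(2)] that(1)] .
  have ex: "q * (Idm (ds A S) - h * f) * i = q * i - ((q * h * j1) * (p1 * f * i) + (q * h * j2) * (p2 * f * i))"
    if "hm G X (ds A S) i" "hm G (ds A S) Y q" for X Y q i
  proof -
    have "h * f = h * ((j1 * p1 + j2 * p2) * f)" using e(2) hm_simps(1)[OF f(1)] by simp
    then show ?thesis using hm_simps[OF that(1)] by (simp add: algebra_simps del: mdim_ds)
  qed
  have ex': "q * (Idm (ds B S) - f * h) * i = q * i - ((q * f * i1) * (q1 * h * i) + (q * f * i2) * (q2 * h * i))"
    if "hm G X (ds B S) i" "hm G (ds B S) Y q" for X Y q i
  proof -
    have "f * h = f * ((i1 * q1 + i2 * q2) * h)" using d(2) hm_simps(1)[OF f(2)] by simp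
    then show ?thesis using hm_simps[OF that(1)] by (simp add: algebra_simps del: mdim_ds)
  qed
  have h4: "hm G A (ds A S) i1" "hm G S (ds A S) i2" "hm G (ds A S) A q1" "hm G (ds A S) S q2"
    "hm G B (ds B S) j1" "hm G S (ds B S) j2" "hm G (ds B S) B p1" "hm G (ds B S) S p2"
    using hz by auto
  have n1: "null A A (Idm A - (a' * a + b' * c))" "null S A (- (a' * b + b' * dd))"
      "null A S (- (c' * a + dd' * c))" "null S S (Idm S - (c' * b + dd' * dd))"
    using nl[OF h4(1,3)] nl[OF h4(2,3)] nl[OF h4(1,4)] nl[OF h4(2,4)] hz
    by (simp_all add: ex[OF h4(1,3)] ex[OF h4(2,3)] ex[OF h4(1,4)] ex[OF h4(2,4)] defs del: mdim_ds)
  have n2: "null B B (Idm B - (a * a' + b * c'))" "null S B (- (a * b' + b * dd'))"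
      "null B S (- (c * a' + dd * c'))" "null S S (Idm S - (c * b' + dd * dd'))"
    using nl'[OF h4(5,7)] nl'[OF h4(6,7)] nl'[OF h4(5,8)] nl'[OF h4(6,8)] hz
    by (simp_all add: ex'[OF h4(5,7)] ex'[OF h4(6,7)] ex'[OF h4(5,8)] ex'[OF h4(6,8)] defs del: mdim_ds)
  have n: "null A A (Idm A - a' * a - b' * c)" "null S A (a' * b + b' * dd)"
    "null B B (Idm B - a * a' - b * c')" "null S B (a * b' + b * dd')" "null B S (c * a' + dd * c')"
    using n1(1) null_uminus[OF n1(2)] n2(1) null_uminus[OF n2(2)] null_uminus[OF n2(3)]
    by (simp_all add: diff_diff_eq add.commute)
  show ?thesis
  proof (cases "dd = 0")
    case False
    obtain e where "hm G S S e" "e * dd = Idm S" "dd * e = Idm S" using schur[OF S hd(4) False] .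
    then show ?thesis using gauss[OF m hd n(1-3,5)] by blast
  next
    case True
    \<comment> \<open>With \<open>dd = 0\<close> the \<open>S\<close>-entries of the two composites
      are \<open>c' * b\<close> and \<open>c * b'\<close>. They agree with the identity up to a null
      endomorphism of \<open>S\<close>, hence exactly.\<close>
    have cb: "c' * b = Idm S" using simple_null_zero[OF S False n1(4)] True by simp
    have cb2: "c * b' = Idm S" using simple_null_zero[OF S False n2(4)] True by simp
    note hs = hd[THEN hm_simps(1)] hd[THEN hm_simps(2)] hd[THEN hm_simps(3)] hd[THEN hm_simps(4)]
      cb cb2 cb[THEN mult_assoc_eq] cb2[THEN mult_assoc_eq]
    show ?thesis
    \<comment> \<open>Multiplication by \<open>(1, 0; c', 1)\<close> from the left gives the lower
      row \<open>(c + c' a, 1)\<close>; accordingly the inverse is multiplied by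
      \<open>(1, 0; - c', 1)\<close> from the right.\<close>
    proof (rule gauss[OF m hd(1,2) _ hm_Id[OF mS]])
      show "hm G A S (c + c' * a)" "hm G B A (a' - b' * c')" "hm G S A b'" "hm G B S (c' - dd' * c')" "hm G S S dd'"
        using hd by (meson hm_add hm_diff hm_comp)+
      show "null A A (Idm A - (a' - b' * c') * a - b' * (c + c' * a))"
        using n(1) by (simp add: algebra_simps)
      show "null S A ((a' - b' * c') * b + b' * Idm S)"
        using n(2) True by (simp add: algebra_simps hs)
      have "null B B (Idm B - a * a' - b * c' + (a * b' + b * dd') * c')"
        by (intro null_add n null_right[OF n(4) hd(7)])
      then show "null B B (Idm B - a * (a' - b' * c') - b * (c' - dd' * c'))"
        by (simp add: algebra_simps)
      have "null B S (c * a' + dd * c' - c' * (Idm B - a * a' - b * c') - c' * ((a * b' + b * dd') * c'))"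
        by (intro null_diff n null_left[OF n(3) hd(7)] null_left[OF null_right[OF n(4) hd(7)] hd(7)])
      then show "null B S ((c + c' * a) * (a' - b' * c') + Idm S * (c' - dd' * c'))"
        using True by (simp add: algebra_simps hs)
    qed (use mS hm_Id in auto)
  qed
qed

lemma siso_cancel_simples:
  assumes "\<And>S. S \<in> set Ss \<Longrightarrow> simple_fgmod G S"
  shows "siso (ds A (dsum Ss)) (ds B (dsum Ss)) \<Longrightarrow> md A \<Longrightarrow> md B \<Longrightarrow> siso A B"
  using assms
proof (induction Ss arbitrary: A B)
  case (Cons S Ss)
  have "siso (ds (ds A S) (dsum Ss)) (ds (ds B S) (dsum Ss))"
    using Cons.prems(1) by (simp add: dsum_Cons ds_assoc)
  moreover have "md S" using Cons.prems(4)[of S] by (simp add: simple_fgmod_def)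
  ultimately have "siso (ds A S) (ds B S)" using Cons.IH[of "ds A S" "ds B S"] Cons.prems by auto
  then show ?case using siso_cancel_simple Cons.prems by auto
qed simp

text \<open>For a simple \<open>S\<close> this means, by Schur's lemma, that \<open>S\<close> is no
  direct summand of \<open>A\<close>.\<close>

definition sfree :: "('g, 'a::field) fgmod \<Rightarrow> ('g, 'a) fgmod \<Rightarrow> bool" where
  "sfree S A \<longleftrightarrow> (\<forall>x y. hm G S A x \<longrightarrow> hm G A S y \<longrightarrow> y * x = 0)"

lemma sfree_dsum:
  assumes "\<And>A. A \<in> set As \<Longrightarrow> md A \<and> sfree S A" shows "sfree S (dsum As)"
  using assms
proof (induction As)
  case Nil
  have "x = 0" if "hm G S (dsum []) x" for x using hm_simps(1)[OF that] by simp
  then show ?case unfolding sfree_def by (metis mult_zero_right)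
next
  case (Cons A As)
  obtain i1 q1 i2 q2 where d: "bip G (ds A (dsum As)) A (dsum As) i1 q1 i2 q2"
    "i1 * q1 + i2 * q2 = Idm (ds A (dsum As))"
    using ds_data[of A "dsum As"] Cons.prems by (metis list.set_intros md_dsum')
  show ?case
    unfolding sfree_def dsum_Cons
  proof (intro allI impI)
    fix x y assume x: "hm G S (ds A (dsum As)) x" and y: "hm G (ds A (dsum As)) S y"
    have "y * x = y * ((i1 * q1 + i2 * q2) * x)" using d(2) hm_simps(1)[OF x] by simp
    also have "\<dots> = (y * i1) * (q1 * x) + (y * i2) * (q2 * x)" by (simp add: algebra_simps)
    also have "(y * i1) * (q1 * x) = 0"
      using Cons.prems[of A] d(1) x y hm_comp unfolding bip_def sfree_def by (metis list.set_intros(1))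
    also have "(y * i2) * (q2 * x) = 0"
      using Cons.IH Cons.prems d(1) x y hm_comp unfolding bip_def sfree_def by (metis list.set_intros(2))
    finally show "y * x = 0" by simp
  qed
qed

text \<open>Induction on the numbers of copies reduces \<open>f\<close> to its matrix entries, and
  these are of the form \<open>y * f * x\<close>.\<close>

lemma isotypic_hom_zero:
  assumes S: "md S" and f: "hm G (dsum (replicate N S)) (dsum (replicate M S)) f"
    and z: "\<And>x y. hm G S (dsum (replicate N S)) x \<Longrightarrow> hm G (dsum (replicate M S)) S y \<Longrightarrow> y * f * x = 0"
  shows "f = 0"
proof -
  have one: "f = 0" if "md W" "hm G W (dsum (replicate M S)) f"
    "\<And>x y. hm G S W x \<Longrightarrow> hm G (dsum (replicate M S)) S y \<Longrightarrow> y * f * x = 0" "W = S" for f W M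
    using that
  proof (induction M arbitrary: f)
    case 0
    then show ?case using hm_simps(1)[of G W "dsum []" f] by simp
  next
    case (Suc M)
    have m: "md (dsum (replicate M S))" using S by auto
    obtain i1 q1 i2 q2 where d: "bip G (ds S (dsum (replicate M S))) S (dsum (replicate M S)) i1 q1 i2 q2"
      "i1 * q1 + i2 * q2 = Idm (ds S (dsum (replicate M S)))"
      using ds_data[OF S m] by metis
    have f: "hm G S (ds S (dsum (replicate M S))) f" using Suc.prems by (simp add: dsum_Cons)
    have z: "y * f * x = 0" if "hm G S S x" "hm G (ds S (dsum (replicate M S))) S y" for x y
      using Suc.prems(3)[of x y] that Suc.prems(4) by (simp add: dsum_Cons)
    have h: "hm G (ds S (dsum (replicate M S))) S q1" "hm G (ds S (dsum (replicate M S))) (dsum (replicate M S)) q2"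
      using d by (auto simp: bip_def)
    have "q1 * f * Idm S = 0" by (rule z[OF hm_Id[OF S] h(1)])
    then have a: "q1 * f = 0" using hm_simps[OF f] by (simp add: mult.assoc)
    have b: "q2 * f = 0"
    proof (rule Suc.IH)
      show "hm G W (dsum (replicate M S)) (q2 * f)" using hm_comp[OF f h(2)] Suc.prems(4) by simp
      show "y * (q2 * f) * x = 0" if "hm G S W x" "hm G (dsum (replicate M S)) S y" for x y
        using z[of x "y * q2"] that hm_comp[OF h(2)] Suc.prems(4) by (simp add: mult.assoc)
    qed (use Suc.prems in auto)
    have "f = (i1 * q1 + i2 * q2) * f" using d(2) hm_simps(1)[OF f] by simp
    then show ?case using a b by (simp add: distrib_right mult.assoc)
  qed
  show ?thesis
    using f z
  proof (induction N arbitrary: f)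
    case 0
    then show ?case using hm_simps(2)[of G "dsum []" "dsum (replicate M S)" f] by simp
  next
    case (Suc N)
    have m: "md (dsum (replicate N S))" using S by auto
    obtain i1 q1 i2 q2 where d: "bip G (ds S (dsum (replicate N S))) S (dsum (replicate N S)) i1 q1 i2 q2"
      "i1 * q1 + i2 * q2 = Idm (ds S (dsum (replicate N S)))"
      using ds_data[OF S m] by metis
    have f: "hm G (ds S (dsum (replicate N S))) (dsum (replicate M S)) f" using Suc.prems by (simp add: dsum_Cons)
    have z: "y * f * x = 0" if "hm G S (ds S (dsum (replicate N S))) x" "hm G (dsum (replicate M S)) S y" for x y
      using Suc.prems(2)[of x y] that by (simp add: dsum_Cons)
    have h: "hm G S (ds S (dsum (replicate N S))) i1" "hm G (dsum (replicate N S)) (ds S (dsum (replicate N S))) i2"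
      using d by (auto simp: bip_def)
    have "y * (f * i1) * x = 0" if "hm G S S x" "hm G (dsum (replicate M S)) S y" for x y
      using z[OF hm_comp[OF that(1) h(1)] that(2)] by (simp add: mult.assoc)
    then have a: "f * i1 = 0" using one[OF S hm_comp[OF h(1) f]] by blast
    have "y * (f * i2) * x = 0" if "hm G S (dsum (replicate N S)) x" "hm G (dsum (replicate M S)) S y" for x y
      using z[OF hm_comp[OF that(1) h(2)] that(2)] by (simp add: mult.assoc)
    then have b: "f * i2 = 0" using Suc.IH[OF hm_comp[OF h(2) f]] by blast
    have "f = f * (i1 * q1 + i2 * q2)" using d(2) hm_simps(2)[OF f] by simp
    then show ?case using a b by (simp add: distrib_left flip: mult.assoc)
  qed
qed

text \<open>The composite from \<open>N\<close> copies of \<open>S\<close> through \<open>n\<close>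
  copies plus \<open>B\<close> and back is the identity modulo null maps. Its entries are
  endomorphisms of \<open>S\<close>, so it is the identity exactly, and the part through
  \<open>B\<close> vanishes by \<open>sfree\<close>. Hence \<open>N\<close> copies are a retract of
  \<open>n\<close> copies, and dimensions decide.\<close>

lemma isotypic_le:
  assumes S: "simple_fgmod G S" "\<not> proj S" and m: "md A" "md B" and B: "sfree S B"
    and iso: "siso (ds (dsum (replicate N S)) A) (ds (dsum (replicate n S)) B)"
  shows "N \<le> n"
proof -
  have mS: "md S" and dS: "mdim S > 0" using S by (auto simp: simple_fgmod_def)
  let ?X = "dsum (replicate N S)" and ?Y = "dsum (replicate n S)"
  have mX: "md ?X" and mY: "md ?Y" using mS by auto
  obtain i1 q1 i2 q2 where d: "bip G (ds ?X A) ?X A i1 q1 i2 q2" "i1 * q1 + i2 * q2 = Idm (ds ?X A)"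
    using ds_data[OF mX m(1)] by metis
  obtain j1 p1 j2 p2 where e: "bip G (ds ?Y B) ?Y B j1 p1 j2 p2" "j1 * p1 + j2 * p2 = Idm (ds ?Y B)"
    using ds_data[OF mY m(2)] by metis
  obtain f h where f: "hm G (ds ?X A) (ds ?Y B) f" "hm G (ds ?Y B) (ds ?X A) h"
    "null (ds ?X A) (ds ?X A) (Idm (ds ?X A) - h * f)"
    using iso by (auto simp: siso_def)
  have hh: "hm G ?X (ds ?X A) i1" "hm G (ds ?X A) ?X q1" "q1 * i1 = Idm ?X"
    "hm G ?Y (ds ?Y B) j1" "hm G (ds ?Y B) ?Y p1" "hm G B (ds ?Y B) j2" "hm G (ds ?Y B) B p2"
    using d(1) e(1) by (auto simp: bip_def)
  define x where "x = f * i1"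
  define y where "y = q1 * h"
  have hx: "hm G ?X (ds ?Y B) x" and hy: "hm G (ds ?Y B) ?X y"
    unfolding x_def y_def by (rule hm_comp[OF hh(1) f(1)], rule hm_comp[OF f(2) hh(2)])
  have nyx: "null ?X ?X (Idm ?X - y * x)"
    using null_right[OF null_left[OF f(3) hh(2)] hh(1)] hm_simps[OF hh(1)] hm_simps[OF hh(2)] hh(3)
    by (simp add: x_def y_def algebra_simps del: mdim_ds)
  have "Idm ?X - y * x = 0"
  proof (rule isotypic_hom_zero[OF mS])
    show "hm G ?X ?X (Idm ?X - y * x)" by (intro hm_diff hm_Id mX hm_comp[OF hx hy])
    show "v * (Idm ?X - y * x) * u = 0" if "hm G S ?X u" "hm G ?X S v" for u v
      using simple_null_zero[OF S null_right[OF null_left[OF nyx that(2)] that(1)]] .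
  qed
  moreover have "(y * j2) * (p2 * x) = 0"
  proof (rule isotypic_hom_zero[OF mS])
    show "hm G ?X ?X ((y * j2) * (p2 * x))" using hx hy hh hm_comp by meson
    show "v * (y * j2 * (p2 * x)) * u = 0" if "hm G S ?X u" "hm G ?X S v" for u v
    proof -
      have "hm G S B (p2 * x * u)" "hm G B S (v * y * j2)" using that hx hy hh hm_comp by meson+
      then have "v * y * j2 * (p2 * x * u) = 0" using B by (simp add: sfree_def)
      then show ?thesis by (simp add: mult.assoc)
    qed
  qed
  moreover have "y * x = (y * j1) * (p1 * x) + (y * j2) * (p2 * x)"
  proof -
    have "y * x = y * ((j1 * p1 + j2 * p2) * x)" using e(2) hm_simps(1)[OF hx] by simp
    then show ?thesis by (simp add: algebra_simps)
  qed
  ultimately have yx: "(y * j1) * (p1 * x) = Idm ?X" by simp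
  have "mdim ?X \<le> mdim ?Y"
    using E_le_if_factor[OF _ _ _ _ yx, of "mdim ?Y"] hm_comp[OF hh(4) hy] hm_comp[OF hx hh(5)]
    by (simp add: hm_simps)
  moreover have "mdim (dsum (replicate k S)) = k * mdim S" for k by (induction k) (auto simp: dsum_Cons)
  ultimately show ?thesis using dS by simp
qed

lemma siso_isotypic_split:
  assumes S: "md S" and Us: "\<And>U. U \<in> set Us \<Longrightarrow> md U"
  shows "siso (dsum Us) (ds (dsum (replicate (length (filter (\<lambda>U. fgiso G U S) Us)) S))
    (dsum (filter (\<lambda>U. \<not> fgiso G U S) Us)))"
proof -
  let ?F = "filter (\<lambda>U. fgiso G U S) Us" and ?N = "filter (\<lambda>U. \<not> fgiso G U S) Us"
  have "siso (dsum Us) (dsum (?F @ ?N))"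
    using Us by (intro siso_dsum_mset) (simp_all add: multiset_partition[symmetric])
  also have "dsum (?F @ ?N) = ds (dsum ?F) (dsum ?N)" by (rule dsum_append)
  finally have 1: "siso (dsum Us) (ds (dsum ?F) (dsum ?N))" .
  have "siso (dsum ?F) (dsum (replicate (length ?F) S))"
    by (rule siso_dsum_cong) (auto simp: list_all2_conv_all_nth fgiso_siso dest: nth_mem)
  then show ?thesis using siso_trans[OF 1 siso_ds[OF _ siso_refl]] Us by auto
qed

lemma summand_count_unique:
  assumes S: "simple_fgmod G S" "\<not> proj S"
    and Us: "\<And>U. U \<in> set Us \<Longrightarrow> md U \<and> (fgiso G U S \<or> sfree S U)"
    and Ws: "\<And>U. U \<in> set Ws \<Longrightarrow> md U \<and> (fgiso G U S \<or> sfree S U)"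
    and iso: "siso (dsum Us) (dsum Ws)"
  shows "length (filter (\<lambda>U. fgiso G U S) Us) = length (filter (\<lambda>U. fgiso G U S) Ws)"
proof -
  have mS: "md S" using S by (simp add: simple_fgmod_def)
  have le: "length (filter (\<lambda>U. fgiso G U S) Us) \<le> length (filter (\<lambda>U. fgiso G U S) Ws)"
    if Us: "\<And>U. U \<in> set Us \<Longrightarrow> md U \<and> (fgiso G U S \<or> sfree S U)"
    and Ws: "\<And>U. U \<in> set Ws \<Longrightarrow> md U \<and> (fgiso G U S \<or> sfree S U)"
    and iso: "siso (dsum Us) (dsum Ws)" for Us Ws
  proof (rule isotypic_le[OF S _ _ _ siso_trans[OF siso_trans[OF siso_sym[OF siso_isotypic_split[OF mS]] iso]
      siso_isotypic_split[OF mS]]])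
    show "sfree S (dsum (filter (\<lambda>U. \<not> fgiso G U S) Ws))"
      by (rule sfree_dsum) (use Ws in force)
  qed (use Us Ws in auto)
  show ?thesis using le[OF Us Ws iso] le[OF Ws Us siso_sym[OF iso]] by simp
qed

lemma retract_ds:
  assumes m: "md U" "md S" and x: "hm G S U x" "hm G U S y" "y * x = Idm S"
  obtains X where "md X" "fgiso G U (ds S X)"
proof -
  note hs = hm_simps[OF x(1)] hm_simps[OF x(2)] x(3) mult_assoc_eq[OF x(3)]
  obtain X i q where X: "md X" "hm G X U i" "hm G U X q" "q * i = Idm X" "i * q = Idm U - x * y"
    using split_idempotent[OF m(1) hm_diff[OF hm_Id[OF m(1)] hm_comp[OF x(2,1)]]]
    by (auto simp: algebra_simps hs)
  have "q * x = q * (i * q * x)" "y * i = y * (i * q) * i"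
    using X(4) hm_simps[OF X(3)] hm_simps[OF X(2)] by (simp_all add: mult.assoc mult_assoc_eq[OF X(4)])
  then have "q * x = 0" "y * i = 0"
    unfolding X(5) by (simp_all add: algebra_simps hs)
  then have "bip G U S X x y i q" using X x by (auto simp: bip_def)
  then show ?thesis using bip_fgiso[OF m X(1)] X that by simp
qed

text \<open>A nonzero composite \<open>y * x\<close> is invertible by Schur's lemma and splits
  \<open>S\<close> off from \<open>U\<close>; indecomposability leaves no room for a
  complement.\<close>

lemma indecomposable_sfree:
  assumes S: "simple_fgmod G S" and U: "indecomposable_fgmod G U"
  shows "fgiso G U S \<or> sfree S U"
proof (rule disjCI)
  assume "\<not> sfree S U"
  then obtain x y where x: "hm G S U x" "hm G U S y" "y * x \<noteq> 0" by (auto simp: sfree_def)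
  have mU: "md U" using U by (simp add: indecomposable_fgmod_def)
  have mS: "md S" "mdim S > 0" using S by (auto simp: simple_fgmod_def)
  obtain e where e: "hm G S S e" "e * (y * x) = Idm S" using schur[OF S hm_comp[OF x(1,2)] x(3)] by blast
  obtain X where X: "md X" "fgiso G U (ds S X)"
    by (rule retract_ds[OF mU mS(1) x(1) hm_comp[OF x(2) e(1)]]) (use e in \<open>simp_all add: mult.assoc\<close>)
  then have "mdim X = 0"
    using U mS unfolding indecomposable_fgmod_def ds_def by fastforce
  obtain i1 q1 i2 q2 where d: "md (ds S X)" "bip G (ds S X) S X i1 q1 i2 q2" "i1 * q1 + i2 * q2 = Idm (ds S X)"
    using ds_data[OF mS(1) X(1)] .
  have "hm G X (ds S X) i2" using d by (simp add: bip_def)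
  then have "i2 = 0" using hm_simps(2)[of G X "ds S X" i2] \<open>mdim X = 0\<close> by simp
  then have "fgiso G (ds S X) S"
    unfolding fgiso_iff using d mS by (intro conjI exI[of _ q1] exI[of _ i1]) (auto simp: bip_def)
  then show "fgiso G U S" using X fgiso_trans by blast
qed

lemma fgiso_ds:
  assumes "fgiso G U U'" "fgiso G W W'" shows "fgiso G (ds U W) (ds U' W')"
proof -
  obtain f h where f: "md U" "md U'" "hm G U U' f" "hm G U' U h" "h * f = Idm U" "f * h = Idm U'"
    using assms(1) unfolding fgiso_iff by auto
  obtain k l where k: "md W" "md W'" "hm G W W' k" "hm G W' W l" "l * k = Idm W" "k * l = Idm W'"
    using assms(2) unfolding fgiso_iff by auto
  obtain i1 q1 i2 q2 where d: "md (ds U W)" "bip G (ds U W) U W i1 q1 i2 q2" "i1 * q1 + i2 * q2 = Idm (ds U W)"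
    using ds_data[OF f(1) k(1)] .
  have h: "hm G U (ds U W) i1" "hm G (ds U W) U q1" "hm G W (ds U W) i2" "hm G (ds U W) W q2"
    and z: "q1 * i1 = Idm U" "q2 * i2 = Idm W" "q1 * i2 = 0" "q2 * i1 = 0"
    using d(2) by (auto simp: bip_def)
  note hs = h[THEN hm_simps(1)] h[THEN hm_simps(2)] h[THEN hm_simps(3)] h[THEN hm_simps(4)] z z[THEN mult_assoc_eq]
    hm_simps[OF f(3)] hm_simps[OF f(4)] hm_simps[OF k(3)] hm_simps[OF k(4)] f(5,6) k(5,6)
    f(5,6)[THEN mult_assoc_eq] k(5,6)[THEN mult_assoc_eq]
  have "bip G (ds U W) U' W' (i1 * h) (f * q1) (i2 * l) (k * q2)"
    unfolding bip_def using hm_comp[OF f(4) h(1)] hm_comp[OF h(2) f(3)] hm_comp[OF k(4) h(3)] hm_comp[OF h(4) k(3)]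
    by (simp add: mult.assoc hs)
  moreover have "i1 * h * (f * q1) + i2 * l * (k * q2) = Idm (ds U W)"
    using d(3) by (simp add: mult.assoc hs)
  ultimately show ?thesis using bip_fgiso d(1) f(2) k(2) by blast
qed

lemma decomposition_exists:
  "md V \<Longrightarrow> \<exists>Us. (\<forall>U\<in>set Us. indecomposable_fgmod G U) \<and> fgiso G V (dsum Us)"
proof (induction "mdim V" arbitrary: V rule: less_induct)
  case less
  show ?case
  proof (cases "mdim V = 0")
    case True
    then have "fgiso G V (dsum [])"
      unfolding fgiso_iff using less.prems by (auto intro!: exI[of _ 0] hm_zero simp flip: E_eq_zero_iff)
    then show ?thesis by (intro exI[of _ "[]"]) auto
  next
    case False
    show ?thesis
    proof (cases "indecomposable_fgmod G V")
      case True
      then show ?thesis using fgiso_refl[OF less.prems] by (intro exI[of _ "[V]"]) auto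
    next
      case nind: False
      then obtain U W where UW: "md U" "md W" "fgiso G V (ds U W)" "mdim U \<noteq> 0" "mdim W \<noteq> 0"
        using False less.prems unfolding indecomposable_fgmod_def ds_def by auto
      then have "mdim V = mdim U + mdim W" using fgiso_mdim by force
      then obtain Us Ws where "\<forall>U\<in>set Us. indecomposable_fgmod G U" "fgiso G U (dsum Us)"
        "\<forall>U\<in>set Ws. indecomposable_fgmod G U" "fgiso G W (dsum Ws)"
        using less.hyps[of U] less.hyps[of W] UW by auto
      then show ?thesis
        using fgiso_trans[OF UW(3) fgiso_ds] by (intro exI[of _ "Us @ Ws"]) (auto simp: dsum_append)
    qed
  qed
qed

text \<open>The multiplicity of a non-projective simple module is determined by the stable class
  alone. This justifies the \<open>THE\<close> in \<open>summand_mult\<close> and allows counting in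
  any stable decomposition whose terms are copies of \<open>S\<close> or free of it.\<close>

lemma summand_mult_eq:
  assumes S: "simple_fgmod G S" "\<not> proj S" and V: "md V" and iso: "siso V (dsum Ws)"
    and Ws: "\<And>U. U \<in> set Ws \<Longrightarrow> md U \<and> (fgiso G U S \<or> sfree S U)"
  shows "summand_mult G V S = length (filter (\<lambda>U. fgiso G U S) Ws)"
  unfolding summand_mult_def
proof (rule the_equality)
  have un: "length (filter (\<lambda>U. fgiso G U S) Us) = length (filter (\<lambda>U. fgiso G U S) Ws)"
    if "\<forall>U\<in>set Us. indecomposable_fgmod G U" "fgiso G V (dsum Us)" for Us
    by (rule summand_count_unique[OF S _ Ws])
      (use that indecomposable_sfree[OF S(1)] siso_trans[OF siso_sym[OF fgiso_siso] iso]
        in \<open>auto simp: indecomposable_fgmod_def\<close>)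
  then show "\<exists>Us. (\<forall>U\<in>set Us. indecomposable_fgmod G U) \<and> fgiso G V (dsum Us) \<and>
      length (filter (\<lambda>U. fgiso G U S) Ws) = length (filter (\<lambda>U. fgiso G U S) Us)"
    using decomposition_exists[OF V] by metis
  show "n = length (filter (\<lambda>U. fgiso G U S) Ws)" if "\<exists>Us. (\<forall>U\<in>set Us. indecomposable_fgmod G U) \<and>
      fgiso G V (dsum Us) \<and> n = length (filter (\<lambda>U. fgiso G U S) Us)" for n
    using that un by auto
qed

end

section \<open>Alternating functions\<close>

lemma sum_induct: "P 0 \<Longrightarrow> (\<And>x y. P x \<Longrightarrow> P y \<Longrightarrow> P (x + y)) \<Longrightarrow> (\<And>a. a \<in> A \<Longrightarrow> P (F a)) \<Longrightarrow> P (sum F A)"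
  by (induction A rule: infinite_finite_induct) simp_all

lemma sum_fun_apply: "(sum F A) x = (\<Sum>a\<in>A. F a x)"
  by (induction A rule: infinite_finite_induct) simp_all

definition sc :: "'a::field \<Rightarrow> ('x \<Rightarrow> 'a) \<Rightarrow> 'x \<Rightarrow> 'a" where "sc c f = (\<lambda>x. c * f x)"

lemma sc_apply [simp]: "sc c f x = c * f x" by (simp add: sc_def)

lemma sc_simps [simp]: "sc c (f + h) = sc c f + sc c h" "sc c (f - h) = sc c f - sc c h" "sc c (- f) = - sc c f"
  "sc (c + d) f = sc c f + sc d f" "sc (c - d) f = sc c f - sc d f" "sc c (sc d f) = sc (c * d) f" "sc 0 f = 0" "sc 1 f = f" "sc c 0 = 0"
  "sc (- c) f = - sc c f"
  by (auto simp: fun_eq_iff algebra_simps)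

lemma sc_sum: "sc c (sum F A) = (\<Sum>a\<in>A. sc c (F a))" "sc (sum s A) f = (\<Sum>a\<in>A. sc (s a) f)"
  by (auto simp: fun_eq_iff sum_fun_apply sum_distrib_left sum_distrib_right)

lemma sum_sc_delta:
  "finite I \<Longrightarrow> (\<Sum>a\<in>I. sc (if a = b then 1 else 0) (F a)) = (if b \<in> I then F b else 0)"
  by (subst sum.cong[OF refl, of _ _ "\<lambda>a. if a = b then F a else 0"]) auto

text \<open>\<open>wedge v\<close> is exterior multiplication by \<open>v\<close> and \<open>contr I v\<close> is contraction with \<open>v\<close>; a function on lists
  of length \<open>n\<close> is a tensor of degree \<open>n\<close>. The recursion makes the Clifford relation between
  \<open>wedge\<close> and \<open>contr\<close> true for all functions on lists.\<close>

definition del :: "'b \<Rightarrow> ('b list \<Rightarrow> 'a) \<Rightarrow> 'b list \<Rightarrow> 'a" where "del a f = (\<lambda>xs. f (a # xs))"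

primrec wedge :: "('b \<Rightarrow> 'a::field) \<Rightarrow> ('b list \<Rightarrow> 'a) \<Rightarrow> 'b list \<Rightarrow> 'a" where
  "wedge v f [] = 0"
| "wedge v f (y # ys) = v y * f ys - wedge v (del y f) ys"

definition contr :: "'b set \<Rightarrow> ('b \<Rightarrow> 'a::field) \<Rightarrow> ('b list \<Rightarrow> 'a) \<Rightarrow> 'b list \<Rightarrow> 'a" where
  "contr I v f = (\<Sum>a\<in>I. sc (v a) (del a f))"

definition ip :: "'b set \<Rightarrow> ('b \<Rightarrow> 'a::field) \<Rightarrow> ('b \<Rightarrow> 'a) \<Rightarrow> 'a" where
  "ip I u v = (\<Sum>a\<in>I. u a * v a)"

definition dirac :: "'b \<Rightarrow> 'b \<Rightarrow> 'a::field" where "dirac a = (\<lambda>b. if b = a then 1 else 0)"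

definition ones :: "'b set \<Rightarrow> 'b \<Rightarrow> 'a::field" where "ones I = (\<lambda>a. if a \<in> I then 1 else 0)"

lemma del_apply [simp]: "del a f xs = f (a # xs)" by (simp add: del_def)

lemma del_simps [simp]: "del a (f + h) = del a f + del a h" "del a (f - h) = del a f - del a h" "del a (- f) = - del a f"
  "del a (sc c f) = sc c (del a f)" "del a 0 = 0" "del a (sum F A) = (\<Sum>b\<in>A. del a (F b))"
  by (auto simp: fun_eq_iff sum_fun_apply)

lemma wedge_add: "wedge v (f + h) = wedge v f + wedge v h"
  and wedge_sc: "wedge v (sc c f) = sc c (wedge v f)"
  and wedge_add_left: "wedge (u + v) f = wedge u f + wedge v f"
  and wedge_sc_left: "wedge (sc c v) f = sc c (wedge v f)"
proof -
  have "wedge v (f + h) xs = wedge v f xs + wedge v h xs" for xs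
    by (induction xs arbitrary: f h) (auto simp: algebra_simps)
  then show "wedge v (f + h) = wedge v f + wedge v h" by (simp add: fun_eq_iff)
  have "wedge v (sc c f) xs = c * wedge v f xs" for xs
    by (induction xs arbitrary: f) (auto simp: algebra_simps)
  then show "wedge v (sc c f) = sc c (wedge v f)" by (simp add: fun_eq_iff)
  have "wedge (u + v) f xs = wedge u f xs + wedge v f xs" for xs
    by (induction xs arbitrary: f) (auto simp: algebra_simps)
  then show "wedge (u + v) f = wedge u f + wedge v f" by (simp add: fun_eq_iff)
  have "wedge (sc c v) f xs = c * wedge v f xs" for xs
    by (induction xs arbitrary: f) (auto simp: algebra_simps)
  then show "wedge (sc c v) f = sc c (wedge v f)" by (simp add: fun_eq_iff)
qed

lemma wedge_simps [simp]: "wedge v (f + h) = wedge v f + wedge v h" "wedge v (f - h) = wedge v f - wedge v h" "wedge v (- f) = - wedge v f" "wedge v 0 = 0"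
  "wedge v (sc c f) = sc c (wedge v f)"
  "wedge (u + v) f = wedge u f + wedge v f" "wedge (u - v) f = wedge u f - wedge v f" "wedge (- v) f = - wedge v f" "wedge 0 f = 0"
  "wedge (sc c v) f = sc c (wedge v f)"
proof -
  have s: "- h = sc (- 1) h" for h :: "'x \<Rightarrow> 'y::field" by (simp add: fun_eq_iff)
  show z: "wedge v 0 = 0" using wedge_sc[of v 0 0] by simp
  show z': "wedge 0 f = 0" using wedge_sc_left[of 0 0 f] by simp
  show u: "wedge v (- f) = - wedge v f" for v f unfolding s wedge_sc ..
  show u': "wedge (- v) f = - wedge v f" for v f unfolding s wedge_sc_left ..
  show "wedge v (f - h) = wedge v f - wedge v h" using wedge_add[of v f "- h"] u by simp
  show "wedge (u - v) f = wedge u f - wedge v f" using wedge_add_left[of u "- v" f] u' by simp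
qed (rule wedge_add wedge_sc wedge_add_left wedge_sc_left)+

lemma wedge_sum [simp]: "wedge v (sum F A) = (\<Sum>a\<in>A. wedge v (F a))" "wedge (sum u A) f = (\<Sum>a\<in>A. wedge (u a) f)"
  by (induction A rule: infinite_finite_induct) auto

lemma contr_simps [simp]: "contr I v (f + h) = contr I v f + contr I v h" "contr I v (f - h) = contr I v f - contr I v h"
  "contr I v (- f) = - contr I v f" "contr I v 0 = 0" "contr I v (sc c f) = sc c (contr I v f)"
  "contr I (u + v) f = contr I u f + contr I v f" "contr I (u - v) f = contr I u f - contr I v f"
  by (auto simp: contr_def fun_eq_iff sum_fun_apply algebra_simps sum.distrib sum_subtractf sum_negf sum_distrib_left)

lemma contr_sum [simp]: "contr I v (sum F A) = (\<Sum>a\<in>A. contr I v (F a))"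
  by (simp add: contr_def sc_sum) (rule sum.swap)

lemma ip_simps [simp]: "ip I (u + w) v = ip I u v + ip I w v" "ip I v (u + w) = ip I v u + ip I v w"
  "ip I (u - w) v = ip I u v - ip I w v" "ip I v (u - w) = ip I v u - ip I v w"
  by (auto simp: ip_def algebra_simps sum.distrib sum_subtractf)

lemma ip_dirac [simp]: "finite I \<Longrightarrow> ip I (dirac a) v = (if a \<in> I then v a else 0)"
  "finite I \<Longrightarrow> ip I v (dirac a) = (if a \<in> I then v a else 0)"
proof -
  assume "finite I"
  moreover have "ip I (dirac a) v = (\<Sum>b\<in>I. if b = a then v b else 0)" unfolding ip_def dirac_def by (rule sum.cong) auto
  moreover have "ip I v (dirac a) = (\<Sum>b\<in>I. if b = a then v b else 0)" unfolding ip_def dirac_def by (rule sum.cong) auto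
  ultimately show "ip I (dirac a) v = (if a \<in> I then v a else 0)" "ip I v (dirac a) = (if a \<in> I then v a else 0)" by simp_all
qed

lemma contr_dirac: "finite I \<Longrightarrow> a \<in> I \<Longrightarrow> contr I (dirac a) f = del a f"
  using sum_sc_delta[of I a "\<lambda>b. del b f"] by (simp add: contr_def dirac_def)

lemma del_wedge: "del a (wedge v f) = sc (v a) f - wedge v (del a f)"
  by (simp add: fun_eq_iff)

lemma clifford: "contr I w (wedge v f) = sc (ip I w v) f - wedge v (contr I w f)"
proof -
  have "contr I w (wedge v f) = (\<Sum>a\<in>I. sc (w a * v a) f) - (\<Sum>a\<in>I. sc (w a) (wedge v (del a f)))"
    unfolding contr_def del_wedge by (simp add: sum_subtractf)
  then show ?thesis by (simp add: contr_def ip_def sc_sum)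
qed

lemma wedge_anti: "wedge u (wedge v f) = - wedge v (wedge u f)"
proof
  fix xs
  show "wedge u (wedge v f) xs = (- wedge v (wedge u f)) xs"
    by (induction xs arbitrary: f) (simp_all add: del_wedge algebra_simps)
qed

lemma wedge_same [simp]: "wedge u (wedge u f) = 0"
proof
  fix xs
  show "wedge u (wedge u f) xs = 0 xs"
    by (induction xs arbitrary: f) (simp_all add: del_wedge)
qed

text \<open>The recursion runs along \<open>del\<close>, so that facts about alternating functions
  become inductions on the degree. Antisymmetry in the first two places on every level amounts to
  antisymmetry in all places.\<close>

primrec alt :: "'b set \<Rightarrow> nat \<Rightarrow> ('b list \<Rightarrow> 'a::field) \<Rightarrow> bool" where
  "alt I 0 f \<longleftrightarrow> (\<forall>a. del a f = 0)"
| "alt I (Suc n) f \<longleftrightarrow> f [] = 0 \<and> (\<forall>a. alt I n (del a f)) \<and> (\<forall>a b. del a (del b f) = - del b (del a f)) \<and>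
     (\<forall>a. a \<notin> I \<longrightarrow> del a f = 0)"

declare alt.simps(2) [simp del]

lemma alt_zero [simp]: "alt I n (0 :: 'b list \<Rightarrow> 'a::field)"
proof (induction n)
  case 0
  show "alt I 0 (0 :: 'b list \<Rightarrow> 'a)" by simp
next
  case (Suc n)
  have "alt I n (0 :: 'b list \<Rightarrow> 'a)" by (rule Suc)
  then show "alt I (Suc n) (0 :: 'b list \<Rightarrow> 'a)" by (simp add: alt.simps(2))
qed

lemma alt_del: "alt I (Suc n) f \<Longrightarrow> alt I n (del a f)"
  and alt_Nil: "alt I (Suc n) f \<Longrightarrow> f [] = 0"
  by (simp_all add: alt.simps(2))

lemma alt_swap: "alt I n f \<Longrightarrow> del a (del b f) = - del b (del a f)"
proof (cases n)
  case 0
  assume "alt I n f"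
  then have "del b f = 0" for b using 0 by simp
  then show ?thesis by simp
next
  case (Suc k)
  assume "alt I n f"
  then show ?thesis unfolding Suc alt.simps by blast
qed

lemma alt_outside: "alt I n f \<Longrightarrow> a \<notin> I \<Longrightarrow> del a f = 0"
  by (cases n) (simp_all add: alt.simps(2))

lemma alt_add: "alt I n f \<Longrightarrow> alt I n h \<Longrightarrow> alt I n (f + h)"
proof (induction n arbitrary: f h)
  case (Suc n)
  show ?case
    unfolding alt.simps
  proof (intro conjI allI impI)
    show "(f + h) [] = 0" using alt_Nil[OF Suc.prems(1)] alt_Nil[OF Suc.prems(2)] by simp
    show "alt I n (del a (f + h))" for a
      unfolding del_simps using Suc.prems by (intro Suc.IH alt_del)
    show "del a (f + h) = 0" if "a \<notin> I" for a
      using alt_outside[OF Suc.prems(1) that] alt_outside[OF Suc.prems(2) that] by simp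
    fix a b
    have s: "del a (del b f) = - del b (del a f)" "del a (del b h) = - del b (del a h)"
      using Suc.prems unfolding alt.simps by blast+
    show "del a (del b (f + h)) = - del b (del a (f + h))" by (simp add: s)
  qed
qed simp

lemma alt_sc: "alt I n f \<Longrightarrow> alt I n (sc c f)"
proof (induction n arbitrary: f)
  case (Suc n)
  show ?case
    unfolding alt.simps
  proof (intro conjI allI impI)
    show "sc c f [] = 0" using alt_Nil[OF Suc.prems] by simp
    show "alt I n (del a (sc c f))" for a
      unfolding del_simps using Suc.prems by (intro Suc.IH alt_del)
    show "del a (sc c f) = 0" if "a \<notin> I" for a
      using alt_outside[OF Suc.prems that] by simp
    fix a b
    have s: "del a (del b f) = - del b (del a f)"
      using Suc.prems unfolding alt.simps by blast
    show "del a (del b (sc c f)) = - del b (del a (sc c f))" by (simp add: s)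
  qed
qed simp

lemma alt_uminus: "alt I n f \<Longrightarrow> alt I n (- f)"
  using alt_sc[of I n f "- 1"] by simp

lemma alt_diff: "alt I n f \<Longrightarrow> alt I n h \<Longrightarrow> alt I n (f - h)"
  using alt_add[of I n f "- h"] alt_uminus[of I n h] by simp

lemma alt_sum:
  assumes "\<And>a. a \<in> A \<Longrightarrow> alt I n (F a)" shows "alt I n (sum F A)"
  by (rule sum_induct[where P = "alt I n"]) (use assms in \<open>simp_all add: alt_add\<close>)

lemma alt_contr: "alt I (Suc n) f \<Longrightarrow> alt I n (contr I v f)"
  unfolding contr_def by (intro alt_sum alt_sc alt_del)

lemma alt_0_contr: "alt I 0 f \<Longrightarrow> contr I v f = 0"
  by (simp add: contr_def)

lemma alt_wedge: "alt I n f \<Longrightarrow> (\<And>a. a \<notin> I \<Longrightarrow> v a = 0) \<Longrightarrow> alt I (Suc n) (wedge v f)"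
proof (induction n arbitrary: f)
  case 0
  then have "del a f = 0" for a by simp
  then show ?case using 0 by (simp add: del_wedge alt.simps(2))
next
  case (Suc n)
  have s: "del a (del b f) = - del b (del a f)" for a b
    using Suc.prems(1) by (rule alt_swap)
  have d: "del a (wedge v f) = sc (v a) f - wedge v (del a f)" for a by (rule del_wedge)
  have "del a (del b (wedge v f)) = - del b (del a (wedge v f))" for a b
    by (simp add: d del_wedge s[of a b])
  moreover have "alt I (Suc n) (del a (wedge v f))" for a
    unfolding d using Suc.prems by (intro alt_diff alt_sc Suc.IH alt_del)
  moreover have "del a (wedge v f) = 0" if "a \<notin> I" for a
    using Suc.prems that alt_outside[OF Suc.prems(1) that] by (simp add: d)
  ultimately show ?case unfolding alt.simps(2)[of I "Suc n"] using wedge.simps(1) by blast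
qed

lemma alt_dirac_wedge: "alt I n f \<Longrightarrow> a \<in> I \<Longrightarrow> alt I (Suc n) (wedge (dirac a) f)"
  by (rule alt_wedge) (auto simp: dirac_def)

lemma del_contr: "alt I n f \<Longrightarrow> del a (contr I v f) = - contr I v (del a f)"
  unfolding contr_def by (simp add: alt_swap[of I n f a] sum_negf)

lemma contr_anti: "alt I n f \<Longrightarrow> contr I u (contr I v f) = - contr I v (contr I u f)"
proof -
  assume f: "alt I n f"
  have "contr I u (contr I v f) = (\<Sum>a\<in>I. sc (u a) (- contr I v (del a f)))"
    by (simp only: contr_def[of I u] del_contr[OF f])
  also have "\<dots> = - contr I v (contr I u f)"
    by (simp only: contr_def[of I u] contr_sum contr_simps sc_simps sum_negf)
  finally show ?thesis .
qed

text \<open>The sum is the degree operator of the exterior algebra. At \<open>y # ys\<close> the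
  terms that use up the letter \<open>y\<close> return \<open>f\<close> once; by antisymmetry the
  rest is the same operator applied to \<open>del y f\<close>, of degree one less.\<close>

lemma euler:
  assumes "finite I" shows "alt I n f \<Longrightarrow> (\<Sum>a\<in>I. wedge (dirac a) (del a f)) = sc (of_nat n) f"
proof (induction n arbitrary: f)
  case 0
  then have "del a f = 0" for a by simp
  then show "(\<Sum>a\<in>I. wedge (dirac a) (del a f)) = sc (of_nat 0) f" by simp
next
  case (Suc n)
  show ?case
  proof
    fix xs
    show "(\<Sum>a\<in>I. wedge (dirac a) (del a f)) xs = sc (of_nat (Suc n)) f xs"
    proof (cases xs)
      case Nil
      then show ?thesis using alt_Nil[OF Suc.prems] by (simp add: sum_fun_apply)
    next
      case (Cons y ys)
      have "(\<Sum>a\<in>I. wedge (dirac a) (del a f)) xs = (\<Sum>a\<in>I. dirac a y * f (a # ys)) + (\<Sum>a\<in>I. wedge (dirac a) (del a (del y f))) ys"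
        unfolding Cons sum_fun_apply wedge.simps(2) alt_swap[OF Suc.prems, of y]
        by (simp add: sum.distrib)
      also have "(\<Sum>a\<in>I. dirac a y * f (a # ys)) = (\<Sum>a\<in>I. if a = y then f (a # ys) else 0)"
        by (rule sum.cong) (auto simp: dirac_def)
      also have "\<dots> = f (y # ys)"
        using assms alt_outside[OF Suc.prems, of y] by (auto simp: fun_eq_iff)
      also have "(\<Sum>a\<in>I. wedge (dirac a) (del a (del y f))) = sc (of_nat n) (del y f)"
        using Suc.prems by (intro Suc.IH alt_del)
      finally have "(\<Sum>a\<in>I. wedge (dirac a) (del a f)) xs = f (y # ys) + of_nat n * f (y # ys)"
        unfolding sc_apply del_apply .
      then show "(\<Sum>a\<in>I. wedge (dirac a) (del a f)) xs = sc (of_nat (Suc n)) f xs"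
        unfolding sc_apply Cons by (simp add: distrib_right)
    qed
  qed
qed

text \<open>The transposition of two points is the reflection in the difference of the basis vectors.\<close>

lemma transpose_alt:
  assumes I: "finite I" "a \<in> I" "b \<in> I" "a \<noteq> b" and two: "(2::'a::field) \<noteq> 0"
  defines "u \<equiv> dirac a - dirac b"
  shows "alt I n (f :: 'b list \<Rightarrow> 'a) \<Longrightarrow> f \<circ> map (transpose a b) = f - wedge u (contr I u f)"
proof (induction n arbitrary: f)
  case 0
  then have d: "del c f = 0" for c by simp
  have "contr I u f = 0" using 0 by (simp add: alt_0_contr)
  then have "f - wedge u (contr I u f) = f" by simp
  moreover have "f (map (transpose a b) xs) = f xs" for xs
    using d by (cases xs) (auto simp: fun_eq_iff)
  then have "f \<circ> map (transpose a b) = f" by (simp add: fun_eq_iff)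
  ultimately show ?case by simp
next
  case (Suc n)
  let ?t = "transpose a b"
  have uu: "contr I u (contr I u f) = 0"
  proof -
    have "contr I u (contr I u f) + contr I u (contr I u f) = 0"
      using contr_anti[OF Suc.prems, of u u] by (metis add.left_inverse)
    then have "sc 2 (contr I u (contr I u f)) = 0" by (simp add: fun_eq_iff)
    then show ?thesis using two by (simp add: fun_eq_iff)
  qed
  have du: "contr I u f = del a f - del b f"
    using I by (simp add: u_def contr_dirac)
  show ?case
  proof
    fix xs
    show "(f \<circ> map ?t) xs = (f - wedge u (contr I u f)) xs"
    proof (cases xs)
      case (Cons y ys)
      have ty: "del (?t y) f = del y f - sc (u y) (contr I u f)"
        unfolding du by (cases "y = a"; cases "y = b") (use I in \<open>auto simp: u_def dirac_def\<close>)
      have "(f \<circ> map ?t) xs = (del (?t y) f \<circ> map ?t) ys" using Cons by simp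
      also have "\<dots> = (del (?t y) f - wedge u (contr I u (del (?t y) f))) ys"
        using Suc.prems by (subst Suc.IH) (auto intro: alt_del)
      also have "\<dots> = (del y f - sc (u y) (contr I u f) - wedge u (contr I u (del y f))) ys"
        unfolding ty by (simp add: uu)
      also have "\<dots> = (f - wedge u (contr I u f)) xs"
        using Cons del_contr[OF Suc.prems, of y u] by (simp add: del_wedge)
      finally show ?thesis .
    qed (use alt_Nil[OF Suc.prems] in simp)
  qed
qed

lemma wedge_map: "wedge v f (map h ys) = wedge (v \<circ> h) (f \<circ> map h) ys"
proof (induction ys arbitrary: f)
  case (Cons y ys)
  have "del (h y) f \<circ> map h = del y (f \<circ> map h)" by (simp add: fun_eq_iff)
  moreover have "wedge v (del (h y) f) (map h ys) = wedge (v \<circ> h) (del (h y) f \<circ> map h) ys"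
    by (rule Cons)
  ultimately show "wedge v f (map h (y # ys)) = wedge (v \<circ> h) (f \<circ> map h) (y # ys)" by simp
qed simp

lemma wedge_comp_map: "wedge v f \<circ> map h = wedge (v \<circ> h) (f \<circ> map h)"
  by (simp add: fun_eq_iff wedge_map)

lemma contr_comp_map:
  assumes "h permutes I" shows "contr I v f \<circ> map h = contr I (v \<circ> h) (f \<circ> map h)"
proof
  fix xs
  have "(\<Sum>a\<in>I. v a * f (a # map h xs)) = (\<Sum>a\<in>I. v (h a) * f (h a # map h xs))"
    using sum.permute[OF assms, of "\<lambda>a. v a * f (a # map h xs)"] by (simp add: comp_def)
  then show "(contr I v f \<circ> map h) xs = contr I (v \<circ> h) (f \<circ> map h) xs"
    by (simp add: contr_def sum_fun_apply)
qed

lemma alt_comp_map: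
  assumes h: "h permutes I" shows "alt I n f \<Longrightarrow> alt I n (f \<circ> map h)"
proof (induction n arbitrary: f)
  case 0
  then have "del a f = 0" for a by simp
  then show ?case by (simp add: fun_eq_iff)
next
  case (Suc n)
  have d: "del a (f \<circ> map h) = del (h a) f \<circ> map h" for a by (simp add: fun_eq_iff)
  have s: "del a (del b f) = - del b (del a f)" for a b using Suc.prems by (rule alt_swap)
  have "del a (del b (f \<circ> map h)) = - del b (del a (f \<circ> map h))" for a b
    using s[of "h a" "h b"] by (simp add: fun_eq_iff)
  moreover have "del a (f \<circ> map h) = 0" if "a \<notin> I" for a
    using alt_outside[OF Suc.prems, of a] that permutes_not_in[OF h that] by (simp add: d fun_eq_iff)
  moreover have "alt I n (del a (f \<circ> map h))" for a
    unfolding d using Suc.prems by (intro Suc.IH alt_del)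
  moreover have "(f \<circ> map h) [] = 0" using alt_Nil[OF Suc.prems] by simp
  ultimately show ?case unfolding alt.simps by blast
qed

text \<open>At a repeated letter antisymmetry only gives \<open>2 * f = 0\<close>, whence the
  assumption on 2.\<close>

lemma alt_support:
  assumes two: "(2::'a::field) \<noteq> 0"
  shows "alt I n (f :: 'b list \<Rightarrow> 'a) \<Longrightarrow> f xs \<noteq> 0 \<Longrightarrow> length xs = n \<and> set xs \<subseteq> I \<and> distinct xs"
proof (induction n arbitrary: f xs)
  case 0
  then show ?case by (cases xs) (auto simp: fun_eq_iff)
next
  case (Suc k)
  obtain a ys where xs: "xs = a # ys" using Suc.prems alt_Nil[of I k f] by (cases xs) auto
  have ys: "length ys = k" "set ys \<subseteq> I" "distinct ys"
    using Suc.IH[OF alt_del[OF Suc.prems(1)], of a ys] Suc.prems(2) xs by auto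
  have "a \<in> I" using alt_outside[OF Suc.prems(1), of a] Suc.prems(2) xs by (auto simp: fun_eq_iff)
  moreover have "a \<notin> set ys"
  proof (cases ys)
    case (Cons b zs)
    have s: "f (a # b # zs) = - f (b # a # zs)"
      using alt_swap[OF Suc.prems(1), of b a] by (simp add: fun_eq_iff)
    have "a \<noteq> b"
    proof
      assume "a = b"
      then have "2 * f (a # b # zs) = 0" using s by simp
      then show False using two Suc.prems(2) Cons xs by auto
    qed
    moreover have "distinct (a # zs)"
      using Suc.IH[OF alt_del[OF Suc.prems(1)], of b "a # zs"] Suc.prems(2) s xs Cons by auto
    ultimately show ?thesis using Cons by simp
  qed simp
  ultimately show ?case using ys xs by simp
qed

lemma perm_extend:
  assumes "finite I" "distinct c" "distinct c'" "length c = length c'" "set c \<subseteq> I" "set c' \<subseteq> I"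
  obtains g where "g permutes I" "map g c = c'"
proof -
  define f where "f x = the (map_of (zip c c') x)" for x
  have fi: "f (c ! i) = c' ! i" if "i < length c" for i
    using that assms by (simp add: f_def map_of_zip_nth)
  have mf: "map f c = c'" using assms fi by (intro nth_equalityI) auto
  have b1: "bij_betw f (set c) (set c')"
    unfolding bij_betw_def using mf assms by (metis distinct_map list.set_map)
  have "card (I - set c) = card (I - set c')"
    using assms by (simp add: card_Diff_subset distinct_card)
  then obtain k where k: "bij_betw k (I - set c) (I - set c')"
    using finite_same_card_bij[of "I - set c" "I - set c'"] assms(1) by blast
  define g where "g x = (if x \<in> set c then f x else if x \<in> I then k x else x)" for x
  have "bij_betw g (set c) (set c')" using b1 by (rule bij_betw_cong[THEN iffD1, rotated]) (simp add: g_def)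
  moreover have "bij_betw g (I - set c) (I - set c')"
    using k by (rule bij_betw_cong[THEN iffD1, rotated]) (simp add: g_def)
  ultimately have "bij_betw g (set c \<union> (I - set c)) (set c' \<union> (I - set c'))"
    by (rule bij_betw_combine) blast
  then have "bij_betw g I I" using assms by (simp add: Un_absorb1)
  then have "g permutes I" by (rule bij_imp_permutes) (use assms in \<open>auto simp: g_def\<close>)
  moreover have "map g c = c'" using mf by (simp add: g_def cong: map_cong)
  ultimately show ?thesis by (rule that)
qed

section \<open>Exterior monomials\<close>

lemma dirac_apply: "dirac a b = (if b = a then 1 else 0)"
  and ones_apply: "ones I a = (if a \<in> I then 1 else 0)"
  by (simp_all add: dirac_def ones_def)

text \<open>The exterior product of the basis vectors listed in \<open>c\<close>, in that
  order.\<close>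

primrec wd :: "'b list \<Rightarrow> 'b list \<Rightarrow> 'a::field" where
  "wd [] = (\<lambda>xs. if xs = [] then 1 else 0)"
| "wd (c # cs) = wedge (dirac c) (wd cs)"

lemma alt_wd: "set c \<subseteq> I \<Longrightarrow> alt I (length c) (wd c :: _ \<Rightarrow> 'a::field)"
proof (induction c)
  case Nil
  have "alt I 0 (wd [] :: _ \<Rightarrow> 'a)" by (auto simp: fun_eq_iff)
  then show "alt I (length []) (wd [] :: _ \<Rightarrow> 'a)" by simp
next
  case (Cons a c)
  have "alt I (length c) (wd c :: _ \<Rightarrow> 'a)" by (rule Cons.IH) (use Cons.prems in simp)
  then show "alt I (length (a # c)) (wd (a # c) :: _ \<Rightarrow> 'a)" using alt_dirac_wedge[of I "length c" "wd c" a] Cons.prems by simp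
qed

lemma wedge_wd_mem: "a \<in> set c \<Longrightarrow> wedge (dirac a) (wd c) = (0 :: _ \<Rightarrow> 'a::field)"
proof (induction c)
  case (Cons b c)
  show "wedge (dirac a) (wd (b # c)) = (0 :: _ \<Rightarrow> 'a)"
  proof (cases "a = b")
    case False
    have "wedge (dirac a) (wd c) = (0 :: _ \<Rightarrow> 'a)" by (rule Cons.IH) (use Cons.prems False in simp)
    then show ?thesis by (simp add: wedge_anti[of "dirac a" "dirac b"])
  qed simp
qed simp

lemma wd_dup: "\<not> distinct c \<Longrightarrow> wd c = (0 :: _ \<Rightarrow> 'a::field)"
proof (induction c)
  case (Cons a c)
  show "wd (a # c) = (0 :: _ \<Rightarrow> 'a)"
  proof (cases "a \<in> set c")
    case False
    have "wd c = (0 :: _ \<Rightarrow> 'a)" by (rule Cons.IH) (use Cons.prems False in simp)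
    then show ?thesis by simp
  qed (simp add: wedge_wd_mem)
qed simp

lemma wedge_dirac_outside: "a \<notin> set ys \<Longrightarrow> wedge (dirac a) f ys = 0"
proof (induction ys arbitrary: f)
  case (Cons y ys)
  have "wedge (dirac a) (del y f) ys = 0" by (rule Cons.IH) (use Cons.prems in simp)
  moreover have "y \<noteq> a" using Cons.prems by auto
  ultimately show "wedge (dirac a) f (y # ys) = 0" by (simp add: dirac_apply)
qed simp

lemma wedge_outside: "(\<And>zs. a \<notin> set zs \<Longrightarrow> f zs = 0) \<Longrightarrow> a \<notin> set ys \<Longrightarrow> wedge v f ys = 0"
proof (induction ys arbitrary: f)
  case (Cons y ys)
  have "wedge v (del y f) ys = 0"
  proof (rule Cons.IH)
    show "del y f zs = 0" if "a \<notin> set zs" for zs using Cons.prems that by simp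
  qed (use Cons.prems in simp)
  then show "wedge v f (y # ys) = 0" using Cons.prems by simp
qed simp

lemma wd_outside: "a \<in> set c \<Longrightarrow> a \<notin> set ys \<Longrightarrow> wd c ys = 0"
proof (induction c arbitrary: ys)
  case (Cons b c)
  then show ?case using wedge_dirac_outside[of b ys "wd c"] wedge_outside[of a "wd c" ys "dirac b"] by auto
qed simp

lemma wd_subset: "wd c ys \<noteq> (0 :: 'a::field) \<Longrightarrow> set c \<subseteq> set ys"
  by (rule subsetI, rule ccontr) (simp add: wd_outside)

lemma wd_self: "distinct c \<Longrightarrow> wd c c = 1"
proof (induction c)
  case (Cons a c)
  then show ?case using wedge_dirac_outside[of a c "del a (wd c)"] by (simp add: dirac_apply)
qed simp

primrec xx :: "('b \<Rightarrow> 'a::field) list \<Rightarrow> ('b list \<Rightarrow> 'a) \<Rightarrow> 'b list \<Rightarrow> 'a" where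
  "xx [] w = w"
| "xx (u # us) w = wedge u (xx us w)"

lemma xx_append: "xx (us @ vs) w = xx us (xx vs w)"
  by (induction us) simp_all

lemma xx_add: "xx us (f - h) = xx us f - xx us h" and xx_sc: "xx us (sc c f) = sc c (xx us f)"
proof -
  show "xx us (f - h) = xx us f - xx us h"
  proof (induction us)
    case (Cons u us)
    have "xx us (f - h) = xx us f - xx us h" by (rule Cons)
    then show "xx (u # us) (f - h) = xx (u # us) f - xx (u # us) h" by simp
  qed simp
  show "xx us (sc c f) = sc c (xx us f)"
  proof (induction us)
    case (Cons u us)
    have "xx us (sc c f) = sc c (xx us f)" by (rule Cons)
    then show "xx (u # us) (sc c f) = sc c (xx (u # us) f)" by simp
  qed simp
qed

primrec iter_contr :: "'b set \<Rightarrow> 'b \<Rightarrow> 'b list \<Rightarrow> ('b list \<Rightarrow> 'a::field) \<Rightarrow> 'b list \<Rightarrow> 'a" where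
  "iter_contr I c0 [] h = h"
| "iter_contr I c0 (c # cs) h = iter_contr I c0 cs (contr I (dirac c - dirac c0) h)"

definition fsp :: "('x \<Rightarrow> 'a::field) set \<Rightarrow> bool" where
  "fsp L \<longleftrightarrow> 0 \<in> L \<and> (\<forall>f\<in>L. \<forall>h\<in>L. f + h \<in> L) \<and> (\<forall>c. \<forall>f\<in>L. sc c f \<in> L)"

lemma fsp_subsp: "fsp L \<longleftrightarrow> subsp L"
  unfolding fsp_def subsp_def zero_fun_def plus_fun_def sc_def ..

lemma fspD:
  assumes "fsp L"
  shows "0 \<in> L" "f \<in> L \<Longrightarrow> h \<in> L \<Longrightarrow> f + h \<in> L" "f \<in> L \<Longrightarrow> sc c f \<in> L" "f \<in> L \<Longrightarrow> h \<in> L \<Longrightarrow> f - h \<in> L"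
    "f \<in> L \<Longrightarrow> - f \<in> L"
proof -
  show a: "0 \<in> L" "f \<in> L \<Longrightarrow> h \<in> L \<Longrightarrow> f + h \<in> L" "f \<in> L \<Longrightarrow> sc c f \<in> L" for f h c
    using assms by (auto simp: fsp_def)
  show u: "- f \<in> L" if "f \<in> L" for f using a(3)[OF that, of "- 1"] by simp
  show "f \<in> L \<Longrightarrow> h \<in> L \<Longrightarrow> f - h \<in> L" using a(2)[of f "- h"] u by simp
qed

lemma fsp_sum: "fsp L \<Longrightarrow> (\<And>a. a \<in> A \<Longrightarrow> F a \<in> L) \<Longrightarrow> sum F A \<in> L"
  by (rule sum_induct[where P = "\<lambda>f. f \<in> L"]) (auto dest: fspD)

section \<open>The two differentials attached to the invariant vector\<close>

locale clifford_space =
  fixes I :: "'b set" and ty :: "'a::field itself"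
  assumes finI: "finite I" and two: "(2::'a) \<noteq> 0" and card0: "(of_nat (card I) :: 'a) = 0"
    and inv: "\<And>k. 0 < k \<Longrightarrow> k < card I \<Longrightarrow> (of_nat k :: 'a) \<noteq> 0" and I2: "card I \<ge> 2"
begin

abbreviation delta :: "('b list \<Rightarrow> 'a) \<Rightarrow> 'b list \<Rightarrow> 'a" where "delta \<equiv> wedge (ones I)"
abbreviation bd :: "('b list \<Rightarrow> 'a) \<Rightarrow> 'b list \<Rightarrow> 'a" where "bd \<equiv> contr I (ones I)"

text \<open>A tabloid of the hook \<open>(|I| - n, 1\<^sup>n)\<close> is given by its rows below the first one, that is, by a
  list of \<open>n\<close> distinct points. In these coordinates \<open>ZZ n\<close> is the Specht module of the hook, spanned
  by the polytabloids \<open>bd (wd c)\<close>, and \<open>UU (n + 1) = delta (ZZ n)\<close> is its simple head.\<close>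

definition ZZ :: "nat \<Rightarrow> ('b list \<Rightarrow> 'a) set" where "ZZ n = {f. alt I n f \<and> bd f = 0}"
definition UU :: "nat \<Rightarrow> ('b list \<Rightarrow> 'a) set" where "UU n = {f. alt I n f \<and> delta f = 0 \<and> bd f = 0}"

lemma ip_ones [simp]: "ip I (ones I) (ones I) = (0::'a)" "a \<in> I \<Longrightarrow> ip I (dirac a) (ones I) = (1::'a)" "a \<in> I \<Longrightarrow> ip I (ones I) (dirac a) = (1::'a)"
  using card0 finI by (simp_all add: ip_def[of I "ones I" "ones I"] ones_apply)

lemma bd_delta: "bd (delta f) = - delta (bd f)"
  by (simp add: clifford)

lemma alt_delta: "alt I n f \<Longrightarrow> alt I (Suc n) (delta f)"
  by (rule alt_wedge) (auto simp: ones_apply)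

lemma sum_del: "(\<Sum>a\<in>I. del a f) = bd f"
  unfolding contr_def by (rule sum.cong) (auto simp: ones_apply)

lemma sum_wedge: "(\<Sum>a\<in>I. wedge (dirac a) f) = delta f"
proof -
  have "(\<Sum>a\<in>I. dirac a) = (ones I :: 'b \<Rightarrow> 'a)"
    using finI by (auto simp: fun_eq_iff sum_fun_apply dirac_apply ones_apply)
  then show ?thesis by (simp flip: wedge_sum(2))
qed

lemma del_wedge_delta: "a \<in> I \<Longrightarrow> del a (delta f) = f - delta (del a f)"
  by (simp add: del_wedge ones_apply)

lemma delta_UU: "f \<in> ZZ n \<Longrightarrow> delta f \<in> UU (Suc n)"
  by (simp add: ZZ_def UU_def alt_delta bd_delta)

text \<open>Since \<open>ones I\<close> has the value 1 at \<open>a\<close>, the operator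
  \<open>del a\<close> is a contracting homotopy for \<open>delta\<close>. It inverts
  \<open>delta\<close> explicitly on the common kernel.\<close>

lemma UU_delta: "f \<in> UU n \<Longrightarrow> a \<in> I \<Longrightarrow> delta (del a f) = f"
  using del_wedge_delta[of a f] by (simp add: UU_def)

lemma del_ZZ: "f \<in> UU (Suc n) \<Longrightarrow> del a f \<in> ZZ n"
  using del_contr[of I "Suc n" f a "ones I"] by (simp add: UU_def ZZ_def alt_del)

lemma fsp_ZZ: "fsp (ZZ n)" and fsp_UU: "fsp (UU n)"
  unfolding fsp_def ZZ_def UU_def by (auto intro: alt_add alt_sc)

lemma ones_permutes: "h permutes I \<Longrightarrow> ones I \<circ> h = (ones I :: 'b \<Rightarrow> 'a)"
  by (auto simp: ones_apply fun_eq_iff permutes_in_image)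

lemma comp_zero: "0 \<circ> h = 0" by (simp add: fun_eq_iff)

lemma ZZ_perm: "h permutes I \<Longrightarrow> f \<in> ZZ n \<Longrightarrow> f \<circ> map h \<in> ZZ n"
  and UU_perm: "h permutes I \<Longrightarrow> f \<in> UU n \<Longrightarrow> f \<circ> map h \<in> UU n"
  using contr_comp_map[of h I "ones I" f] wedge_comp_map[of "ones I" f h] ones_permutes[of h]
  by (auto simp: ZZ_def UU_def comp_zero intro: alt_comp_map)

lemma I_nonempty: "I \<noteq> {}"
  using I2 by auto

lemma UU_0: "f \<in> UU 0 \<Longrightarrow> f = 0"
proof -
  assume f: "f \<in> UU 0"
  obtain a where a: "a \<in> I" using I_nonempty by blast
  have "del a f = 0" using f by (simp add: UU_def)
  then show "f = 0" using UU_delta[OF f a] by simp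
qed

lemma alt_big: "alt I n f \<Longrightarrow> card I < n \<Longrightarrow> f = (0 :: _ \<Rightarrow> 'a)"
proof
  fix xs assume a: "alt I n f" "card I < n"
  show "f xs = 0 xs"
  proof (rule ccontr)
    assume "f xs \<noteq> 0 xs"
    then have "length xs = n \<and> set xs \<subseteq> I \<and> distinct xs" using alt_support[OF two a(1), of xs] by simp
    then have "n \<le> card I" using card_mono[OF finI, of "set xs"] by (simp add: distinct_card)
    then show False using a by simp
  qed
qed

text \<open>Dually, multiplication by \<open>dirac a\<close> is a contracting homotopy for
  \<open>bd\<close>.\<close>

lemma ZZ_bd: "f \<in> ZZ n \<Longrightarrow> a \<in> I \<Longrightarrow> bd (wedge (dirac a) f) = f"
  by (simp add: clifford ZZ_def)

text \<open>Multiplication by \<open>dirac a\<close> leads beyond the top degree, so the homotopy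
  for \<open>bd\<close> returns zero. Together with \<open>UU_0\<close> this is the source of the
  truncation at both ends.\<close>

lemma UU_card: "f \<in> UU (card I) \<Longrightarrow> f = 0"
proof -
  assume f: "f \<in> UU (card I)"
  obtain a where a: "a \<in> I" using I_nonempty by blast
  have "wedge (dirac a) f = 0" using f alt_big[OF alt_dirac_wedge[OF _ a, of "card I" f]] by (simp add: UU_def)
  moreover have "f \<in> ZZ (card I)" using f by (simp add: UU_def ZZ_def)
  ultimately show "f = 0" using ZZ_bd[of f "card I" a] a by simp
qed

text \<open>The difference \<open>u\<close> of two factors of the monomial satisfies
  \<open>wedge u (wd c) = 0\<close>, so by the Clifford relation the reflection in \<open>u\<close>
  sends \<open>wd c\<close> to \<open>wd c - 2 wd c\<close>.\<close>

lemma wd_transpose: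
  assumes "a \<in> set c" "b \<in> set c" "a \<noteq> b" "set c \<subseteq> I"
  shows "wd c \<circ> map (transpose a b) = - (wd c :: _ \<Rightarrow> 'a)"
proof -
  let ?u = "dirac a - dirac b :: 'b \<Rightarrow> 'a"
  have ab: "a \<in> I" "b \<in> I" using assms by auto
  have Xu: "wedge ?u (wd c) = 0" using assms by (simp add: wedge_wd_mem)
  have "ip I ?u ?u = 2" using ab assms finI by (simp add: dirac_apply)
  then have "wedge ?u (contr I ?u (wd c)) = sc 2 (wd c)" using clifford[of I ?u ?u "wd c"] unfolding Xu by simp
  then have "wd c \<circ> map (transpose a b) = wd c - sc (2::'a) (wd c)"
    using transpose_alt[OF finI ab assms(3) two alt_wd[OF assms(4)]] by simp
  then show ?thesis by (simp add: fun_eq_iff)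
qed

lemma wd_permutes:
  assumes "distinct c" "set c \<subseteq> I" "g permutes set c"
  shows "wd c (map g c) = (of_int (sign g) :: 'a)"
  using assms(3) finite_set[of c]
proof (induction g rule: permutes_induct)
  case id
  then show ?case using assms by (simp add: wd_self)
next
  case (swap a b p)
  have "wd c (map (transpose a b \<circ> p) c) = (wd c \<circ> map (transpose a b)) (map p c)" by simp
  also have "\<dots> = - (of_int (sign p) :: 'a)"
    using wd_transpose[of a c b] swap assms by simp
  also have "sign p = - sign (transpose a b \<circ> p)"
    using swap by (subst sign_compose)
      (auto simp: sign_swap_id permutation_swap_id intro: permutation_permutes[THEN iffD2] exI[of _ "set c"])
  finally show "wd c (map (transpose a b \<circ> p) c) = (of_int (sign (transpose a b \<circ> p)) :: 'a)"
    by (simp only: of_int_minus minus_minus)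
qed

text \<open>The Leibniz expansion of the monomial, in the shape of the signed sum that defines
  polytabloids.\<close>

lemma wd_eval:
  assumes "distinct c" "set c \<subseteq> I"
  shows "wd c ys = (\<Sum>g | g permutes set c. if ys = map g c then of_int (sign g) else (0::'a))"
proof (cases "\<exists>g. g permutes set c \<and> ys = map g c")
  case True
  then obtain g where g: "g permutes set c" "ys = map g c" by blast
  have un: "h = g" if "h permutes set c" "ys = map h c" for h
  proof
    fix x
    show "h x = g x"
    proof (cases "x \<in> set c")
      case True
      then show ?thesis using that(2) g(2) by (metis map_eq_conv)
    next
      case False
      then show ?thesis using that(1) g(1) by (simp add: permutes_not_in)
    qed
  qed
  have "(\<Sum>h | h permutes set c. if ys = map h c then of_int (sign h) else (0::'a)) =
      (\<Sum>h | h permutes set c. if h = g then of_int (sign g) else 0)"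
    by (rule sum.cong) (use un g in auto)
  then show ?thesis using wd_permutes[OF assms g(1)] g finite_permutations[of "set c"] by simp
next
  case False
  have "wd c ys = (0::'a)"
  proof (rule ccontr)
    assume nz: "wd c ys \<noteq> (0::'a)"
    have "length ys = length c \<and> set ys \<subseteq> I \<and> distinct ys"
      by (rule alt_support[OF two alt_wd[OF assms(2)] nz])
    then have ys: "length ys = length c" "distinct ys" by blast+
    have sub: "set c \<subseteq> set ys" by (rule wd_subset[OF nz])
    then have "set c = set ys"
      by (rule card_subset_eq[OF List.finite_set]) (simp add: distinct_card ys assms(1))
    then obtain g where "g permutes set c" "map g c = ys"
      using perm_extend[of "set c" c ys] ys assms(1) by (metis List.finite_set subset_refl)
    then show False using False by metis
  qed
  moreover have "(\<Sum>h | h permutes set c. if ys = map h c then of_int (sign h) else (0::'a)) = 0"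
    by (rule sum.neutral) (use False in auto)
  ultimately show ?thesis by simp
qed

text \<open>\<open>bd\<close> sums over the first letter, that is, it forgets which point of the
  first column sits in the first row, just as passing to tabloids does.\<close>

lemma bd_wd_eval:
  assumes "distinct (c0 # cs)" "set (c0 # cs) \<subseteq> I"
  shows "bd (wd (c0 # cs)) xs = (\<Sum>g | g permutes set (c0 # cs). if xs = map g cs then of_int (sign g) else (0::'a))"
proof -
  let ?P = "{g. g permutes set (c0 # cs)}"
  have "bd (wd (c0 # cs)) xs = (\<Sum>a\<in>I. wd (c0 # cs) (a # xs))"
    by (simp add: sum_del[symmetric] sum_fun_apply del: wd.simps)
  also have "\<dots> = (\<Sum>a\<in>I. \<Sum>g\<in>?P. if a # xs = map g (c0 # cs) then of_int (sign g) else 0)"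
    by (simp only: wd_eval[OF assms])
  also have "\<dots> = (\<Sum>g\<in>?P. \<Sum>a\<in>I. if a # xs = map g (c0 # cs) then of_int (sign g) else 0)"
    by (rule sum.swap)
  also have "\<dots> = (\<Sum>g\<in>?P. if xs = map g cs then of_int (sign g) else 0)"
  proof (rule sum.cong)
    fix g assume "g \<in> ?P"
    then have "g c0 \<in> I" using assms permutes_in_image[of g "set (c0 # cs)" c0] by auto
    moreover have "(\<Sum>a\<in>I. if a # xs = map g (c0 # cs) then of_int (sign g) else (0::'a)) =
        (\<Sum>a\<in>I. if a = g c0 then (if xs = map g cs then of_int (sign g) else 0) else 0)"
      by (rule sum.cong) auto
    ultimately show "(\<Sum>a\<in>I. if a # xs = map g (c0 # cs) then of_int (sign g) else (0::'a)) =
        (if xs = map g cs then of_int (sign g) else 0)"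
      using finI by simp
  qed simp
  finally show ?thesis .
qed

text \<open>\<open>euler\<close> expresses the degree times \<open>f\<close> through the functions
  \<open>wedge (dirac a) (del a f)\<close>, and degrees between 0 and \<open>card I\<close> are
  invertible.\<close>

lemma alt_span:
  assumes "n < card I" "fsp W" "\<And>c. length c = n \<Longrightarrow> set c \<subseteq> I \<Longrightarrow> wd c \<in> W" "alt I n f"
  shows "f \<in> (W :: ('b list \<Rightarrow> 'a) set)"
  using assms
proof (induction n arbitrary: f W)
  case 0
  have "f xs = sc (f []) (wd []) xs" for xs
    using 0(4) by (cases xs) (auto simp: fun_eq_iff)
  then have "f = sc (f []) (wd [])" by (rule ext)
  then show ?case using fspD(3)[OF 0(2) 0(3)[of "[]"], of "f []"] by simp
next
  case (Suc n)
  have "wedge (dirac a) (del a f) \<in> W" if a: "a \<in> I" for a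
  proof -
    have "del a f \<in> {h. wedge (dirac a) h \<in> W}"
    proof (rule Suc.IH)
      show "fsp {h. wedge (dirac a) h \<in> W}" using Suc.prems(2) by (simp add: fsp_def)
      show "wd c \<in> {h. wedge (dirac a) h \<in> W}" if "length c = n" "set c \<subseteq> I" for c
        using Suc.prems(3)[of "a # c"] that a by simp
      show "alt I n (del a f)" by (rule alt_del[OF Suc.prems(4)])
    qed (use Suc.prems(1) in simp)
    then show ?thesis by simp
  qed
  then have "sc (of_nat (Suc n)) f \<in> W"
    using fsp_sum[OF Suc.prems(2), of I "\<lambda>a. wedge (dirac a) (del a f)"] euler[OF finI Suc.prems(4)] by simp
  then have "sc (1 / of_nat (Suc n)) (sc (of_nat (Suc n)) f) \<in> W"
    by (rule fspD(3)[OF Suc.prems(2)])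
  moreover have "(of_nat (Suc n) :: 'a) \<noteq> 0" using inv Suc.prems(1) by blast
  ultimately show ?case by (simp del: of_nat_Suc)
qed

text \<open>\<open>f\<close> is \<open>bd\<close> of \<open>wedge (dirac a) f\<close>, which is a
  combination of monomials.\<close>

lemma ZZ_span:
  assumes "Suc n < card I" "fsp W" "\<And>c. length c = Suc n \<Longrightarrow> set c \<subseteq> I \<Longrightarrow> bd (wd c) \<in> W" "f \<in> ZZ n"
  shows "f \<in> W"
proof -
  obtain a where a: "a \<in> I" using I_nonempty by blast
  have "wedge (dirac a) f \<in> {h. bd h \<in> W}"
  proof (rule alt_span[OF assms(1)])
    show "fsp {h. bd h \<in> W}" using assms(2) by (auto simp: fsp_def)
    show "alt I (Suc n) (wedge (dirac a) f)" using assms(4) a by (auto simp: ZZ_def intro: alt_dirac_wedge)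
  qed (use assms in auto)
  then show ?thesis using ZZ_bd[OF assms(4) a] by simp
qed

text \<open>The value of \<open>delta h\<close> at \<open>c0 # cs\<close> is what remains after
  contracting \<open>h\<close> with all the vectors \<open>dirac c - dirac c0\<close>. Thus
  \<open>delta h\<close> being nonzero means that some such full contraction is a nonzero
  scalar.\<close>

lemma delta_iter_contr:
  "alt I (length cs) h \<Longrightarrow> c0 \<in> I \<Longrightarrow> set cs \<subseteq> I \<Longrightarrow> delta h (c0 # cs) = iter_contr I c0 cs h []"
proof (induction cs arbitrary: h)
  case Nil
  then show ?case by (simp add: ones_apply)
next
  case (Cons c cs)
  have h: "alt I (Suc (length cs)) h" using Cons.prems by simp
  have c: "c \<in> I" using Cons.prems by simp
  have dd: "contr I (dirac c - dirac c0) h = del c h - del c0 h" using finI c Cons.prems by (simp add: contr_dirac)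
  have "iter_contr I c0 (c # cs) h [] = delta (contr I (dirac c - dirac c0) h) (c0 # cs)"
    unfolding iter_contr.simps
    by (rule Cons.IH[OF alt_contr[OF h] Cons.prems(2), symmetric]) (use Cons.prems in simp)
  also have "\<dots> = delta (del c h) (c0 # cs) - delta (del c0 h) (c0 # cs)" unfolding dd by simp
  also have "\<dots> = h (c # cs) - delta (del c0 (del c h)) cs - h (c0 # cs) + delta (del c0 (del c0 h)) cs"
    using Cons.prems by (simp add: ones_apply)
  also have "del c0 (del c0 h) = 0"
  proof -
    have "del c0 (del c0 h) = - del c0 (del c0 h)" by (rule alt_swap[OF h])
    then have "sc 2 (del c0 (del c0 h)) = 0" by (simp add: fun_eq_iff)
    then show ?thesis using two by (simp add: fun_eq_iff)
  qed
  also have "del c0 (del c h) = - del c (del c0 h)" by (rule alt_swap[OF h])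
  finally have E: "iter_contr I c0 (c # cs) h [] = h (c # cs) - delta (- del c (del c0 h)) cs - h (c0 # cs) + delta 0 cs" .
  show "delta h (c0 # c # cs) = iter_contr I c0 (c # cs) h []"
    unfolding E using Cons.prems(2) c by (simp add: ones_apply)
qed

text \<open>The operator \<open>wedge u \<circ> contr v\<close> is a polynomial in the reflections defined by \<open>u\<close> and by \<open>v\<close>
  unless \<open>u\<close> and \<open>v\<close> are orthogonal.\<close>

lemma wedge_contr_closed:
  assumes L: "fsp L" "\<And>f. f \<in> L \<Longrightarrow> alt I n f"
    and u: "\<And>f. f \<in> L \<Longrightarrow> wedge u (contr I u f) \<in> L" and v: "\<And>f. f \<in> L \<Longrightarrow> wedge v (contr I v f) \<in> L"
    and ip: "ip I u u = 2" "ip I u v = s" "s \<noteq> (0::'a)" and f: "f \<in> L"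
  shows "wedge u (contr I v f) \<in> L"
proof -
  have alt: "alt I n f" using L(2) f .
  have same: "contr I w (contr I w g) = 0" if "alt I k g" for w k and g :: "'b list \<Rightarrow> 'a"
  proof -
    have "contr I w (contr I w g) = - contr I w (contr I w g)" by (rule contr_anti[OF that])
    then have "sc 2 (contr I w (contr I w g)) = 0" by (simp add: fun_eq_iff)
    then show ?thesis using two by (simp add: fun_eq_iff)
  qed
  have vu: "ip I v u = s" using ip(2) by (simp add: ip_def mult.commute)
  have ab: "wedge u (contr I u (wedge v (contr I v g))) = sc s (wedge u (contr I v g)) - wedge u (wedge v (contr I u (contr I v g)))" for g
    by (simp add: clifford ip)
  \<comment> \<open>Let \<open>A\<close> and \<open>B\<close> be the operators attached to
    \<open>u\<close> and \<open>v\<close> in the hypotheses. \<open>A B A f = s^2 A f - 2 Q\<close>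
    puts \<open>Q\<close> into \<open>L\<close>, and then \<open>s\<close> times the function in
    question is \<open>A B f + Q\<close>.\<close>
  define g where "g = wedge u (contr I u f)"
  define Q where "Q = wedge u (wedge v (contr I u (contr I v f)))"
  have dvu: "contr I v (contr I u f) = - contr I u (contr I v f)" by (rule contr_anti[OF alt])
  have udvu: "contr I u (contr I v (contr I u f)) = 0"
  proof (cases n)
    case 0
    then show ?thesis using alt_0_contr[of I f] alt by simp
  next
    case (Suc k)
    have "contr I u (contr I v (contr I u f)) = - contr I v (contr I u (contr I u f))"
      by (rule contr_anti) (use alt Suc alt_contr in blast)
    then show ?thesis by (simp add: same[OF alt])
  qed
  have 1: "wedge u (contr I v g) = sc s (wedge u (contr I u f))" by (simp add: g_def clifford vu)
  have 2: "contr I u (contr I v g) = sc 2 (contr I u (contr I v f))"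
    by (simp add: g_def clifford vu same[OF alt] ip udvu) (simp add: dvu)
  have aba: "wedge u (contr I u (wedge v (contr I v g))) = sc (s * s) g - sc 2 Q"
    unfolding ab 1 2 by (simp add: g_def Q_def)
  have gL: "g \<in> L" unfolding g_def by (rule u[OF f])
  have "sc 2 Q = sc (s * s) g - wedge u (contr I u (wedge v (contr I v g)))" using aba by simp
  also have "\<dots> \<in> L" by (intro fspD[OF L(1)] u v gL)
  finally have "sc (1 / 2) (sc 2 Q) \<in> L" by (rule fspD(3)[OF L(1)])
  then have Q: "Q \<in> L" using two by simp
  have "sc s (wedge u (contr I v f)) = wedge u (contr I u (wedge v (contr I v f))) + Q"
    unfolding ab by (simp add: Q_def)
  also have "\<dots> \<in> L" by (intro fspD[OF L(1)] u v f Q)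
  finally have "sc (1 / s) (sc s (wedge u (contr I v f))) \<in> L" by (rule fspD(3)[OF L(1)])
  then show ?thesis using ip by simp
qed

text \<open>The contraction is moved to the left through \<open>us\<close>, one factor at a time.
  Each exchange costs a product of \<open>m\<close> vectors without contraction, which is in
  \<open>L\<close> by assumption. Once a single factor stands to its left, the closure of
  \<open>L\<close> under \<open>wedge u (contr I v _)\<close> applies.\<close>

lemma xx_contr_closed:
  assumes L: "fsp L" and wedge: "\<And>u v f. u \<in> R \<Longrightarrow> v \<in> R \<Longrightarrow> f \<in> L \<Longrightarrow> wedge u (contr I v f) \<in> L"
    and w: "\<And>us. set us \<subseteq> R \<Longrightarrow> length us = m \<Longrightarrow> xx us w \<in> L" and v: "v \<in> R"
    and us: "set us \<subseteq> R" "length us = Suc m"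
  shows "xx us (contr I v w) \<in> L"
proof -
  have "xx as (contr I v (xx bs w)) \<in> L" if "length as = Suc j" "Suc j + length bs = Suc m" "set as \<subseteq> R" "set bs \<subseteq> R" for j as bs
    using that
  proof (induction j arbitrary: as bs)
    case 0
    then obtain u where "as = [u]" by (cases as) auto
    then show ?case using wedge[OF _ v w, of u bs] 0 by simp
  next
    case (Suc j)
    obtain cs b where as: "as = cs @ [b]" using Suc.prems(1) by (cases as rule: rev_cases) auto
    have 1: "xx cs (contr I v (xx (b # bs) w)) \<in> L" using Suc.prems as by (intro Suc.IH) auto
    have 2: "xx (cs @ bs) w \<in> L" using Suc.prems as by (intro w) auto
    have eq: "xx as (contr I v (xx bs w)) = sc (ip I v b) (xx (cs @ bs) w) - xx cs (contr I v (xx (b # bs) w))"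
      by (simp add: as xx_append clifford xx_add xx_sc)
    show "xx as (contr I v (xx bs w)) \<in> L" unfolding eq by (rule fspD(4)[OF L fspD(3)[OF L 2] 1])
  qed
  from this[of us m "[]"] us show ?thesis by simp
qed

text \<open>After multiplication by \<open>dirac c0\<close> the corrections
  \<open>- dirac c0\<close> are invisible. The product on the right is killed by \<open>bd\<close>,
  as its factors are orthogonal to \<open>ones I\<close>; so the homotopy property of
  \<open>dirac c0\<close> recovers it.\<close>

lemma bd_wd_xx: "c0 \<in> I \<Longrightarrow> set cs \<subseteq> I \<Longrightarrow> bd (wd (c0 # cs)) = xx (map (\<lambda>c. dirac c - dirac c0) cs) (wd [] :: _ \<Rightarrow> 'a)"
proof -
  assume I: "c0 \<in> I" "set cs \<subseteq> I"
  let ?y = "xx (map (\<lambda>c. dirac c - dirac c0) cs) (wd [] :: _ \<Rightarrow> 'a)"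
  have 1: "wedge (dirac c0) (wd cs) = wedge (dirac c0) ?y"
    using I(2)
  proof (induction cs)
    case (Cons c cs)
    have IH: "wedge (dirac c0) (wd cs) = wedge (dirac c0) (xx (map (\<lambda>c. dirac c - dirac c0) cs) (wd [] :: _ \<Rightarrow> 'a))"
      by (rule Cons.IH) (use Cons.prems in simp)
    have "wedge (dirac c0) (wd (c # cs)) = - wedge (dirac c) (wedge (dirac c0) (wd cs) :: _ \<Rightarrow> 'a)"
      by (simp add: wedge_anti[of "dirac c0" "dirac c"])
    then show "wedge (dirac c0) (wd (c # cs)) = wedge (dirac c0) (xx (map (\<lambda>c. dirac c - dirac c0) (c # cs)) (wd [] :: _ \<Rightarrow> 'a))"
      unfolding IH by (simp add: wedge_anti[of "dirac c0" "dirac c"])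
  qed simp
  have "bd (xx (map (\<lambda>c. dirac c - dirac c0) ds) (wd [])) = (0 :: _ \<Rightarrow> 'a)" if "set ds \<subseteq> I" for ds
    using that
  proof (induction ds)
    case Nil
    have "alt I 0 (wd [] :: _ \<Rightarrow> 'a)" using alt_wd[of "[]" I] by simp
    then show "bd (xx (map (\<lambda>c. dirac c - dirac c0) []) (wd [])) = (0 :: _ \<Rightarrow> 'a)" by (simp add: alt_0_contr del: wd.simps)
  next
    case (Cons d ds)
    have IH: "bd (xx (map (\<lambda>c. dirac c - dirac c0) ds) (wd [])) = (0 :: _ \<Rightarrow> 'a)"
      by (rule Cons.IH) (use Cons.prems in simp)
    have "ip I (ones I) (dirac d - dirac c0) = (0::'a)" using I(1) Cons.prems by simp
    then show "bd (xx (map (\<lambda>c. dirac c - dirac c0) (d # ds)) (wd [])) = (0 :: _ \<Rightarrow> 'a)"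
      by (simp only: list.map xx.simps clifford IH wedge_simps(4) sc_simps diff_zero)
  qed
  then have "bd ?y = 0" using I(2) by blast
  then show ?thesis using I(1) by (simp add: 1 clifford del: wd.simps(1))
qed

text \<open>Contracting \<open>h\<close> with all vectors \<open>dirac c - dirac c0\<close> and
  multiplying by them again does not leave \<open>L\<close>, by the two closure lemmas. The full
  contraction is the scalar \<open>delta h (c0 # cs)\<close>, so a nonzero multiple of the
  polytabloid lies in \<open>L\<close>.\<close>

lemma james_generator:
  assumes L: "fsp L" "\<And>f. f \<in> L \<Longrightarrow> alt I n f"
    and tr: "\<And>f a b. f \<in> L \<Longrightarrow> a \<in> I \<Longrightarrow> b \<in> I \<Longrightarrow> f \<circ> map (transpose a b) \<in> L"
    and h: "h \<in> L" "delta h (c0 # cs) \<noteq> 0"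
    and c: "distinct (c0 # cs)" "set (c0 # cs) \<subseteq> I" "length cs = n"
  shows "bd (wd (c0 # cs)) \<in> L"
proof -
  define R :: "('b \<Rightarrow> 'a) set" where "R = (\<lambda>c. dirac c - dirac c0) ` set cs"
  have refl: "wedge u (contr I u f) \<in> L" if u: "u \<in> R" and f: "f \<in> L" for u f
  proof -
    obtain a where a: "a \<in> set cs" "u = dirac a - dirac c0" using u by (auto simp: R_def)
    then have ac: "a \<in> I" "c0 \<in> I" "a \<noteq> c0" using c by auto
    have eq: "f \<circ> map (transpose a c0) = f - wedge u (contr I u f)"
      unfolding a(2) by (rule transpose_alt[OF finI ac two L(2)[OF f]])
    have "f - (f \<circ> map (transpose a c0)) = wedge u (contr I u f)" unfolding eq by simp
    then show ?thesis using fspD(4)[OF L(1) f tr[OF f ac(1,2)]] by metis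
  qed
  have wedge: "wedge u (contr I v f) \<in> L" if u: "u \<in> R" and v: "v \<in> R" and f: "f \<in> L" for u v f
  proof -
    obtain a b where a: "a \<in> set cs" "u = dirac a - dirac c0" "b \<in> set cs" "v = dirac b - dirac c0"
      using u v by (auto simp: R_def)
    then have ac: "a \<in> I" "c0 \<in> I" "a \<noteq> c0" "b \<in> I" "b \<noteq> c0" using c by auto
    have "ip I u u = 2" "ip I u v = (if a = b then 2 else 1)"
      using ac finI by (auto simp: a dirac_apply)
    then show ?thesis
      using two by (intro wedge_contr_closed[OF L refl[OF u] refl[OF v] _ _ _ f, of "ip I u v"]) auto
  qed
  have "xx us (iter_contr I c0 ds w) \<in> L"
    if "\<And>us. set us \<subseteq> R \<Longrightarrow> length us = m \<Longrightarrow> xx us w \<in> L" "set ds \<subseteq> set cs" "set us \<subseteq> R" "length us = m + length ds"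
    for us ds w m
    using that
  proof (induction ds arbitrary: w m)
    case (Cons d ds)
    have "dirac d - dirac c0 \<in> R" using Cons.prems(2) by (auto simp: R_def)
    then have "xx us (contr I (dirac d - dirac c0) w) \<in> L" if "set us \<subseteq> R" "length us = Suc m" for us
      using xx_contr_closed[OF L(1) wedge Cons.prems(1) _ that] by blast
    then show ?case
      unfolding iter_contr.simps by (rule Cons.IH[of "Suc m"]) (use Cons.prems in auto)
  qed simp
  from this[of 0 h cs "map (\<lambda>c. dirac c - dirac c0) cs"]
  have x: "xx (map (\<lambda>c. dirac c - dirac c0) cs) (iter_contr I c0 cs h) \<in> L"
    using h by (auto simp: R_def)
  have a0: "alt I 0 (iter_contr I c0 ds w)" if "alt I (length ds) w" for ds w
    using that
  proof (induction ds arbitrary: w)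
    case (Cons d ds)
    have "alt I (length ds) (contr I (dirac d - dirac c0) w)" by (rule alt_contr) (use Cons.prems in simp)
    then show ?case unfolding iter_contr.simps by (rule Cons.IH)
  qed simp
  define s where "s = iter_contr I c0 cs h []"
  have "delta h (c0 # cs) = s"
    unfolding s_def by (rule delta_iter_contr) (use L(2)[OF h(1)] c in auto)
  then have s: "s \<noteq> 0" using h(2) by metis
  have "alt I 0 (iter_contr I c0 cs h)" by (rule a0) (use L(2)[OF h(1)] c in simp)
  then have "iter_contr I c0 cs h xs = sc s (wd []) xs" for xs
    by (cases xs) (auto simp: s_def fun_eq_iff)
  then have "iter_contr I c0 cs h = sc s (wd [])" by (rule ext)
  then have "sc s (xx (map (\<lambda>c. dirac c - dirac c0) cs) (wd [])) \<in> L" using x by (simp add: xx_sc del: wd.simps)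
  then have "sc (1 / s) (sc s (xx (map (\<lambda>c. dirac c - dirac c0) cs) (wd []))) \<in> L" by (rule fspD(3)[OF L(1)])
  then show ?thesis using s bd_wd_xx[of c0 cs] c by (simp del: wd.simps)
qed

lemma wd_map: "g permutes I \<Longrightarrow> wd (map g c) = (wd c :: _ \<Rightarrow> 'a) \<circ> map (inv' g)"
proof (induction c)
  case Nil
  show "wd (map g []) = (wd [] :: _ \<Rightarrow> 'a) \<circ> map (inv' g)" by (auto simp: fun_eq_iff)
next
  case (Cons a c)
  have IH: "wd (map g c) = (wd c :: _ \<Rightarrow> 'a) \<circ> map (inv' g)" by (rule Cons.IH[OF Cons.prems])
  have ea: "dirac a \<circ> inv' g = (dirac (g a) :: _ \<Rightarrow> 'a)"
    using Cons.prems by (auto simp: dirac_apply fun_eq_iff permutes_inv_eq)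
  then show "wd (map g (a # c)) = (wd (a # c) :: _ \<Rightarrow> 'a) \<circ> map (inv' g)"
    by (simp only: list.map wd.simps wedge_comp_map IH ea)
qed

lemma bd_wd_map: "g permutes I \<Longrightarrow> bd (wd (map g c)) = (bd (wd c) :: _ \<Rightarrow> 'a) \<circ> map (inv' g)"
  by (simp add: wd_map contr_comp_map permutes_inv ones_permutes)

text \<open>The hook case of James' submodule theorem: one polytabloid in \<open>L\<close> yields
  all others by transitivity of the group on lists of distinct points, and they span
  \<open>ZZ n\<close>.\<close>

theorem james_submodule:
  assumes n: "Suc n < card I" and L: "fsp L" "L \<subseteq> ZZ n"
    and G: "\<And>f g. f \<in> L \<Longrightarrow> g permutes I \<Longrightarrow> f \<circ> map g \<in> L" and h: "h \<in> L" "delta h \<noteq> 0"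
  shows "L = ZZ n"
proof -
  have alt: "alt I n f" if "f \<in> L" for f using L(2) that by (auto simp: ZZ_def)
  obtain ys where ys: "delta h ys \<noteq> 0" using h(2) by (auto simp: fun_eq_iff)
  then have "length ys = Suc n \<and> set ys \<subseteq> I \<and> distinct ys"
    using alt_support[OF two alt_delta[OF alt[OF h(1)]]] by blast
  then obtain c0 cs where c: "ys = c0 # cs" "length cs = n" "set (c0 # cs) \<subseteq> I" "distinct (c0 # cs)"
    by (cases ys) auto
  have gen: "bd (wd (c0 # cs)) \<in> L"
    by (rule james_generator[OF L(1) alt _ h(1) _ c(4,3,2)]) (use G ys c in \<open>auto simp: permutes_swap_id\<close>)
  have "ZZ n \<subseteq> L"
  proof
    fix f assume f: "f \<in> ZZ n"
    show "f \<in> L"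
    proof (rule ZZ_span[OF n L(1) _ f])
      fix d assume d: "length d = Suc n" "set d \<subseteq> I"
      show "bd (wd d) \<in> L"
      proof (cases "distinct d")
        case True
        obtain g where g: "g permutes I" "map g (c0 # cs) = d"
          using perm_extend[OF finI c(4) True _ c(3) d(2)] c(2) d(1) by auto
        have "bd (wd d) = bd (wd (c0 # cs)) \<circ> map (inv' g)"
          using bd_wd_map[OF g(1), of "c0 # cs"] unfolding g(2) .
        then show ?thesis using G[OF gen permutes_inv[OF g(1)]] by metis
      next
        case False
        then have z: "wd d = (0 :: _ \<Rightarrow> 'a)" by (rule wd_dup)
        show ?thesis unfolding z contr_simps by (rule fspD(1)[OF L(1)])
      qed
    qed
  qed
  then show ?thesis using L(2) by blast
qed

end

section \<open>Modules of functions\<close>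

text \<open>Coordinates are the values at the points \<open>ppt\<close>. So operators on functions
  become matrices (\<open>lmat\<close>), and substitutions of the argument become modules
  (\<open>prep\<close>), by evaluation.\<close>

record ('x, 'a) pb =
  pdim :: nat
  ppt :: "nat \<Rightarrow> 'x"
  pbs :: "nat \<Rightarrow> 'x \<Rightarrow> 'a"

definition is_pb :: "('x \<Rightarrow> 'a::field) set \<Rightarrow> ('x, 'a) pb \<Rightarrow> bool" where
  "is_pb U B \<longleftrightarrow> fsp U \<and> pbas U (pdim B) (ppt B) (pbs B)"

lemma is_pb_exists:
  assumes "fsp U" "finite S" "\<And>f x. f \<in> U \<Longrightarrow> x \<notin> S \<Longrightarrow> f x = 0"
  shows "\<exists>B. is_pb U B"
proof -
  obtain d pt bs where "pbas U d pt bs"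
    using pbas_exists[of U S] assms fsp_subsp by blast
  then have "is_pb U \<lparr> pdim = d, ppt = pt, pbs = bs \<rparr>" using assms by (simp add: is_pb_def)
  then show ?thesis by blast
qed

lemma is_pbD:
  assumes "is_pb U B"
  shows "fsp U" "j < pdim B \<Longrightarrow> pbs B j \<in> U"
    "j < pdim B \<Longrightarrow> k < pdim B \<Longrightarrow> pbs B j (ppt B k) = (if j = k then 1 else 0)"
    "f \<in> U \<Longrightarrow> f = (\<Sum>j<pdim B. sc (f (ppt B j)) (pbs B j))"
  using assms by (auto simp: is_pb_def pbas_def fun_eq_iff sum_fun_apply)

definition lin :: "(('x \<Rightarrow> 'a::field) \<Rightarrow> 'y \<Rightarrow> 'a) \<Rightarrow> bool" where
  "lin T \<longleftrightarrow> (\<forall>f h. T (f + h) = T f + T h) \<and> (\<forall>c f. T (sc c f) = sc c (T f))"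

lemma lin_sum:
  assumes "lin T" shows "T (\<Sum>j\<in>A. sc (c j) (F j)) = (\<Sum>j\<in>A. sc (c j) (T (F j)))"
proof (induction A rule: infinite_finite_induct)
  have z: "T 0 = 0" using assms unfolding lin_def by (metis sc_simps(7))
  show "T (\<Sum>j\<in>A. sc (c j) (F j)) = (\<Sum>j\<in>A. sc (c j) (T (F j)))" if "infinite A" for A
    unfolding sum.infinite[OF that] by (rule z)
  show "T (\<Sum>j\<in>{}. sc (c j) (F j)) = (\<Sum>j\<in>{}. sc (c j) (T (F j)))"
    unfolding sum.empty by (rule z)
  fix x A assume x: "finite A" "x \<notin> A" and IH: "T (\<Sum>j\<in>A. sc (c j) (F j)) = (\<Sum>j\<in>A. sc (c j) (T (F j)))"
  show "T (\<Sum>j\<in>insert x A. sc (c j) (F j)) = (\<Sum>j\<in>insert x A. sc (c j) (T (F j)))"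
    unfolding sum.insert[OF x] IH[symmetric] using assms by (simp only: lin_def)
qed

lemma lin_comp: "lin (\<lambda>f. f \<circ> s)"
  by (simp add: lin_def fun_eq_iff)

lemma lin_compose: "lin S \<Longrightarrow> lin T \<Longrightarrow> lin (\<lambda>f. S (T f))"
  unfolding lin_def by metis

definition lmat :: "('x, 'a::field) pb \<Rightarrow> ('y, 'a) pb \<Rightarrow> (('x \<Rightarrow> 'a) \<Rightarrow> 'y \<Rightarrow> 'a) \<Rightarrow> 'a fmat" where
  "lmat B B' T = fm (pdim B') (pdim B) (\<lambda>j k. T (pbs B k) (ppt B' j))"

lemma lmat_E: "E (pdim B') * lmat B B' T = lmat B B' T" "lmat B B' T * E (pdim B) = lmat B B' T"
  by (auto simp: lmat_def E_fm fm_E)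

lemma lmat_cong:
  assumes "is_pb U B" "\<And>f. f \<in> U \<Longrightarrow> S f = T f" shows "lmat B B' S = lmat B B' T"
  by (rule fmat_eqI) (use is_pbD(2)[OF assms(1)] assms(2) in \<open>simp add: lmat_def\<close>)

lemma lmat_comp:
  assumes B: "is_pb U B" "is_pb U' B'" and S: "lin S" and T: "\<And>f. f \<in> U \<Longrightarrow> T f \<in> U'"
  shows "lmat B' B'' S * lmat B B' T = lmat B B'' (\<lambda>f. S (T f))"
proof (rule fmat_eqI)
  fix i k
  have "ent (lmat B' B'' S * lmat B B' T) i k = (\<Sum>j<pdim B'. ent (lmat B' B'' S) i j * ent (lmat B B' T) j k)"
    by (rule ent_times_gen) (simp add: lmat_def)
  also have "\<dots> = ent (lmat B B'' (\<lambda>f. S (T f))) i k"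
  proof (cases "i < pdim B'' \<and> k < pdim B")
    case True
    then have f: "T (pbs B k) \<in> U'" using is_pbD(2)[OF B(1)] T by blast
    have "S (T (pbs B k)) = S (\<Sum>j<pdim B'. sc (T (pbs B k) (ppt B' j)) (pbs B' j))"
      using is_pbD(4)[OF B(2) f] by (rule arg_cong)
    also have "\<dots> = (\<Sum>j<pdim B'. sc (T (pbs B k) (ppt B' j)) (S (pbs B' j)))" by (rule lin_sum[OF S])
    finally have "S (T (pbs B k)) (ppt B'' i) = (\<Sum>j<pdim B'. sc (T (pbs B k) (ppt B' j)) (S (pbs B' j))) (ppt B'' i)"
      by (rule arg_cong)
    then show ?thesis using True by (simp add: lmat_def sum_fun_apply mult.commute)
  qed (auto simp: lmat_def)
  finally show "ent (lmat B' B'' S * lmat B B' T) i k = ent (lmat B B'' (\<lambda>f. S (T f))) i k" .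
qed

lemma lmat_id: "is_pb U B \<Longrightarrow> lmat B B (\<lambda>f. f) = E (pdim B)"
  by (rule fmat_eqI) (auto simp: lmat_def ent_E is_pbD(3))

lemma lmat_add: "lmat B B' (\<lambda>f. S f + T f) = lmat B B' S + lmat B B' T"
  and lmat_diff: "lmat B B' (\<lambda>f. S f - T f) = lmat B B' S - lmat B B' T"
  and lmat_zero: "lmat B B' (\<lambda>f. 0) = 0"
  by (auto intro!: fmat_eqI simp: lmat_def)

lemma lmat_sum: "lmat B B' (\<lambda>f. \<Sum>a\<in>A. T a f) = (\<Sum>a\<in>A. lmat B B' (T a))"
  by (auto intro!: fmat_eqI simp: lmat_def sum_fun_apply)

text \<open>\<open>g\<close> acts by \<open>f \<mapsto> f \<circ> t g\<close>; for a left module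
  \<open>t\<close> has to act on points from the right, which is the condition
  \<open>ract\<close>.\<close>

definition prep :: "('x, 'a::field) pb \<Rightarrow> ('g \<Rightarrow> 'x \<Rightarrow> 'x) \<Rightarrow> ('g, 'a) fgmod" where
  "prep B t = \<lparr> mdim = pdim B, mact = (\<lambda>g. mat (pdim B) (pdim B) (\<lambda>(j, k). pbs B k (t g (ppt B j)))) \<rparr>"

lemma mdim_prep [simp]: "mdim (prep B t) = pdim B"
  by (simp add: prep_def)

lemma rh_prep: "rh (prep B t) g = lmat B B (\<lambda>f. f \<circ> t g)"
  by (rule fmat_eqI) (simp add: rh_def prep_def em_def lmat_def)

text \<open>The tensor product of two function spaces, realised inside the functions of two
  variables.\<close>

definition ten :: "('x \<Rightarrow> 'a::field) set \<Rightarrow> ('y \<Rightarrow> 'a) set \<Rightarrow> ('x \<times> 'y \<Rightarrow> 'a) set" where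
  "ten U U' = {H. (\<forall>y. (\<lambda>x. H (x, y)) \<in> U) \<and> (\<forall>x. (\<lambda>y. H (x, y)) \<in> U')}"

definition pbt :: "('x, 'a::field) pb \<Rightarrow> ('y, 'a) pb \<Rightarrow> ('x \<times> 'y, 'a) pb" where
  "pbt B B' = \<lparr> pdim = pdim B * pdim B',
     ppt = (\<lambda>i. (ppt B (i div pdim B'), ppt B' (i mod pdim B'))),
     pbs = (\<lambda>i (x, y). pbs B (i div pdim B') x * pbs B' (i mod pdim B') y) \<rparr>"

lemma fsp_ten: "fsp U \<Longrightarrow> fsp U' \<Longrightarrow> fsp (ten U U')"
  unfolding fsp_subsp by (auto simp: subsp_def ten_def)

lemma is_pb_pbt:
  assumes B: "is_pb U B" and B': "is_pb U' B'" shows "is_pb (ten U U') (pbt B B')"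
proof -
  let ?d = "pdim B" and ?d' = "pdim B'"
  have U: "subsp U" "subsp U'" using is_pbD(1)[OF B] is_pbD(1)[OF B'] by (simp_all add: fsp_subsp)
  have lt: "i div ?d' < ?d \<and> i mod ?d' < ?d'" if "i < ?d * ?d'" for i
    using that less_mult_div[OF that] by (cases "?d' = 0") auto
  have f: "fsp (ten U U')"
    by (rule fsp_ten[OF is_pbD(1)[OF B] is_pbD(1)[OF B']])
  have b: "pbs (pbt B B') i \<in> ten U U'" if "i < ?d * ?d'" for i
  proof -
    have "pbs B (i div ?d') \<in> U" "pbs B' (i mod ?d') \<in> U'"
      using is_pbD(2)[OF B] is_pbD(2)[OF B'] lt[OF that] by auto
    then show ?thesis
      using subspD(3)[OF U(1), of "pbs B (i div ?d')" "pbs B' (i mod ?d') _"]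
        subspD(3)[OF U(2), of "pbs B' (i mod ?d')" "pbs B (i div ?d') _"]
      by (simp add: ten_def pbt_def mult.commute[of "pbs B (i div ?d') _"])
  qed
  have o: "pbs (pbt B B') i (ppt (pbt B B') k) = (if i = k then 1 else 0)" if "i < ?d * ?d'" "k < ?d * ?d'" for i k
  proof -
    have "i = k \<longleftrightarrow> i div ?d' = k div ?d' \<and> i mod ?d' = k mod ?d'" by (metis div_mult_mod_eq)
    then show ?thesis
      using lt[OF that(1)] lt[OF that(2)] by (auto simp: pbt_def is_pbD(3)[OF B] is_pbD(3)[OF B'])
  qed
  have x: "H z = (\<Sum>i<?d * ?d'. H (ppt (pbt B B') i) * pbs (pbt B B') i z)" if H: "H \<in> ten U U'" for H z
  proof -
    obtain x y where z: "z = (x, y)" by (cases z)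
    have e1: "H (x, y) = (\<Sum>j<?d. H (ppt B j, y) * pbs B j x)"
    proof -
      have "\<forall>f\<in>U. \<forall>x. f x = (\<Sum>j<?d. f (ppt B j) * pbs B j x)" using B by (simp add: is_pb_def pbas_def)
      from this[rule_format, of "\<lambda>x. H (x, y)" x] H show ?thesis by (simp add: ten_def)
    qed
    have e2: "H (x', y) = (\<Sum>k<?d'. H (x', ppt B' k) * pbs B' k y)" for x'
    proof -
      have "\<forall>f\<in>U'. \<forall>y. f y = (\<Sum>k<?d'. f (ppt B' k) * pbs B' k y)" using B' by (simp add: is_pb_def pbas_def)
      from this[rule_format, of "\<lambda>y. H (x', y)" y] H show ?thesis by (simp add: ten_def)
    qed
    have "H z = (\<Sum>j<?d. \<Sum>k<?d'. H (ppt B j, ppt B' k) * (pbs B j x * pbs B' k y))"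
      unfolding z e1 by (subst e2) (simp add: sum_distrib_right mult.assoc mult.commute[of "pbs B _ x"])
    also have "\<dots> = (\<Sum>i<?d * ?d'. H (ppt B (i div ?d'), ppt B' (i mod ?d')) * (pbs B (i div ?d') x * pbs B' (i mod ?d') y))"
      by (rule sum_divmod[symmetric])
    finally show ?thesis by (simp add: pbt_def z)
  qed
  show ?thesis unfolding is_pb_def pbas_def using f b o x by (simp add: pbt_def)
qed

text \<open>An equality of modules, because \<open>pbt\<close> numbers pairs of basis functions in
  the same way as \<open>kronecker\<close>.\<close>

lemma tensor_prep:
  "tensor (prep B t) (prep B' t') = prep (pbt B B') (\<lambda>g. map_prod (t g) (t' g))"
proof -
  have "kronecker (mat (pdim B) (pdim B) (\<lambda>(j, k). pbs B k (t g (ppt B j)))) (mat (pdim B') (pdim B') (\<lambda>(j, k). pbs B' k (t' g (ppt B' j))))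
    = mat (pdim B * pdim B') (pdim B * pdim B') (\<lambda>(j, k). pbs (pbt B B') k (map_prod (t g) (t' g) (ppt (pbt B B') j)))" for g
  proof (rule eq_matI)
    fix i k
    assume "i < dim_row (mat (pdim B * pdim B') (pdim B * pdim B') (\<lambda>(j, k). pbs (pbt B B') k (map_prod (t g) (t' g) (ppt (pbt B B') j))))"
      "k < dim_col (mat (pdim B * pdim B') (pdim B * pdim B') (\<lambda>(j, k). pbs (pbt B B') k (map_prod (t g) (t' g) (ppt (pbt B B') j))))"
    then have ik: "i < pdim B * pdim B'" "k < pdim B * pdim B'" by auto
    then have "0 < pdim B'" by (auto intro: ccontr)
    then show "kronecker (mat (pdim B) (pdim B) (\<lambda>(j, k). pbs B k (t g (ppt B j)))) (mat (pdim B') (pdim B') (\<lambda>(j, k). pbs B' k (t' g (ppt B' j)))) $$ (i, k)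
      = mat (pdim B * pdim B') (pdim B * pdim B') (\<lambda>(j, k). pbs (pbt B B') k (map_prod (t g) (t' g) (ppt (pbt B B') j))) $$ (i, k)"
      using ik less_mult_div[OF ik(1)] less_mult_div[OF ik(2)] by (simp add: kronecker_def pbt_def)
  qed (simp_all add: kronecker_def)
  then show ?thesis by (simp add: tensor_def prep_def) (simp add: pbt_def)
qed

context fin_group
begin

definition ract :: "('g \<Rightarrow> 'x \<Rightarrow> 'x) \<Rightarrow> bool" where
  "ract t \<longleftrightarrow> t \<one> = id \<and> (\<forall>g\<in>carrier G. \<forall>h\<in>carrier G. t (g \<otimes> h) = t h \<circ> t g)"

definition stab :: "('x \<Rightarrow> 'a::field) set \<Rightarrow> ('g \<Rightarrow> 'x \<Rightarrow> 'x) \<Rightarrow> bool" where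
  "stab U t \<longleftrightarrow> (\<forall>g\<in>carrier G. \<forall>f\<in>U. f \<circ> t g \<in> U)"

lemma ract_prod: "ract t \<Longrightarrow> ract t' \<Longrightarrow> ract (\<lambda>g. map_prod (t g) (t' g))"
  by (auto simp: ract_def map_prod_def fun_eq_iff)

lemma stab_ten: "stab U t \<Longrightarrow> stab U' t' \<Longrightarrow> stab (ten U U') (\<lambda>g. map_prod (t g) (t' g))"
  unfolding stab_def
proof (intro ballI)
  fix g H
  assume t: "\<forall>g\<in>carrier G. \<forall>f\<in>U. f \<circ> t g \<in> U" "\<forall>g\<in>carrier G. \<forall>f\<in>U'. f \<circ> t' g \<in> U'"
    and g: "g \<in> carrier G" and H: "H \<in> ten U U'"
  have 1: "(\<lambda>x. H (x, y)) \<circ> t g \<in> U" for y using t(1) g H by (simp add: ten_def)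
  have 2: "(\<lambda>y. H (x, y)) \<circ> t' g \<in> U'" for x using t(2) g H by (simp add: ten_def)
  show "H \<circ> map_prod (t g) (t' g) \<in> ten U U'"
    using 1[of "t' g _"] 2[of "t g _"] by (simp add: ten_def comp_def)
qed

lemma md_prep:
  assumes B: "is_pb U B" and t: "ract t" "stab U t" shows "md (prep B t)"
  unfolding is_fgmod_def
proof (intro conjI ballI)
  have c: "mact (prep B t) g \<in> carrier_mat (pdim B) (pdim B)" for g by (simp add: prep_def)
  then show "mact (prep B t) g \<in> carrier_mat (mdim (prep B t)) (mdim (prep B t))" for g by simp
  have "em (mact (prep B t) \<one>) = em (1\<^sub>m (pdim B))"
    using rh_prep[of B t \<one>] t(1) lmat_id[OF B] by (simp add: ract_def rh_def em_one)
  then show "mact (prep B t) \<one> = 1\<^sub>m (mdim (prep B t))" using em_inj[OF c] by simp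
  fix g h assume g: "g \<in> carrier G" and h: "h \<in> carrier G"
  have "(\<lambda>f. f \<circ> t (g \<otimes> h)) = (\<lambda>f. (f \<circ> t h) \<circ> t g :: _ \<Rightarrow> 'b)"
    using t(1) g h by (simp add: ract_def comp_assoc)
  then have "rh (prep B t) (g \<otimes> h) = rh (prep B t) g * rh (prep B t) h"
    unfolding rh_prep using lmat_comp[OF B B lin_comp[of "t g"], of "\<lambda>f. f \<circ> t h"] t(2) h by (simp add: stab_def)
  then show "mact (prep B t) (g \<otimes> h) = mact (prep B t) g * mact (prep B t) h"
    using em_mult[OF c[of g] c[of h]] by (intro em_inj[OF c mult_carrier_mat[OF c c]]) (simp add: rh_def)
qed

lemma hm_lmat:
  assumes B: "is_pb U B" "is_pb U' B'" and t: "stab U t" "stab U' t'" and T: "lin T" "\<And>f. f \<in> U \<Longrightarrow> T f \<in> U'"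
    and eq: "\<And>f g. g \<in> carrier G \<Longrightarrow> f \<in> U \<Longrightarrow> T (f \<circ> t g) = T f \<circ> t' g"
  shows "hm G (prep B t) (prep B' t') (lmat B B' T)"
  unfolding hm_def
proof (intro conjI ballI)
  fix g assume g: "g \<in> carrier G"
  have "lmat B B' T * rh (prep B t) g = lmat B B' (\<lambda>f. T (f \<circ> t g))"
    unfolding rh_prep by (rule lmat_comp[OF B(1,1) T(1)]) (use t g in \<open>simp add: stab_def\<close>)
  also have "\<dots> = lmat B B' (\<lambda>f. T f \<circ> t' g)" by (rule lmat_cong[OF B(1) eq[OF g]])
  also have "\<dots> = rh (prep B' t') g * lmat B B' T"
    unfolding rh_prep by (rule lmat_comp[OF B lin_comp T(2), symmetric])
  finally show "lmat B B' T * rh (prep B t) g = rh (prep B' t') g * lmat B B' T" .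
qed (simp_all add: lmat_E)

lemma Tr_lmat:
  assumes B: "is_pb U B" "is_pb U' B'" and t: "stab U t" "stab U' t'" and T: "lin T" "\<And>f. f \<in> U \<Longrightarrow> T f \<in> U'"
  shows "Tr (prep B t) (prep B' t') (lmat B B' T) = lmat B B' (\<lambda>f. \<Sum>g\<in>carrier G. T (f \<circ> t (inv g)) \<circ> t' g)"
  unfolding Tr_def lmat_sum
proof (rule sum.cong)
  fix g assume g: "g \<in> carrier G"
  have st: "f \<circ> t (inv g) \<in> U" if "f \<in> U" for f using t(1) g that by (simp add: stab_def)
  have "rh (prep B' t') g * lmat B B' T = lmat B B' (\<lambda>f. T f \<circ> t' g)"
    unfolding rh_prep by (rule lmat_comp[OF B lin_comp T(2)])
  then have "rh (prep B' t') g * lmat B B' T * rh (prep B t) (inv g) = lmat B B' (\<lambda>f. T f \<circ> t' g) * lmat B B (\<lambda>f. f \<circ> t (inv g))"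
    by (simp only: rh_prep)
  also have "\<dots> = lmat B B' (\<lambda>f. T (f \<circ> t (inv g)) \<circ> t' g)"
    by (rule lmat_comp[OF B(1,1) lin_compose[OF lin_comp T(1)] st])
  finally show "rh (prep B' t') g * lmat B B' T * rh (prep B t) (inv g) = lmat B B' (\<lambda>f. T (f \<circ> t (inv g)) \<circ> t' g)" .
qed simp

end

section \<open>Tensoring with the first hook module\<close>

text \<open>A function in degree two that is killed by \<open>delta\<close> has the form \<open>H [a, b] = h a - h b\<close>; \<open>sl\<close> and
  \<open>dif\<close> translate between \<open>H\<close> and \<open>h\<close>, where \<open>sl b\<close> normalises \<open>h\<close> to vanish at \<open>b\<close>.\<close>

definition sl :: "'b \<Rightarrow> 'b \<Rightarrow> ('b list \<times> 'y \<Rightarrow> 'a) \<Rightarrow> 'y \<Rightarrow> 'a" where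
  "sl b a H = (\<lambda>y. H ([a, b], y))"

definition dif :: "'b set \<Rightarrow> ('b \<Rightarrow> 'y \<Rightarrow> 'a::field) \<Rightarrow> 'b list \<times> 'y \<Rightarrow> 'a" where
  "dif I F = (\<lambda>(xs, y). case xs of [a, b] \<Rightarrow> if a \<in> I \<and> b \<in> I then F a y - F b y else 0 | _ \<Rightarrow> 0)"

lemma sl_dif: "a \<in> I \<Longrightarrow> b \<in> I \<Longrightarrow> sl b a (dif I F) = F a - F b"
  by (simp add: sl_def dif_def fun_eq_iff)

lemma sl_simps: "sl b a (H + K) = sl b a H + sl b a K" "sl b a (H - K) = sl b a H - sl b a K"
  "sl b a (sc c H) = sc c (sl b a H)" "sl b a 0 = 0" "sl b a (sum S A) = (\<Sum>i\<in>A. sl b a (S i))"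
  by (auto simp: sl_def fun_eq_iff sum_fun_apply)

lemma dif_simps: "dif I (\<lambda>a. F a + K a) = dif I F + dif I K" "dif I (\<lambda>a. sc c (F a)) = sc c (dif I F)"
  by (auto simp: dif_def fun_eq_iff algebra_simps split: list.split)

lemma sl_comp: "sl b a (H \<circ> map_prod (map s) (map s)) = sl (s b) (s a) H \<circ> map s"
  by (simp add: sl_def fun_eq_iff)

lemma dif_comp: "s permutes I \<Longrightarrow> dif I F \<circ> map_prod (map s) (map s) = dif I (\<lambda>a. F (s a) \<circ> map s)"
  by (auto simp: dif_def fun_eq_iff permutes_in_image split: list.split)

lemma dirac_comp: "s permutes I \<Longrightarrow> dirac (s a) \<circ> s = dirac a"
  by (auto simp: dirac_apply fun_eq_iff dest: permutes_inj injD)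

lemma wedge_dirac_comp: "s permutes I \<Longrightarrow> wedge (dirac a) (f \<circ> map s) = wedge (dirac (s a)) f \<circ> map s"
  by (simp only: wedge_comp_map dirac_comp)

lemma del_comp: "del a (f \<circ> map s) = del (s a) f \<circ> map s"
  by (simp add: fun_eq_iff)

context clifford_space
begin

abbreviation TT :: "nat \<Rightarrow> ('b list \<times> 'b list \<Rightarrow> 'a) set" where "TT n \<equiv> ten (UU 2) (UU n)"

lemma sl_UU: "H \<in> TT n \<Longrightarrow> sl b a H \<in> UU n"
  by (simp add: ten_def sl_def)

lemma sl_diff: "H \<in> TT n \<Longrightarrow> a \<in> I \<Longrightarrow> b \<in> I \<Longrightarrow> c \<in> I \<Longrightarrow> sl b a H = sl c a H - sl c b H"
proof
  fix ys assume H: "H \<in> TT n" and I: "a \<in> I" "b \<in> I" "c \<in> I"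
  let ?f = "\<lambda>xs. H (xs, ys)"
  have "?f \<in> UU 2" using H by (simp add: ten_def)
  then have "delta ?f = 0" by (simp add: UU_def)
  then have "delta ?f [a, b, c] = 0" by (simp only: zero_fun_def)
  then show "sl b a H ys = (sl c a H - sl c b H) ys"
    using I by (simp add: sl_def ones_apply)
qed

lemma sl_sum: "H \<in> TT n \<Longrightarrow> (\<Sum>a\<in>I. sl b a H) = 0"
proof
  fix ys assume H: "H \<in> TT n"
  let ?f = "\<lambda>xs. H (xs, ys)"
  have "?f \<in> UU 2" using H by (simp add: ten_def)
  then have "bd ?f = 0" by (simp add: UU_def)
  then have "bd ?f [b] = 0" by (simp only: zero_fun_def)
  then show "(\<Sum>a\<in>I. sl b a H) ys = 0 ys"
    by (simp add: sl_def contr_def sum_fun_apply ones_apply)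
qed

lemma ten_ext:
  assumes "H \<in> TT n" "K \<in> TT n" "\<And>a b. a \<in> I \<Longrightarrow> b \<in> I \<Longrightarrow> sl b a H = sl b a K" shows "H = K"
proof
  fix z :: "'b list \<times> 'b list"
  obtain xs ys where z: "z = (xs, ys)" by (cases z)
  have s: "L (xs, ys) = 0" if "L \<in> TT n" "\<not> (length xs = 2 \<and> set xs \<subseteq> I)" for L
  proof -
    have "(\<lambda>xs. L (xs, ys)) \<in> UU 2" using that by (simp add: ten_def)
    then have "alt I 2 (\<lambda>xs. L (xs, ys))" by (simp add: UU_def)
    then show ?thesis using alt_support[OF two, of I 2 "\<lambda>xs. L (xs, ys)" xs] that by blast
  qed
  show "H z = K z"
  proof (cases "length xs = 2 \<and> set xs \<subseteq> I")
    case True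
    then obtain a b where "xs = [a, b]" "a \<in> I" "b \<in> I"
      by (cases xs; cases "tl xs") auto
    then show ?thesis using assms(3)[of a b] by (simp add: z sl_def fun_eq_iff)
  qed (simp add: z s[OF assms(1)] s[OF assms(2)])
qed

text \<open>Differences are automatically alternating and killed by \<open>delta\<close>. For
  \<open>bd\<close> the sum of all \<open>F a\<close> contributes zero by assumption, and the other
  term is a multiple of \<open>card I\<close>, which is zero in the field.\<close>

lemma dif_TT:
  assumes F: "\<And>a b. a \<in> I \<Longrightarrow> b \<in> I \<Longrightarrow> F a - F b \<in> UU n" and s: "(\<Sum>a\<in>I. F a) = 0"
  shows "dif I F \<in> TT n"
  unfolding ten_def
proof (intro CollectI conjI allI)
  fix xs
  show "(\<lambda>ys. dif I F (xs, ys)) \<in> UU n"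
  proof (cases "\<exists>a b. xs = [a, b] \<and> a \<in> I \<and> b \<in> I")
    case True
    then obtain a b where "xs = [a, b]" "a \<in> I" "b \<in> I" by blast
    then have "(\<lambda>ys. dif I F (xs, ys)) = F a - F b" by (simp add: dif_def fun_eq_iff)
    then show ?thesis using F \<open>a \<in> I\<close> \<open>b \<in> I\<close> by simp
  next
    case False
    then have "(\<lambda>ys. dif I F (xs, ys)) = 0" by (auto simp: dif_def fun_eq_iff split: list.split)
    then show ?thesis using fspD(1)[OF fsp_UU, of n] by simp
  qed
next
  fix ys
  define f where "f = (\<lambda>xs. dif I F (xs, ys))"
  have f2: "f [a, b] = (if a \<in> I \<and> b \<in> I then F a ys - F b ys else 0)" for a b by (simp add: f_def dif_def)
  have f0: "f xs = 0" if "length xs \<noteq> 2" for xs using that by (auto simp: f_def dif_def split: list.split)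
  have d3: "del c (del b (del a f)) = 0" for a b c by (auto simp: fun_eq_iff f0)
  have sw: "del a (del b f) = - del b (del a f)" for a b
  proof
    fix xs show "del a (del b f) xs = (- del b (del a f)) xs" by (cases xs) (simp_all add: f0 f2)
  qed
  have out: "del a f = 0 \<and> del b (del a f) = 0 \<and> del a (del b f) = 0" if "a \<notin> I" for a b
  proof -
    have "f (a # xs) = 0 \<and> f (b # a # xs) = 0 \<and> f (a # b # xs) = 0" for xs b
      using that f0 by (cases xs; cases "tl xs") (auto simp: f2 f0)
    then show ?thesis by (simp add: fun_eq_iff)
  qed
  have a2: "alt I (Suc (Suc 0)) f"
    unfolding alt.simps(2)
  proof (intro conjI allI impI)
    show "f [] = 0" "del a f [] = 0" for a by (simp_all add: f0)
    show "alt I 0 (del b (del a f))" for a b unfolding alt.simps(1) using d3 by blast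
    show "del a (del b f) = - del b (del a f)" for a b by (rule sw)
    show "del b (del c (del a f)) = - del c (del b (del a f))" for a b c by (simp only: d3 minus_zero)
    show "del a f = 0" "del a (del b f) = 0" if "a \<notin> I" for a b using out[OF that] by blast+
  qed
  have "delta f = 0"
  proof
    fix xs :: "'b list"
    consider "length xs \<noteq> 3" | a b c where "xs = [a, b, c]"
      by (cases xs; cases "tl xs"; cases "tl (tl xs)"; cases "tl (tl (tl xs))") auto
    then show "delta f xs = 0 xs"
    proof cases
      case 1
      have "alt I (Suc (Suc (Suc 0))) (delta f)" by (rule alt_delta[OF a2])
      then show ?thesis using alt_support[OF two, of I "Suc (Suc (Suc 0))" "delta f" xs] 1 by auto
    next
      case 2
      then show ?thesis by (simp add: f2 ones_apply)
    qed
  qed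
  moreover have "bd f = 0"
  proof
    fix xs show "bd f xs = 0 xs"
    proof (cases "\<exists>b\<in>I. xs = [b]")
      case True
      then obtain b where b: "xs = [b]" "b \<in> I" by blast
      have "bd f xs = (\<Sum>a\<in>I. F a ys) - of_nat (card I) * F b ys"
        using b by (simp add: contr_def sum_fun_apply ones_apply f2 sum_subtractf)
      also have "(\<Sum>a\<in>I. F a ys) = (\<Sum>a\<in>I. F a) ys" by (simp add: sum_fun_apply)
      finally show ?thesis unfolding s card0 by simp
    next
      case False
      have "f (a # xs) = 0" if "a \<in> I" for a
        using False f0 by (cases xs; cases "tl xs") (auto simp: f2)
      then show ?thesis by (simp add: contr_def sum_fun_apply)
    qed
  qed
  ultimately show "(\<lambda>xs. dif I F (xs, ys)) \<in> UU 2"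
    unfolding f_def[symmetric] UU_def numeral_2_eq_2 using a2 by blast
qed

text \<open>\<open>mu\<close> and \<open>cc\<close> are the projections of \<open>D\<^sub>1 \<otimes> D\<^sub>n\<^sub>-\<^sub>1\<close> to \<open>D\<^sub>n\<close> and \<open>D\<^sub>n\<^sub>-\<^sub>2\<close>, and \<open>comu\<close>, \<open>cocc\<close> the injections up to
  scalars. The group permutes the maps \<open>theta c d\<close> as it permutes pairs, so their sum is a trace
  and therefore vanishes in the stable category.\<close>

definition mu :: "'b \<Rightarrow> ('b list \<times> 'b list \<Rightarrow> 'a) \<Rightarrow> 'b list \<Rightarrow> 'a" where
  "mu b H = (\<Sum>a\<in>I. wedge (dirac a) (sl b a H))"
definition cc :: "'b \<Rightarrow> ('b list \<times> 'b list \<Rightarrow> 'a) \<Rightarrow> 'b list \<Rightarrow> 'a" where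
  "cc b H = (\<Sum>a\<in>I. del a (sl b a H))"
definition comu :: "('b list \<Rightarrow> 'a) \<Rightarrow> 'b list \<times> 'b list \<Rightarrow> 'a" where
  "comu w = dif I (\<lambda>a. del a w)"
definition cocc :: "('b list \<Rightarrow> 'a) \<Rightarrow> 'b list \<times> 'b list \<Rightarrow> 'a" where
  "cocc w = dif I (\<lambda>a. wedge (dirac a) w)"
definition theta :: "'b \<Rightarrow> 'b \<Rightarrow> ('b list \<times> 'b list \<Rightarrow> 'a) \<Rightarrow> 'b list \<times> 'b list \<Rightarrow> 'a" where
  "theta c d H = dif I (\<lambda>a. sc ((dirac c - dirac d) a) (wedge (dirac c - dirac d) (contr I (dirac c - dirac d) (sl d c H))))"

lemma UUD: "f \<in> UU n \<Longrightarrow> alt I n f" "f \<in> UU n \<Longrightarrow> delta f = 0" "f \<in> UU n \<Longrightarrow> bd f = 0"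
  by (simp_all add: UU_def)

lemma mu_UU:
  assumes H: "H \<in> TT n" and b: "b \<in> I" shows "mu b H \<in> UU (Suc n)"
proof -
  note h = sl_UU[OF H]
  have "alt I (Suc n) (mu b H)"
    unfolding mu_def using UUD(1)[OF h] by (intro alt_sum alt_dirac_wedge)
  moreover have "delta (mu b H) = 0"
    unfolding mu_def wedge_sum wedge_anti[of "ones I"] UUD(2)[OF h] by simp
  moreover have "bd (mu b H) = (\<Sum>a\<in>I. sl b a H)"
    unfolding mu_def contr_sum clifford UUD(3)[OF h] by (rule sum.cong) simp_all
  ultimately show ?thesis using sl_sum[OF H, of b] by (simp add: UU_def)
qed

lemma cc_UU:
  assumes H: "H \<in> TT (Suc n)" and b: "b \<in> I" shows "cc b H \<in> UU n"
proof -
  note h = sl_UU[OF H]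
  have "alt I n (cc b H)"
    unfolding cc_def using UUD(1)[OF h] by (intro alt_sum alt_del)
  moreover have "delta (cc b H) = (\<Sum>a\<in>I. sl b a H)"
    unfolding cc_def wedge_sum using UU_delta[OF h] by (intro sum.cong) simp_all
  moreover have "bd (cc b H) = 0"
  proof -
    have "bd (del a (sl b a H)) = 0" for a
      using del_contr[OF UUD(1)[OF h], of a "ones I" b a] UUD(3)[OF h, of b a] by simp
    then show ?thesis by (simp add: cc_def)
  qed
  ultimately show ?thesis using sl_sum[OF H, of b] by (simp add: UU_def)
qed

lemma comu_TT:
  assumes w: "w \<in> UU (Suc n)" shows "comu w \<in> TT n"
  unfolding comu_def
proof (rule dif_TT)
  fix a b assume I: "a \<in> I" "b \<in> I"
  have "bd (del c w) = 0" for c using del_contr[OF UUD(1)[OF w], of c "ones I"] UUD(3)[OF w] by simp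
  then show "del a w - del b w \<in> UU n"
    using UUD(1)[OF w] UU_delta[OF w I(1)] UU_delta[OF w I(2)] by (simp add: UU_def alt_diff alt_del)
qed (simp add: sum_del UUD(3)[OF w])

lemma cocc_TT:
  assumes w: "w \<in> UU n" shows "cocc w \<in> TT (Suc n)"
  unfolding cocc_def
proof (rule dif_TT)
  fix a b assume I: "a \<in> I" "b \<in> I"
  have "delta (wedge (dirac c) w) = 0" for c unfolding wedge_anti[of "ones I"] UUD(2)[OF w] by simp
  then show "wedge (dirac a) w - wedge (dirac b) w \<in> UU (Suc n)"
    using UUD(1,3)[OF w] I by (simp add: UU_def alt_diff alt_dirac_wedge clifford)
qed (simp add: sum_wedge UUD(2)[OF w])

lemma reflection_UU:
  assumes f: "f \<in> UU n" and I: "c \<in> I" "d \<in> I"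
  shows "wedge (dirac c - dirac d) (contr I (dirac c - dirac d) f) \<in> UU n"
proof (cases n)
  case 0
  then have "f = 0" using f UU_0 by blast
  then show ?thesis using fspD(1)[OF fsp_UU, of n] by simp
next
  case (Suc m)
  let ?u = "dirac c - dirac d :: 'b \<Rightarrow> 'a"
  have d: "contr I ?u f = del c f - del d f" using I by (simp add: contr_dirac finI)
  have "alt I (Suc m) (wedge ?u (contr I ?u f))"
  proof (rule alt_wedge)
    show "alt I m (contr I ?u f)" by (rule alt_contr) (use UUD(1)[OF f] Suc in simp)
  qed (use I in \<open>auto simp: dirac_apply\<close>)
  moreover have "delta (contr I ?u f) = 0" unfolding d using UU_delta[OF f] I by simp
  then have "delta (wedge ?u (contr I ?u f)) = 0" unfolding wedge_anti[of "ones I"] by simp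
  moreover have "bd (contr I ?u f) = 0" using contr_anti[OF UUD(1)[OF f], of "ones I" ?u] UUD(3)[OF f] by simp
  then have "bd (wedge ?u (contr I ?u f)) = 0" using I by (simp add: clifford)
  ultimately show ?thesis by (simp add: UU_def Suc)
qed

lemma theta_TT:
  assumes H: "H \<in> TT n" and I: "c \<in> I" "d \<in> I" shows "theta c d H \<in> TT n"
  unfolding theta_def
proof (rule dif_TT)
  let ?K = "wedge (dirac c - dirac d) (contr I (dirac c - dirac d) (sl d c H))"
  have K: "?K \<in> UU n" by (rule reflection_UU[OF sl_UU[OF H] I])
  show "sc ((dirac c - dirac d) a) ?K - sc ((dirac c - dirac d) b) ?K \<in> UU n" for a b
    by (intro fspD[OF fsp_UU] K)
  have "(\<Sum>a\<in>I. (dirac c - dirac d) a) = (0 :: 'a)" using I finI by (simp add: sum_subtractf dirac_apply)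
  then show "(\<Sum>a\<in>I. sc ((dirac c - dirac d) a) ?K) = 0" unfolding sc_sum(2)[symmetric] by simp
qed

text \<open>\<open>euler\<close> contributes the degree \<open>n + 1\<close>, and the slice at the
  base point subtracts 1.\<close>

lemma mu_comu:
  assumes w: "w \<in> UU (Suc n)" and b: "b \<in> I" shows "mu b (comu w) = sc (of_nat n) w"
proof -
  have "mu b (comu w) = (\<Sum>a\<in>I. wedge (dirac a) (del a w)) - (\<Sum>a\<in>I. wedge (dirac a) (del b w))"
    unfolding mu_def comu_def sum_subtractf[symmetric] using b by (intro sum.cong) (simp_all add: sl_dif)
  also have "\<dots> = sc (of_nat (Suc n)) w - w"
    unfolding euler[OF finI UUD(1)[OF w]] sum_wedge UU_delta[OF w b] ..
  also have "\<dots> = sc (of_nat n) w" by (simp add: fun_eq_iff algebra_simps)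
  finally show ?thesis .
qed

lemma sum_del_wedge: "(\<Sum>a\<in>I. del a (wedge (dirac a) w)) = - (\<Sum>a\<in>I. wedge (dirac a) (del a w) :: _ \<Rightarrow> 'a)"
proof -
  have "(\<Sum>a\<in>I. del a (wedge (dirac a) w)) = (\<Sum>a\<in>I. w) - (\<Sum>a\<in>I. wedge (dirac a) (del a w))"
    unfolding sum_subtractf[symmetric] by (intro sum.cong) (simp_all add: del_wedge dirac_apply)
  moreover have "(\<Sum>a\<in>I. w) = sc (of_nat (card I)) w" by (simp add: fun_eq_iff sum_fun_apply)
  ultimately show ?thesis using card0 by simp
qed

text \<open>Exchanging \<open>del a\<close> and \<open>wedge (dirac a)\<close> reverses the sign in
  \<open>euler\<close>, as the scalar term is \<open>card I = 0\<close> in the field; the base point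
  again subtracts 1.\<close>

lemma cc_cocc:
  assumes w: "w \<in> UU n" and b: "b \<in> I" shows "cc b (cocc w) = - sc (of_nat (Suc n)) w"
proof -
  have "cc b (cocc w) = (\<Sum>a\<in>I. del a (wedge (dirac a) w)) - (\<Sum>a\<in>I. del a (wedge (dirac b) w))"
    unfolding cc_def cocc_def sum_subtractf[symmetric] using b by (intro sum.cong) (simp_all add: sl_dif)
  also have "(\<Sum>a\<in>I. del a (wedge (dirac b) w)) = w"
    unfolding sum_del clifford UUD(3)[OF w] using b by simp
  also have "(\<Sum>a\<in>I. del a (wedge (dirac a) w)) - w = - sc (of_nat (Suc n)) w"
    unfolding sum_del_wedge euler[OF finI UUD(1)[OF w]] by (simp add: fun_eq_iff algebra_simps)
  finally show ?thesis .
qed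

lemma cc_comu:
  assumes w: "w \<in> UU n" and b: "b \<in> I" shows "cc b (comu w) = 0"
proof -
  have "cc b (comu w) = (\<Sum>a\<in>I. del a (del a w)) - (\<Sum>a\<in>I. del a (del b w))"
    unfolding cc_def comu_def sum_subtractf[symmetric] using b by (intro sum.cong) (simp_all add: sl_dif)
  also have "(\<Sum>a\<in>I. del a (del b w)) = 0"
    unfolding sum_del using del_contr[OF UUD(1)[OF w], of b "ones I"] UUD(3)[OF w] by simp
  finally have eq: "cc b (comu w) = (\<Sum>a\<in>I. del a (del a w)) - 0" .
  have "del a (del a w) = 0" for a
  proof
    fix xs
    have "del a (del a w) = - del a (del a w)" by (rule alt_swap[OF UUD(1)[OF w]])
    then have "del a (del a w) xs = - del a (del a w) xs" by (metis uminus_apply)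
    then have "2 * w (a # a # xs) = 0" by simp
    then show "del a (del a w) xs = 0 xs" using two by simp
  qed
  then show ?thesis unfolding eq by simp
qed

lemma mu_cocc:
  assumes w: "w \<in> UU n" and b: "b \<in> I" shows "mu b (cocc w) = 0"
proof -
  have "mu b (cocc w) = (\<Sum>a\<in>I. wedge (dirac a) (wedge (dirac a) w)) - (\<Sum>a\<in>I. wedge (dirac a) (wedge (dirac b) w))"
    unfolding mu_def cocc_def sum_subtractf[symmetric] using b by (intro sum.cong) (simp_all add: sl_dif)
  then show ?thesis unfolding sum_wedge wedge_anti[of "ones I"] UUD(2)[OF w] by simp
qed

text \<open>For \<open>c \<noteq> d\<close> the map \<open>theta c d\<close> is \<open>1 - t\<close>
  on both tensor factors, where \<open>t\<close> is the transposition of \<open>c\<close> and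
  \<open>d\<close> and \<open>1 - t\<close> is written as a reflection operator. The sum over all
  pairs yields the decomposition of \<open>n\<close> times the identity into \<open>comu\<close>
  after \<open>mu\<close>, minus \<open>cocc\<close> after \<open>cc\<close>, plus half of that
  sum.\<close>

lemma theta_sum:
  assumes H: "H \<in> TT n" and b: "b \<in> I"
  shows "(\<Sum>c\<in>I. \<Sum>d\<in>I. theta c d H) = sc 2 (sc (of_nat n) H + cocc (cc b H) - comu (mu b H))"
proof -
  define K where "K c d = wedge (dirac c - dirac d) (contr I (dirac c - dirac d) (sl d c H))" for c d
  define h where "h a = sl b a H" for a
  have hUU: "h a \<in> UU n" for a unfolding h_def by (rule sl_UU[OF H])
  have sh: "sl d a H = h a - h d" if "a \<in> I" "d \<in> I" for a d
    unfolding h_def by (rule sl_diff[OF H that b])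
  have h0: "(\<Sum>d\<in>I. h d) = 0" unfolding h_def by (rule sl_sum[OF H])
  have cch: "(\<Sum>d\<in>I. del d (h d)) = cc b H" and muh: "(\<Sum>d\<in>I. wedge (dirac d) (h d)) = mu b H"
    by (simp_all add: cc_def mu_def h_def)
  \<comment> \<open>Independent of \<open>a\<close>, so it cancels in the differences formed by
    \<open>dif\<close>.\<close>
  define Q where "Q = (\<Sum>d\<in>I. wedge (dirac d) (del d (h d)))"
  \<comment> \<open>Expanding \<open>K a d\<close> in both differences gives eight sums over
    \<open>d\<close>. The one with constant terms is a multiple of \<open>card I\<close>, some
    vanish by \<open>h0\<close> or because \<open>bd\<close> kills the slices, and
    \<open>UU_delta\<close> and \<open>euler\<close> evaluate others.\<close>
  have S: "(\<Sum>d\<in>I. K a d) = sc (of_nat n) (h a) + wedge (dirac a) (cc b H) - del a (mu b H) - Q" if a: "a \<in> I" for a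
  proof -
    have dmu: "del a (mu b H) = h a - (\<Sum>d\<in>I. wedge (dirac d) (del a (h d)))"
    proof -
      have "del a (mu b H) = (\<Sum>d\<in>I. sc (if d = a then 1 else 0) (h d)) - (\<Sum>d\<in>I. wedge (dirac d) (del a (h d)))"
        unfolding muh[symmetric] del_simps sum_subtractf[symmetric] by (rule sum.cong) (auto simp: del_wedge dirac_apply)
      then show ?thesis unfolding sum_sc_delta[OF finI] using a by simp
    qed
    have "K a d = (wedge (dirac a) (del a (h a)) - wedge (dirac a) (del a (h d)) - wedge (dirac a) (del d (h a)) + wedge (dirac a) (del d (h d)))
        - (wedge (dirac d) (del a (h a)) - wedge (dirac d) (del a (h d)) - wedge (dirac d) (del d (h a)) + wedge (dirac d) (del d (h d)))" if "d \<in> I" for d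
      unfolding K_def sh[OF a that] using a that by (simp add: contr_dirac[OF finI] algebra_simps)
    then have "(\<Sum>d\<in>I. K a d) = (\<Sum>d\<in>I. wedge (dirac a) (del a (h a))) - wedge (dirac a) (del a (\<Sum>d\<in>I. h d)) - wedge (dirac a) (\<Sum>d\<in>I. del d (h a))
        + wedge (dirac a) (\<Sum>d\<in>I. del d (h d))
        - ((\<Sum>d\<in>I. wedge (dirac d) (del a (h a))) - (\<Sum>d\<in>I. wedge (dirac d) (del a (h d))) - (\<Sum>d\<in>I. wedge (dirac d) (del d (h a))) + Q)"
      unfolding del_simps wedge_sum Q_def by (simp add: sum_subtractf sum.distrib)
    also have "(\<Sum>d\<in>I. wedge (dirac a) (del a (h a))) = sc (of_nat (card I)) (wedge (dirac a) (del a (h a)))"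
      by (simp add: fun_eq_iff sum_fun_apply)
    also have "\<dots> = 0" by (simp add: card0)
    finally have eq: "(\<Sum>d\<in>I. K a d) = 0 - wedge (dirac a) (del a 0) - wedge (dirac a) 0 + wedge (dirac a) (cc b H)
        - (h a - (\<Sum>d\<in>I. wedge (dirac d) (del a (h d))) - sc (of_nat n) (h a) + Q)"
      unfolding h0 cch sum_del sum_wedge UU_delta[OF hUU a] euler[OF finI UUD(1)[OF hUU]] UUD(3)[OF hUU] .
    show ?thesis unfolding eq dmu del_simps(5) wedge_simps(4) by (simp only: algebra_simps diff_0 diff_0_right add_0_left add_0_right)
  qed
  have Ks: "K c d = - K d c" if "c \<in> I" "d \<in> I" for c d
  proof -
    have "dirac c - dirac d = - (dirac d - dirac c :: 'b \<Rightarrow> 'a)" "sl d c H = - sl c d H" using sh[OF that] sh[OF that(2,1)] by simp_all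
    then have "K c d = - wedge (dirac d - dirac c) (contr I (- (dirac d - dirac c)) (- sl c d H))" unfolding K_def by (simp only: wedge_simps)
    moreover have "contr I (- (dirac d - dirac c)) (- f) = contr I (dirac d - dirac c) f" for f :: "'b list \<Rightarrow> 'a"
      by (simp add: contr_def fun_eq_iff sum_fun_apply)
    ultimately show ?thesis by (simp only: K_def)
  qed
  \<comment> \<open>Only \<open>c = a\<close> or \<open>d = a\<close> matter. As \<open>K\<close> is
    antisymmetric, both cases contribute equally, whence the factor 2.\<close>
  have sth: "(\<Sum>c\<in>I. \<Sum>d\<in>I. sc ((dirac c - dirac d) a) (K c d)) = sc 2 (\<Sum>d\<in>I. K a d)" if a: "a \<in> I" for a
  proof -
    have "(\<Sum>c\<in>I. \<Sum>d\<in>I. sc ((dirac c - dirac d) a) (K c d)) = (\<Sum>c\<in>I. \<Sum>d\<in>I. sc (if c = a then 1 else 0) (K c d) - sc (if d = a then 1 else 0) (K c d))"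
      by (intro sum.cong refl) (auto simp: dirac_apply)
    also have "\<dots> = (\<Sum>c\<in>I. sc (if c = a then 1 else 0) (\<Sum>d\<in>I. K c d)) - (\<Sum>c\<in>I. K c a)"
      unfolding sum_subtractf sc_sum(1) sum_sc_delta[OF finI] using a by simp
    also have "\<dots> = (\<Sum>d\<in>I. K a d) - (\<Sum>c\<in>I. K c a)"
      unfolding sum_sc_delta[OF finI] using a by simp
    also have "(\<Sum>c\<in>I. K c a) = - (\<Sum>d\<in>I. K a d)"
      unfolding sum_negf[symmetric] by (rule sum.cong[OF refl Ks]) (use a in auto)
    also have "F - - F = sc 2 F" for F :: "'b list \<Rightarrow> 'a" by (simp add: fun_eq_iff)
    finally show ?thesis .
  qed
  have T: "fsp (TT n)" by (rule fsp_ten[OF fsp_UU fsp_UU])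
  show ?thesis
  proof (rule ten_ext)
    show "(\<Sum>c\<in>I. \<Sum>d\<in>I. theta c d H) \<in> TT n"
      by (intro fsp_sum[OF T] theta_TT[OF H])
    have "cocc (cc b H) \<in> TT n"
    proof (cases n)
      case 0
      then have "h a = 0" for a using hUU UU_0 by blast
      then have z: "cc b H = 0" unfolding cch[symmetric] by simp
      have "cocc 0 = 0" by (simp only: cocc_def wedge_simps) (simp add: dif_def fun_eq_iff split: list.split)
      then show ?thesis unfolding z using fspD(1)[OF T] by simp
    qed (use cocc_TT cc_UU H b in blast)
    then show "sc 2 (sc (of_nat n) H + cocc (cc b H) - comu (mu b H)) \<in> TT n"
      by (intro fspD[OF T] H comu_TT mu_UU b)
    fix a b' assume I: "a \<in> I" "b' \<in> I"
    have "sl b' a (\<Sum>c\<in>I. \<Sum>d\<in>I. theta c d H) = (\<Sum>c\<in>I. \<Sum>d\<in>I. sc ((dirac c - dirac d) a) (K c d)) - (\<Sum>c\<in>I. \<Sum>d\<in>I. sc ((dirac c - dirac d) b') (K c d))"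
      unfolding sl_simps theta_def sl_dif[OF I] K_def by (simp only: sum_subtractf)
    also have "\<dots> = sc 2 (sc (of_nat n) (h a - h b') + (wedge (dirac a) (cc b H) - wedge (dirac b') (cc b H)) - (del a (mu b H) - del b' (mu b H)))"
      unfolding sth[OF I(1)] sth[OF I(2)] S[OF I(1)] S[OF I(2)] by (simp add: fun_eq_iff algebra_simps)
    also have "\<dots> = sl b' a (sc 2 (sc (of_nat n) H + cocc (cc b H) - comu (mu b H)))"
      unfolding sl_simps cocc_def comu_def sl_dif[OF I] sh[OF I] ..
    finally show "sl b' a (\<Sum>c\<in>I. \<Sum>d\<in>I. theta c d H) = sl b' a (sc 2 (sc (of_nat n) H + cocc (cc b H) - comu (mu b H)))" .
  qed
qed

text \<open>A change of base point alters every slice by the same function, which contributes its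
  image under \<open>delta\<close>, that is, zero. Equivariance in \<open>mu_comp\<close> depends on
  this, since a permutation moves the base point.\<close>

lemma mu_indep: "H \<in> TT n \<Longrightarrow> b \<in> I \<Longrightarrow> c \<in> I \<Longrightarrow> mu b H = mu c H"
proof -
  assume H: "H \<in> TT n" and I: "b \<in> I" "c \<in> I"
  have "mu b H = (\<Sum>a\<in>I. wedge (dirac a) (sl c a H)) - (\<Sum>a\<in>I. wedge (dirac a) (sl c b H))"
    unfolding mu_def sum_subtractf[symmetric] using sl_diff[OF H _ I] by (intro sum.cong) simp_all
  then show ?thesis unfolding sum_wedge UUD(2)[OF sl_UU[OF H]] by (simp add: mu_def)
qed

lemma cc_indep: "H \<in> TT n \<Longrightarrow> b \<in> I \<Longrightarrow> c \<in> I \<Longrightarrow> cc b H = cc c H"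
proof -
  assume H: "H \<in> TT n" and I: "b \<in> I" "c \<in> I"
  have "cc b H = (\<Sum>a\<in>I. del a (sl c a H)) - (\<Sum>a\<in>I. del a (sl c b H))"
    unfolding cc_def sum_subtractf[symmetric] using sl_diff[OF H _ I] by (intro sum.cong) simp_all
  then show ?thesis unfolding sum_del UUD(3)[OF sl_UU[OF H]] by (simp add: cc_def)
qed

lemma mu_comp:
  assumes H: "H \<in> TT n" and b: "b \<in> I" and s: "s permutes I"
  shows "mu b (H \<circ> map_prod (map s) (map s)) = mu b H \<circ> map s"
proof -
  have "mu b (H \<circ> map_prod (map s) (map s)) = (\<Sum>a\<in>I. wedge (dirac (s a)) (sl (s b) (s a) H) \<circ> map s)"
    unfolding mu_def sl_comp wedge_dirac_comp[OF s] ..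
  also have "\<dots> = (\<Sum>a\<in>I. wedge (dirac a) (sl (s b) a H) \<circ> map s)"
    using sum.permute[OF s, of "\<lambda>a. wedge (dirac a) (sl (s b) a H) \<circ> map s"] by (simp add: comp_def)
  also have "\<dots> = mu (s b) H \<circ> map s" by (simp add: mu_def fun_eq_iff sum_fun_apply)
  also have "mu (s b) H = mu b H" by (rule mu_indep[OF H]) (use b s in \<open>simp_all add: permutes_in_image\<close>)
  finally show ?thesis .
qed

lemma cc_comp:
  assumes H: "H \<in> TT n" and b: "b \<in> I" and s: "s permutes I"
  shows "cc b (H \<circ> map_prod (map s) (map s)) = cc b H \<circ> map s"
proof -
  have "cc b (H \<circ> map_prod (map s) (map s)) = (\<Sum>a\<in>I. del (s a) (sl (s b) (s a) H) \<circ> map s)"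
    unfolding cc_def sl_comp del_comp ..
  also have "\<dots> = (\<Sum>a\<in>I. del a (sl (s b) a H) \<circ> map s)"
    using sum.permute[OF s, of "\<lambda>a. del a (sl (s b) a H) \<circ> map s"] by (simp add: comp_def)
  also have "\<dots> = cc (s b) H \<circ> map s" by (simp add: cc_def fun_eq_iff sum_fun_apply)
  also have "cc (s b) H = cc b H" by (rule cc_indep[OF H]) (use b s in \<open>simp_all add: permutes_in_image\<close>)
  finally show ?thesis .
qed

lemma comu_comp: "s permutes I \<Longrightarrow> comu (w \<circ> map s) = comu w \<circ> map_prod (map s) (map s)"
  unfolding comu_def by (simp only: dif_comp del_comp)

lemma cocc_comp: "s permutes I \<Longrightarrow> cocc (w \<circ> map s) = cocc w \<circ> map_prod (map s) (map s)"
  unfolding cocc_def by (simp only: dif_comp wedge_dirac_comp)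

lemma theta_comp:
  assumes s: "s permutes I"
  shows "theta c d (H \<circ> map_prod (map s) (map s)) = theta (s c) (s d) H \<circ> map_prod (map s) (map s)"
proof -
  have u: "(dirac (s c) - dirac (s d)) \<circ> s = (dirac c - dirac d :: 'b \<Rightarrow> 'a)"
  proof -
    have "dirac (s c) \<circ> s = (dirac c :: 'b \<Rightarrow> 'a)" "dirac (s d) \<circ> s = (dirac d :: 'b \<Rightarrow> 'a)" by (rule dirac_comp[OF s])+
    then show ?thesis by (simp add: fun_eq_iff)
  qed
  have ua: "(dirac (s c) - dirac (s d)) (s a) = ((dirac c - dirac d) a :: 'a)" for a
    using fun_cong[OF u, of a] by simp
  have "wedge (dirac c - dirac d) (contr I (dirac c - dirac d) (sl d c (H \<circ> map_prod (map s) (map s))))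
    = wedge (dirac (s c) - dirac (s d)) (contr I (dirac (s c) - dirac (s d)) (sl (s d) (s c) H)) \<circ> map s"
    unfolding sl_comp by (simp only: wedge_comp_map contr_comp_map[OF s] u)
  then show ?thesis
    unfolding theta_def dif_comp[OF s] ua by (simp add: comp_def sc_def)
qed

lemma theta_same: "theta c c H = 0"
  by (simp add: theta_def dif_def fun_eq_iff split: list.split)

lemma lin_mu: "lin (mu b)" and lin_cc: "lin (cc b)" and lin_comu: "lin comu" and lin_cocc: "lin cocc"
  by (simp_all add: lin_def mu_def cc_def comu_def cocc_def sl_simps sum.distrib sc_sum dif_simps)

lemma lin_theta: "lin (theta c d)"
proof -
  have s: "sc x (sc y f) = sc y (sc x f)" for x y :: 'a and f :: "'b list \<Rightarrow> 'a"
    by (simp add: mult.commute)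
  have "theta c d (H + K) = theta c d H + theta c d K" for H K
    unfolding theta_def sl_simps contr_simps(1) wedge_simps(1) sc_simps(1) by (rule dif_simps)
  moreover have "theta c d (sc k H) = sc k (theta c d H)" for k H
    unfolding theta_def sl_simps contr_simps(5) wedge_simps(5) s[of _ k] by (rule dif_simps)
  ultimately show ?thesis by (simp add: lin_def)
qed

end

section \<open>The modules of the symmetric group\<close>

text \<open>Otherwise the simplifier turns \<open>{1..p}\<close> into \<open>{Suc 0..p}\<close>, to which the facts of the locale
  instance below do not apply.\<close>

declare One_nat_def [simp del]

lemma prep_iso:
  assumes G: "fin_group G" and B: "is_pb U B" "is_pb U B'" and t: "fin_group.ract G t" "fin_group.stab G U t"
  shows "fgiso G (prep B t) (prep B' t)"
proof -
  interpret fin_group G by fact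
  have "hm G (prep B t) (prep B' t) (lmat B B' (\<lambda>f. f))" "hm G (prep B' t) (prep B t) (lmat B' B (\<lambda>f. f))"
    using B t by (auto intro!: hm_lmat simp: lin_def)
  moreover have "lmat B' B (\<lambda>f. f) * lmat B B' (\<lambda>f. f) = E (pdim B)" "lmat B B' (\<lambda>f. f) * lmat B' B (\<lambda>f. f) = E (pdim B')"
    using lmat_comp[OF B, of "\<lambda>f. f" "\<lambda>f. f" B] lmat_comp[OF B(2,1), of "\<lambda>f. f" "\<lambda>f. f" B'] lmat_id[OF B(1)] lmat_id[OF B(2)]
    by (simp_all add: lin_def)
  ultimately show ?thesis
    unfolding fgiso_iff using md_prep[OF B(1) t] md_prep[OF B(2) t] by auto
qed

text \<open>Each ordered pair of distinct points is the image of \<open>(a, b)\<close> under exactly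
  \<open>(card I - 2)!\<close> permutations. The multiple is written as iterated addition because
  \<open>F\<close> takes values in a bare commutative monoid.\<close>

lemma sum_perm_pairs:
  assumes "finite I" "a \<in> I" "b \<in> I" "a \<noteq> b" and F: "\<And>c. F c c = (0 :: 'y::comm_monoid_add)"
  shows "(\<Sum>g | g permutes I. F (g a) (g b)) = (\<Sum>c\<in>I. \<Sum>d\<in>I. ((+) (F c d) ^^ fact (card I - 2)) 0)"
proof -
  let ?P = "{g. g permutes I}"
  have fin: "finite ?P" using assms(1) by (rule finite_permutations)
  have N: "card {g \<in> ?P. (g a, g b) = (c, d)} = fact (card I - 2)" if cd: "c \<in> I" "d \<in> I" "c \<noteq> d" for c d
  proof -
    obtain s where s: "s permutes I" "map s [a, b] = [c, d]"
      using perm_extend[of I "[a, b]" "[c, d]"] assms cd by auto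
    have "bij_betw (\<lambda>g. s \<circ> g) {g. g permutes I - {a, b}} {g \<in> ?P. (g a, g b) = (c, d)}"
    proof (rule bij_betw_byWitness[where f' = "\<lambda>g. inv' s \<circ> g"])
      show "\<forall>g\<in>{g. g permutes I - {a, b}}. inv' s \<circ> (s \<circ> g) = g"
        using s(1) by (simp add: comp_assoc[symmetric] permutes_inv_o)
      show "\<forall>g\<in>{g \<in> ?P. (g a, g b) = (c, d)}. s \<circ> (inv' s \<circ> g) = g"
        using s(1) by (simp add: comp_assoc[symmetric] permutes_inv_o)
      show "(\<lambda>g. s \<circ> g) ` {g. g permutes I - {a, b}} \<subseteq> {g \<in> ?P. (g a, g b) = (c, d)}"
        using s by (auto intro!: permutes_compose intro: permutes_subset dest: permutes_not_in)
      show "(\<lambda>g. inv' s \<circ> g) ` {g \<in> ?P. (g a, g b) = (c, d)} \<subseteq> {g. g permutes I - {a, b}}"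
      proof safe
        fix g assume g: "g permutes I" "c = g a" "d = g b"
        have "inv' s \<circ> g permutes I" using g s by (intro permutes_compose permutes_inv)
        moreover have "(inv' s \<circ> g) x = x" if "x \<in> {a, b}" for x
        proof -
          have "s x = g x" using that s(2) g(2,3) by auto
          then show ?thesis using permutes_inverses(2)[OF s(1), of x] by simp
        qed
        ultimately show "inv' s \<circ> g permutes I - {a, b}" by (auto intro: permutes_superset)
      qed
    qed
    then have "card {g \<in> ?P. (g a, g b) = (c, d)} = card {g. g permutes I - {a, b}}"
      by (simp only: bij_betw_same_card)
    also have "\<dots> = fact (card I - 2)"
      using assms by (intro card_permutations) (auto simp: card_Diff_subset)
    finally show ?thesis .
  qed
  have cst: "(\<Sum>x\<in>A. y) = ((+) y ^^ card A) 0" for A :: "('b \<Rightarrow> 'b) set" and y :: 'y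
    by (induction A rule: infinite_finite_induct) simp_all
  have z: "((+) (0::'y) ^^ k) 0 = 0" for k by (induction k) simp_all
  have "(\<Sum>g | g permutes I. F (g a) (g b)) = (\<Sum>z\<in>I \<times> I. \<Sum>g | g \<in> ?P \<and> (g a, g b) = z. F (g a) (g b))"
    by (rule sum.group[symmetric]) (use fin assms in \<open>auto simp: permutes_in_image\<close>)
  also have "\<dots> = (\<Sum>(c, d)\<in>I \<times> I. ((+) (F c d) ^^ fact (card I - 2)) 0)"
  proof (rule sum.cong[OF refl])
    fix z assume "z \<in> I \<times> I"
    then obtain c d where cd: "z = (c, d)" "c \<in> I" "d \<in> I" by auto
    have "(\<Sum>g | g \<in> ?P \<and> (g a, g b) = z. F (g a) (g b)) = (\<Sum>g | g \<in> ?P \<and> (g a, g b) = (c, d). F c d)"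
      unfolding cd by (rule sum.cong) auto
    also have "\<dots> = ((+) (F c d) ^^ fact (card I - 2)) 0"
    proof (cases "c = d")
      case True
      then show ?thesis by (simp add: F z)
    next
      case False
      show ?thesis unfolding cst N[OF cd(2,3) False] ..
    qed
    finally show "(\<Sum>g | g \<in> ?P \<and> (g a, g b) = z. F (g a) (g b)) = (case z of (c, d) \<Rightarrow> ((+) (F c d) ^^ fact (card I - 2)) 0)"
      by (simp add: cd)
  qed
  also have "\<dots> = (\<Sum>c\<in>I. \<Sum>d\<in>I. ((+) (F c d) ^^ fact (card I - 2)) 0)" by (simp add: sum.cartesian_product)
  finally show ?thesis .
qed

lemma funpow_sc: "((+) f ^^ k) 0 = sc (of_nat k) f"
  by (induction k) simp_all

lemma sc_comp: "sc c f \<circ> s = sc c (f \<circ> s)"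
  by (simp add: fun_eq_iff)

lemma sym_group_simps:
  "carrier (sym_group n) = {g. g permutes {1..n}}" "x \<otimes>\<^bsub>sym_group n\<^esub> y = x \<circ> y" "\<one>\<^bsub>sym_group n\<^esub> = id"
  by (simp_all add: sym_group_def)

locale sym_char =
  fixes p :: nat and ty :: "'a::field itself"
  assumes p: "prime p" "p \<ge> 3" and char: "CHAR('a) = p"
begin

abbreviation G where "G \<equiv> sym_group p"

lemma of_nat_0_iff: "(of_nat k :: 'a) = 0 \<longleftrightarrow> p dvd k"
  by (simp add: of_nat_eq_0_iff_char_dvd char)

sublocale clifford_space "{1..p}" ty
proof unfold_locales
  have "\<not> p dvd 2" using p(2) by (auto dest: dvd_imp_le)
  then show "(2 :: 'a) \<noteq> 0" using of_nat_0_iff[of 2] by simp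
  show "(of_nat (card {1..p}) :: 'a) = 0" by (simp add: of_nat_0_iff)
  show "(of_nat k :: 'a) \<noteq> 0" if "0 < k" "k < card {1..p}" for k
    using that by (auto simp: of_nat_0_iff dest: dvd_imp_le)
qed (use p in auto)

sublocale SG: fin_group "sym_group p"
  by (intro fin_group.intro fin_group_axioms.intro) (simp_all add: sym_group_is_group sym_group_simps finite_permutations)

lemma fact_nz: "k < p \<Longrightarrow> (of_nat (fact k) :: 'a) \<noteq> 0"
  using prime_dvd_fact_iff[OF p(1), of k] by (simp add: of_nat_0_iff)

lemma inv_sym: "g permutes {1..p} \<Longrightarrow> inv\<^bsub>G\<^esub> g = inv' g"
  using SG.inv_equality[of "inv' g" g] by (simp add: sym_group_simps permutes_inv permutes_inv_o)

text \<open>The inverse turns the natural left action on lists into the right action that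
  \<open>prep\<close> expects.\<close>

definition tt :: "(nat \<Rightarrow> nat) \<Rightarrow> nat list \<Rightarrow> nat list" where "tt g = map (inv' g)"

definition BB :: "nat \<Rightarrow> (nat list, 'a) pb" where "BB n = (SOME B. is_pb (UU n) B)"

text \<open>The hook module with label \<open>n - 1\<close>; \<open>W 0\<close> and
  \<open>W p\<close> are zero.\<close>

definition W :: "nat \<Rightarrow> (nat \<Rightarrow> nat, 'a) fgmod" where "W n = prep (BB n) tt"

lemma alt_finite:
  obtains S where "finite S" "\<forall>f xs. alt {1..p} n (f :: _ \<Rightarrow> 'a) \<longrightarrow> xs \<notin> S \<longrightarrow> f xs = 0"
proof (rule that[OF _ allI[OF allI[OF impI[OF impI]]]])
  show "finite {xs. set xs \<subseteq> {1..p} \<and> length xs = n}" by (rule finite_lists_length_eq) simp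
  show "f xs = 0" if "alt {1..p} n f" "xs \<notin> {xs. set xs \<subseteq> {1..p} \<and> length xs = n}" for f :: "_ \<Rightarrow> 'a" and xs
    using alt_support[OF two that(1), of xs] that(2) by blast
qed

lemma is_pb_BB: "is_pb (UU n) (BB n)"
proof -
  obtain S where S: "finite S" "\<forall>f xs. alt {1..p} n (f :: _ \<Rightarrow> 'a) \<longrightarrow> xs \<notin> S \<longrightarrow> f xs = 0"
    using alt_finite[of n] .
  have "\<exists>B. is_pb (UU n :: (nat list \<Rightarrow> 'a) set) B"
    by (rule is_pb_exists[OF fsp_UU S(1)]) (rule S(2)[rule_format, OF UUD(1)])
  then show ?thesis unfolding BB_def by (rule someI_ex)
qed

lemma ract_tt: "SG.ract tt"
  by (auto simp: SG.ract_def tt_def sym_group_simps fun_eq_iff permutes_inv_o o_inv_distrib permutes_bij)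

lemma stab_UU: "SG.stab (UU n :: (nat list \<Rightarrow> 'a) set) tt"
  unfolding SG.stab_def tt_def sym_group_simps
proof (intro ballI)
  fix g :: "nat \<Rightarrow> nat" and f :: "nat list \<Rightarrow> 'a" assume "g \<in> {g. g permutes {1..p}}" and f: "f \<in> UU n"
  then have "inv' g permutes {1..p}" by (simp add: permutes_inv)
  then show "f \<circ> map (inv' g) \<in> UU n" using f by (rule UU_perm)
qed

lemma md_W: "SG.md (W n)"
  unfolding W_def by (rule SG.md_prep[OF is_pb_BB ract_tt stab_UU])

lemma W_zero:
  assumes "n = 0 \<or> n = p" shows "mdim (W n) = 0"
proof (rule ccontr)
  assume "mdim (W n) \<noteq> 0"
  then have d: "0 < pdim (BB n)" by (simp add: W_def)
  have "pbs (BB n) 0 = 0" using is_pbD(2)[OF is_pb_BB d] assms UU_0 UU_card by auto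
  then show False using is_pbD(3)[OF is_pb_BB d d] by simp
qed

abbreviation BT :: "nat \<Rightarrow> (nat list \<times> nat list, 'a) pb" where "BT n \<equiv> pbt (BB 2) (BB n)"

abbreviation tT :: "(nat \<Rightarrow> nat) \<Rightarrow> nat list \<times> nat list \<Rightarrow> nat list \<times> nat list" where
  "tT \<equiv> \<lambda>g. map_prod (tt g) (tt g)"

lemma lin_sc: "lin T \<Longrightarrow> lin (\<lambda>f. sc c (T f))"
  by (simp add: lin_def mult.commute)

lemma fusion:
  assumes n: "1 \<le> n" "n < p"
  shows "SG.siso (tensor (W 2) (W n)) (ds (W (Suc n)) (W (n - 1)))"
proof -
  obtain m where m: "n = Suc m" using n by (cases n) auto
  have nz: "(of_nat n :: 'a) \<noteq> 0" using inv[of n] n by simp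
  have one: "1 \<in> {1..p}" "2 \<in> {1..p}" using p by auto
  note pb = is_pb_BB
  have pT: "is_pb (TT n) (BT n)" by (rule is_pb_pbt[OF pb pb])
  have sT: "SG.stab (TT n) tT" by (rule SG.stab_ten[OF stab_UU stab_UU])
  have T: "fsp (TT n)" by (rule fsp_ten[OF fsp_UU fsp_UU])
  define V where "V = prep (BT n) tT"
  have tV: "tensor (W 2) (W n) = V" unfolding W_def V_def by (rule tensor_prep)
  have V: "SG.md V" unfolding V_def by (rule SG.md_prep[OF pT SG.ract_prod[OF ract_tt ract_tt] sT])
  \<comment> \<open>The scalars normalise \<open>comu\<close> and \<open>cocc\<close>: the factors
    in \<open>mu_comu\<close> and in \<open>cc_cocc\<close> are \<open>n\<close> and, for degree
    \<open>m = n - 1\<close>, \<open>- n\<close>.\<close>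
  define i1 where "i1 = lmat (BB (Suc n)) (BT n) (\<lambda>w. sc (1 / of_nat n) (comu w))"
  define q1 where "q1 = lmat (BT n) (BB (Suc n)) (mu 1)"
  define i2 where "i2 = lmat (BB m) (BT n) (\<lambda>w. sc (- 1 / of_nat n) (cocc w))"
  define q2 where "q2 = lmat (BT n) (BB m) (cc 1)"
  have m1: "sc k (comu w) \<in> TT n" if "w \<in> UU (Suc n)" for w k by (rule fspD(3)[OF T comu_TT[OF that]])
  have m2: "sc k (cocc w) \<in> TT n" if "w \<in> UU m" for w k unfolding m by (rule fspD(3)[OF T[unfolded m] cocc_TT[OF that]])
  have m3: "mu 1 H \<in> UU (Suc n)" if "H \<in> TT n" for H by (rule mu_UU[OF that one(1)])
  have m4: "cc 1 H \<in> UU m" if "H \<in> TT n" for H by (rule cc_UU[OF that[unfolded m] one(1)])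
  have inv': "inv' g permutes {1..p}" if "g \<in> carrier G" for g
    using that by (simp add: sym_group_simps permutes_inv)
  note eq = tt_def comu_comp[OF inv'] cocc_comp[OF inv'] mu_comp[OF _ one(1) inv'] cc_comp[OF _ one(1) inv'] sc_comp
  have h: "hm G (W (Suc n)) V i1" "hm G V (W (Suc n)) q1" "hm G (W m) V i2" "hm G V (W m) q2"
    unfolding W_def V_def i1_def q1_def i2_def q2_def
  proof -
    show "hm G (prep (BB (Suc n)) tt) (prep (BT n) tT) (lmat (BB (Suc n)) (BT n) (\<lambda>w. sc (1 / of_nat n) (comu w)))"
      by (rule SG.hm_lmat[OF pb pT stab_UU sT lin_sc[OF lin_comu] m1]) (simp_all only: eq)
    show "hm G (prep (BB m) tt) (prep (BT n) tT) (lmat (BB m) (BT n) (\<lambda>w. sc (- 1 / of_nat n) (cocc w)))"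
      by (rule SG.hm_lmat[OF pb pT stab_UU sT lin_sc[OF lin_cocc] m2]) (simp_all only: eq)
    show "hm G (prep (BT n) tT) (prep (BB (Suc n)) tt) (lmat (BT n) (BB (Suc n)) (mu 1))"
      by (rule SG.hm_lmat[OF pT pb sT stab_UU lin_mu m3]) (simp_all only: eq)
    show "hm G (prep (BT n) tT) (prep (BB m) tt) (lmat (BT n) (BB m) (cc 1))"
      by (rule SG.hm_lmat[OF pT pb sT stab_UU lin_cc m4]) (simp_all only: eq)
  qed
  have ls: "mu 1 (sc k H) = sc k (mu 1 H)" "cc 1 (sc k H) = sc k (cc 1 H)" for k H
    using lin_mu[of 1] lin_cc[of 1] unfolding lin_def by blast+
  have 1: "q1 * i1 = Idm (W (Suc n))"
  proof -
    have "q1 * i1 = lmat (BB (Suc n)) (BB (Suc n)) (\<lambda>w. mu 1 (sc (1 / of_nat n) (comu w)))"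
      unfolding q1_def i1_def by (rule lmat_comp[OF pb pT lin_mu m1])
    also have "\<dots> = lmat (BB (Suc n)) (BB (Suc n)) (\<lambda>w. w)"
      by (rule lmat_cong[OF pb]) (simp only: ls mu_comu[OF _ one(1)], simp add: nz)
    finally show ?thesis using lmat_id[OF pb, of "Suc n"] by (simp add: W_def)
  qed
  have 2: "q2 * i2 = Idm (W m)"
  proof -
    have "q2 * i2 = lmat (BB m) (BB m) (\<lambda>w. cc 1 (sc (- 1 / of_nat n) (cocc w)))"
      unfolding q2_def i2_def by (rule lmat_comp[OF pb pT lin_cc m2])
    also have "\<dots> = lmat (BB m) (BB m) (\<lambda>w. w)"
      by (rule lmat_cong[OF pb]) (simp only: ls cc_cocc[OF _ one(1)] m[symmetric], simp add: nz)
    finally show ?thesis using lmat_id[OF pb, of m] by (simp add: W_def)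
  qed
  have 3: "q1 * i2 = 0"
  proof -
    have "q1 * i2 = lmat (BB m) (BB (Suc n)) (\<lambda>w. mu 1 (sc (- 1 / of_nat n) (cocc w)))"
      unfolding q1_def i2_def by (rule lmat_comp[OF pb pT lin_mu m2])
    also have "\<dots> = lmat (BB m) (BB (Suc n)) (\<lambda>w. 0)"
      by (rule lmat_cong[OF pb]) (simp only: ls mu_cocc[OF _ one(1)] sc_simps)
    finally show ?thesis by (simp only: lmat_zero)
  qed
  have 4: "q2 * i1 = 0"
  proof -
    have "q2 * i1 = lmat (BB (Suc n)) (BB m) (\<lambda>w. cc 1 (sc (1 / of_nat n) (comu w)))"
      unfolding q2_def i1_def by (rule lmat_comp[OF pb pT lin_cc m1])
    also have "\<dots> = lmat (BB (Suc n)) (BB m) (\<lambda>w. 0)"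
      by (rule lmat_cong[OF pb]) (simp only: ls cc_comu[OF _ one(1)] sc_simps)
    finally show ?thesis by (simp only: lmat_zero)
  qed
  have b: "bip G V (W (Suc n)) (W m) i1 q1 i2 q2"
    unfolding bip_def using h 1 2 3 4 by blast
  \<comment> \<open>In \<open>k\<close>, the factors 2 and \<open>n\<close> come from
    \<open>theta_sum\<close>, and \<open>N\<close> counts the permutations that carry
    \<open>(1, 2)\<close> to a given pair. All of them are units in the field.\<close>
  define N where "N = (of_nat (fact (p - 2)) :: 'a)"
  define k where "k = 1 / (2 * of_nat n * N)"
  have N: "N \<noteq> 0" unfolding N_def by (rule fact_nz) (use p in simp)
  have main: "H - (sc (1 / of_nat n) (comu (mu 1 H)) + sc (- 1 / of_nat n) (cocc (cc 1 H)))
      = (\<Sum>g\<in>carrier G. sc k (theta 1 2 (H \<circ> tT (inv\<^bsub>G\<^esub> g))) \<circ> tT g)" if H: "H \<in> TT n" for H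
  proof -
    have "(\<Sum>g\<in>carrier G. sc k (theta 1 2 (H \<circ> tT (inv\<^bsub>G\<^esub> g))) \<circ> tT g) = (\<Sum>g | g permutes {1..p}. sc k (theta (g 1) (g 2) H))"
    proof (rule sum.cong)
      fix g assume "g \<in> {g. g permutes {1..p}}"
      then have g: "g permutes {1..p}" by simp
      have t: "tt (inv\<^bsub>G\<^esub> g) = map g" using g by (simp add: tt_def inv_sym inv_inv_eq permutes_bij)
      have c: "map g \<circ> tt g = id" using g by (simp add: tt_def permutes_inv_o)
      have "theta 1 2 (H \<circ> tT (inv\<^bsub>G\<^esub> g)) \<circ> tT g = theta (g 1) (g 2) H \<circ> (map_prod (map g) (map g) \<circ> tT g)"
        unfolding t theta_comp[OF g] comp_assoc ..
      also have "\<dots> = theta (g 1) (g 2) H" by (simp only: map_prod.comp c map_prod.id comp_id)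
      finally show "sc k (theta 1 2 (H \<circ> tT (inv\<^bsub>G\<^esub> g))) \<circ> tT g = sc k (theta (g 1) (g 2) H)"
        by (simp only: sc_comp)
    qed (simp add: sym_group_simps)
    also have "\<dots> = sc k (\<Sum>g | g permutes {1..p}. theta (g 1) (g 2) H)" by (simp only: sc_sum)
    also have "(\<Sum>g | g permutes {1..p}. theta (g 1) (g 2) H) = (\<Sum>c\<in>{1..p}. \<Sum>d\<in>{1..p}. sc (of_nat (fact (card {1..p} - 2))) (theta c d H))"
      unfolding funpow_sc[symmetric] by (rule sum_perm_pairs) (use one theta_same in auto)
    also have "\<dots> = sc N (\<Sum>c\<in>{1..p}. \<Sum>d\<in>{1..p}. theta c d H)"
      by (simp only: sc_sum N_def card_atLeastAtMost diff_Suc_1 Suc_eq_plus1[symmetric])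
    also have "\<dots> = sc N (sc 2 (sc (of_nat n) H + cocc (cc 1 H) - comu (mu 1 H)))"
      by (simp only: theta_sum[OF H one(1)])
    also have "sc k (sc N (sc 2 (sc (of_nat n) H + cocc (cc 1 H) - comu (mu 1 H))))
        = sc (k * N * 2 * of_nat n) H + sc (k * N * 2) (cocc (cc 1 H)) - sc (k * N * 2) (comu (mu 1 H))"
      by (simp add: mult.assoc)
    also have "k * N * 2 * of_nat n = 1" using N nz two by (simp add: k_def)
    also have "k * N * 2 = 1 / of_nat n" using N nz two by (simp add: k_def)
    also have "sc 1 H + sc (1 / of_nat n) (cocc (cc 1 H)) - sc (1 / of_nat n) (comu (mu 1 H))
      = H - (sc (1 / of_nat n) (comu (mu 1 H)) + sc (- 1 / of_nat n) (cocc (cc 1 H)))"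
      by (simp add: fun_eq_iff)
    finally show ?thesis ..
  qed
  have "Idm V - (i1 * q1 + i2 * q2) = SG.Tr V V (lmat (BT n) (BT n) (\<lambda>H. sc k (theta 1 2 H)))"
  proof -
    have "Idm V - (i1 * q1 + i2 * q2) = lmat (BT n) (BT n) (\<lambda>H. H) -
       (lmat (BT n) (BT n) (\<lambda>H. sc (1 / of_nat n) (comu (mu 1 H))) + lmat (BT n) (BT n) (\<lambda>H. sc (- 1 / of_nat n) (cocc (cc 1 H))))"
    proof -
      have "i1 * q1 = lmat (BT n) (BT n) (\<lambda>H. sc (1 / of_nat n) (comu (mu 1 H)))"
        unfolding i1_def q1_def by (rule lmat_comp[OF pT pb lin_sc[OF lin_comu] m3])
      moreover have "i2 * q2 = lmat (BT n) (BT n) (\<lambda>H. sc (- 1 / of_nat n) (cocc (cc 1 H)))"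
        unfolding i2_def q2_def by (rule lmat_comp[OF pT pb lin_sc[OF lin_cocc] m4])
      ultimately show ?thesis unfolding lmat_id[OF pT] by (simp only: V_def mdim_prep)
    qed
    also have "\<dots> = lmat (BT n) (BT n) (\<lambda>H. \<Sum>g\<in>carrier G. sc k (theta 1 2 (H \<circ> tT (inv\<^bsub>G\<^esub> g))) \<circ> tT g)"
      unfolding lmat_add[symmetric] lmat_diff[symmetric] by (rule lmat_cong[OF pT main])
    also have "\<dots> = SG.Tr V V (lmat (BT n) (BT n) (\<lambda>H. sc k (theta 1 2 H)))"
      unfolding V_def
      by (rule SG.Tr_lmat[OF pT pT sT sT lin_sc[OF lin_theta] fspD(3)[OF T theta_TT[OF _ one]], symmetric])
    finally show ?thesis .
  qed
  then have "SG.null V V (Idm V - (i1 * q1 + i2 * q2))" unfolding SG.null_def by blast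
  then show ?thesis
    unfolding tV using SG.bip_siso_ds[OF V md_W md_W b] by (simp add: m)
qed

text \<open>The witness is \<open>delta\<close> of the polytabloid on the points 1 to
  \<open>n\<close>. As \<open>n < p\<close>, the point \<open>p\<close> is not among them;
  contracting with \<open>p\<close> shows that \<open>delta\<close> can kill this polytabloid only
  if it is zero, and then the monomial would be zero.\<close>

lemma W_nonzero:
  assumes n: "1 \<le> n" "n < p" shows "0 < mdim (W n)"
proof -
  obtain m where m: "n = Suc m" using n by (cases n) auto
  let ?c = "[1..<Suc (Suc m)]"
  have c: "distinct ?c" "length ?c = Suc m" "set ?c \<subseteq> {1..p}" using n m by auto
  have c': "?c = 1 # [2..<Suc (Suc m)]" using upt_conv_Cons[of 1 "Suc (Suc m)"] by (simp add: numeral_2_eq_2 One_nat_def del: upt_Suc)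
  have a: "alt {1..p} (Suc m) (wd ?c :: _ \<Rightarrow> 'a)" using alt_wd[OF c(3)] c(2) by simp
  define f where "f = bd (wd ?c)"
  have af: "alt {1..p} m f" unfolding f_def by (rule alt_contr[OF a])
  have "bd f = - bd f" unfolding f_def by (rule contr_anti[OF a])
  then have "sc 2 (bd f) = 0" by (simp add: fun_eq_iff)
  then have "bd f = 0" using two by (simp add: fun_eq_iff)
  then have fZ: "f \<in> ZZ m" using af by (simp add: ZZ_def)
  then have U: "delta f \<in> UU n" unfolding m by (rule delta_UU)
  have nz: "delta f \<noteq> 0"
  proof
    assume d0: "delta f = 0"
    have pI: "p \<in> {1..p}" "p \<notin> set ?c" using p n m by auto
    have "alt (set ?c) (Suc m) (wd ?c :: _ \<Rightarrow> 'a)" using alt_wd[of ?c "set ?c"] c(2) by simp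
    then have "del p (wd ?c) = (0 :: _ \<Rightarrow> 'a)" using pI(2) by (rule alt_outside)
    then have "del p f = 0" unfolding f_def del_contr[OF a] by simp
    then have f0: "f = 0" using del_wedge_delta[OF pI(1), of f] unfolding d0 by simp
    have "wedge (dirac 1) (wd ?c) = (0 :: _ \<Rightarrow> 'a)" by (rule wedge_wd_mem) (simp del: upt_Suc)
    then have "bd (wedge (dirac 1) (wd ?c)) = 0" by (simp only: contr_simps)
    moreover have "bd (wedge (dirac 1) (wd ?c)) = wd ?c - wedge (dirac 1) f"
      unfolding clifford f_def using p by (simp add: ones_apply del: upt_Suc)
    ultimately have "wd ?c = wedge (dirac 1) f" by (simp only: right_minus_eq)
    then have "wd ?c ?c = (0 :: 'a)" unfolding f0 by simp
    then show False using wd_self[OF c(1), where 'b = 'a] by (simp del: upt_Suc)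
  qed
  show ?thesis
  proof (rule ccontr)
    assume "\<not> 0 < mdim (W n)"
    then have "pdim (BB n) = 0" by (simp add: W_def)
    then have "delta f = 0" using is_pbD(4)[OF is_pb_BB U] by simp
    then show False using nz by simp
  qed
qed

text \<open>A Jucys--Murphy element, used to tell the modules \<open>W n\<close> apart.\<close>

lemma jm:
  assumes f: "f \<in> UU n" and a: "a \<in> {1..p}"
  shows "(\<Sum>b\<in>{1..p}. f - (f \<circ> map (transpose a b))) = sc (of_nat n - 1) f"
proof -
  note alt = UUD(1)[OF f]
  have "f - (f \<circ> map (transpose a b)) = wedge (dirac a) (del a f) - wedge (dirac a) (del b f) - wedge (dirac b) (del a f) + wedge (dirac b) (del b f)"
    if b: "b \<in> {1..p}" for b
  proof (cases "a = b")
    case True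
    then show ?thesis by (simp add: fun_eq_iff)
  next
    case False
    have "f - (f \<circ> map (transpose a b)) = wedge (dirac a - dirac b) (contr {1..p} (dirac a - dirac b) f)"
      unfolding transpose_alt[OF finI a b False two alt] by simp
    also have "contr {1..p} (dirac a - dirac b) f = del a f - del b f"
      unfolding contr_simps contr_dirac[OF finI a] contr_dirac[OF finI b] ..
    also have "wedge (dirac a - dirac b) (del a f - del b f) = wedge (dirac a) (del a f) - wedge (dirac a) (del b f) - wedge (dirac b) (del a f) + wedge (dirac b) (del b f)"
      unfolding wedge_simps by (simp only: algebra_simps)
    finally show ?thesis .
  qed
  then have "(\<Sum>b\<in>{1..p}. f - (f \<circ> map (transpose a b))) = (\<Sum>b\<in>{1..p}. wedge (dirac a) (del a f))
      - wedge (dirac a) (\<Sum>b\<in>{1..p}. del b f) - (\<Sum>b\<in>{1..p}. wedge (dirac b) (del a f)) + (\<Sum>b\<in>{1..p}. wedge (dirac b) (del b f))"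
    unfolding wedge_sum by (simp add: sum_subtractf sum.distrib)
  also have "(\<Sum>b\<in>{1..p}. wedge (dirac a) (del a f)) = sc (of_nat (card {1..p})) (wedge (dirac a) (del a f))"
    by (simp add: fun_eq_iff sum_fun_apply)
  also have "\<dots> - wedge (dirac a) (\<Sum>b\<in>{1..p}. del b f) - (\<Sum>b\<in>{1..p}. wedge (dirac b) (del a f)) + (\<Sum>b\<in>{1..p}. wedge (dirac b) (del b f))
    = 0 - 0 - f + sc (of_nat n) f"
    unfolding sum_del sum_wedge UU_delta[OF f a] euler[OF finI alt] UUD(3)[OF f] card0 by simp
  also have "\<dots> = sc (of_nat n - 1) f" by simp
  finally show ?thesis .
qed

text \<open>By \<open>jm\<close> the sum of all \<open>1 - (1 b)\<close> acts on \<open>W n\<close>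
  as the scalar \<open>n - 1\<close>, and these scalars are distinct modulo
  \<open>p\<close>.\<close>

lemma not_iso:
  assumes n: "1 \<le> n" "n < p" "n' < p" and iso: "fgiso G (W n) (W n')" shows "n = n'"
proof -
  obtain A A' where A: "hm G (W n) (W n') A" "A' * A = Idm (W n)"
    using iso unfolding SG.fgiso_iff by blast
  let ?T = "\<lambda>b. transpose 1 b"
  have T: "?T b \<in> carrier G" if "b \<in> {1..p}" for b
    using that p by (simp add: sym_group_simps permutes_swap_id)
  have J: "(\<Sum>b\<in>{1..p}. Idm (W k) - rh (W k) (?T b)) = fm (mdim (W k)) (mdim (W k)) (\<lambda>i j. if i = j then of_nat k - 1 else 0)" for k
  proof -
    have "(\<Sum>b\<in>{1..p}. Idm (W k) - rh (W k) (?T b)) = (\<Sum>b\<in>{1..p}. lmat (BB k) (BB k) (\<lambda>f. f - (f \<circ> map (transpose 1 b))))"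
      unfolding W_def rh_prep lmat_diff lmat_id[OF is_pb_BB] mdim_prep tt_def by simp
    also have "\<dots> = lmat (BB k) (BB k) (\<lambda>f. sc (of_nat k - 1) f)"
      unfolding lmat_sum[symmetric] by (rule lmat_cong[OF is_pb_BB jm]) (use p in auto)
    also have "\<dots> = fm (mdim (W k)) (mdim (W k)) (\<lambda>i j. if i = j then of_nat k - 1 else 0)"
      by (rule fmat_eqI) (auto simp: lmat_def W_def is_pbD(3)[OF is_pb_BB])
    finally show ?thesis .
  qed
  have com: "A * (\<Sum>b\<in>{1..p}. Idm (W n) - rh (W n) (?T b)) = (\<Sum>b\<in>{1..p}. Idm (W n') - rh (W n') (?T b)) * A"
    unfolding sum_distrib_left sum_distrib_right
  proof (rule sum.cong[OF refl])
    fix b assume "b \<in> {1..p}"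
    then have "?T b \<in> carrier G" by (rule T)
    then show "A * (Idm (W n) - rh (W n) (?T b)) = (Idm (W n') - rh (W n') (?T b)) * A"
      using A(1) unfolding hm_def by (simp add: right_diff_distrib left_diff_distrib)
  qed
  have AE: "ent A i j = 0" if "\<not> (i < mdim (W n') \<and> j < mdim (W n))" for i j
    using A(1) that unfolding hm_def by (metis ent_E_mult ent_mult_E)
  have l: "ent (A * fm (mdim (W n)) (mdim (W n)) (\<lambda>i j. if i = j then c else 0)) i j = ent A i j * c" for c i j
  proof -
    have "ent (A * fm (mdim (W n)) (mdim (W n)) (\<lambda>i j. if i = j then c else 0)) i j
      = (\<Sum>k<mdim (W n). ent A i k * ent (fm (mdim (W n)) (mdim (W n)) (\<lambda>i j. if i = j then c else 0)) k j)"
      by (rule ent_times_gen) simp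
    also have "\<dots> = (\<Sum>k<mdim (W n). if k = j then ent A i j * c else 0)" by (rule sum.cong) auto
    finally show ?thesis using AE[of i j] by auto
  qed
  have r: "ent (fm (mdim (W n')) (mdim (W n')) (\<lambda>i j. if i = j then c else 0) * A) i j = c * ent A i j" for c i j
  proof -
    have "ent (fm (mdim (W n')) (mdim (W n')) (\<lambda>i j. if i = j then c else 0) * A) i j
      = (\<Sum>k<mdim (W n'). ent (fm (mdim (W n')) (mdim (W n')) (\<lambda>i j. if i = j then c else 0)) i k * ent A k j)"
      by (rule ent_times_gen) simp
    also have "\<dots> = (\<Sum>k<mdim (W n'). if k = i then c * ent A i j else 0)" by (rule sum.cong) auto
    finally show ?thesis using AE[of i j] by auto
  qed
  have eq: "ent A i j * (of_nat n - 1) = (of_nat n' - 1) * ent A i j" for i j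
    using arg_cong[OF com, of "\<lambda>M. ent M i j"] unfolding J l r .
  have "A \<noteq> 0"
  proof
    assume "A = 0"
    then have "Idm (W n) = (0 :: 'a fmat)" using A(2) by simp
    then show False using W_nonzero[OF n(1,2)] by (simp add: E_eq_zero_iff)
  qed
  then obtain i j where "ent A i j \<noteq> 0" by (metis fmat_eqI ent_zero)
  then have "(of_nat n :: 'a) = of_nat n'" using eq[of i j] by (simp add: mult.commute)
  then have "of_nat (n - n') = (0 :: 'a)" "of_nat (n' - n) = (0 :: 'a)"
    by (cases "n \<le> n'", simp_all add: of_nat_diff)+
  then have "p dvd n - n'" "p dvd n' - n" by (simp_all only: of_nat_0_iff)
  then show ?thesis using n by (meson diff_is_0_eq dvd_imp_le less_imp_diff_less le_antisym linorder_not_less neq0_conv)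
qed

text \<open>In degree one \<open>delta f = 0\<close> says that \<open>f\<close> is constant on the
  points, and constants are killed by \<open>bd\<close> because \<open>p\<close> is zero in the
  field.\<close>

lemma W_trivial: "SG.siso (W 1) trivial_fgmod"
proof -
  define B :: "(nat list, 'a) pb" where "B = \<lparr> pdim = 1, ppt = (\<lambda>_. [1]), pbs = (\<lambda>_ xs. case xs of [a] \<Rightarrow> ones {1..p} a | _ \<Rightarrow> 0) \<rparr>"
  define h where "h = pbs B 0"
  have h: "h [] = 0" "h [a] = ones {1..p} a" "h (a # b # xs) = 0" for a b xs by (simp_all add: h_def B_def)
  have d2: "del b (del a h) = 0" for a b by (simp add: fun_eq_iff h)
  have U: "h \<in> UU 1"
  proof -
    have "del a h = 0" if "a \<notin> {1..p}" for a
    proof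
      fix xs show "del a h xs = 0 xs" using that by (cases xs) (simp_all add: h ones_apply)
    qed
    then have "alt {1..p} (Suc 0) h" unfolding alt.simps using d2 h(1) by simp
    moreover have "delta h xs = 0 xs" for xs
    proof (cases xs)
      case (Cons y ys)
      show ?thesis
      proof (cases ys)
        case (Cons z zs)
        then show ?thesis using \<open>xs = y # ys\<close> by (cases zs) (simp_all add: h d2)
      qed (use Cons in \<open>simp add: h\<close>)
    qed simp
    then have "delta h = 0" by (rule ext)
    moreover have "bd h xs = 0 xs" for xs
      using card0 by (cases xs) (simp_all add: h contr_def sum_fun_apply ones_apply)
    then have "bd h = 0" by (rule ext)
    ultimately have "h \<in> UU (Suc 0)" unfolding UU_def by blast
    then show ?thesis by (simp add: One_nat_def)
  qed
  have pb: "is_pb (UU 1) B"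
    unfolding is_pb_def pbas_def
  proof (intro conjI allI impI ballI fsp_UU)
    show "pbs B j \<in> UU 1" if "j < pdim B" for j using that U by (simp add: B_def h_def)
    show "pbs B j (ppt B k) = (if j = k then 1 else 0)" if "j < pdim B" "k < pdim B" for j k
      using that p by (simp add: B_def ones_apply)
    fix f :: "nat list \<Rightarrow> 'a" and xs assume f: "f \<in> UU 1"
    have "f xs = f [1] * h xs"
    proof (cases "\<exists>a\<in>{1..p}. xs = [a]")
      case True
      then obtain a where a: "a \<in> {1..p}" "xs = [a]" by blast
      have "delta f [1, a] = 0" using UUD(2)[OF f] by simp
      then show ?thesis using a p by (simp add: ones_apply h)
    next
      case False
      then have "f xs = 0" using alt_support[OF two UUD(1)[OF f], of xs] by (cases xs) auto
      moreover have "h xs = 0" using False by (cases xs; cases "tl xs") (auto simp: h ones_apply)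
      ultimately show ?thesis by simp
    qed
    then show "f xs = (\<Sum>j<pdim B. f (ppt B j) * pbs B j xs)" by (simp add: B_def h_def)
  qed
  have md: "SG.md (prep B tt)" by (rule SG.md_prep[OF pb ract_tt stab_UU])
  have iso: "fgiso G (W 1) (prep B tt)"
    unfolding W_def by (rule prep_iso[OF SG.fin_group_axioms is_pb_BB pb ract_tt stab_UU])
  have "rh (prep B tt) g = E 1" if "g \<in> carrier G" for g
  proof (rule fmat_eqI)
    have "inv' g permutes {1..p}" using that by (simp add: sym_group_simps permutes_inv)
    then have "inv' g 1 \<in> {1..p}" by (rule permutes_in_image[THEN iffD2]) (use p in simp)
    then show "ent (rh (prep B tt) g) i j = ent (E 1) i j" for i j
      unfolding rh_prep by (simp add: lmat_def B_def ent_E tt_def ones_apply)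
  qed
  then have "hm G (prep B tt) trivial_fgmod (E 1)" "hm G trivial_fgmod (prep B tt) (E 1)"
    by (simp_all add: hm_def trivial_fgmod_def rh_def em_one B_def)
  then have "fgiso G (prep B tt) trivial_fgmod"
    unfolding SG.fgiso_iff using md SG.md_trivial by (fastforce simp: trivial_fgmod_def B_def)
  then show ?thesis using iso by (blast intro: SG.fgiso_siso SG.siso_trans)
qed

text \<open>A trace on the trivial module is a multiple of the group order \<open>p!\<close>, which
  is zero in the field.\<close>

lemma trivial_not_proj: "\<not> SG.proj (trivial_fgmod :: (nat \<Rightarrow> nat, 'a) fgmod)"
proof
  assume "SG.proj (trivial_fgmod :: (nat \<Rightarrow> nat, 'a) fgmod)"
  then obtain t where t: "E 1 = SG.Tr trivial_fgmod (trivial_fgmod :: (nat \<Rightarrow> nat, 'a) fgmod) t"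
    unfolding SG.proj_def SG.null_def by (auto simp: trivial_fgmod_def)
  have "SG.Tr trivial_fgmod (trivial_fgmod :: (nat \<Rightarrow> nat, 'a) fgmod) t = (\<Sum>g\<in>carrier G. E 1 * t * E 1)"
    unfolding SG.Tr_def by (simp add: rh_def trivial_fgmod_def em_one)
  from arg_cong[OF trans[OF t this], of "\<lambda>M. ent M 0 0"]
  have "ent (E 1 :: 'a fmat) 0 0 = (\<Sum>g\<in>carrier G. ent (E 1 * t * E 1) 0 0)"
    by (simp only: ent_sum)
  also have "\<dots> = of_nat (card (carrier G)) * ent (E 1 * t * E 1) 0 0" by simp
  also have "(of_nat (card (carrier G)) :: 'a) = 0"
    using card_permutations[of "{1..p}" p] by (simp add: sym_group_simps of_nat_0_iff p prime_dvd_fact_iff del: of_nat_fact)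
  finally show False by (simp add: ent_E)
qed

end

section \<open>Specht modules of hooks\<close>

context fin_group
begin

lemma ap_comm:
  assumes "md V" "md W" "hm G V W f" "g \<in> carrier G"
  shows "ap (mdim V) f (ap (mdim V) (rh V g) u) = ap (mdim W) (rh W g) (ap (mdim V) f u)"
proof -
  have "ap (mdim V) f (ap (mdim V) (rh V g) u) = ap (mdim V) (f * rh V g) u"
    using assms by (intro ap_mult[symmetric]) (simp_all add: hm_def rh_simps)
  also have "\<dots> = ap (mdim V) (rh W g * f) u" using assms by (simp add: hm_def)
  also have "\<dots> = ap (mdim W) (rh W g) (ap (mdim V) f u)"
    using assms by (intro ap_mult) (simp_all add: hm_def rh_simps)
  finally show ?thesis .
qed

text \<open>By \<open>top\<close> every proper submodule of \<open>Z\<close> lies in the kernel of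
  \<open>q\<close>. Preimages of submodules under \<open>q\<close> give simplicity of
  \<open>W\<close>. If \<open>f\<close> maps \<open>Z\<close> onto a simple \<open>D\<close>, its
  kernel is proper, so \<open>q\<close> factors through \<open>f\<close>, and the induced map from
  \<open>D\<close> onto \<open>W\<close> is invertible.\<close>

lemma unique_top:
  fixes Z W D :: "('g, 'b::field) fgmod"
  assumes Z: "md Z" and W: "md W" and q: "hm G Z W q" "Idm Z * s = s" "s * Idm W = s" "q * s = Idm W"
    and pos: "0 < mdim W"
    and top: "\<And>L. fsub G Z L \<Longrightarrow> L = {u. sup_le (mdim Z) u} \<or> (\<forall>u\<in>L. ap (mdim Z) q u = (\<lambda>i. 0))"
  shows "simple_fgmod G W"
    and "simple_fgmod G D \<Longrightarrow> hm G Z D f \<Longrightarrow> Idm Z * t = t \<Longrightarrow> t * Idm D = t \<Longrightarrow> f * t = Idm D \<Longrightarrow> fgiso G D W"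
proof -
  have qs: "ap (mdim Z) q (ap (mdim W) s v) = v" if "sup_le (mdim W) v" for v
    using ap_mult[of q "mdim Z" s "mdim W" v] q ap_E[OF that] by (simp add: hm_def)
  have ss: "sup_le (mdim Z) (ap (mdim W) s v)" for v by (rule sup_ap[OF q(2)])
  show simple: "simple_fgmod G W"
    unfolding simple_fgmod_def
  proof (intro conjI allI impI W pos)
    fix U assume "fgsub G W U"
    then have U: "U \<subseteq> carrier_vec (mdim W)" "fsub G W (fv (mdim W) ` U)" by (simp_all add: fgsub_iff[OF W])
    define M where "M = fv (mdim W) ` U"
    have M: "subsp M" "\<And>u. u \<in> M \<Longrightarrow> sup_le (mdim W) u" "\<And>g u. g \<in> carrier G \<Longrightarrow> u \<in> M \<Longrightarrow> ap (mdim W) (rh W g) u \<in> M"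
      using U(2) by (auto simp: fsub_def M_def)
    define L where "L = {u. sup_le (mdim Z) u \<and> ap (mdim Z) q u \<in> M}"
    have "fsub G Z L"
      unfolding fsub_def L_def
    proof (intro conjI ballI)
      show "subsp {u. sup_le (mdim Z) u \<and> ap (mdim Z) q u \<in> M}"
        using subspD[OF M(1)] by (auto simp: subsp_def ap_linear sup_le_def)
      fix g u assume g: "g \<in> carrier G" and u: "u \<in> {u. sup_le (mdim Z) u \<and> ap (mdim Z) q u \<in> M}"
      have "sup_le (mdim Z) (ap (mdim Z) (rh Z g) u)" by (rule sup_ap) (simp add: rh_simps[OF Z] g)
      then show "ap (mdim Z) (rh Z g) u \<in> {u. sup_le (mdim Z) u \<and> ap (mdim Z) q u \<in> M}"
        using u M(3)[OF g] ap_comm[OF Z W q(1) g] by simp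
    qed simp
    then have "L = {u. sup_le (mdim Z) u} \<or> (\<forall>u\<in>L. ap (mdim Z) q u = (\<lambda>i. 0))" by (rule top)
    then show "U = {0\<^sub>v (mdim W)} \<or> U = carrier_vec (mdim W)"
    proof
      assume L: "L = {u. sup_le (mdim Z) u}"
      have "v \<in> U" if v: "v \<in> carrier_vec (mdim W)" for v
      proof -
        have "ap (mdim W) s (fv (mdim W) v) \<in> L" using L ss by simp
        then have "fv (mdim W) v \<in> M" using qs[of "fv (mdim W) v"] by (simp add: L_def)
        then obtain w where w: "w \<in> U" "fv (mdim W) v = fv (mdim W) w" by (auto simp: M_def)
        then have "v = w" using fv_inj[OF v _ w(2)] U(1) by blast
        then show ?thesis using w by simp
      qed
      then show ?thesis using U(1) by blast
    next
      assume L: "\<forall>u\<in>L. ap (mdim Z) q u = (\<lambda>i. 0)"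
      have z: "v = 0\<^sub>v (mdim W)" if "v \<in> U" for v
      proof -
        have "ap (mdim W) s (fv (mdim W) v) \<in> L" using qs[of "fv (mdim W) v"] that ss by (simp add: L_def M_def)
        then have "fv (mdim W) v = (\<lambda>i. 0)" using L qs[of "fv (mdim W) v"] by simp
        also have "\<dots> = fv (mdim W) (0\<^sub>v (mdim W))" by (simp add: fv_def fun_eq_iff)
        finally show ?thesis using fv_inj[of v "mdim W" "0\<^sub>v (mdim W)"] that U(1) by auto
      qed
      moreover have "U \<noteq> {}" using subspD(1)[OF M(1)] by (auto simp: M_def)
      ultimately show ?thesis by blast
    qed
  qed
  assume D: "simple_fgmod G D" and f: "hm G Z D f" and t: "Idm Z * t = t" "t * Idm D = t" "f * t = Idm D"
  have mD: "md D" "0 < mdim D" using D by (simp_all add: simple_fgmod_def)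
  have ft: "ap (mdim Z) f (ap (mdim D) t v) = v" if "sup_le (mdim D) v" for v
    using ap_mult[of f "mdim Z" t "mdim D" v] f t ap_E[OF that] by (simp add: hm_def)
  define L where "L = {u. sup_le (mdim Z) u \<and> ap (mdim Z) f u = (\<lambda>i. 0)}"
  have "fsub G Z L"
    unfolding fsub_def L_def
  proof (intro conjI ballI)
    show "subsp {u. sup_le (mdim Z) u \<and> ap (mdim Z) f u = (\<lambda>i. 0)}"
      by (auto simp: subsp_def ap_linear sup_le_def)
    fix g u assume g: "g \<in> carrier G" and u: "u \<in> {u. sup_le (mdim Z) u \<and> ap (mdim Z) f u = (\<lambda>i. 0)}"
    have "sup_le (mdim Z) (ap (mdim Z) (rh Z g) u)" by (rule sup_ap) (simp add: rh_simps[OF Z] g)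
    then show "ap (mdim Z) (rh Z g) u \<in> {u. sup_le (mdim Z) u \<and> ap (mdim Z) f u = (\<lambda>i. 0)}"
      using u ap_comm[OF Z mD(1) f g] by (simp add: ap_linear)
  qed simp
  moreover have "L \<noteq> {u. sup_le (mdim Z) u}"
  proof
    assume L: "L = {u. sup_le (mdim Z) u}"
    define v :: "nat \<Rightarrow> 'b" where "v = (\<lambda>i. if i = 0 then 1 else 0)"
    have v: "sup_le (mdim D) v" using mD(2) by (simp add: sup_le_def v_def)
    have "ap (mdim D) t v \<in> L" unfolding L using sup_ap[OF t(1)] by simp
    then have "v = (\<lambda>i. 0)" using ft[OF v] by (simp add: L_def)
    then show False by (simp add: v_def fun_eq_iff) (metis zero_neq_one)
  qed
  ultimately have kill: "ap (mdim Z) q u = (\<lambda>i. 0)" if "u \<in> L" for u using top that by blast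
  \<comment> \<open>\<open>f\<close> kills the columns of \<open>1 - t f\<close>, so they lie in
    \<open>L\<close> and \<open>q\<close> kills them too.\<close>
  have qtf: "q * t * f = q"
  proof -
    define Y where "Y = Idm Z - t * f"
    have EY: "Idm Z * Y = Y" using t f by (simp add: Y_def right_diff_distrib E_E mult.assoc[symmetric])
    have "f * Y = 0" using f t by (simp add: Y_def right_diff_distrib mult.assoc[symmetric] hm_def)
    have "clm (q * Y) j = (\<lambda>i. 0)" for j
    proof -
      have "ap (mdim Z) f (clm Y j) = clm (f * Y) j" by (rule clm_mult[symmetric]) (simp add: EY)
      then have "clm Y j \<in> L" using \<open>f * Y = 0\<close> sup_clm[OF EY] by (simp add: L_def clm_def)
      then show ?thesis using kill clm_mult[of q "mdim Z" Y j] EY by simp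
    qed
    then have "q * Y = 0" by (intro clm_eqI) (simp add: clm_def)
    then show ?thesis using q(1) by (simp add: Y_def right_diff_distrib hm_def mult.assoc)
  qed
  define h where "h = q * t"
  have hf: "h * f = q" using qtf by (simp add: h_def)
  have h: "hm G D W h"
    unfolding hm_def
  proof (intro conjI ballI)
    show "Idm W * h = h" unfolding h_def by (rule hm_simps(3)[OF q(1)])
    show "h * Idm D = h" unfolding h_def mult.assoc t(2) ..
    fix g assume g: "g \<in> carrier G"
    have fg: "f * rh Z g = rh D g * f" "q * rh Z g = rh W g * q" using f q(1) g by (simp_all add: hm_def)
    have "h * rh D g = h * (rh D g * (f * t))" using t rh_simps[OF mD(1)] g by simp
    also have "\<dots> = h * f * rh Z g * t"
      unfolding mult.assoc[of "rh D g" f t, symmetric] fg(1)[symmetric] by (simp only: mult.assoc)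
    also have "\<dots> = rh W g * h" unfolding hf fg by (simp add: h_def mult.assoc)
    finally show "h * rh D g = rh W g * h" .
  qed
  have hs: "h * (f * s) = Idm W" using hf q by (simp flip: mult.assoc)
  obtain K i r where K: "md K" "hm G K D i" "Idm K * r = r" "r * Idm D = r" "r * i = Idm K" "h * i = 0"
    "\<forall>Y. Idm D * Y = Y \<longrightarrow> h * Y = 0 \<longrightarrow> i * (r * Y) = Y"
    using kernel_factor[OF mD(1) W h] .
  have "i * r \<noteq> Idm D"
  proof
    assume "i * r = Idm D"
    then have "h = h * i * r" using h by (simp add: hm_def mult.assoc)
    then have "h = 0" using K(6) by simp
    then have "Idm W = (0 :: 'b fmat)" using hs by simp
    then show False using pos by (simp add: E_eq_zero_iff)
  qed
  then have "mdim K = 0" using simple_sub[OF D K(1-5)] by blast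
  then have "i = 0" using K(2) by (metis E_eq_zero_iff hm_def mult_zero_right)
  define Y where "Y = f * s * h - Idm D"
  have "Idm D * Y = Y" using f by (simp add: Y_def right_diff_distrib E_E hm_def mult.assoc[symmetric])
  moreover have "h * Y = 0"
    unfolding Y_def right_diff_distrib mult.assoc[of h "f * s" h, symmetric] hs using h by (simp add: hm_def)
  ultimately have "Y = 0" using K(7) \<open>i = 0\<close> by (metis mult_zero_left)
  then have hi: "f * s * h = Idm D" by (simp add: Y_def)
  have "hm G W D (f * s)"
    by (rule hm_inverse[OF mD(1) W h hm_simps(3)[OF f] _ hi hs]) (simp only: mult.assoc q(3))
  then show "fgiso G D W"
    unfolding fgiso_iff using mD W h hs hi by blast
qed

end

definition co :: "('x, 'a::field) pb \<Rightarrow> ('x \<Rightarrow> 'a) \<Rightarrow> nat \<Rightarrow> 'a" where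
  "co B f = (\<lambda>j. if j < pdim B then f (ppt B j) else 0)"

definition fco :: "('x, 'a::field) pb \<Rightarrow> (nat \<Rightarrow> 'a) \<Rightarrow> 'x \<Rightarrow> 'a" where
  "fco B u = (\<Sum>j<pdim B. sc (u j) (pbs B j))"

lemma sup_co: "sup_le (pdim B) (co B f)"
  by (simp add: sup_le_def co_def)

lemma fco_mem: "is_pb U B \<Longrightarrow> fco B u \<in> U"
  unfolding fco_def by (rule fsp_sum) (auto dest: is_pbD(1,2) fspD(3))

lemma co_fco: "is_pb U B \<Longrightarrow> sup_le (pdim B) u \<Longrightarrow> co B (fco B u) = u"
proof
  fix i assume B: "is_pb U B" and u: "sup_le (pdim B) u"
  have "fco B u (ppt B i) = (\<Sum>j<pdim B. if j = i then u i else 0)" if "i < pdim B"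
    unfolding fco_def sum_fun_apply using that by (intro sum.cong) (auto simp: is_pbD(3)[OF B])
  then show "co B (fco B u) i = u i" using u by (auto simp: co_def sup_le_def)
qed

lemma ap_lmat:
  assumes B: "is_pb U B" and T: "lin T" and f: "f \<in> U"
  shows "ap (pdim B) (lmat B B' T) (co B f) = co B' (T f)"
proof
  fix i
  have "T f = T (\<Sum>j<pdim B. sc (f (ppt B j)) (pbs B j))" using is_pbD(4)[OF B f] by (rule arg_cong)
  also have "\<dots> = (\<Sum>j<pdim B. sc (f (ppt B j)) (T (pbs B j)))" by (rule lin_sum[OF T])
  finally have "T f (ppt B' i) = (\<Sum>j<pdim B. f (ppt B j) * T (pbs B j) (ppt B' i))"
    by (simp add: sum_fun_apply)
  then show "ap (pdim B) (lmat B B' T) (co B f) i = co B' (T f) i"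
    by (auto simp: ap_def lmat_def co_def mult.commute intro!: sum.cong)
qed

section \<open>The kernel of \<open>bd\<close> and its simple head\<close>

locale hook = sym_char +
  fixes i :: nat
  assumes i: "i \<le> p - 2"
begin

definition BZ :: "(nat list, 'a) pb" where "BZ = (SOME B. is_pb (ZZ i) B)"

definition Zm :: "(nat \<Rightarrow> nat, 'a) fgmod" where "Zm = prep BZ tt"

lemma is_pb_BZ: "is_pb (ZZ i) BZ"
proof -
  obtain S where S: "finite S" "\<forall>f xs. alt {1..p} i (f :: _ \<Rightarrow> 'a) \<longrightarrow> xs \<notin> S \<longrightarrow> f xs = 0"
    using alt_finite[of i] .
  have "\<exists>B. is_pb (ZZ i :: (nat list \<Rightarrow> 'a) set) B"
    by (rule is_pb_exists[OF fsp_ZZ S(1)]) (use S(2) in \<open>auto simp: ZZ_def\<close>)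
  then show ?thesis unfolding BZ_def by (rule someI_ex)
qed

lemma stab_ZZ: "SG.stab (ZZ i :: (nat list \<Rightarrow> 'a) set) tt"
  unfolding SG.stab_def tt_def sym_group_simps
proof (intro ballI)
  fix g :: "nat \<Rightarrow> nat" and f :: "nat list \<Rightarrow> 'a" assume "g \<in> {g. g permutes {1..p}}" and f: "f \<in> ZZ i"
  then have "inv' g permutes {1..p}" by (simp add: permutes_inv)
  then show "f \<circ> map (inv' g) \<in> ZZ i" using f by (rule ZZ_perm)
qed

lemma md_Zm: "SG.md Zm"
  unfolding Zm_def by (rule SG.md_prep[OF is_pb_BZ ract_tt stab_ZZ])

lemma lin_delta: "lin delta" by (simp add: lin_def)

definition gam :: "'a fmat" where "gam = lmat BZ (BB (Suc i)) delta"

lemma hm_gam: "hm G Zm (W (Suc i)) gam"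
  unfolding Zm_def W_def gam_def
proof (rule SG.hm_lmat[OF is_pb_BZ is_pb_BB stab_ZZ stab_UU lin_delta delta_UU])
  fix f g assume "g \<in> carrier G"
  then have "inv' g permutes {1..p}" by (simp add: sym_group_simps permutes_inv)
  then show "delta (f \<circ> tt g) = delta f \<circ> tt g" unfolding tt_def by (simp only: wedge_comp_map ones_permutes)
qed

text \<open>By \<open>UU_delta\<close> contraction at the point 1 is a section of
  \<open>delta\<close>; only its linearity is used.\<close>

definition sec :: "'a fmat" where "sec = lmat (BB (Suc i)) BZ (del 1)"

lemma sec: "Idm Zm * sec = sec" "sec * Idm (W (Suc i)) = sec" "gam * sec = Idm (W (Suc i))"
proof -
  show "Idm Zm * sec = sec" "sec * Idm (W (Suc i)) = sec"
    by (simp_all add: sec_def Zm_def W_def lmat_E)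
  have "gam * sec = lmat (BB (Suc i)) (BB (Suc i)) (\<lambda>w. delta (del 1 w))"
    unfolding gam_def sec_def by (rule lmat_comp[OF is_pb_BB is_pb_BZ lin_delta del_ZZ])
  also have "\<dots> = lmat (BB (Suc i)) (BB (Suc i)) (\<lambda>w. w)"
    by (rule lmat_cong[OF is_pb_BB]) (use UU_delta[of _ "Suc i" 1] p in auto)
  finally show "gam * sec = Idm (W (Suc i))" using lmat_id[OF is_pb_BB, of "Suc i"] by (simp add: W_def)
qed

text \<open>\<open>james_submodule\<close>, carried over from functions to coordinate
  vectors.\<close>

lemma Zm_top:
  assumes L: "fsub G Zm L"
  shows "L = {u. sup_le (mdim Zm) u} \<or> (\<forall>u\<in>L. ap (mdim Zm) gam u = (\<lambda>i. 0))"
proof -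
  have Ls: "subsp L" "\<And>u. u \<in> L \<Longrightarrow> sup_le (mdim Zm) u"
    "\<And>g u. g \<in> carrier G \<Longrightarrow> u \<in> L \<Longrightarrow> ap (mdim Zm) (rh Zm g) u \<in> L"
    using L by (auto simp: fsub_def)
  define M where "M = {f \<in> ZZ i. co BZ f \<in> L}"
  have M: "fsp M"
    unfolding fsp_def M_def
  proof (intro conjI ballI allI CollectI)
    have "co BZ 0 = (\<lambda>j. 0)" by (auto simp: co_def)
    then show "co BZ 0 \<in> L" using subspD(1)[OF Ls(1)] by simp
    fix f assume f: "f \<in> {f \<in> ZZ i. co BZ f \<in> L}"
    show "f + h \<in> ZZ i" if "h \<in> {f \<in> ZZ i. co BZ f \<in> L}" for h
      using f that fspD(2)[OF fsp_ZZ] by blast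
    have "co BZ (f + h) = (\<lambda>j. co BZ f j + co BZ h j)" for h by (auto simp: co_def)
    then show "co BZ (f + h) \<in> L" if "h \<in> {f \<in> ZZ i. co BZ f \<in> L}" for h
      using f that subspD(2)[OF Ls(1)] by simp
    show "sc c f \<in> ZZ i" for c using f fspD(3)[OF fsp_ZZ] by blast
    have "co BZ (sc c f) = (\<lambda>j. c * co BZ f j)" for c by (auto simp: co_def)
    then show "co BZ (sc c f) \<in> L" for c using f subspD(3)[OF Ls(1)] by simp
  qed (use fspD(1)[OF fsp_ZZ] in auto)
  have g: "f \<circ> map g \<in> M" if f: "f \<in> M" and g: "g permutes {1..p}" for f g
  proof -
    have fZ: "f \<in> ZZ i" "co BZ f \<in> L" using f by (auto simp: M_def)
    have t: "tt (inv' g) = map g" using g by (simp add: tt_def inv_inv_eq permutes_bij)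
    have "ap (mdim Zm) (rh Zm (inv' g)) (co BZ f) = co BZ (f \<circ> map g)"
      unfolding Zm_def rh_prep mdim_prep t by (rule ap_lmat[OF is_pb_BZ lin_comp fZ(1)])
    moreover have "ap (mdim Zm) (rh Zm (inv' g)) (co BZ f) \<in> L"
      by (rule Ls(3)[OF _ fZ(2)]) (use g in \<open>simp add: sym_group_simps permutes_inv\<close>)
    ultimately show ?thesis using ZZ_perm[OF g fZ(1)] by (simp add: M_def)
  qed
  have fM: "fco BZ u \<in> M" if "u \<in> L" for u
    using co_fco[OF is_pb_BZ, of u] Ls(2)[OF that] that fco_mem[OF is_pb_BZ] by (simp add: M_def Zm_def)
  show ?thesis
  proof (cases "\<forall>f\<in>M. delta f = 0")
    case True
    have "ap (mdim Zm) gam u = (\<lambda>i. 0)" if "u \<in> L" for u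
    proof -
      have "ap (mdim Zm) gam (co BZ (fco BZ u)) = co (BB (Suc i)) (delta (fco BZ u))"
        unfolding Zm_def mdim_prep gam_def by (rule ap_lmat[OF is_pb_BZ lin_delta fco_mem[OF is_pb_BZ]])
      moreover have "co BZ (fco BZ u) = u" using co_fco[OF is_pb_BZ, of u] Ls(2)[OF that] by (simp add: Zm_def)
      ultimately show ?thesis using True fM[OF that] by (auto simp: co_def)
    qed
    then show ?thesis by blast
  next
    case False
    then obtain h where h: "h \<in> M" "delta h \<noteq> 0" by blast
    have MZ: "M = ZZ i" by (rule james_submodule[OF _ M _ g h]) (use i p in \<open>auto simp: M_def\<close>)
    have "u \<in> L" if "sup_le (mdim Zm) u" for u
    proof -
      have "fco BZ u \<in> M" unfolding MZ by (rule fco_mem[OF is_pb_BZ])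
      then show ?thesis using co_fco[OF is_pb_BZ, of u] that by (simp add: M_def Zm_def)
    qed
    then show ?thesis using Ls(2) by blast
  qed
qed

lemma W_pos: "0 < mdim (W (Suc i))"
  by (rule W_nonzero) (use i p in auto)

lemma W_simple: "simple_fgmod G (W (Suc i))"
  by (rule SG.unique_top(1)[OF md_Zm md_W hm_gam sec W_pos Zm_top])

abbreviation ps :: "nat list" where "ps \<equiv> (p - i) # replicate i 1"

lemma sum_ps: "sum_list ps = p"
  using i p by (simp add: sum_list_replicate)

lemma diagram_ps: "diagram ps = (\<lambda>a. (a, 0)) ` {..<Suc i} \<union> (\<lambda>b. (0, Suc b)) ` {..<p - i - 1}"
proof -
  have "(a, b) \<in> diagram ps \<longleftrightarrow> (a < Suc i \<and> b = 0) \<or> (a = 0 \<and> b \<in> Suc ` {..<p - i - 1})" for a b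
    using i p by (cases a; cases b) (auto simp: diagram_def)
  then show ?thesis by (auto simp: image_iff)
qed

definition fc :: "(nat \<times> nat \<Rightarrow> nat) \<Rightarrow> nat list" where "fc t = map (\<lambda>a. t (a, 0)) [0..<Suc i]"

text \<open>Below its first row a hook tabloid consists of singletons, so it is determined by the
  list \<open>xs\<close> of their entries.\<close>

definition tb :: "nat list \<Rightarrow> nat set list" where "tb xs = ({1..p} - set xs) # map (\<lambda>x. {x}) xs"

definition XS :: "nat list set" where "XS = {xs. distinct xs \<and> set xs \<subseteq> {1..p} \<and> length xs = i}"

lemma tableauxD:
  assumes "t \<in> tableaux ps"
  shows "inj_on t (diagram ps)" "t ` diagram ps = {1..p}"
  using assms unfolding tableaux_def sum_ps by (auto simp: bij_betw_def)

lemma fc_props: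
  assumes "t \<in> tableaux ps"
  shows "distinct (fc t)" "set (fc t) \<subseteq> {1..p}" "length (fc t) = Suc i"
proof -
  have "inj_on (\<lambda>a. t (a, 0)) {0..<Suc i}"
  proof (rule inj_onI)
    fix x y assume "x \<in> {0..<Suc i}" "y \<in> {0..<Suc i}" and eq: "t (x, 0) = t (y, 0)"
    then have "(x, 0) \<in> diagram ps" "(y, 0) \<in> diagram ps" unfolding diagram_ps by auto
    with inj_onD[OF tableauxD(1)[OF assms] eq] show "x = y" by simp
  qed
  then show "distinct (fc t)" unfolding fc_def by (simp add: distinct_map del: upt_Suc)
  show "set (fc t) \<subseteq> {1..p}" unfolding tableauxD(2)[OF assms, symmetric] diagram_ps fc_def
    by (auto simp del: upt_Suc)
qed (simp add: fc_def)

lemma fc_Cons: "fc t = t (0, 0) # tl (fc t)" "tl (fc t) = map (\<lambda>a. t (Suc a, 0)) [0..<i]"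
  unfolding fc_def map_upt_Suc by simp_all

lemma tabloid_tb:
  assumes t: "t \<in> tableaux ps" shows "tabloid ps t = tb (tl (fc t))" "tl (fc t) \<in> XS"
proof -
  note T = tableauxD[OF t]
  have "(\<lambda>b. t (0, b)) ` {..<p - i} = {1..p} - set (tl (fc t))"
  proof -
    have d: "diagram ps = (\<lambda>b. (0, b)) ` {..<p - i} \<union> (\<lambda>a. (Suc a, 0)) ` {..<i}"
    proof -
      have "(a, b) \<in> diagram ps \<longleftrightarrow> (a = 0 \<and> b < p - i) \<or> (a \<in> Suc ` {..<i} \<and> b = 0)" for a b
        using i p by (cases a) (auto simp: diagram_def)
      then show ?thesis by (auto simp: image_iff)
    qed
    have "t ` ((\<lambda>b. (0, b)) ` {..<p - i}) \<inter> t ` ((\<lambda>a. (Suc a, 0)) ` {..<i}) = {}"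
      using T(1) unfolding d by (subst inj_on_image_Int[symmetric, of t "(\<lambda>b. (0, b)) ` {..<p - i} \<union> (\<lambda>a. (Suc a, 0)) ` {..<i}"]) auto
    moreover have "t ` ((\<lambda>b. (0, b)) ` {..<p - i}) \<union> t ` ((\<lambda>a. (Suc a, 0)) ` {..<i}) = {1..p}"
      using T(2) unfolding d image_Un .
    moreover have "t ` ((\<lambda>a. (Suc a, 0)) ` {..<i}) = set (tl (fc t))" unfolding fc_Cons(2) by (auto simp: image_image)
    ultimately show ?thesis by (auto simp: image_image)
  qed
  moreover have "{..<1::nat} = {0}" by auto
  ultimately show "tabloid ps t = tb (tl (fc t))"
    unfolding tabloid_def tb_def fc_Cons(2) by (simp add: map_upt_Suc del: upt_Suc) 
  show "tl (fc t) \<in> XS"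
    using fc_props[OF t] by (cases "fc t") (simp_all add: XS_def)
qed

lemma tableau_exists:
  assumes c: "distinct c" "set c \<subseteq> {1..p}" "length c = Suc i"
  obtains t where "t \<in> tableaux ps" "fc t = c"
proof -
  obtain r where r: "set r = {1..p} - set c" "distinct r"
    using finite_distinct_list[of "{1..p} - set c"] by auto
  have lr: "length r = p - i - 1"
    using distinct_card[OF r(2)] distinct_card[OF c(1)] c r(1) by (simp add: card_Diff_subset)
  define t where "t = (\<lambda>(a, b). if b = 0 then c ! a else r ! (b - 1))"
  have t0: "t ` ((\<lambda>a. (a, 0)) ` {..<Suc i}) = set c"
    unfolding image_image t_def using c(3) by (auto simp: set_conv_nth image_iff)
  have t1: "t ` ((\<lambda>b. (0, Suc b)) ` {..<p - i - 1}) = set r"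
    unfolding image_image t_def using lr by (auto simp: set_conv_nth image_iff)
  have "inj_on t ((\<lambda>a. (a, 0)) ` {..<Suc i})" "inj_on t ((\<lambda>b. (0, Suc b)) ` {..<p - i - 1})"
    using c r lr by (auto simp: inj_on_def t_def nth_eq_iff_index_eq)
  moreover have "set c \<inter> set r = {}" and un: "set c \<union> set r = {1..p}" using r c by auto
  ultimately have "inj_on t (diagram ps)"
    unfolding diagram_ps inj_on_Un using t0 t1 by blast
  then have "bij_betw t (diagram ps) {1..p}"
    unfolding bij_betw_def diagram_ps image_Un t0 t1 un by blast
  then have "t \<in> tableaux ps" by (simp only: tableaux_def sum_ps mem_Collect_eq)
  moreover have "fc t = c" unfolding fc_def t_def using c(3) by (simp add: map_nth del: upt_Suc flip: c(3))
  ultimately show ?thesis by (rule that)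
qed

lemma tabloids_ps: "tabloids ps = tb ` XS"
proof
  show "tabloids ps \<subseteq> tb ` XS" unfolding tabloids_def using tabloid_tb by auto
  show "tb ` XS \<subseteq> tabloids ps"
  proof
    fix T assume "T \<in> tb ` XS"
    then obtain xs where xs: "T = tb xs" "distinct xs" "set xs \<subseteq> {1..p}" "length xs = i" by (auto simp: XS_def)
    have "card (set xs) < card {1..p}" using xs i p distinct_card[OF xs(2)] by simp
    then obtain c0 where c0: "c0 \<in> {1..p}" "c0 \<notin> set xs" using xs(3) by (metis less_irrefl subsetI subset_antisym)
    obtain t where t: "t \<in> tableaux ps" "fc t = c0 # xs"
      using tableau_exists[of "c0 # xs"] xs c0 by auto
    then show "T \<in> tabloids ps" unfolding tabloids_def using tabloid_tb(1)[OF t(1)] t xs(1) by (metis imageI list.sel(3))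
  qed
qed

text \<open>Every column of a hook other than the first has a single box, whose entry must be
  fixed.\<close>

lemma column_stabilizer_iff:
  assumes t: "t \<in> tableaux ps"
  shows "\<pi> \<in> column_stabilizer ps t \<longleftrightarrow> \<pi> permutes set (fc t)"
proof -
  note T = tableauxD[OF t]
  define C where "C j = {t (a, j) | a. (a, j) \<in> diagram ps}" for j
  have C0: "C 0 = set (fc t)"
    unfolding C_def fc_def diagram_ps by (auto simp del: upt_Suc)
  have C1: "C (Suc b) \<subseteq> {t (0, Suc b)}" for b
    unfolding C_def diagram_ps by auto
  have C2: "b < p - i - 1 \<Longrightarrow> C (Suc b) = {t (0, Suc b)}" for b
    unfolding C_def diagram_ps by auto
  have CC: "C (Suc b) \<inter> set (fc t) = {}" for b
    unfolding C0[symmetric] C_def using T(1) by (auto dest!: inj_onD)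
  have cs: "\<pi> \<in> column_stabilizer ps t \<longleftrightarrow> \<pi> permutes {1..p} \<and> (\<forall>j. \<pi> ` C j = C j)"
    unfolding column_stabilizer_def sum_ps C_def Let_def by simp
  show ?thesis
  proof
    assume "\<pi> \<in> column_stabilizer ps t"
    then have \<pi>: "\<pi> permutes {1..p}" "\<And>j. \<pi> ` C j = C j" by (auto simp: cs)
    have "\<pi> x = x" if "x \<in> {1..p} - set (fc t)" for x
    proof -
      have "x \<in> t ` diagram ps" using that unfolding T(2) by blast
      then obtain z where z: "z \<in> diagram ps" "x = t z" by blast
      have "z \<notin> (\<lambda>a. (a, 0)) ` {..<Suc i}" using that z(2) by (auto simp: fc_def simp del: upt_Suc)
      then obtain b where b: "b < p - i - 1" "z = (0, Suc b)" using z(1) unfolding diagram_ps by auto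
      show ?thesis using \<pi>(2)[of "Suc b"] unfolding C2[OF b(1)] z(2) b(2) by simp
    qed
    then show "\<pi> permutes set (fc t)" by (rule permutes_superset[OF \<pi>(1)])
  next
    assume \<pi>: "\<pi> permutes set (fc t)"
    have "\<pi> ` C j = C j" for j
    proof (cases j)
      case 0
      then show ?thesis using permutes_image[OF \<pi>] by (simp add: C0)
    next
      case (Suc b)
      have "\<pi> x = x" if "x \<in> C (Suc b)" for x using CC[of b] that permutes_not_in[OF \<pi>] by blast
      then show ?thesis by (simp add: Suc image_def)
    qed
    then show "\<pi> \<in> column_stabilizer ps t" using permutes_subset[OF \<pi> fc_props(2)[OF t]] by (simp add: cs)
  qed
qed

end

section \<open>Uniqueness of the module that realises a submodule\<close>

context fin_group
begin

lemma realizes_sub_I: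
  fixes Z M :: "('g, 'b::field) fgmod"
  assumes Z: "md Z" and M: "md M" and z: "hm G Z M z" and r: "Idm Z * r = r" "r * Idm M = r" "r * z = Idm Z"
    and U: "U \<subseteq> carrier_vec (mdim M)" "fv (mdim M) ` U = {ap (mdim Z) z u |u. sup_le (mdim Z) u}"
  shows "realizes_sub G Z M U"
proof -
  let ?A = "dm (mdim M) (mdim Z) z"
  have A: "?A \<in> fghom G Z M" "em ?A = z" using hm_fghom[OF z Z M] by auto
  then have cA: "?A \<in> carrier_mat (mdim M) (mdim Z)" by (simp add: fghom_def)
  have fA: "fv (mdim M) (?A *\<^sub>v v) = ap (mdim Z) z (fv (mdim Z) v)" if "v \<in> carrier_vec (mdim Z)" for v
    using fv_mult[OF cA that] A(2) by simp
  have rz: "ap (mdim M) r (ap (mdim Z) z u) = u" if "sup_le (mdim Z) u" for u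
    using ap_mult[of r "mdim M" z "mdim Z" u] r z ap_E[OF that] by (simp add: hm_def)
  have "bij_betw (\<lambda>v. ?A *\<^sub>v v) (carrier_vec (mdim Z)) U"
    unfolding bij_betw_def
  proof
    show "inj_on (\<lambda>v. ?A *\<^sub>v v) (carrier_vec (mdim Z))"
    proof (rule inj_onI)
      fix v w assume v: "v \<in> carrier_vec (mdim Z)" "w \<in> carrier_vec (mdim Z)" "?A *\<^sub>v v = ?A *\<^sub>v w"
      then have "ap (mdim Z) z (fv (mdim Z) v) = ap (mdim Z) z (fv (mdim Z) w)" using fA by metis
      then have "fv (mdim Z) v = fv (mdim Z) w" using rz sup_fv by metis
      then show "v = w" by (rule fv_inj[OF v(1,2)])
    qed
    show "(\<lambda>v. ?A *\<^sub>v v) ` carrier_vec (mdim Z) = U"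
    proof
      show "(\<lambda>v. ?A *\<^sub>v v) ` carrier_vec (mdim Z) \<subseteq> U"
      proof safe
        fix v :: "'b vec" assume v: "v \<in> carrier_vec (mdim Z)"
        have "fv (mdim M) (?A *\<^sub>v v) \<in> fv (mdim M) ` U" unfolding U(2) fA[OF v] using sup_fv by blast
        then obtain u where u: "u \<in> U" "fv (mdim M) (?A *\<^sub>v v) = fv (mdim M) u" by auto
        have "?A *\<^sub>v v = u" by (rule fv_inj[OF mult_mat_vec_carrier[OF cA v] _ u(2)]) (use u U(1) in auto)
        then show "?A *\<^sub>v v \<in> U" using u by simp
      qed
      show "U \<subseteq> (\<lambda>v. ?A *\<^sub>v v) ` carrier_vec (mdim Z)"
      proof
        fix u assume u: "u \<in> U"
        then obtain w where w: "sup_le (mdim Z) w" "fv (mdim M) u = ap (mdim Z) z w" using U(2) by blast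
        have v: "vec (mdim Z) w \<in> carrier_vec (mdim Z)" by simp
        have eq: "fv (mdim M) (?A *\<^sub>v vec (mdim Z) w) = fv (mdim M) u" unfolding fA[OF v] fv_vec[OF w(1)] w(2) ..
        have "?A *\<^sub>v vec (mdim Z) w = u" by (rule fv_inj[OF mult_mat_vec_carrier[OF cA v] _ eq]) (use u U(1) in auto)
        then show "u \<in> (\<lambda>v. ?A *\<^sub>v v) ` carrier_vec (mdim Z)" using v by blast
      qed
    qed
  qed
  then show ?thesis unfolding realizes_sub_def using Z A(1) by blast
qed

text \<open>Two injections with the same image differ by an isomorphism. This frees
  \<open>specht\<close> from the choice made in it.\<close>

lemma realizes_sub_unique:
  fixes Z M S :: "('g, 'b::field) fgmod"
  assumes Z: "md Z" and M: "md M" and z: "hm G Z M z" and r: "Idm Z * r = r" "r * Idm M = r" "r * z = Idm Z"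
    and U: "U \<subseteq> carrier_vec (mdim M)" "fv (mdim M) ` U = {ap (mdim Z) z u |u. sup_le (mdim Z) u}"
    and S: "realizes_sub G S M U"
  shows "fgiso G S Z"
proof -
  obtain A where mS: "md S" and A: "A \<in> fghom G S M" and bij: "bij_betw (\<lambda>v. A *\<^sub>v v) (carrier_vec (mdim S)) U"
    using S by (auto simp: realizes_sub_def)
  have cA: "A \<in> carrier_mat (mdim M) (mdim S)" using A by (simp add: fghom_def)
  define a where "a = em A"
  have a: "hm G S M a" unfolding a_def by (rule fghom_hm[OF A mS M])
  have fA: "ap (mdim S) a u = fv (mdim M) (A *\<^sub>v vec (mdim S) u)" if "sup_le (mdim S) u" for u
    using fv_mult[OF cA, of "vec (mdim S) u"] fv_vec[OF that] by (simp add: a_def)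
  have inj: "u = w" if "sup_le (mdim S) u" "sup_le (mdim S) w" "ap (mdim S) a u = ap (mdim S) a w" for u w
  proof -
    have "A *\<^sub>v vec (mdim S) u = A *\<^sub>v vec (mdim S) w"
      by (rule fv_inj[OF mult_mat_vec_carrier[OF cA] mult_mat_vec_carrier[OF cA]]) (use that fA in auto)
    then have "vec (mdim S) u = vec (mdim S) w"
      using inj_onD[OF bij_betw_imp_inj_on[OF bij]] by simp
    then show ?thesis using fv_vec that(1,2) by metis
  qed
  have img: "fv (mdim M) ` U = {ap (mdim S) a u |u. sup_le (mdim S) u}"
  proof -
    have "U = (\<lambda>v. A *\<^sub>v v) ` carrier_vec (mdim S)" using bij by (simp add: bij_betw_def)
    then have "fv (mdim M) ` U = (\<lambda>v. fv (mdim M) (A *\<^sub>v v)) ` carrier_vec (mdim S)" by (simp add: image_image)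
    also have "\<dots> = {ap (mdim S) a u |u. sup_le (mdim S) u}"
    proof safe
      fix v :: "'b vec" assume v: "v \<in> carrier_vec (mdim S)"
      show "\<exists>u. fv (mdim M) (A *\<^sub>v v) = ap (mdim S) a u \<and> sup_le (mdim S) u"
        by (rule exI[of _ "fv (mdim S) v"]) (simp add: fA vec_fv[OF v])
    next
      fix u :: "nat \<Rightarrow> 'b" assume "sup_le (mdim S) u"
      then show "ap (mdim S) a u \<in> (\<lambda>v. fv (mdim M) (A *\<^sub>v v)) ` carrier_vec (mdim S)" using fA by auto
    qed
    finally show ?thesis .
  qed
  have E: "sup_le n (clm (E n) j)" for n j by (rule sup_clm) (simp add: E_E)
  have ca: "clm a j = ap (mdim S) a (clm (E (mdim S)) j)" for j
  proof -
    have "clm (a * Idm S) j = ap (mdim S) a (clm (Idm S) j)" by (rule clm_mult) (rule disjI1[OF hm_simps(2)[OF a]])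
    then show ?thesis unfolding hm_simps(2)[OF a] .
  qed
  have cz: "clm z j = ap (mdim Z) z (clm (E (mdim Z)) j)" for j
  proof -
    have "clm (z * Idm Z) j = ap (mdim Z) z (clm (Idm Z) j)" by (rule clm_mult) (rule disjI1[OF hm_simps(2)[OF z]])
    then show ?thesis unfolding hm_simps(2)[OF z] .
  qed
  have rz: "ap (mdim M) r (ap (mdim Z) z u) = u" if "sup_le (mdim Z) u" for u
    using ap_mult[of r "mdim M" z "mdim Z" u] r z ap_E[OF that] by (simp add: hm_def)
  have zra: "z * (r * a) = a"
  proof (rule clm_eqI)
    fix j
    have "clm a j \<in> fv (mdim M) ` U" unfolding img ca using E by blast
    then obtain u where u: "sup_le (mdim Z) u" "clm a j = ap (mdim Z) z u" unfolding U(2) by blast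
    have "clm (z * (r * a)) j = ap (mdim Z) z (clm (r * a) j)" by (rule clm_mult) (use z in \<open>simp add: hm_def\<close>)
    also have "clm (r * a) j = ap (mdim M) r (clm a j)" by (rule clm_mult) (use r in simp)
    finally show "clm (z * (r * a)) j = clm a j" unfolding u(2) rz[OF u(1)] .
  qed
  have ra: "hm G S Z (r * a)" by (rule hm_lift[OF Z M mS z r(1,3) a zra])
  have "\<exists>u. sup_le (mdim S) u \<and> ap (mdim S) a u = clm z j" for j
  proof -
    have "clm z j \<in> fv (mdim M) ` U" unfolding U(2) cz using E by blast
    then show ?thesis unfolding img by force
  qed
  then obtain c where c: "\<And>j. sup_le (mdim S) (c j)" "\<And>j. ap (mdim S) a (c j) = clm z j" by metis
  obtain Y where Y: "Idm S * Y = Y" "Y * Idm Z = Y" "\<And>j. clm Y j = (if j < mdim Z then c j else (\<lambda>i. 0))"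
    using matrix_of_cols[of "mdim Z" "mdim S" c] c(1) by blast
  have aY: "a * Y = z"
  proof (rule clm_eqI)
    fix j
    have "clm (a * Y) j = ap (mdim S) a (clm Y j)" by (rule clm_mult) (simp add: Y)
    also have "\<dots> = clm z j"
    proof (cases "j < mdim Z")
      case False
      have "z * Idm Z = z" using z by (simp add: hm_def)
      then have "clm z j = (\<lambda>i. 0)" using False by (auto simp: clm_def mult_E_iff)
      then show ?thesis using False by (simp add: Y ap_linear)
    qed (simp add: Y c)
    finally show "clm (a * Y) j = clm z j" .
  qed
  have 1: "r * a * Y = Idm Z" by (simp add: mult.assoc aY r)
  have 2: "Y * (r * a) = Idm S"
  proof (rule clm_eqI)
    fix j
    have "a * (Y * (r * a)) = a * Idm S" using a by (simp add: mult.assoc[symmetric] aY hm_def) (simp add: mult.assoc zra)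
    then have "clm (a * (Y * (r * a))) j = clm (a * Idm S) j" by simp
    moreover have "clm (a * (Y * (r * a))) j = ap (mdim S) a (clm (Y * (r * a)) j)"
      "clm (a * Idm S) j = ap (mdim S) a (clm (Idm S) j)" by (rule clm_mult, rule disjI1, rule hm_simps(2)[OF a])+
    ultimately have "ap (mdim S) a (clm (Y * (r * a)) j) = ap (mdim S) a (clm (Idm S) j)" by simp
    then show "clm (Y * (r * a)) j = clm (Idm S) j"
      by (rule inj[rotated 2]) (auto intro!: sup_clm E simp: Y mult.assoc[symmetric])
  qed
  have "hm G Z S Y" by (rule hm_inverse[OF mS Z ra Y(1,2) 2 1])
  then show ?thesis unfolding fgiso_iff using mS Z ra 1 2 by blast
qed

end

section \<open>Permutation modules and polytabloids in list coordinates\<close>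

context hook
begin

abbreviation ts :: "nat set list list" where "ts \<equiv> tabloid_list ps"

lemma finite_XS: "finite XS"
  by (rule finite_subset[OF _ finite_lists_length_eq[of "{1..p}" i]]) (auto simp: XS_def)

lemma ts: "distinct ts" "set ts = tb ` XS"
proof -
  have "\<exists>ts. distinct ts \<and> set ts = tabloids ps"
    using finite_distinct_list[of "tabloids ps"] finite_XS unfolding tabloids_ps by blast
  from someI_ex[OF this] show "distinct ts" "set ts = tb ` XS"
    unfolding tabloid_list_def tabloids_ps by auto
qed

lemma inj_tb: "inj_on tb A"
proof -
  have "inj (map (\<lambda>x :: nat. {x}))" by (rule inj_mapI) (simp add: inj_on_def)
  then show ?thesis by (auto simp: tb_def inj_on_def)
qed

definition xl :: "nat \<Rightarrow> nat list" where "xl j = inv_into XS tb (ts ! j)"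

lemma xl: "j < length ts \<Longrightarrow> xl j \<in> XS" "j < length ts \<Longrightarrow> tb (xl j) = ts ! j"
proof -
  assume "j < length ts"
  then have "ts ! j \<in> tb ` XS" using nth_mem ts(2) by blast
  then show "xl j \<in> XS" "tb (xl j) = ts ! j" by (simp_all only: xl_def inv_into_into f_inv_into_f)
qed

lemma tb_xl: "j < length ts \<Longrightarrow> ts ! j = tb xs \<longleftrightarrow> xl j = xs"
  using xl(2)[of j] inj_tb[of UNIV] by (auto simp: inj_on_def)

lemma xl_inj: "j < length ts \<Longrightarrow> k < length ts \<Longrightarrow> xl j = xl k \<longleftrightarrow> j = k"
  using tb_xl[of j "xl k"] xl(2)[of k] nth_eq_iff_index_eq[OF ts(1)] by simp

lemma xl_ex: "xs \<in> XS \<Longrightarrow> \<exists>j<length ts. xl j = xs"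
  using ts(2) tb_xl by (metis imageI in_set_conv_nth)

definition Bp :: "(nat list, 'a) pb" where
  "Bp = \<lparr> pdim = length ts, ppt = xl, pbs = (\<lambda>j xs. if xs = xl j then 1 else 0) \<rparr>"

definition XF :: "(nat list \<Rightarrow> 'a) set" where "XF = {f. \<forall>xs. xs \<notin> XS \<longrightarrow> f xs = 0}"

lemma is_pb_Bp: "is_pb XF Bp"
  unfolding is_pb_def pbas_def
proof (intro conjI allI impI ballI)
  show "fsp XF" by (simp add: fsp_def XF_def)
  show "pbs Bp j \<in> XF" if "j < pdim Bp" for j using that xl(1) by (auto simp: Bp_def XF_def)
  show "pbs Bp j (ppt Bp k) = (if j = k then 1 else 0)" if "j < pdim Bp" "k < pdim Bp" for j k
    using that xl_inj by (auto simp: Bp_def)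
  fix f xs assume f: "f \<in> XF"
  show "f xs = (\<Sum>j<pdim Bp. f (ppt Bp j) * pbs Bp j xs)"
  proof (cases "xs \<in> XS")
    case True
    then obtain k where k: "k < length ts" "xl k = xs" using xl_ex by blast
    have "(\<Sum>j<pdim Bp. f (ppt Bp j) * pbs Bp j xs) = (\<Sum>j<length ts. if j = k then f xs else 0)"
      using k xl_inj by (intro sum.cong) (auto simp: Bp_def)
    then show ?thesis using k by simp
  next
    case False
    have "xs \<noteq> xl j" if "j < length ts" for j using xl(1)[OF that] False by auto
    then show ?thesis using f False by (auto simp: XF_def Bp_def intro!: sum.neutral[symmetric])
  qed
qed

lemma XS_map: "g permutes {1..p} \<Longrightarrow> map g xs \<in> XS \<longleftrightarrow> xs \<in> XS"
proof -
  assume g: "g permutes {1..p}"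
  have "set (map g xs) \<subseteq> {1..p} \<longleftrightarrow> set xs \<subseteq> {1..p}"
  proof -
    have "set (map g xs) \<subseteq> {1..p} \<longleftrightarrow> (\<forall>x\<in>set xs. g x \<in> {1..p})" by auto
    also have "\<dots> \<longleftrightarrow> set xs \<subseteq> {1..p}" unfolding permutes_in_image[OF g] by blast
    finally show ?thesis .
  qed
  then show ?thesis unfolding XS_def using permutes_inj_on[OF g, of "set xs"] by (simp add: distinct_map)
qed

lemma stab_XF: "SG.stab XF tt"
  by (auto simp: SG.stab_def XF_def tt_def sym_group_simps XS_map permutes_inv)

lemma md_Bp: "SG.md (prep Bp tt)"
  by (rule SG.md_prep[OF is_pb_Bp ract_tt stab_XF])

abbreviation M :: "(nat \<Rightarrow> nat, 'a) fgmod" where "M \<equiv> perm_module ps"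

lemma mdim_M: "mdim M = length ts" by (simp add: perm_module_def Let_def)

text \<open>Tabloids are moved by \<open>g\<close> while functions on lists are composed with the
  inverse of \<open>g\<close>; on basis elements the two conditions coincide.\<close>

lemma mact_M: "g \<in> carrier G \<Longrightarrow> mact M g = mact (prep Bp tt) g"
proof -
  assume "g \<in> carrier G"
  then have g: "g permutes {1..p}" by (simp add: sym_group_simps)
  have e: "map (image g) (tb xs) = tb (map g xs)" if "xs \<in> XS" for xs
    using that permutes_image[OF g] permutes_inj[OF g] by (simp add: tb_def image_set_diff)
  have "ts ! j = map (image g) (ts ! k) \<longleftrightarrow> map (inv' g) (xl j) = xl k" if "j < length ts" "k < length ts" for j k
  proof -
    have "ts ! j = map (image g) (ts ! k) \<longleftrightarrow> xl j = map g (xl k)"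
      using e[OF xl(1)[OF that(2)]] tb_xl[OF that(1)] xl(2)[OF that(2)] by simp
    also have "\<dots> \<longleftrightarrow> map (inv' g) (xl j) = xl k"
    proof
      assume "map (inv' g) (xl j) = xl k"
      then have "map g (map (inv' g) (xl j)) = map g (xl k)" by simp
      then show "xl j = map g (xl k)" using permutes_inverses[OF g] by (simp add: comp_def)
    qed (use permutes_inverses[OF g] in \<open>simp add: comp_def\<close>)
    finally show ?thesis .
  qed
  then show ?thesis
    by (auto simp: perm_module_def Let_def prep_def Bp_def tt_def intro!: cong_mat)
qed

lemma hm_M: "SG.md Z \<Longrightarrow> hm G Z (prep Bp tt) f \<Longrightarrow> hm G Z M f"
  unfolding hm_def by (simp add: mdim_M Bp_def rh_def mact_M)

lemma md_M: "SG.md M"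
proof -
  have d: "mdim (prep Bp tt) = mdim M" by (simp add: mdim_M Bp_def)
  show ?thesis
    using md_Bp SG.one_closed SG.m_closed unfolding is_fgmod_def d by (simp add: mact_M)
qed

lemma XF_alt: "alt {1..p} i f \<Longrightarrow> f \<in> XF"
  using alt_support[OF two, of "{1..p}" i f] by (auto simp: XF_def XS_def)

lemma ZZ_XF: "f \<in> ZZ i \<Longrightarrow> f \<in> XF"
  by (simp add: ZZ_def XF_alt)

text \<open>The column stabilizer consists of the permutations of the first column, so the defining
  sum is the one in \<open>bd_wd_eval\<close>.\<close>

lemma polytabloid_eq:
  assumes t: "t \<in> tableaux ps"
  shows "polytabloid ps t = vec (length ts) (co Bp (bd (wd (fc t)) :: _ \<Rightarrow> 'a))"
proof (rule eq_vecI)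
  fix j assume "j < dim_vec (vec (length ts) (co Bp (bd (wd (fc t)) :: _ \<Rightarrow> 'a)))"
  then have j: "j < length ts" by simp
  define cs where "cs = tl (fc t)"
  have c: "fc t = t (0, 0) # cs" using fc_Cons(1)[of t] by (simp only: cs_def)
  have cst: "column_stabilizer ps t = {\<pi>. \<pi> permutes set (fc t)}"
    using column_stabilizer_iff[OF t] by blast
  have tp: "ts ! j = tabloid ps (\<pi> \<circ> t) \<longleftrightarrow> xl j = map \<pi> cs" if \<pi>: "\<pi> permutes set (fc t)" for \<pi>
  proof -
    have "\<pi> permutes {1..p}" using permutes_subset[OF \<pi> fc_props(2)[OF t]] .
    then have "\<pi> \<circ> t \<in> tableaux ps"
      using t unfolding tableaux_def sum_ps by (auto intro: bij_betw_trans permutes_imp_bij)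
    moreover have "tl (fc (\<pi> \<circ> t)) = map \<pi> cs" unfolding cs_def fc_Cons(2) by simp
    ultimately show ?thesis using tabloid_tb(1)[of "\<pi> \<circ> t"] tb_xl[OF j] by simp
  qed
  have "polytabloid ps t $ j = (\<Sum>\<pi> | \<pi> permutes set (fc t). if xl j = map \<pi> cs then of_int (sign \<pi>) else (0::'a))"
    unfolding polytabloid_def Let_def index_vec[OF j] cst by (rule sum.cong) (use tp in simp_all)
  also have "\<dots> = bd (wd (fc t)) (xl j)"
    unfolding c by (rule bd_wd_eval[symmetric]) (use fc_props[OF t] in \<open>simp_all only: c[symmetric]\<close>)
  also have "\<dots> = vec (length ts) (co Bp (bd (wd (fc t)) :: _ \<Rightarrow> 'a)) $ j" using j by (simp add: co_def Bp_def)
  finally show "polytabloid ps t $ j = vec (length ts) (co Bp (bd (wd (fc t)) :: _ \<Rightarrow> 'a)) $ j" .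
qed (simp add: polytabloid_def Let_def)

lemma bd_wd_ZZ: "set c \<subseteq> {1..p} \<Longrightarrow> length c = Suc n \<Longrightarrow> bd (wd c) \<in> (ZZ n :: (nat list \<Rightarrow> 'a) set)"
proof -
  assume c: "set c \<subseteq> {1..p}" "length c = Suc n"
  have a: "alt {1..p} (Suc n) (wd c :: _ \<Rightarrow> 'a)" using alt_wd[OF c(1)] c(2) by simp
  have "bd (bd (wd c)) = - bd (bd (wd c) :: _ \<Rightarrow> 'a)" by (rule contr_anti[OF a])
  then have "sc 2 (bd (bd (wd c))) = (0 :: _ \<Rightarrow> 'a)" by (simp add: fun_eq_iff)
  then have "bd (bd (wd c)) = (0 :: _ \<Rightarrow> 'a)" using two by (simp add: fun_eq_iff)
  then show "bd (wd c) \<in> (ZZ n :: (nat list \<Rightarrow> 'a) set)" using alt_contr[OF a] by (simp add: ZZ_def)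
qed

abbreviation SP :: "'a vec set" where "SP \<equiv> specht_space ps"

definition vc :: "(nat list \<Rightarrow> 'a) \<Rightarrow> 'a vec" where "vc f = vec (length ts) (co Bp f)"

lemma vc_simps: "vc 0 = 0\<^sub>v (length ts)" "vc (f + h) = vc f + vc h" "vc (sc c f) = c \<cdot>\<^sub>v vc f"
  by (auto simp: vc_def co_def Bp_def)

text \<open>Polytabloids are boundaries and so lie in the kernel of \<open>bd\<close>. Conversely
  \<open>ZZ_span\<close> applies, where lists with repetitions contribute zero and all other lists
  are first columns of tableaux.\<close>

lemma specht_space_eq: "SP = vc ` ZZ i"
proof -
  interpret V: vec_space "TYPE('a)" "length ts" .
  let ?V = "module_vec TYPE('a) (length ts)"
  define E where "E = (polytabloid ps ` tableaux ps :: 'a vec set)"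
  have SP: "SP = V.span E" by (simp add: specht_space_def E_def)
  have E: "E \<subseteq> carrier_vec (length ts)" by (auto simp: E_def polytabloid_eq)
  have sub: "VectorSpace.subspace class_ring (V.span E) ?V"
    by (rule V.span_is_subspace) (simp add: E)
  have sp: "V.span E \<subseteq> carrier_vec (length ts)" "0\<^sub>v (length ts) \<in> V.span E"
    "\<And>u v. u \<in> V.span E \<Longrightarrow> v \<in> V.span E \<Longrightarrow> u + v \<in> V.span E" "\<And>c u. u \<in> V.span E \<Longrightarrow> c \<cdot>\<^sub>v u \<in> V.span E"
    using sub unfolding subspace_iff by auto
  have "VectorSpace.subspace class_ring (vc ` ZZ i) ?V"
    unfolding subspace_iff
  proof (intro conjI ballI allI)
    show "vc ` ZZ i \<subseteq> carrier_vec (length ts)" by (auto simp: vc_def)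
    show "0\<^sub>v (length ts) \<in> vc ` ZZ i" using fspD(1)[OF fsp_ZZ] by (metis imageI vc_simps(1))
    fix u assume "u \<in> vc ` ZZ i"
    then obtain f where f: "f \<in> ZZ i" "u = vc f" by blast
    show "c \<cdot>\<^sub>v u \<in> vc ` ZZ i" for c
      unfolding f(2) vc_simps(3)[symmetric] using fspD(3)[OF fsp_ZZ f(1)] by blast
    fix v assume "v \<in> vc ` ZZ i"
    then obtain h where h: "h \<in> ZZ i" "v = vc h" by blast
    show "u + v \<in> vc ` ZZ i"
      unfolding f(2) h(2) vc_simps(2)[symmetric] using fspD(2)[OF fsp_ZZ f(1) h(1)] by blast
  qed
  then have "submodule class_ring (vc ` ZZ i) ?V" by (simp add: VectorSpace.subspace_def)
  moreover have "E \<subseteq> vc ` ZZ i"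
    unfolding E_def using polytabloid_eq bd_wd_ZZ fc_props(2,3) by (auto simp: vc_def)
  ultimately have 1: "V.span E \<subseteq> vc ` ZZ i" by (intro V.span_is_subset)
  define L where "L = {f. vc f \<in> V.span E}"
  have L: "fsp L" unfolding fsp_def L_def using sp by (simp add: vc_simps)
  have "vc f \<in> V.span E" if f: "f \<in> ZZ i" for f
  proof -
    have "f \<in> L"
    proof (rule ZZ_span[OF _ L _ f])
      show "Suc i < card {1..p}" using i p by auto
      fix c assume c: "length c = Suc i" "set c \<subseteq> {1..p}"
      show "bd (wd c) \<in> L"
      proof (cases "distinct c")
        case True
        obtain t where t: "t \<in> tableaux ps" "fc t = c" using tableau_exists[OF True c(2,1)] .
        have "vc (bd (wd c)) \<in> E" unfolding E_def vc_def by (simp add: polytabloid_eq[OF t(1), unfolded t(2), symmetric] t(1))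
        then show ?thesis using V.in_own_span[of E] E by (auto simp: L_def)
      next
        case False
        have "wd c = (0 :: _ \<Rightarrow> 'a)" by (rule wd_dup[OF False])
        then show ?thesis using fspD(1)[OF L] by simp
      qed
    qed
    then show ?thesis by (simp add: L_def)
  qed
  then show ?thesis using 1 SP by blast
qed

definition zm :: "'a fmat" where "zm = lmat BZ Bp (\<lambda>f. f)"
definition rm :: "'a fmat" where "rm = lmat Bp BZ (\<lambda>f. f)"

lemma lin_id: "lin (\<lambda>f. f)" by (simp add: lin_def)

lemma zm: "hm G Zm M zm" "Idm Zm * rm = rm" "rm * Idm M = rm" "rm * zm = Idm Zm"
proof -
  show "hm G Zm M zm"
    unfolding Zm_def zm_def
    by (rule hm_M[OF md_Zm[unfolded Zm_def]], rule SG.hm_lmat[OF is_pb_BZ is_pb_Bp stab_ZZ stab_XF lin_id ZZ_XF]) simp_all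
  show "Idm Zm * rm = rm" by (simp add: rm_def Zm_def lmat_E)
  have "mdim M = pdim Bp" by (simp add: mdim_M Bp_def)
  then show "rm * Idm M = rm" by (simp add: rm_def lmat_E)
  have "rm * zm = lmat BZ BZ (\<lambda>f. f)"
    unfolding rm_def zm_def by (rule lmat_comp[OF is_pb_BZ is_pb_Bp lin_id ZZ_XF])
  then show "rm * zm = Idm Zm" using lmat_id[OF is_pb_BZ] by (simp add: Zm_def)
qed

lemma SP: "SP \<subseteq> carrier_vec (mdim M)" "fv (mdim M) ` SP = {ap (mdim Zm) zm u |u. sup_le (mdim Zm) u}"
proof -
  show "SP \<subseteq> carrier_vec (mdim M)" unfolding specht_space_eq by (auto simp: vc_def mdim_M)
  have f: "fv (mdim M) (vc f) = co Bp f" for f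
    unfolding vc_def mdim_M using fv_vec[of "pdim Bp" "co Bp f"] sup_co[of Bp f] by (simp add: Bp_def)
  have a: "ap (mdim Zm) zm (co BZ f) = co Bp f" if "f \<in> ZZ i" for f
    unfolding Zm_def zm_def mdim_prep by (rule ap_lmat[OF is_pb_BZ lin_id that])
  show "fv (mdim M) ` SP = {ap (mdim Zm) zm u |u. sup_le (mdim Zm) u}"
  proof safe
    fix v assume "v \<in> SP"
    then obtain h where h: "h \<in> ZZ i" "v = vc h" unfolding specht_space_eq by blast
    show "\<exists>u. fv (mdim M) v = ap (mdim Zm) zm u \<and> sup_le (mdim Zm) u"
      using a[OF h(1)] f[of h] sup_co[of BZ h] by (intro exI[of _ "co BZ h"]) (simp add: h(2) Zm_def)
  next
    fix u :: "nat \<Rightarrow> 'a" assume u: "sup_le (mdim Zm) u"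
    have m: "fco BZ u \<in> ZZ i" by (rule fco_mem[OF is_pb_BZ])
    have "ap (mdim Zm) zm u = fv (mdim M) (vc (fco BZ u))"
      using a[OF m] f co_fco[OF is_pb_BZ, of u] u by (simp add: Zm_def)
    then show "ap (mdim Zm) zm u \<in> fv (mdim M) ` SP" using m unfolding specht_space_eq by blast
  qed
qed

lemma specht_iso: "fgiso G (specht ps) Zm"
proof -
  have "realizes_sub G Zm M SP" by (rule SG.realizes_sub_I[OF md_Zm md_M zm SP])
  then have "realizes_sub G (specht ps) M SP"
    unfolding specht_def sum_ps by (rule someI[where P = "\<lambda>S. realizes_sub G S M SP"])
  then show ?thesis by (rule SG.realizes_sub_unique[OF md_Zm md_M zm SP])
qed

text \<open>\<open>W (Suc i)\<close> is a simple quotient of the Specht module, and by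
  \<open>unique_top\<close> every simple quotient is isomorphic to it. So the \<open>SOME\<close> in
  \<open>simple_D\<close> can select nothing else.\<close>

theorem hook_D_iso: "fgiso G (hook_D p i) (W (Suc i))" and hook_D_simple: "simple_fgmod G (hook_D p i :: (nat \<Rightarrow> nat, 'a) fgmod)"
proof -
  define S :: "(nat \<Rightarrow> nat, 'a) fgmod" where "S = specht ps"
  obtain f h where mS: "SG.md S" and f: "hm G S Zm f" "hm G Zm S h" "h * f = Idm S" "f * h = Idm Zm"
    using specht_iso unfolding SG.fgiso_iff S_def by blast
  have "hm G S (W (Suc i)) (gam * f)" by (rule hm_comp[OF f(1) hm_gam])
  then have "dm (mdim (W (Suc i))) (mdim S) (gam * f) \<in> fgsurj G S (W (Suc i))"
  proof (rule SG.section_surj[OF mS md_W])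
    show "Idm S * (h * sec) = h * sec" by (rule hm_simps(3)[OF f(2)])
    show "h * sec * Idm (W (Suc i)) = h * sec" by (simp add: mult.assoc sec)
    have "gam * f * (h * sec) = gam * ((f * h) * sec)" by (simp only: mult.assoc)
    then show "gam * f * (h * sec) = Idm (W (Suc i))" by (simp add: f sec)
  qed
  then have ex: "\<exists>D. simple_fgmod G D \<and> fgsurj G S D \<noteq> {}" using W_simple by blast
  have "simple_fgmod G (hook_D p i :: (nat \<Rightarrow> nat, 'a) fgmod) \<and> fgsurj G S (hook_D p i) \<noteq> {}"
    using someI_ex[OF ex] unfolding hook_D_def simple_D_def sum_ps S_def[symmetric] Let_def .
  then obtain A where D: "simple_fgmod G (hook_D p i :: (nat \<Rightarrow> nat, 'a) fgmod)" and A: "A \<in> fgsurj G S (hook_D p i)" by blast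
  show "simple_fgmod G (hook_D p i :: (nat \<Rightarrow> nat, 'a) fgmod)" by (rule D)
  have mD: "SG.md (hook_D p i :: (nat \<Rightarrow> nat, 'a) fgmod)" using D by (simp add: simple_fgmod_def)
  obtain t where t: "Idm S * t = t" "t * Idm (hook_D p i) = t" "em A * t = Idm (hook_D p i)"
    using SG.surj_section[OF mS mD A] .
  have a: "hm G S (hook_D p i) (em A)" using A by (intro fghom_hm mS mD) (simp add: fgsurj_def)
  have 1: "hm G Zm (hook_D p i) (em A * h)" by (rule hm_comp[OF f(2) a])
  have 2: "Idm Zm * (f * t) = f * t" by (rule hm_simps(3)[OF f(1)])
  have 3: "f * t * Idm (hook_D p i) = f * t" by (simp add: mult.assoc t)
  have "em A * h * (f * t) = em A * ((h * f) * t)" by (simp only: mult.assoc)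
  then have 4: "em A * h * (f * t) = Idm (hook_D p i)" by (simp add: f t)
  from SG.unique_top(2)[OF md_Zm md_W hm_gam sec W_pos Zm_top D 1 2 3 4]
  show "fgiso G (hook_D p i) (W (Suc i))" .
qed

end

section \<open>Clebsch--Gordan rule for hooks\<close>

context fin_group
begin

lemma simple_sfree:
  assumes S: "simple_fgmod G S" and U: "simple_fgmod G U" shows "fgiso G U S \<or> sfree S U"
proof (rule disjCI)
  assume "\<not> sfree S U"
  then obtain x y where x: "hm G S U x" "hm G U S y" "y * x \<noteq> 0" by (auto simp: sfree_def)
  have m: "md S" "md U" "mdim S > 0" using S U by (simp_all add: simple_fgmod_def)
  obtain d where d: "hm G S S d" "d * (y * x) = Idm S"
    using schur[OF S hm_comp[OF x(1,2)] x(3)] by blast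
  have r: "hm G U S (d * y)" "d * y * x = Idm S" using hm_comp[OF x(2) d(1)] d(2) by (simp_all add: mult.assoc)
  have "x * (d * y) = Idm U"
    using simple_sub[OF U m(1) x(1) hm_simps(1)[OF r(1)] hm_simps(2)[OF r(1)] r(2)] m(3) by simp
  then show "fgiso G U S" unfolding fgiso_iff using m x r by blast
qed

lemma proj_ds: "proj (ds U V) \<Longrightarrow> md U \<Longrightarrow> md V \<Longrightarrow> proj U \<and> proj V"
proof -
  assume P: "proj (ds U V)" and m: "md U" "md V"
  obtain i1 q1 i2 q2 where d: "bip G (ds U V) U V i1 q1 i2 q2" using ds_data[OF m] .
  then show ?thesis
    using proj_retract[OF P m(1), of i1 q1] proj_retract[OF P m(2), of i2 q2] by (simp add: bip_def)
qed

lemma proj_dsum: "proj (dsum Vs) \<Longrightarrow> (\<And>V. V \<in> set Vs \<Longrightarrow> md V) \<Longrightarrow> V \<in> set Vs \<Longrightarrow> proj V"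
proof (induction Vs)
  case (Cons U Vs)
  have "proj U \<and> proj (dsum Vs)" by (rule proj_ds) (use Cons.prems in \<open>auto simp: dsum_Cons\<close>)
  then show ?case using Cons by auto
qed simp

lemma siso_dsum_map:
  "(\<And>x. x \<in> set xs \<Longrightarrow> siso (f x) (g x)) \<Longrightarrow> siso (dsum (map f xs)) (dsum (map g xs))"
  by (rule siso_dsum_cong) (simp add: list_all2_conv_all_nth)

end

text \<open>The rule for \<open>SL\<^sub>2\<close>, truncated as for fusion products.\<close>

definition CG :: "nat \<Rightarrow> nat \<Rightarrow> nat \<Rightarrow> nat list" where
  "CG n i j = filter (\<lambda>l. l \<le> i + j \<and> i \<le> j + l \<and> j \<le> i + l \<and> i + j + l \<le> 2 * n \<and> even (i + j + l)) [0..<Suc n]"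

lemma count_concat: "count (mset (concat xss)) y = sum_list (map (\<lambda>xs. count (mset xs) y) xss)"
  by (induction xss) simp_all

lemma count_CG: "count (mset (CG n i j)) l =
    (if l \<le> n \<and> l \<le> i + j \<and> i \<le> j + l \<and> j \<le> i + l \<and> i + j + l \<le> 2 * n \<and> even (i + j + l) then 1 else 0)"
proof -
  have "distinct (CG n i j)" unfolding CG_def by (rule distinct_filter) (simp only: distinct_upt)
  then have "count (mset (CG n i j)) l = (if l \<in> set (CG n i j) then 1 else 0)"
    unfolding distinct_count_atmost_1 by blast
  also have "l \<in> set (CG n i j) \<longleftrightarrow> l \<le> n \<and> l \<le> i + j \<and> i \<le> j + l \<and> j \<le> i + l \<and> i + j + l \<le> 2 * n \<and> even (i + j + l)"
    unfolding CG_def set_filter mem_Collect_eq set_upt atLeastLessThan_iff less_Suc_eq_le by simp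
  finally show ?thesis .
qed

text \<open>The neighbours of \<open>l\<close> on the path from 0 to \<open>n\<close>: the labels
  produced by tensoring with the module of label 1.\<close>

definition nbr :: "nat \<Rightarrow> nat \<Rightarrow> nat list" where
  "nbr n l = (if l < n then [Suc l] else []) @ (if 0 < l then [l - 1] else [])"

lemma sum_list_CG: "sum_list (map f (CG n i j)) = (\<Sum>m\<le>n. count (mset (CG n i j)) m * f m)"
proof -
  have "sum_list (map f (CG n i j)) = (\<Sum>m\<in>set (CG n i j). count (mset (CG n i j)) m * f m)"
    by (simp add: sum_list_map_eq_sum_count count_mset)
  also have "\<dots> = (\<Sum>m\<le>n. count (mset (CG n i j)) m * f m)"
    by (rule sum.mono_neutral_left) (auto simp: CG_def not_in_iff)
  finally show ?thesis .
qed

lemma CG_count_arith: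
  assumes "Suc (Suc i) \<le> n" "j \<le> n"
  shows "(if 0 < l \<and> l \<le> n then count (mset (CG n (Suc i) j)) (l - 1) else 0) + (if l < n then count (mset (CG n (Suc i) j)) (Suc l) else 0)
    = count (mset (CG n (Suc (Suc i)) j @ CG n i j)) l"
proof (cases "even (i + j + l)")
  case True
  then obtain k where k: "i + j + l = 2 * k" by blast
  define P1 where "P1 \<longleftrightarrow> l \<le> n \<and> l - 1 \<le> Suc i + j \<and> Suc i \<le> j + (l - 1) \<and> j \<le> Suc i + (l - 1) \<and> Suc i + j + (l - 1) \<le> 2 * n"
  define P2 where "P2 \<longleftrightarrow> l < n \<and> Suc l \<le> Suc i + j \<and> Suc i \<le> j + Suc l \<and> j \<le> Suc i + Suc l \<and> Suc i + j + Suc l \<le> 2 * n"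
  define Q1 where "Q1 \<longleftrightarrow> l \<le> n \<and> l \<le> Suc (Suc i) + j \<and> Suc (Suc i) \<le> j + l \<and> j \<le> Suc (Suc i) + l \<and> Suc (Suc i) + j + l \<le> 2 * n"
  define Q2 where "Q2 \<longleftrightarrow> l \<le> n \<and> l \<le> i + j \<and> i \<le> j + l \<and> j \<le> i + l \<and> i + j + l \<le> 2 * n"
  have e: "(if l < n then count (mset (CG n (Suc i) j)) (Suc l) else 0) = (if P2 then 1 else 0)"
    "count (mset (CG n (Suc (Suc i)) j @ CG n i j)) l = (if Q1 then 1 else 0) + (if Q2 then 1 else 0)"
    unfolding mset_append count_union count_CG P2_def Q1_def Q2_def using True by auto
  show ?thesis
  proof (cases "0 < l")
    case l: True
    have "even (Suc i + j + (l - 1))" using True l by (cases l) auto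
    then have e1: "(if 0 < l \<and> l \<le> n then count (mset (CG n (Suc i) j)) (l - 1) else 0) = (if P1 then 1 else 0)"
      unfolding count_CG P1_def using l by auto
    \<comment> \<open>Each unprimed inequality is its primed version sharpened by 2, so by parity
      they differ in one boundary case only. Two boundary cases exclude each other
      (\<open>two\<close>). Hence \<open>P1\<close>, \<open>P2\<close> and \<open>Q1\<close>,
      \<open>Q2\<close> have the same conjunction and the same disjunction.\<close>
    define a a' b b' c c' d d' where defs: "a \<longleftrightarrow> i + 2 \<le> j + l" "a' \<longleftrightarrow> i \<le> j + l" "b \<longleftrightarrow> j \<le> i + l" "b' \<longleftrightarrow> j \<le> i + l + 2"
      "c \<longleftrightarrow> l \<le> i + j" "c' \<longleftrightarrow> l \<le> i + j + 2" "d \<longleftrightarrow> i + j + l + 2 \<le> 2 * n" "d' \<longleftrightarrow> i + j + l \<le> 2 * n"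
    obtain q where q: "l = Suc q" using l by (cases l) auto
    have PQ: "P1 \<longleftrightarrow> l \<le> n \<and> a \<and> b \<and> c' \<and> d'" "P2 \<longleftrightarrow> l < n \<and> c \<and> a' \<and> b' \<and> d"
      "Q1 \<longleftrightarrow> l \<le> n \<and> c' \<and> a \<and> b' \<and> d" "Q2 \<longleftrightarrow> l \<le> n \<and> c \<and> a' \<and> b \<and> d'"
      unfolding P1_def P2_def Q1_def Q2_def defs q by auto
    have imp: "a \<Longrightarrow> a'" "b \<Longrightarrow> b'" "c \<Longrightarrow> c'" "d \<Longrightarrow> d'" "c \<Longrightarrow> d \<Longrightarrow> l < n"
      unfolding defs by auto
    have two: "a' \<Longrightarrow> b' \<Longrightarrow> a \<or> b" "a' \<Longrightarrow> c' \<Longrightarrow> a \<or> c" "a' \<Longrightarrow> d' \<Longrightarrow> a \<or> d"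
      "b' \<Longrightarrow> c' \<Longrightarrow> b \<or> c" "b' \<Longrightarrow> d' \<Longrightarrow> b \<or> d" "c' \<Longrightarrow> d' \<Longrightarrow> l \<le> n \<Longrightarrow> c \<or> d"
    proof -
      have pa: "a' \<Longrightarrow> \<not> a \<Longrightarrow> i = j + l" and pb: "b' \<Longrightarrow> \<not> b \<Longrightarrow> j = i + l + 2"
        and pc: "c' \<Longrightarrow> \<not> c \<Longrightarrow> l = i + j + 2" and pd: "d' \<Longrightarrow> \<not> d \<Longrightarrow> i + j + l = 2 * n"
        unfolding defs using k by presburger+
      show "a' \<Longrightarrow> b' \<Longrightarrow> a \<or> b" using pa pb by fastforce
      show "a' \<Longrightarrow> c' \<Longrightarrow> a \<or> c" using pa pc by fastforce
      show "a' \<Longrightarrow> d' \<Longrightarrow> a \<or> d" using pa pd assms by fastforce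
      show "b' \<Longrightarrow> c' \<Longrightarrow> b \<or> c" using pb pc by fastforce
      show "b' \<Longrightarrow> d' \<Longrightarrow> b \<or> d" using pb pd assms by fastforce
      show "c' \<Longrightarrow> d' \<Longrightarrow> l \<le> n \<Longrightarrow> c \<or> d" using pc pd by fastforce
    qed
    have "P1 \<and> P2 \<longleftrightarrow> Q1 \<and> Q2" unfolding PQ using imp by blast
    moreover have "P1 \<or> P2 \<longleftrightarrow> Q1 \<or> Q2" unfolding PQ using imp two by (metis order_less_imp_le)
    ultimately show ?thesis unfolding e e1 by auto
  next
    case l: False
    have "j < i \<or> j = i \<or> j = i + 2 \<or> j > i + 2" using k l by presburger
    then have "\<not> (Q1 \<and> Q2)" "P2 \<longleftrightarrow> Q1 \<or> Q2"
      unfolding P2_def Q1_def Q2_def using assms l by auto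
    then show ?thesis unfolding e using l by auto
  qed
next
  case False
  have "odd (Suc i + j + (l - 1))" if "0 < l" using False that by (cases l) auto
  then show ?thesis unfolding mset_append count_union count_CG using False by auto
qed

lemma mset_CG_Suc:
  assumes "Suc (Suc i) \<le> n" "j \<le> n"
  shows "mset (concat (map (nbr n) (CG n (Suc i) j))) = mset (CG n (Suc (Suc i)) j @ CG n i j)"
proof (rule multiset_eqI)
  fix l
  have nb: "count (mset (nbr n m)) l = (if Suc m = l \<and> m < n then 1 else 0) + (if m = Suc l then 1 else 0)" for m
    by (auto simp: nbr_def)
  let ?c = "\<lambda>m. count (mset (CG n (Suc i) j)) m"
  have "count (mset (concat (map (nbr n) (CG n (Suc i) j)))) l
      = (\<Sum>m\<le>n. ?c m * ((if Suc m = l \<and> m < n then 1 else 0) + (if m = Suc l then 1 else 0)))"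
    unfolding count_concat map_map comp_def nb sum_list_CG ..
  also have "\<dots> = (\<Sum>m\<le>n. if m = l - 1 then (if 0 < l \<and> l \<le> n then ?c (l - 1) else 0) else 0) + (\<Sum>m\<le>n. if m = Suc l then ?c (Suc l) else 0)"
    unfolding sum.distrib[symmetric] by (rule sum.cong) auto
  also have "\<dots> = (if 0 < l \<and> l \<le> n then ?c (l - 1) else 0) + (if l < n then ?c (Suc l) else 0)"
    by auto
  also have "\<dots> = count (mset (CG n (Suc (Suc i)) j @ CG n i j)) l"
    using CG_count_arith[OF assms, of l] .
  finally show "count (mset (concat (map (nbr n) (CG n (Suc i) j)))) l = count (mset (CG n (Suc (Suc i)) j @ CG n i j)) l" .
qed

lemma mset_CG_0: "j \<le> n \<Longrightarrow> mset (CG n 0 j) = mset [j]"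
  by (rule multiset_eqI) (simp only: count_CG, auto)

lemma mset_CG_1:
  assumes "j \<le> n" "1 \<le> n" shows "mset (CG n 1 j) = mset (nbr n j)"
proof (rule multiset_eqI)
  fix l
  have nb: "count (mset (nbr n j)) l = (if Suc j = l \<and> j < n then 1 else 0) + (if j = Suc l then 1 else 0)"
    by (auto simp: nbr_def)
  have "(l \<le> n \<and> l \<le> 1 + j \<and> 1 \<le> j + l \<and> j \<le> 1 + l \<and> 1 + j + l \<le> 2 * n \<and> even (1 + j + l)) \<longleftrightarrow> (Suc j = l \<and> j < n) \<or> j = Suc l"
  proof (cases "even (1 + j + l)")
    case True
    then have "l < j - 1 \<or> Suc l = j \<or> l = Suc j \<or> l > Suc j" by presburger
    then show ?thesis using True assms by auto
  qed auto
  then show "count (mset (CG n 1 j)) l = count (mset (nbr n j)) l"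
    unfolding nb count_CG by auto
qed

section \<open>Tensor products of hook modules\<close>

context sym_char
begin

abbreviation DD :: "nat \<Rightarrow> (nat \<Rightarrow> nat, 'a) fgmod" where "DD i \<equiv> W (Suc i)"
abbreviation HD :: "nat \<Rightarrow> (nat \<Rightarrow> nat, 'a) fgmod" where "HD i \<equiv> hook_D p i"

lemma DD_simple: "i \<le> p - 2 \<Longrightarrow> simple_fgmod G (DD i)"
  and HD_simple: "i \<le> p - 2 \<Longrightarrow> simple_fgmod G (HD i)"
  and HD_iso: "i \<le> p - 2 \<Longrightarrow> fgiso G (HD i) (DD i)"
proof -
  assume "i \<le> p - 2"
  then interpret hook p ty i by unfold_locales
  show "simple_fgmod G (DD i)" "simple_fgmod G (HD i)" "fgiso G (HD i) (DD i)"
    by (rule W_simple hook_D_simple hook_D_iso)+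
qed

lemma md_HD: "i \<le> p - 2 \<Longrightarrow> SG.md (HD i)"
  using HD_simple by (simp add: simple_fgmod_def)

lemma siso_DDs: "mset us = mset vs \<Longrightarrow> SG.siso (dsum (map (\<lambda>u. heller G N (DD u)) us)) (dsum (map (\<lambda>u. heller G N (DD u)) vs))"
  by (rule SG.siso_dsum_mset) (auto simp: md_W)

declare SG.siso_trans [trans]

lemma tensor_DD_1:
  assumes "i \<le> p - 2" shows "SG.siso (tensor (DD 1) (DD i)) (dsum (map DD (nbr (p - 2) i)))"
proof -
  have "Suc 1 = 2" by simp
  then have "SG.siso (tensor (DD 1) (DD i)) (ds (W (Suc (Suc i))) (W i))"
    using fusion[of "Suc i"] assms p by simp
  also have "SG.siso \<dots> (ds (dsum (map DD (if i < p - 2 then [Suc i] else []))) (dsum (map DD (if 0 < i then [i - 1] else []))))"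
  proof (rule SG.siso_ds)
    have "SG.proj (W (Suc (Suc i)))" if "\<not> i < p - 2"
      by (rule SG.siso_zero_proj[OF W_zero md_W]) (use that assms p in auto)
    then show "SG.siso (W (Suc (Suc i))) (dsum (map DD (if i < p - 2 then [Suc i] else [])))"
      using SG.siso_refl[OF md_W, of "Suc (Suc i)"] SG.siso_projs[OF _ SG.proj_dsum_Nil, of "W (Suc (Suc i))"] by auto
    have "SG.proj (W i)" if "\<not> 0 < i"
      by (rule SG.siso_zero_proj[OF W_zero md_W]) (use that in auto)
    then show "SG.siso (W i) (dsum (map DD (if 0 < i then [i - 1] else [])))"
      using SG.siso_refl[OF md_W, of i] SG.siso_projs[OF _ SG.proj_dsum_Nil, of "W i"] by auto
  qed
  finally show ?thesis by (simp only: nbr_def map_append dsum_append)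
qed

lemma CG_le: "l \<in> set (CG n i j) \<Longrightarrow> l \<le> n"
  by (simp add: CG_def less_Suc_eq_le del: upt_Suc)

lemma siso_DDs_0: "mset us = mset vs \<Longrightarrow> SG.siso (dsum (map DD us)) (dsum (map DD vs))"
  using siso_DDs[of us vs 0] by simp

text \<open>The triple product of the modules with labels 1, \<open>Suc i\<close> and
  \<open>j\<close> is bracketed in two ways. Both results contain the product for \<open>i\<close>
  and \<open>j\<close>, which by induction is stably a sum of simple modules and can be
  cancelled.\<close>

lemma tensor_DD:
  assumes j: "j \<le> p - 2"
  shows "i \<le> p - 2 \<Longrightarrow> SG.siso (tensor (DD i) (DD j)) (dsum (map DD (CG (p - 2) i j)))"
proof (induction i rule: induct_nat_012)
  case 0
  have "SG.siso (tensor (DD 0) (DD j)) (tensor trivial_fgmod (DD j))"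
    using SG.siso_tensor_left[OF W_trivial md_W] by (simp add: One_nat_def)
  also have "tensor trivial_fgmod (DD j) = dsum (map DD [j])" by (simp add: tensor_trivial)
  also have "SG.siso \<dots> (dsum (map DD (CG (p - 2) 0 j)))"
    by (rule siso_DDs_0) (rule mset_CG_0[OF j, symmetric])
  finally show ?case .
next
  case 1
  have "SG.siso (tensor (DD 1) (DD j)) (dsum (map DD (CG (p - 2) 1 j)))"
    by (rule SG.siso_trans[OF tensor_DD_1[OF j] siso_DDs_0]) (use mset_CG_1[OF j] p in simp)
  then show ?case by (simp only: One_nat_def)
next
  case (ge2 i)
  let ?n = "p - 2"
  let ?T = "tensor (DD 1) (tensor (DD (Suc i)) (DD j))"
  have i: "Suc (Suc i) \<le> ?n" by (rule ge2)
  have IH: "SG.siso (tensor (DD i) (DD j)) (dsum (map DD (CG ?n i j)))"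
    "SG.siso (tensor (DD (Suc i)) (DD j)) (dsum (map DD (CG ?n (Suc i) j)))"
    using ge2 by simp_all
  have "?T = tensor (tensor (DD 1) (DD (Suc i))) (DD j)" by (rule tensor_assoc[symmetric])
  also have "SG.siso \<dots> (tensor (dsum (map DD (nbr ?n (Suc i)))) (DD j))"
    by (rule SG.siso_tensor_left[OF tensor_DD_1 md_W]) (use i in simp)
  also have "dsum (map DD (nbr ?n (Suc i))) = ds (DD (Suc (Suc i))) (DD i)"
    using i by (simp add: nbr_def dsum_Cons)
  also have "SG.siso (tensor \<dots> (DD j)) (ds (tensor (DD (Suc (Suc i))) (DD j)) (tensor (DD i) (DD j)))"
    by (rule SG.siso_tensor_ds) (rule md_W)+
  also have "SG.siso \<dots> (ds (tensor (DD (Suc (Suc i))) (DD j)) (dsum (map DD (CG ?n i j))))"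
    by (rule SG.siso_ds[OF SG.siso_refl IH(1)]) (simp add: md_W)
  finally have 1: "SG.siso ?T (ds (tensor (DD (Suc (Suc i))) (DD j)) (dsum (map DD (CG ?n i j))))" .
  have "SG.siso ?T (tensor (DD 1) (dsum (map DD (CG ?n (Suc i) j))))"
    by (rule SG.siso_tensor_right[OF IH(2) md_W])
  also have "SG.siso \<dots> (dsum (map (tensor (DD 1)) (map DD (CG ?n (Suc i) j))))"
    by (rule SG.siso_tensor_dsum_right) (auto simp: md_W)
  also have "map (tensor (DD 1)) (map DD (CG ?n (Suc i) j)) = map (\<lambda>l. tensor (DD 1) (DD l)) (CG ?n (Suc i) j)" by simp
  also have "SG.siso (dsum \<dots>) (dsum (map (\<lambda>l. dsum (map DD (nbr ?n l))) (CG ?n (Suc i) j)))"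
    by (rule SG.siso_dsum_map) (rule tensor_DD_1[OF CG_le])
  also have "dsum (map (\<lambda>l. dsum (map DD (nbr ?n l))) (CG ?n (Suc i) j)) = dsum (map DD (concat (map (nbr ?n) (CG ?n (Suc i) j))))"
    by (simp add: map_concat dsum_concat comp_def)
  also have "SG.siso \<dots> (dsum (map DD (CG ?n (Suc (Suc i)) j @ CG ?n i j)))"
    by (rule siso_DDs_0) (rule mset_CG_Suc[OF i j])
  also have "\<dots> = ds (dsum (map DD (CG ?n (Suc (Suc i)) j))) (dsum (map DD (CG ?n i j)))" by (simp only: map_append dsum_append)
  finally have 2: "SG.siso ?T \<dots>" .
  show ?case
  proof (rule SG.siso_cancel_simples)
    show "SG.siso (ds (tensor (DD (Suc (Suc i))) (DD j)) (dsum (map DD (CG ?n i j)))) (ds (dsum (map DD (CG ?n (Suc (Suc i)) j))) (dsum (map DD (CG ?n i j))))"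
      by (rule SG.siso_trans[OF SG.siso_sym[OF 1] 2])
    show "simple_fgmod G S" if "S \<in> set (map DD (CG ?n i j))" for S
      using that DD_simple CG_le by auto
  qed (auto simp: md_W)
qed

text \<open>Otherwise its tensor square would be projective, although the trivial module is one of
  the stable summands.\<close>

lemma HD_not_proj:
  assumes "i \<le> p - 2" shows "\<not> SG.proj (HD i)"
proof
  assume "SG.proj (HD i)"
  then have "SG.proj (DD i)" using SG.siso_proj[OF SG.fgiso_siso[OF HD_iso[OF assms]]] by blast
  then have "SG.proj (tensor (DD i) (DD i))" by (rule SG.proj_tensor) (rule md_W)
  then have "SG.proj (dsum (map DD (CG (p - 2) i i)))" by (rule SG.siso_proj[OF tensor_DD[OF assms assms]])
  moreover have "0 \<in> set (CG (p - 2) i i)" using assms by (simp add: CG_def del: upt_Suc)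
  ultimately have "SG.proj (DD 0)" using SG.proj_dsum[of "map DD (CG (p - 2) i i)" "DD 0"] md_W by auto
  then show False using SG.siso_proj[OF W_trivial] trivial_not_proj by (simp add: One_nat_def)
qed

lemma length_filter_eq_count: "length (filter (\<lambda>y. y = x) xs) = count (mset xs) x"
  by (induction xs) auto

text \<open>\<open>HD l\<close> is simple and not projective, so the stable decomposition of
  \<open>tensor_DD\<close> may be used for counting; \<open>not_iso\<close> keeps different labels
  apart.\<close>

lemma summand_mult_HD:
  assumes "i \<le> p - 2" "j \<le> p - 2" "l \<le> p - 2"
  shows "summand_mult G (tensor (HD i) (HD j)) (HD l) = count (mset (CG (p - 2) i j)) l"
proof -
  let ?c = "CG (p - 2) i j"
  have iso: "fgiso G (DD u) (HD l) \<longleftrightarrow> u = l" if "u \<le> p - 2" for u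
  proof
    assume "fgiso G (DD u) (HD l)"
    then have "fgiso G (DD u) (DD l)" using SG.fgiso_trans HD_iso[OF assms(3)] by blast
    then have "Suc u = Suc l" by (rule not_iso[rotated 3]) (use that assms p in auto)
    then show "u = l" by simp
  qed (use SG.fgiso_sym[OF HD_iso[OF assms(3)]] in blast)
  have "SG.siso (tensor (HD i) (HD j)) (tensor (DD i) (DD j))"
    by (intro SG.siso_tensor SG.fgiso_siso HD_iso assms)
  also have "SG.siso \<dots> (dsum (map DD ?c))" by (rule tensor_DD[OF assms(2,1)])
  finally have V: "SG.siso (tensor (HD i) (HD j)) (dsum (map DD ?c))" .
  have "summand_mult G (tensor (HD i) (HD j)) (HD l) = length (filter (\<lambda>U. fgiso G U (HD l)) (map DD ?c))"
    using HD_simple[OF assms(3)] HD_not_proj[OF assms(3)] _ V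
  proof (rule SG.summand_mult_eq)
    show "SG.md (tensor (HD i) (HD j))" by (simp add: md_HD assms)
    fix U assume "U \<in> set (map DD ?c)"
    then obtain u where u: "U = DD u" "u \<le> p - 2" using CG_le by auto
    show "SG.md U \<and> (fgiso G U (HD l) \<or> SG.sfree (HD l) U)"
      unfolding u(1) using SG.simple_sfree[OF HD_simple[OF assms(3)] DD_simple[OF u(2)]] md_W by blast
  qed
  also have "\<dots> = length (filter (\<lambda>u. u = l) ?c)"
    unfolding filter_map length_map comp_def using iso CG_le by (intro arg_cong[where f = length] filter_cong) auto
  finally show ?thesis unfolding length_filter_eq_count .
qed

text \<open>All summands are translated by the same \<open>N\<close>, so a list of labels describes
  the stable class.\<close>

definition HS :: "nat \<Rightarrow> nat list \<Rightarrow> (nat \<Rightarrow> nat, 'a) fgmod" where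
  "HS N us = dsum (map (\<lambda>u. heller G N (DD u)) us)"

lemma HS_concat: "dsum (map (\<lambda>x. HS N (f x)) xs) = HS N (concat (map f xs))"
  by (simp add: HS_def map_concat dsum_concat comp_def)

lemma md_HS: "SG.md (HS N us)"
  by (auto simp: HS_def md_W)

lemma tensor_HS:
  assumes us: "\<And>u. u \<in> set us \<Longrightarrow> u \<le> p - 2" and vs: "\<And>v. v \<in> set vs \<Longrightarrow> v \<le> p - 2"
  shows "SG.siso (tensor (HS a us) (HS b vs)) (HS (a + b) (concat (map (\<lambda>u. concat (map (CG (p - 2) u) vs)) us)))"
proof -
  have 1: "SG.siso (tensor (heller G a (DD u)) (heller G b (DD v))) (HS (a + b) (CG (p - 2) u v))"
    if "u \<le> p - 2" "v \<le> p - 2" for u v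
  proof -
    have "SG.siso (tensor (heller G a (DD u)) (heller G b (DD v))) (heller G (a + b) (tensor (DD u) (DD v)))"
      by (rule SG.heller_tensor[OF md_W md_W])
    also have "SG.siso \<dots> (heller G (a + b) (dsum (map DD (CG (p - 2) u v))))"
      by (rule SG.siso_heller[OF tensor_DD[OF that(2,1)]])
    also have "SG.siso \<dots> (dsum (map (heller G (a + b)) (map DD (CG (p - 2) u v))))"
      by (rule SG.heller_dsum) (auto simp: md_W)
    finally show ?thesis by (simp add: HS_def comp_def)
  qed
  have 2: "SG.siso (tensor (heller G a (DD u)) (HS b vs)) (HS (a + b) (concat (map (CG (p - 2) u) vs)))"
    if u: "u \<le> p - 2" for u
  proof -
    have "SG.siso (tensor (heller G a (DD u)) (HS b vs)) (dsum (map (tensor (heller G a (DD u))) (map (\<lambda>v. heller G b (DD v)) vs)))"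
      unfolding HS_def by (rule SG.siso_tensor_dsum_right) (auto simp: md_W)
    also have "map (tensor (heller G a (DD u))) (map (\<lambda>v. heller G b (DD v)) vs) = map (\<lambda>v. tensor (heller G a (DD u)) (heller G b (DD v))) vs"
      by simp
    also have "SG.siso (dsum \<dots>) (dsum (map (\<lambda>v. HS (a + b) (CG (p - 2) u v)) vs))"
      by (rule SG.siso_dsum_map) (rule 1[OF u vs])
    finally show ?thesis unfolding HS_concat .
  qed
  have "SG.siso (tensor (HS a us) (HS b vs)) (dsum (map (\<lambda>V. tensor V (HS b vs)) (map (\<lambda>u. heller G a (DD u)) us)))"
    unfolding HS_def[of a] by (rule SG.siso_tensor_dsum_left) (auto simp: md_W md_HS)
  also have "map (\<lambda>V. tensor V (HS b vs)) (map (\<lambda>u. heller G a (DD u)) us) = map (\<lambda>u. tensor (heller G a (DD u)) (HS b vs)) us"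
    by simp
  also have "SG.siso (dsum \<dots>) (dsum (map (\<lambda>u. HS (a + b) (concat (map (CG (p - 2) u) vs))) us))"
    by (rule SG.siso_dsum_map) (rule 2[OF us])
  finally show ?thesis unfolding HS_concat .
qed

lemma HS_mset: "mset us = mset vs \<Longrightarrow> SG.siso (HS N us) (HS N vs)"
  unfolding HS_def by (rule siso_DDs)

end

section \<open>Powers of the matrix of multiplicities\<close>

text \<open>Matrix powers grow by a factor on the right, whereas one more tensor factor acts on
  column 0 from the left.\<close>

lemma mult_pow_mat_comm:
  fixes A :: "'s::semiring_1 mat"
  assumes A: "A \<in> carrier_mat n n" shows "A * A ^\<^sub>m b = A ^\<^sub>m b * A"
proof (induction b)
  case 0
  then show ?case using A by simp
next
  case (Suc b)
  have "A * A ^\<^sub>m Suc b = (A * A ^\<^sub>m b) * A" using A by (simp add: assoc_mult_mat[of _ n n _ n _ n])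
  then show ?case using Suc by simp
qed

lemma sum_list_replicates:
  "sum_list (map f (concat (map (\<lambda>l. replicate (c l) (h l)) xs))) = sum_list (map (\<lambda>l. c l * (f (h l) :: nat)) xs)"
  by (induction xs) (simp_all add: sum_list_replicate)

context sym_char
begin

abbreviation N :: nat where "N \<equiv> (p - 1) div 2"

lemma N: "2 * N = p - 1"
proof -
  have "odd p" using p by (intro prime_odd_nat) auto
  then show ?thesis by (auto elim!: oddE)
qed

definition MM :: "nat \<Rightarrow> nat mat" where MM_def: "MM k = mat_M TYPE('a) p k"

lemma MM_carrier: "MM k \<in> carrier_mat N N"
  by (simp add: MM_def mat_M_def)

lemma MM_entry:
  assumes "l < N" "j < N"
  shows "MM k $$ (l, j) = (\<Sum>i=0..min k (p - 2 - k). count (mset (CG (p - 2) (2 * i) (2 * j))) (2 * l))"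
  unfolding MM_def mat_M_def using assms
  by (simp del: One_nat_def) (rule sum.cong[OF refl], rule summand_mult_HD, use N in auto)

text \<open>Column 0 of the matrix power unfolded into a list of even labels; column 0 because the
  zeroth tensor power is the trivial module, with label 0.\<close>

definition us :: "nat \<Rightarrow> nat \<Rightarrow> nat list" where
  "us k b = concat (map (\<lambda>l. replicate ((MM k ^\<^sub>m b) $$ (l, 0)) (2 * l)) [0..<N])"

lemma us_le: "u \<in> set (us k b) \<Longrightarrow> u \<le> p - 2"
  using N by (auto simp: us_def)

lemma sum_us: "sum_list (map f (us k b)) = (\<Sum>l<N. (MM k ^\<^sub>m b) $$ (l, 0) * f (2 * l))"
  unfolding us_def sum_list_replicates by (simp add: interv_sum_list_conv_sum_set_nat atLeast0LessThan)

lemma count_us: "count (mset (us k b)) y = (\<Sum>l<N. if y = 2 * l then (MM k ^\<^sub>m b) $$ (l, 0) else 0)"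
proof -
  have "count (mset (us k b)) y = (\<Sum>l<N. count (mset (replicate ((MM k ^\<^sub>m b) $$ (l, 0)) (2 * l))) y)"
    unfolding us_def count_concat map_map comp_def by (simp add: interv_sum_list_conv_sum_set_nat atLeast0LessThan)
  then show ?thesis by (auto simp: intro!: sum.cong)
qed

text \<open>For equal labels the conditions in \<open>CG\<close> become: \<open>l\<close> even,
  \<open>l \<le> 2 * k\<close> and \<open>l \<le> 2 * (p - 2 - k)\<close>. This is the origin of the
  bound \<open>min k (p - 2 - k)\<close> in \<open>mat_M\<close>.\<close>

lemma mset_CG_same:
  assumes "k \<le> p - 2"
  shows "mset (CG (p - 2) k k) = mset (map ((*) 2) [0..<Suc (min k (p - 2 - k))])"
proof (rule set_eq_iff_mset_eq_distinct[THEN iffD1])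
  show "distinct (CG (p - 2) k k)" unfolding CG_def by (rule distinct_filter) (simp only: distinct_upt)
  show "distinct (map ((*) 2) [0..<Suc (min k (p - 2 - k))])" by (simp add: distinct_map inj_on_def del: upt_Suc)
  have "l \<in> set (CG (p - 2) k k) \<longleftrightarrow> (\<exists>i\<le>min k (p - 2 - k). l = 2 * i)" for l
  proof
    assume "l \<in> set (CG (p - 2) k k)"
    then have "l \<le> k + k" "k + k + l \<le> 2 * (p - 2)" "even (k + k + l)" by (simp_all add: CG_def del: upt_Suc)
    then show "\<exists>i\<le>min k (p - 2 - k). l = 2 * i" by (intro exI[of _ "l div 2"]) auto
  next
    assume "\<exists>i\<le>min k (p - 2 - k). l = 2 * i"
    then show "l \<in> set (CG (p - 2) k k)" using assms by (auto simp: CG_def less_Suc_eq_le simp del: upt_Suc)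
  qed
  then show "set (CG (p - 2) k k) = set (map ((*) 2) [0..<Suc (min k (p - 2 - k))])"
    by (auto simp: less_Suc_eq_le simp del: upt_Suc)
qed

text \<open>Counting an even label \<open>2 * l\<close> below \<open>p - 1\<close> on the left gives
  the entry \<open>(l, 0)\<close> of \<open>MM k\<close> times its \<open>b\<close>th power; other
  labels occur on neither side.\<close>

lemma mset_us_Suc:
  "mset (concat (map (\<lambda>u. concat (map (CG (p - 2) u) (us k b))) (map ((*) 2) [0..<Suc (min k (p - 2 - k))]))) = mset (us k (Suc b))"
proof (rule multiset_eqI)
  fix y
  let ?m = "min k (p - 2 - k)" and ?P = "MM k ^\<^sub>m b"
  let ?c = "\<lambda>i l. count (mset (CG (p - 2) (2 * i) (2 * l))) y"
  have "count (mset (concat (map (\<lambda>u. concat (map (CG (p - 2) u) (us k b))) (map ((*) 2) [0..<Suc ?m])))) y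
      = (\<Sum>i=0..?m. \<Sum>l<N. ?P $$ (l, 0) * ?c i l)"
    unfolding count_concat map_map comp_def sum_us
    by (simp only: interv_sum_list_conv_sum_set_nat set_upt atLeastLessThanSuc_atLeastAtMost)
  also have "\<dots> = (\<Sum>l<N. (\<Sum>i=0..?m. ?c i l) * ?P $$ (l, 0))"
    by (subst sum.swap) (simp add: sum_distrib_left mult.commute)
  also have "\<dots> = count (mset (us k (Suc b))) y"
  proof (cases "\<exists>l<N. y = 2 * l")
    case True
    then obtain l where l: "l < N" "y = 2 * l" by blast
    have "(\<Sum>j<N. (\<Sum>i=0..?m. ?c i j) * ?P $$ (j, 0)) = (\<Sum>j<N. MM k $$ (l, j) * ?P $$ (j, 0))"
      by (rule sum.cong) (simp_all add: MM_entry l)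
    also have "\<dots> = (MM k * ?P) $$ (l, 0)"
      using l MM_carrier[of k] pow_carrier_mat[OF MM_carrier[of k], of b]
      by (simp add: scalar_prod_def atLeast0LessThan)
    also have "MM k * ?P = MM k ^\<^sub>m Suc b" using mult_pow_mat_comm[OF MM_carrier[of k], of b] by simp
    also have "(MM k ^\<^sub>m Suc b) $$ (l, 0) = (\<Sum>j<N. if j = l then (MM k ^\<^sub>m Suc b) $$ (l, 0) else 0)" using l by simp
    also have "\<dots> = count (mset (us k (Suc b))) y"
      unfolding count_us by (rule sum.cong) (auto simp: l)
    finally show ?thesis .
  next
    case False
    have "?c i l = 0" for i l
    proof -
      \<comment> \<open>An even label outside the index range is at least
        \<open>2 * N = p - 1\<close>.\<close>
      have "odd (2 * i + 2 * l + y) \<or> \<not> y \<le> p - 2"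
      proof (cases "even y")
        case True
        then obtain q where q: "y = 2 * q" by blast
        then have "N \<le> q" using False by (auto simp: not_le[symmetric])
        then show ?thesis using N q p by auto
      qed simp
      then show ?thesis unfolding count_CG by auto
    qed
    moreover have "count (mset (us k (Suc b))) y = 0"
      unfolding count_us using False by (intro sum.neutral) auto
    ultimately show ?thesis by simp
  qed
  finally show "count (mset (concat (map (\<lambda>u. concat (map (CG (p - 2) u) (us k b))) (map ((*) 2) [0..<Suc ?m])))) y = count (mset (us k (Suc b))) y" .
qed

lemma mset_us_0: "mset (us k 0) = mset [0]"
proof -
  have "N = Suc (N - 1)" using p by simp
  then have "us k 0 = [0] @ concat (map (\<lambda>l. replicate ((MM k ^\<^sub>m 0) $$ (l, 0)) (2 * l)) [1..<N])"
    unfolding us_def using MM_carrier[of k] by (simp add: upt_conv_Cons One_nat_def)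
  moreover have "concat (map (\<lambda>l. replicate ((MM k ^\<^sub>m 0) $$ (l, 0)) (2 * l)) [1..<N]) = []"
    using MM_carrier[of k] by auto
  ultimately show ?thesis by simp
qed

text \<open>Two factors are split off at a time, since only the tensor square has purely even
  labels; each pair adds \<open>2 * r\<close> to the translate and multiplies column 0 by
  \<open>MM k\<close>.\<close>

lemma tensor_power_HD:
  assumes k: "k \<le> p - 2"
  shows "SG.siso (tensor_power (heller G r (HD k)) (2 * b)) (HS (2 * b * r) (us k b))"
proof (induction b)
  case 0
  have "SG.siso trivial_fgmod (W 1)" by (rule SG.siso_sym[OF W_trivial])
  also have "W 1 = HS 0 [0]" by (simp add: HS_def One_nat_def)
  also have "SG.siso \<dots> (HS 0 (us k 0))" by (rule HS_mset) (rule mset_us_0[symmetric])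
  finally show ?case by simp
next
  case (Suc b)
  let ?X = "heller G r (HD k)" and ?T = "tensor_power (heller G r (HD k)) (2 * b)"
  let ?m = "min k (p - 2 - k)"
  have X: "SG.siso ?X (HS r [k])"
    using SG.siso_heller[OF SG.fgiso_siso[OF HD_iso[OF k]]] by (simp add: HS_def)
  have "SG.siso (tensor ?X ?X) (tensor (HS r [k]) (HS r [k]))" by (rule SG.siso_tensor[OF X X])
  also have "SG.siso \<dots> (HS (r + r) (concat (map (\<lambda>u. concat (map (CG (p - 2) u) [k])) [k])))"
    by (rule tensor_HS) (use k in auto)
  also have "SG.siso \<dots> (HS (r + r) (map ((*) 2) [0..<Suc ?m]))"
    by (rule HS_mset) (simp add: mset_CG_same[OF k] del: upt_Suc)
  finally have XX: "SG.siso (tensor ?X ?X) (HS (r + r) (map ((*) 2) [0..<Suc ?m]))" .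
  have "tensor_power ?X (2 * Suc b) = tensor (tensor ?X ?X) ?T"
    by (simp add: tensor_assoc)
  also have "SG.siso \<dots> (tensor (HS (r + r) (map ((*) 2) [0..<Suc ?m])) (HS (2 * b * r) (us k b)))"
    by (rule SG.siso_tensor[OF XX Suc])
  also have "SG.siso \<dots> (HS (r + r + 2 * b * r) (concat (map (\<lambda>u. concat (map (CG (p - 2) u) (us k b))) (map ((*) 2) [0..<Suc ?m]))))"
    by (rule tensor_HS[OF _ us_le]) (use k in auto)
  also have "SG.siso \<dots> (HS (r + r + 2 * b * r) (us k (Suc b)))"
    by (rule HS_mset) (rule mset_us_Suc)
  also have "r + r + 2 * b * r = 2 * Suc b * r" by simp
  finally show ?case .
qed

lemma HS_us:
  "SG.siso (HS n (us k b)) (dsum (concat (map (\<lambda>l. replicate ((MM k ^\<^sub>m b) $$ (l, 0)) (heller G n (HD (2 * l)))) [0..<N])))"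
proof -
  have "SG.siso (HS n (us k b)) (dsum (map (\<lambda>u. heller G n (HD u)) (us k b)))"
    unfolding HS_def
    by (rule SG.siso_dsum_map) (rule SG.siso_heller[OF SG.siso_sym[OF SG.fgiso_siso[OF HD_iso[OF us_le]]]])
  then show ?thesis by (simp add: us_def map_concat comp_def)
qed

end

theorem theorem3p7:
  fixes p k b r :: nat
  assumes "prime p" and "p \<ge> 3"
    and "CHAR('a::alg_closed_field) = p"
    and "k \<le> p - 2" and "r \<le> 2 * p - 3"
  shows "proj_equiv (sym_group p)
    (tensor_power (heller (sym_group p) r (hook_D p k :: (nat \<Rightarrow> nat, 'a) fgmod)) (2 * b))
    (dsum (concat (map
      (\<lambda>l. replicate ((mat_M TYPE('a) p k ^\<^sub>m b) $$ (l, 0))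
             (heller (sym_group p) (2 * b * r) (hook_D p (2 * l))))
      [0..<(p - 1) div 2])))"
proof -
  interpret sym_char p "TYPE('a)"
    by unfold_locales (use assms in auto)
  show ?thesis
    by (rule SG.siso_proj_equiv[OF SG.siso_trans[OF tensor_power_HD[OF assms(4)] HS_us[unfolded MM_def]]])
qed

end
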